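(* Let $d\ge 1$, let $\Psi\in L^2(\mathbb{R}^d)$ with $\|\Psi\|_2=1$, and let $\widehat{\Psi}$ be its Fourier transform. Let $\mathcal{D}_0=\{(\alpha,\beta):\alpha>\tfrac12,\ \beta>\tilde{\alpha}\}$ with $\tilde\alpha=\frac{\alpha}{2\alpha-1}$, $\mathcal{D}=[0,\infty)^2\setminus\mathcal{D}_0$ and $\mathcal{S}=[0,\tfrac12)^2$. Then for every pair $(\alpha,\beta)\in\mathcal{D}$, $$N_\alpha(\Psi)\,N_\beta(\widehat{\Psi})\ \ge\ B_{\alpha,\beta},$$ where $$B_{\alpha,\beta}=\begin{cases} B(\alpha) & \text{if } (\alpha,\beta)\in\mathcal{D}\setminus\mathcal{S} \text{ and } \alpha\ge\beta,\\ B(\beta) & \text{if } (\alpha,\beta)\in\mathcal{D}\setminus\mathcal{S} \text{ and } \beta\ge\alpha,\\ 2\pi & \text{if } (\alpha,\beta)\in\mathcal{S},\end{cases}$$ and $B(\alpha)=\pi\,\alpha^{\frac{1}{2(\alpha-1)}}\,\tilde{\alpha}^{\frac{1}{2(\tilde{\alpha}-1)}}$ for $\alpha>\tfrac12$, $\alpha\neq1$, with $B(\tfrac12)=2\pi$ and $B(1)=e\pi$.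
   Context: Fourier transform (continuous case): $\widehat{\Psi}(x)=(2\pi)^{-d/2}\int_{\mathbb{R}^d}\Psi(u)e^{-\imath u^t x}\,du$, extended to $L^2(\mathbb{R}^d)$ as the unitary Plancherel transform. Rényi $\lambda$-entropy of a function $\Psi$ on $\mathbb{R}^d$ with $\|\Psi\|_2=1$: for $\lambda>0$, $\lambda\ne1$, $H_\lambda(\Psi)=\frac{2\lambda}{1-\lambda}\ln\|\Psi\|_{2\lambda}=\frac{1}{1-\lambda}\ln\int_{\mathbb{R}^d}|\Psi(u)|^{2\lambda}\,du$; for $\lambda=1$, $H_1(\Psi)=-\int_{\mathbb{R}^d}|\Psi(u)|^2\ln|\Psi(u)|^2\,du$ (Shannon entropy); for $\lambda=0$, $H_0(\Psi)=\ln\mu(\{x:\Psi(x)\ne0\})$ with $\mu$ Lebesgue measure. Rényi $\lambda$-entropy power: $N_\lambda(\Psi)=\exp\left(\frac1d H_\lambda(\Psi)\right)$. (If $A$ is an operator whose state is described by $\Psi$ and $\widetilde{A}$ is the conjugate operator, with state described by $\widehat{\Psi}$, one writes $N_\lambda(A)$ and $N_\lambda(\widetilde A)$ for $N_\lambda(\Psi)$ and $N_\lambda(\widehat\Psi)$.) Conventions: entropies take values in $[-\infty,+\infty]$, so entropy powers take values in $[0,+\infty]$ (with $e^{-\infty}=0$, $e^{+\infty}=+\infty$); the inequality is asserted whenever the left-hand side is well defined, i.e. the Shannon integral exists in $[-\infty,+\infty]$ if an index equals $1$, and the product is not of the form $0\cdot\infty$. *)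

theory Defs
  imports "HOL-Analysis.Analysis"
begin

section \<open>Extended logarithm and exponential\<close>

definition eln :: "ennreal \<Rightarrow> ereal" where
  "eln x = (if x = 0 then -\<infinity> else if x = \<infinity> then \<infinity> else ereal (ln (enn2real x)))"

definition eexp :: "ereal \<Rightarrow> ennreal" where
  "eexp x = (if x = -\<infinity> then 0 else if x = \<infinity> then \<infinity> else ennreal (exp (real_of_ereal x)))"

section \<open>The space L2 and the Fourier--Plancherel transform\<close>

text \<open>Functions are Lebesgue measurable representatives of the classes in L2. The square of the
  L2 norm is a nonnegative integral, so it is infinite for functions outside L2.\<close>

definition L2_normsq :: "('a::euclidean_space \<Rightarrow> complex) \<Rightarrow> ennreal" where
  "L2_normsq f = (\<integral>\<^sup>+ u. ennreal ((norm (f u))\<^sup>2) \<partial>lebesgue)"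

definition L2_functions :: "('a::euclidean_space \<Rightarrow> complex) set" where
  "L2_functions = {f. f \<in> borel_measurable lebesgue \<and> L2_normsq f < \<infinity>}"

definition fourier_integral :: "('a::euclidean_space \<Rightarrow> complex) \<Rightarrow> 'a \<Rightarrow> complex" where
  "fourier_integral f x =
     of_real ((2 * pi) powr (- real DIM('a) / 2)) *
     (\<integral>u. f u * exp (- \<i> * of_real (u \<bullet> x)) \<partial>lebesgue)"

text \<open>The extension by L2 continuity of the Fourier integral from the intersection of L1 and L2.
  It determines the transform up to equality almost everywhere; the function
  \<open>fourier_transform\<close> picks a representative.\<close>

definition has_fourier_transform ::
    "('a::euclidean_space \<Rightarrow> complex) \<Rightarrow> ('a \<Rightarrow> complex) \<Rightarrow> bool" where
  "has_fourier_transform \<Psi> \<Phi> \<longleftrightarrow>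
     \<Psi> \<in> L2_functions \<and> \<Phi> \<in> L2_functions \<and>
     (\<exists>f. (\<forall>n::nat. f n \<in> L2_functions \<and> integrable lebesgue (f n)) \<and>
          (\<lambda>n. L2_normsq (\<lambda>u. f n u - \<Psi> u)) \<longlonglongrightarrow> 0 \<and>
          (\<lambda>n. L2_normsq (\<lambda>x. fourier_integral (f n) x - \<Phi> x)) \<longlonglongrightarrow> 0)"

definition fourier_transform :: "('a::euclidean_space \<Rightarrow> complex) \<Rightarrow> 'a \<Rightarrow> complex" where
  "fourier_transform \<Psi> = (SOME \<Phi>. has_fourier_transform \<Psi> \<Phi>)"

section \<open>Renyi entropies and entropy powers\<close>

text \<open>Positive and negative part of the Shannon integral; \<open>ennreal\<close> maps negative reals to 0.\<close>

definition shannon_pos :: "('a::euclidean_space \<Rightarrow> complex) \<Rightarrow> ennreal" where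
  "shannon_pos \<Psi> = (\<integral>\<^sup>+ u. ennreal (- ((norm (\<Psi> u))\<^sup>2 * ln ((norm (\<Psi> u))\<^sup>2))) \<partial>lebesgue)"

definition shannon_neg :: "('a::euclidean_space \<Rightarrow> complex) \<Rightarrow> ennreal" where
  "shannon_neg \<Psi> = (\<integral>\<^sup>+ u. ennreal ((norm (\<Psi> u))\<^sup>2 * ln ((norm (\<Psi> u))\<^sup>2)) \<partial>lebesgue)"

definition renyi_entropy :: "real \<Rightarrow> ('a::euclidean_space \<Rightarrow> complex) \<Rightarrow> ereal" where
  "renyi_entropy l \<Psi> =
     (if l = 0 then eln (emeasure lebesgue {u. \<Psi> u \<noteq> 0})
      else if l = 1 then enn2ereal (shannon_pos \<Psi>) - enn2ereal (shannon_neg \<Psi>)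
      else ereal (1 / (1 - l)) * eln (\<integral>\<^sup>+ u. ennreal (norm (\<Psi> u) powr (2 * l)) \<partial>lebesgue))"

definition renyi_entropy_defined :: "real \<Rightarrow> ('a::euclidean_space \<Rightarrow> complex) \<Rightarrow> bool" where
  "renyi_entropy_defined l \<Psi> \<longleftrightarrow> (l = 1 \<longrightarrow> \<not> (shannon_pos \<Psi> = \<infinity> \<and> shannon_neg \<Psi> = \<infinity>))"

definition renyi_power :: "real \<Rightarrow> ('a::euclidean_space \<Rightarrow> complex) \<Rightarrow> ennreal" where
  "renyi_power l \<Psi> = eexp (ereal (1 / real DIM('a)) * renyi_entropy l \<Psi>)"

section \<open>Index domains and the bound\<close>

definition conj_index :: "real \<Rightarrow> real" where
  "conj_index \<alpha> = \<alpha> / (2 * \<alpha> - 1)"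

definition D0_set :: "(real \<times> real) set" where
  "D0_set = {(\<alpha>, \<beta>). \<alpha> > 1 / 2 \<and> \<beta> > conj_index \<alpha>}"

definition D_set :: "(real \<times> real) set" where
  "D_set = {0..} \<times> {0..} - D0_set"

definition S_set :: "(real \<times> real) set" where
  "S_set = {0..<1 / 2} \<times> {0..<1 / 2}"

definition B_single :: "real \<Rightarrow> real" where
  "B_single \<alpha> =
     (if \<alpha> = 1 / 2 then 2 * pi
      else if \<alpha> = 1 then exp 1 * pi
      else pi * \<alpha> powr (1 / (2 * (\<alpha> - 1))) *
           conj_index \<alpha> powr (1 / (2 * (conj_index \<alpha> - 1))))"

definition B_bound :: "real \<Rightarrow> real \<Rightarrow> real" where
  "B_bound \<alpha> \<beta> =
     (if (\<alpha>, \<beta>) \<in> S_set then 2 * pi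
      else if \<alpha> \<ge> \<beta> then B_single \<alpha>
      else B_single \<beta>)"

end

theory Submission
  imports Defs "HOL-Probability.Characteristic_Functions"
begin

text \<open>
  For a pair of conjugate indices, \<open>\<beta> = \<alpha> / (2 \<alpha> - 1)\<close>, the relation is the sharp Hausdorff--Young inequality
  with \<open>p = 2 \<beta>\<close>, \<open>q = 2 \<alpha>\<close> or the other way round; every other pair with an index above \<open>1 / 2\<close> is reached by
  lowering an index, since Renyi entropy powers decrease in the index. If no index exceeds \<open>1 / 2\<close>, the bound of the
  supremum of the transform by the \<open>L\<^sup>1\<close> norm takes the place of the Hausdorff--Young inequality.

  The sharp constant is proved first for finite combinations of Gaussians of equal width. After extraction of the
  Gaussian factors it becomes Beckner's complex hypercontractivity: the map that sends the combination of real
  exponentials \<open>exp (a \<bullet> \<xi>)\<close> to the corresponding combination of imaginary ones is a contraction between the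
  \<open>L\<^sup>p\<close> and \<open>L\<^sup>q\<close> spaces of the Gaussian measure. The two sides are the endpoints \<open>t = 0\<close> and \<open>t = 1\<close> of the mixed norm
  \<open>\<integral>(\<integral>(\<bar>h\<^sub>t(\<xi>, \<eta>)\<bar>\<^sup>2 + \<epsilon>\<^sup>2)\<^bsup>p/2\<^esup> d\<gamma>(\<xi>))\<^bsup>q/p\<^esup> d\<gamma>(\<eta>)\<close> of an interpolation \<open>h\<^sub>t\<close> that moves the real variable
  \<open>\<xi>\<close> into the imaginary variable \<open>\<eta>\<close>. Gaussian integration by parts turns its time derivative into an integral
  which is nonpositive by the Cauchy--Schwarz inequality, so the mixed norm decreases in \<open>t\<close>.

  For \<open>\<alpha> = \<beta> = 1\<close> differentiating the Hausdorff--Young inequality at \<open>p = 2\<close> would need integrability that is not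
  available. Instead the inequality with \<open>p = 2 / (1 + s)\<close> is applied to \<open>\<Psi>\<close> multiplied by the
  bounded weight \<open>(min \<bar>\<Psi>\<bar> M)\<^sup>s\<close>, and the transform of this product is tested against \<open>\<Phi>\<close>, the transform of \<open>\<Psi>\<close>,
  multiplied by \<open>(min \<bar>\<Phi>\<bar> M)\<^sup>s\<close>. The terms of first order in \<open>s\<close>, with the errors controlled by Plancherel's theorem,
  give the Shannon bound after \<open>M\<close> tends to infinity.
\<close>

section \<open>The standard Gaussian measure\<close>

text \<open>The map on exponentials is the Mehler semigroup at the imaginary parameter i sqrt(p -
  1). In the generating function exp(a x - |a|^2/2) of the Hermite polynomials it replaces a by i
  sqrt(p - 1) a, whence the factor exp(p |a|^2/2) with p = 1 + (p - 1). For this parameter the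
  second derivatives of the flow cancel in the time derivative of the mixed norm, and the two terms
  that remain match through Cauchy-Schwarz with equal constants; nothing is lost on the way to the
  sharp constant. The regularisation \<epsilon> is there because a complex combination of
  exponentials has zeros, at which the negative powers that appear after two differentiations would
  be singular. The width of the Gaussians has to be free although p singles out one: narrow
  Gaussians give density, and rescaling shows that the constant does not depend on the width. Only
  pairs with the larger index on the function itself are treated directly. Fourier inversion
  exchanges the two functions up to a reflection, which changes no entropy. An infinite entropy
  power forms a separate case wherever Hausdorff-Young is void.\<close>

definition gauss_density :: "'a::euclidean_space \<Rightarrow> real" where
  "gauss_density x = (2 * pi) powr (- real DIM('a) / 2) * exp (- (norm x)\<^sup>2 / 2)"

definition gauss :: "'a::euclidean_space measure" where
  "gauss = density lborel (\<lambda>x. ennreal (gauss_density x))"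

lemma gauss_density_pos: "0 < gauss_density x"
  by (simp add: gauss_density_def)

lemma gauss_density_measurable [measurable]: "gauss_density \<in> borel_measurable borel"
  unfolding gauss_density_def by measurable

lemma sets_gauss [measurable_cong, simp]: "sets gauss = sets borel"
  and space_gauss [simp]: "space gauss = UNIV"
  by (simp_all add: gauss_def)

lemma gauss_density_prod:
  "gauss_density x = (\<Prod>b\<in>Basis. std_normal_density (x \<bullet> b))" for x :: "'a::euclidean_space"
proof -
  have "(2 * pi) powr (- real DIM('a) / 2) = (1 / sqrt (2 * pi)) ^ DIM('a)"
    by (simp add: powr_half_sqrt [symmetric] powr_realpow [symmetric] powr_powr powr_minus_divide
        power_one_over)
  moreover have "(norm x)\<^sup>2 = (\<Sum>b\<in>Basis. (x \<bullet> b)\<^sup>2)"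
    unfolding power2_norm_eq_inner by (subst euclidean_inner) (simp add: power2_eq_square)
  ultimately show ?thesis
    unfolding gauss_density_def std_normal_density_def
    by (simp add: prod_dividef exp_sum [symmetric] sum_negf sum_divide_distrib prod.distrib power_one_over divide_simps)
qed

lemma nn_integral_gauss_density: "(\<integral>\<^sup>+x. ennreal (gauss_density x) \<partial>lborel) = 1"
proof -
  have "(\<integral>\<^sup>+x. ennreal (gauss_density x) \<partial>(lborel :: 'a measure)) =
      (\<integral>\<^sup>+x. (\<Prod>b\<in>Basis. ennreal (std_normal_density (x \<bullet> b))) \<partial>(lborel :: 'a measure))"
    by (simp add: gauss_density_prod prod_ennreal)
  also have "\<dots> = (\<Prod>b\<in>(Basis :: 'a set). (\<integral>\<^sup>+x. ennreal (std_normal_density x) \<partial>lborel))"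
    by (rule nn_integral_lborel_prod) auto
  also have "\<dots> = 1"
    by (subst nn_integral_eq_integral) auto
  finally show ?thesis .
qed

lemma prob_space_gauss: "prob_space gauss"
  by standard (simp add: gauss_def emeasure_density nn_integral_gauss_density)

interpretation gauss: prob_space gauss
  by (rule prob_space_gauss)

lemma cis_measurable [measurable]: "cis \<in> borel_measurable borel"
  by (intro borel_measurable_continuous_onI continuous_intros)

text \<open>Density and plane wave both split over the coordinates, so the integral is a product of
  characteristic functions of the one-dimensional normal law.\<close>

lemma char_gauss:
  fixes \<xi> :: "'a::euclidean_space"
  shows "(\<integral>x. cis (\<xi> \<bullet> x) \<partial>gauss) = of_real (exp (- (norm \<xi>)\<^sup>2 / 2))"
proof -
  interpret product_sigma_finite "\<lambda>b::'a. lborel :: real measure" ..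
  let ?f = "\<lambda>b t. complex_of_real (std_normal_density t) * cis ((\<xi> \<bullet> b) * t)"
  have int: "integrable lborel (?f b)" for b
  proof (rule Bochner_Integration.integrable_bound)
    show "integrable lborel std_normal_density"
      by simp
  qed (simp_all add: norm_mult)
  have "(\<integral>x. cis (\<xi> \<bullet> x) \<partial>gauss) = (\<integral>x. gauss_density x *\<^sub>R cis (\<xi> \<bullet> x) \<partial>(lborel :: 'a measure))"
    unfolding gauss_def by (rule integral_density) (auto simp: gauss_density_pos less_imp_le)
  also have "\<dots> = (\<integral>x. (\<Prod>b\<in>Basis. ?f b (x \<bullet> b)) \<partial>(lborel :: 'a measure))"
  proof (rule Bochner_Integration.integral_cong [OF refl])
    fix x :: 'a
    have "cis (\<xi> \<bullet> x) = (\<Prod>b\<in>Basis. cis ((\<xi> \<bullet> b) * (x \<bullet> b)))"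
      by (subst euclidean_inner) (simp add: cis_conv_exp exp_sum sum_distrib_left)
    then show "gauss_density x *\<^sub>R cis (\<xi> \<bullet> x) = (\<Prod>b\<in>Basis. ?f b (x \<bullet> b))"
      by (simp add: gauss_density_prod scaleR_conv_of_real prod.distrib)
  qed
  also have "\<dots> = (\<integral>f. (\<Prod>b\<in>Basis. ?f b (f b)) \<partial>(\<Pi>\<^sub>M b\<in>(Basis::'a set). lborel))"
    by (subst lborel_eq, subst integral_distr) (auto intro!: Bochner_Integration.integral_cong prod.cong)
  also have "\<dots> = (\<Prod>b\<in>(Basis::'a set). (\<integral>t. ?f b t \<partial>lborel))"
    by (rule product_integral_prod) (auto intro: int)
  also have "\<dots> = (\<Prod>b\<in>(Basis::'a set). of_real (exp (- (\<xi> \<bullet> b)\<^sup>2 / 2)))"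
  proof (rule prod.cong [OF refl])
    fix b :: 'a
    have "(\<integral>t. ?f b t \<partial>lborel) = char std_normal_distribution (\<xi> \<bullet> b)"
      unfolding char_def by (subst integral_density) (auto simp: scaleR_conv_of_real cis_conv_exp mult.commute)
    then show "(\<integral>t. ?f b t \<partial>lborel) = of_real (exp (- (\<xi> \<bullet> b)\<^sup>2 / 2))"
      by (simp add: char_std_normal_distribution)
  qed
  also have "\<dots> = of_real (exp (- (norm \<xi>)\<^sup>2 / 2))"
  proof -
    have "(norm \<xi>)\<^sup>2 = (\<Sum>b\<in>Basis. (\<xi> \<bullet> b)\<^sup>2)"
      unfolding power2_norm_eq_inner by (subst euclidean_inner) (simp add: power2_eq_square)
    then show ?thesis
      by (simp add: exp_sum [symmetric] sum_negf sum_divide_distrib flip: of_real_prod)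
  qed
  finally show ?thesis .
qed

section \<open>Gaussian integrals and integrability under exponential growth\<close>

lemma nn_integral_lborel_scale:
  fixes f :: "'a::euclidean_space \<Rightarrow> ennreal"
  assumes [measurable]: "f \<in> borel_measurable borel" and "c \<noteq> 0"
  shows "(\<integral>\<^sup>+x. f (t + c *\<^sub>R x) \<partial>lborel) = ennreal (\<bar>c\<bar> powr (- real DIM('a))) * (\<integral>\<^sup>+x. f x \<partial>lborel)"
proof -
  have "(\<integral>\<^sup>+x. f x \<partial>lborel) =
      (\<integral>\<^sup>+x. f x \<partial>(density (distr lborel borel (\<lambda>x. t + c *\<^sub>R x)) (\<lambda>_. (\<Prod>j\<in>(Basis::'a set). \<bar>c\<bar>))))"
    using lborel_affine_euclidean [where c = "\<lambda>_. c" and t = t] \<open>c \<noteq> 0\<close>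
    by (simp add: scaleR_sum_right [symmetric] euclidean_representation flip: scaleR_scaleR)
  also have "\<dots> = ennreal (\<bar>c\<bar> ^ DIM('a)) * (\<integral>\<^sup>+x. f (t + c *\<^sub>R x) \<partial>lborel)"
    by (simp add: nn_integral_density nn_integral_distr nn_integral_cmult prod_ennreal ennreal_power)
  finally have *: "(\<integral>\<^sup>+x. f x \<partial>lborel) = ennreal (\<bar>c\<bar> ^ DIM('a)) * (\<integral>\<^sup>+x. f (t + c *\<^sub>R x) \<partial>lborel)" .
  have "ennreal (\<bar>c\<bar> powr (- real DIM('a))) * ennreal (\<bar>c\<bar> ^ DIM('a)) = 1"
    using \<open>c \<noteq> 0\<close> by (subst ennreal_mult [symmetric]) (auto simp: powr_minus powr_realpow)
  then show ?thesis
    unfolding * by (simp add: mult.assoc [symmetric])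
qed

text \<open>The substitution of sqrt(2 c) x turns the integrand into a multiple of
  \<open>gauss_density\<close>, whose total mass is 1; the value is the Jacobian times the
  normalisation.\<close>

lemma nn_integral_gaussian:
  assumes "0 < c"
  shows "(\<integral>\<^sup>+x. ennreal (exp (- c * (norm x)\<^sup>2)) \<partial>(lborel :: 'a::euclidean_space measure)) =
     ennreal ((pi / c) powr (real DIM('a) / 2))"
proof -
  let ?d = "real DIM('a)"
  have "(\<integral>\<^sup>+x. ennreal (gauss_density (0 + sqrt (2 * c) *\<^sub>R x)) \<partial>(lborel :: 'a measure)) =
     ennreal (\<bar>sqrt (2 * c)\<bar> powr (- ?d)) * 1"
    using assms by (subst nn_integral_lborel_scale) (auto simp: nn_integral_gauss_density)
  moreover have "gauss_density (0 + sqrt (2 * c) *\<^sub>R x) = (2 * pi) powr (- ?d / 2) * exp (- c * (norm x)\<^sup>2)" for x :: 'a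
    using assms by (simp add: gauss_density_def power_mult_distrib)
  ultimately have "ennreal ((2 * pi) powr (- ?d / 2)) * (\<integral>\<^sup>+x. ennreal (exp (- c * (norm x)\<^sup>2)) \<partial>(lborel :: 'a measure)) =
     ennreal ((sqrt (2 * c)) powr (- ?d))"
    using assms by (simp add: ennreal_mult nn_integral_cmult)
  then have "ennreal ((2 * pi) powr (?d / 2)) * (ennreal ((2 * pi) powr (- ?d / 2)) * (\<integral>\<^sup>+x. ennreal (exp (- c * (norm x)\<^sup>2)) \<partial>(lborel :: 'a measure))) =
     ennreal ((2 * pi) powr (?d / 2)) * ennreal ((sqrt (2 * c)) powr (- ?d))"
    by simp
  then have "(\<integral>\<^sup>+x. ennreal (exp (- c * (norm x)\<^sup>2)) \<partial>(lborel :: 'a measure)) =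
     ennreal ((2 * pi) powr (?d / 2) * (sqrt (2 * c)) powr (- ?d))"
    by (simp add: mult.assoc [symmetric] ennreal_mult [symmetric] powr_add [symmetric] del: ennreal_mult)
  also have "(2 * pi) powr (?d / 2) * (sqrt (2 * c)) powr (- ?d) = (pi / c) powr (?d / 2)"
    using assms
    by (simp add: powr_half_sqrt [symmetric] powr_powr powr_divide powr_mult powr_minus_divide field_simps)
  finally show ?thesis .
qed

lemma integrable_gaussian:
  assumes "0 < c"
  shows "integrable (lborel :: 'a::euclidean_space measure) (\<lambda>x. exp (- c * (norm x)\<^sup>2))"
  using nn_integral_gaussian[OF assms, where 'a = 'a] by (intro integrableI_nonneg) auto

lemma integrable_gauss_iff:
  fixes f :: "'a::euclidean_space \<Rightarrow> 'b::{banach,second_countable_topology}"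
  assumes [measurable]: "f \<in> borel_measurable borel"
  shows "integrable gauss f \<longleftrightarrow> integrable lborel (\<lambda>x. gauss_density x *\<^sub>R f x)"
  unfolding gauss_def by (rule integrable_density) (auto simp: gauss_density_pos less_imp_le)

lemma integral_gauss:
  fixes f :: "'a::euclidean_space \<Rightarrow> 'b::{banach,second_countable_topology}"
  assumes [measurable]: "f \<in> borel_measurable borel"
  shows "integral\<^sup>L gauss f = (\<integral>x. gauss_density x *\<^sub>R f x \<partial>lborel)"
  unfolding gauss_def by (rule integral_density) (auto simp: gauss_density_pos less_imp_le)

lemma integrable_gauss_exp_sq:
  assumes "c < 1 / 2"
  shows "integrable (gauss :: 'a::euclidean_space measure) (\<lambda>x. exp (c * (norm x)\<^sup>2))"
proof -
  have "gauss_density x *\<^sub>R exp (c * (norm x)\<^sup>2) =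
      (2 * pi) powr (- real DIM('a) / 2) * exp (- (1 / 2 - c) * (norm x)\<^sup>2)" for x :: 'a
    by (simp add: gauss_density_def exp_add [symmetric] algebra_simps)
  then show ?thesis
    using integrable_gaussian [of "1/2 - c", where 'a = 'a] assms
    by (subst integrable_gauss_iff) auto
qed

lemma integrable_gauss_exp: "integrable (gauss :: 'a::euclidean_space measure) (\<lambda>x. exp (K * norm x))"
proof (rule Bochner_Integration.integrable_bound)
  show "integrable (gauss :: 'a measure) (\<lambda>x. exp (K\<^sup>2) * exp ((1/4) * (norm x)\<^sup>2))"
    by (intro integrable_mult_right integrable_gauss_exp_sq) simp
  \<comment> \<open>From (K - |x|/2)^2 \<ge> 0. The rate 1/4 stays below the critical rate 1/2 of
    \<open>integrable_gauss_exp_sq\<close>.\<close>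
  have "K * norm x \<le> K\<^sup>2 + (1/4) * (norm x)\<^sup>2" for x :: 'a
    using zero_le_power2 [of "K - norm x / 2"] by (simp add: power2_eq_square algebra_simps)
  then show "AE x in (gauss :: 'a measure). norm (exp (K * norm x)) \<le> norm (exp (K\<^sup>2) * exp ((1/4) * (norm x)\<^sup>2))"
    by (simp add: exp_add [symmetric])
qed simp

lemma integrable_gauss_bound:
  fixes f :: "'a::euclidean_space \<Rightarrow> 'b::{banach,second_countable_topology}"
  assumes "f \<in> borel_measurable borel" "\<And>x. norm (f x) \<le> C * exp (K * norm x)"
  shows "integrable gauss f"
  by (rule Bochner_Integration.integrable_bound [where f = "\<lambda>x. C * exp (K * norm x)"])
     (use assms order_trans[OF norm_ge_zero assms(2)] in \<open>auto intro: integrable_gauss_exp\<close>)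

section \<open>Translation, differentiation under the integral, integration by parts\<close>

lemma cameron_martin:
  fixes f :: "'a::euclidean_space \<Rightarrow> real"
  assumes [measurable]: "f \<in> borel_measurable borel"
  shows "(\<integral>x. f (x + v) \<partial>gauss) = (\<integral>x. f x * exp (v \<bullet> x - (norm v)\<^sup>2 / 2) \<partial>gauss)"
proof -
  have "(\<integral>x. f x * exp (v \<bullet> x - (norm v)\<^sup>2 / 2) \<partial>gauss) =
      (\<integral>x. gauss_density (x - v) * f x \<partial>lborel)"
    by (subst integral_gauss)
       (auto simp: gauss_density_def power2_norm_eq_inner inner_simps exp_add [symmetric] exp_diff [symmetric]
          inner_commute field_simps intro!: Bochner_Integration.integral_cong)
  also have "\<dots> = (\<integral>x. gauss_density (x - v) * f x \<partial>(distr lborel borel ((+) v)))"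
    by (simp add: lborel_distr_plus)
  also have "\<dots> = (\<integral>x. f (x + v) \<partial>gauss)"
    by (subst integral_distr) (auto simp: integral_gauss add.commute)
  finally show ?thesis ..
qed

text \<open>The bound \<open>g\<close> on the derivative near \<open>t0\<close> dominates the
  difference quotients by the mean value inequality, so dominated convergence applies along every
  sequence tending to \<open>t0\<close>.\<close>

lemma has_real_derivative_integral:
  fixes f f' :: "real \<Rightarrow> 'b \<Rightarrow> real"
  assumes "0 < e"
    and int: "\<And>t. \<bar>t - t0\<bar> < e \<Longrightarrow> integrable M (f t)"
    and der: "\<And>t x. \<bar>t - t0\<bar> < e \<Longrightarrow> ((\<lambda>t. f t x) has_real_derivative f' t x) (at t)"
    and bound: "\<And>t x. \<bar>t - t0\<bar> < e \<Longrightarrow> \<bar>f' t x\<bar> \<le> g x"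
    and g: "integrable M g"
    and meas: "f' t0 \<in> borel_measurable M"
  shows "((\<lambda>t. \<integral>x. f t x \<partial>M) has_real_derivative (\<integral>x. f' t0 x \<partial>M)) (at t0)"
  unfolding has_field_derivative_iff tendsto_at_iff_sequentially
proof (intro allI impI)
  fix X :: "nat \<Rightarrow> real"
  assume X0: "\<forall>i. X i \<in> UNIV - {t0}" and X: "X \<longlonglongrightarrow> t0"
  obtain N where N: "\<And>n. n \<ge> N \<Longrightarrow> \<bar>X n - t0\<bar> < e"
    using LIMSEQ_D [OF X \<open>0 < e\<close>] by (auto simp: real_norm_def)
  \<comment> \<open>The tail of the sequence that stays within \<open>e\<close> of
    \<open>t0\<close>, where the hypotheses hold; the shift is undone by
    \<open>LIMSEQ_offset\<close>.\<close>
  define Y where "Y n = X (n + N)" for n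
  have Y: "\<bar>Y n - t0\<bar> < e" "Y n \<noteq> t0" for n
    using N X0 by (auto simp: Y_def)
  have Yl: "Y \<longlonglongrightarrow> t0"
    unfolding Y_def by (rule LIMSEQ_ignore_initial_segment [OF X])
  have "(\<lambda>n. \<integral>x. (f (Y n) x - f t0 x) / (Y n - t0) \<partial>M) \<longlonglongrightarrow> (\<integral>x. f' t0 x \<partial>M)"
  proof (rule integral_dominated_convergence [where w = g])
    show "AE x in M. (\<lambda>n. (f (Y n) x - f t0 x) / (Y n - t0)) \<longlonglongrightarrow> f' t0 x"
    proof (rule AE_I2)
      fix x
      have "((\<lambda>t. (f t x - f t0 x) / (t - t0)) \<longlongrightarrow> f' t0 x) (at t0)"
        using der [of t0 x] \<open>0 < e\<close> by (simp add: has_field_derivative_iff)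
      then show "(\<lambda>n. (f (Y n) x - f t0 x) / (Y n - t0)) \<longlonglongrightarrow> f' t0 x"
        unfolding tendsto_at_iff_sequentially comp_def using Y Yl by blast
    qed
    show "AE x in M. norm ((f (Y n) x - f t0 x) / (Y n - t0)) \<le> g x" for n
    proof (rule AE_I2)
      fix x
      have "norm (f (Y n) x - f t0 x) \<le> g x * norm (Y n - t0)"
      proof (rule field_differentiable_bound [where S = "ball t0 e"])
        show "\<And>z. z \<in> ball t0 e \<Longrightarrow> ((\<lambda>t. f t x) has_field_derivative f' z x) (at z within ball t0 e)"
          using der by (auto simp: dist_real_def abs_minus_commute intro: has_field_derivative_at_within)
        show "\<And>z. z \<in> ball t0 e \<Longrightarrow> norm (f' z x) \<le> g x"
          using bound by (auto simp: dist_real_def abs_minus_commute)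
      qed (use Y \<open>0 < e\<close> in \<open>auto simp: dist_real_def abs_minus_commute\<close>)
      then show "norm ((f (Y n) x - f t0 x) / (Y n - t0)) \<le> g x"
        using Y(2)[of n] by (simp add: divide_le_eq)
    qed
    show "(\<lambda>x. (f (Y n) x - f t0 x) / (Y n - t0)) \<in> borel_measurable M" for n
      using int [of "Y n"] int [of t0] Y(1)[of n] \<open>0 < e\<close>
      by (intro borel_measurable_divide borel_measurable_diff) (auto intro: borel_measurable_integrable)
  qed (use g meas in auto)
  moreover have "(\<integral>x. (f (Y n) x - f t0 x) / (Y n - t0) \<partial>M) =
      ((\<integral>x. f (Y n) x \<partial>M) - (\<integral>x. f t0 x \<partial>M)) / (Y n - t0)" for n
    using int [of "Y n"] int [of t0] Y(1)[of n] \<open>0 < e\<close> by simp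
  ultimately have "(\<lambda>n. (((\<lambda>t. ((\<integral>x. f t x \<partial>M) - (\<integral>x. f t0 x \<partial>M)) / (t - t0)) \<circ> X) (n + N))) \<longlonglongrightarrow> (\<integral>x. f' t0 x \<partial>M)"
    by (simp only: comp_def Y_def)
  then show "((\<lambda>t. ((\<integral>x. f t x \<partial>M) - (\<integral>x. f t0 x \<partial>M)) / (t - t0)) \<circ> X) \<longlonglongrightarrow> (\<integral>x. f' t0 x \<partial>M)"
    by (rule LIMSEQ_offset)
qed

lemma continuous_on_integral_dominated:
  fixes f :: "real \<Rightarrow> 'b \<Rightarrow> real"
  assumes cont: "\<And>x. continuous_on T (\<lambda>t. f t x)"
    and bound: "\<And>t x. t \<in> T \<Longrightarrow> \<bar>f t x\<bar> \<le> g x"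
    and g: "integrable M g"
    and meas: "\<And>t. t \<in> T \<Longrightarrow> f t \<in> borel_measurable M"
  shows "continuous_on T (\<lambda>t. \<integral>x. f t x \<partial>M)"
  unfolding continuous_on_sequentially comp_def
proof (intro allI ballI impI, elim conjE)
  fix X t assume t: "t \<in> T" and X: "\<forall>n. X n \<in> T" "X \<longlonglongrightarrow> t"
  show "(\<lambda>n. \<integral>x. f (X n) x \<partial>M) \<longlonglongrightarrow> (\<integral>x. f t x \<partial>M)"
  proof (rule integral_dominated_convergence [where w = g])
    show "AE x in M. (\<lambda>n. f (X n) x) \<longlonglongrightarrow> f t x"
      using cont t X unfolding continuous_on_sequentially comp_def by blast
  qed (use bound meas g t X in auto)
qed

text \<open>Both sides are the derivative at \<tau> = 0 of the integral of F(x + \<tau> b). The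
  right side differentiates the function; the left side differentiates the exponential weight that
  \<open>cameron_martin\<close> puts in place of the translation.\<close>

lemma gauss_integration_by_parts:
  fixes F F' :: "'a::euclidean_space \<Rightarrow> real"
  assumes der: "\<And>x \<tau>. ((\<lambda>\<tau>. F (x + \<tau> *\<^sub>R b)) has_real_derivative F' (x + \<tau> *\<^sub>R b)) (at \<tau>)"
    and [measurable]: "F \<in> borel_measurable borel" "F' \<in> borel_measurable borel"
    and bF: "\<And>x. \<bar>F x\<bar> \<le> C * exp (K * norm x)"
    and bF': "\<And>x. \<bar>F' x\<bar> \<le> C * exp (K * norm x)"
    and "0 \<le> K"
  shows "(\<integral>x. (x \<bullet> b) * F x \<partial>gauss) = (\<integral>x. F' x \<partial>gauss)"
proof -
  have C: "0 \<le> C" using order_trans [OF abs_ge_zero bF [of 0]] by simp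
  have nb: "norm (x + \<tau> *\<^sub>R b) \<le> norm x + norm b" if "\<bar>\<tau>\<bar> < 1" for x \<tau>
  proof -
    have "\<bar>\<tau>\<bar> * norm b \<le> 1 * norm b"
      using that by (intro mult_right_mono) auto
    then show ?thesis using norm_triangle_ineq [of x "\<tau> *\<^sub>R b"] by simp
  qed
  have bd: "C * exp (K * norm (x + \<tau> *\<^sub>R b)) \<le> C * exp (K * norm b) * exp (K * norm x)" if "\<bar>\<tau>\<bar> < 1" for x \<tau>
  proof -
    have "C * exp (K * norm (x + \<tau> *\<^sub>R b)) \<le> C * exp (K * (norm x + norm b))"
      using nb[OF that] \<open>0 \<le> K\<close> C by (intro mult_left_mono iffD2[OF exp_le_cancel_iff]) auto
    then show ?thesis by (simp add: exp_add algebra_simps)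
  qed
  have D1: "((\<lambda>\<tau>. \<integral>x. F (x + \<tau> *\<^sub>R b) \<partial>gauss) has_real_derivative (\<integral>x. F' (x + 0 *\<^sub>R b) \<partial>gauss)) (at 0)"
  proof (rule has_real_derivative_integral [where e = 1 and g = "\<lambda>x. C * exp (K * norm b) * exp (K * norm x)"])
    show "integrable gauss (\<lambda>x. F (x + t *\<^sub>R b))" if "\<bar>t - 0\<bar> < 1" for t
      using that by (intro integrable_gauss_bound [where C = "C * exp (K * norm b)" and K = K])
         (auto intro: order_trans [OF bF bd])
  qed (auto intro: order_trans [OF bF' bd] der integrable_gauss_exp)
  have D2: "((\<lambda>\<tau>. \<integral>x. F x * exp ((\<tau> *\<^sub>R b) \<bullet> x - (norm (\<tau> *\<^sub>R b))\<^sup>2 / 2) \<partial>gauss) has_real_derivative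
      (\<integral>x. F x * exp ((0 *\<^sub>R b) \<bullet> x - (norm (0 *\<^sub>R b))\<^sup>2 / 2) * (b \<bullet> x - 0 * (norm b)\<^sup>2) \<partial>gauss)) (at 0)"
  proof (rule has_real_derivative_integral [where e = 1 and
        f' = "\<lambda>\<tau> x. F x * exp ((\<tau> *\<^sub>R b) \<bullet> x - (norm (\<tau> *\<^sub>R b))\<^sup>2 / 2) * (b \<bullet> x - \<tau> * (norm b)\<^sup>2)" and
        g = "\<lambda>x. (C * exp (norm b + (norm b)\<^sup>2)) * exp ((K + 2 * norm b) * norm x)"])
    fix t :: real and x :: 'a assume t: "\<bar>t - 0\<bar> < 1"
    have tb: "\<bar>t\<bar> * norm b \<le> norm b"
      using t mult_right_mono [of "\<bar>t\<bar>" 1 "norm b"] by simp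
    have "\<bar>(t *\<^sub>R b) \<bullet> x\<bar> \<le> \<bar>t\<bar> * norm b * norm x"
      using Cauchy_Schwarz_ineq2 [of "t *\<^sub>R b" x] by simp
    then have tx: "\<bar>(t *\<^sub>R b) \<bullet> x\<bar> \<le> norm b * norm x"
      using mult_right_mono [OF tb, of "norm x"] by simp
    have e1: "exp ((t *\<^sub>R b) \<bullet> x - (norm (t *\<^sub>R b))\<^sup>2 / 2) \<le> exp (norm b * norm x)"
      using tx zero_le_power2 [of "norm (t *\<^sub>R b)"] unfolding exp_le_cancel_iff by linarith
    have "\<bar>b \<bullet> x - t * (norm b)\<^sup>2\<bar> \<le> norm b * norm x + (norm b)\<^sup>2"
    proof -
      have "\<bar>t\<bar> * (norm b)\<^sup>2 \<le> (norm b)\<^sup>2"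
        using t mult_right_mono [of "\<bar>t\<bar>" 1 "(norm b)\<^sup>2"] by simp
      moreover have "\<bar>t * (norm b)\<^sup>2\<bar> = \<bar>t\<bar> * (norm b)\<^sup>2"
        by (simp add: abs_mult)
      ultimately show ?thesis
        using Cauchy_Schwarz_ineq2 [of b x] abs_triangle_ineq4 [of "b \<bullet> x" "t * (norm b)\<^sup>2"] by linarith
    qed
    \<comment> \<open>The factor that is linear in x is absorbed by y \<le> exp y; together with the
      weight this explains the rate K + 2 |b| of the majorant.\<close>
    also have "\<dots> \<le> exp (norm b * norm x + (norm b)\<^sup>2)"
      using exp_ge_add_one_self [of "norm b * norm x + (norm b)\<^sup>2"] by linarith
    finally have e2: "\<bar>b \<bullet> x - t * (norm b)\<^sup>2\<bar> \<le> exp (norm b * norm x + (norm b)\<^sup>2)" .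
    have "\<bar>F x\<bar> * exp ((t *\<^sub>R b) \<bullet> x - (norm (t *\<^sub>R b))\<^sup>2 / 2) \<le> (C * exp (K * norm x)) * exp (norm b * norm x)"
      by (rule mult_mono [OF bF e1]) (auto simp: C)
    then have "\<bar>F x\<bar> * exp ((t *\<^sub>R b) \<bullet> x - (norm (t *\<^sub>R b))\<^sup>2 / 2) * \<bar>b \<bullet> x - t * (norm b)\<^sup>2\<bar> \<le>
       (C * exp (K * norm x) * exp (norm b * norm x)) * exp (norm b * norm x + (norm b)\<^sup>2)"
      by (rule mult_mono [OF _ e2]) (auto simp: C)
    also have "\<dots> \<le> C * exp (norm b + (norm b)\<^sup>2) * exp ((K + 2 * norm b) * norm x)"
    proof -
      have "exp (K * norm x) * exp (norm b * norm x) * exp (norm b * norm x + (norm b)\<^sup>2) \<le>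
         exp (norm b + (norm b)\<^sup>2) * exp ((K + 2 * norm b) * norm x)"
        by (simp add: exp_add [symmetric] algebra_simps)
      from mult_left_mono [OF this C] show ?thesis by (simp add: mult.assoc)
    qed
    finally show "\<bar>F x * exp ((t *\<^sub>R b) \<bullet> x - (norm (t *\<^sub>R b))\<^sup>2 / 2) * (b \<bullet> x - t * (norm b)\<^sup>2)\<bar> \<le>
      C * exp (norm b + (norm b)\<^sup>2) * exp ((K + 2 * norm b) * norm x)"
      by (simp add: abs_mult)
  next
    fix t :: real assume t: "\<bar>t - 0\<bar> < 1"
    show "integrable gauss (\<lambda>x. F x * exp ((t *\<^sub>R b) \<bullet> x - (norm (t *\<^sub>R b))\<^sup>2 / 2))"
    proof (rule integrable_gauss_bound [where C = C and K = "K + norm b"])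
      fix x :: 'a
      have tb: "\<bar>t\<bar> * norm b \<le> norm b"
        using t mult_right_mono [of "\<bar>t\<bar>" 1 "norm b"] by simp
      have "\<bar>(t *\<^sub>R b) \<bullet> x\<bar> \<le> \<bar>t\<bar> * norm b * norm x"
        using Cauchy_Schwarz_ineq2 [of "t *\<^sub>R b" x] by simp
      then have tx: "\<bar>(t *\<^sub>R b) \<bullet> x\<bar> \<le> norm b * norm x"
        using mult_right_mono [OF tb, of "norm x"] by simp
      have e1: "exp ((t *\<^sub>R b) \<bullet> x - (norm (t *\<^sub>R b))\<^sup>2 / 2) \<le> exp (norm b * norm x)"
        using tx zero_le_power2 [of "norm (t *\<^sub>R b)"] unfolding exp_le_cancel_iff by linarith
      have "\<bar>F x\<bar> * exp ((t *\<^sub>R b) \<bullet> x - (norm (t *\<^sub>R b))\<^sup>2 / 2) \<le> (C * exp (K * norm x)) * exp (norm b * norm x)"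
        by (rule mult_mono [OF bF e1]) (auto simp: C)
      then show "norm (F x * exp ((t *\<^sub>R b) \<bullet> x - (norm (t *\<^sub>R b))\<^sup>2 / 2)) \<le> C * exp ((K + norm b) * norm x)"
        by (simp add: abs_mult exp_add algebra_simps)
    qed measurable
  next
    fix t :: real and x :: 'a
    have eq: "(norm (s *\<^sub>R b))\<^sup>2 = s\<^sup>2 * (norm b)\<^sup>2" for s :: real by (simp add: power_mult_distrib)
    show "((\<lambda>t. F x * exp ((t *\<^sub>R b) \<bullet> x - (norm (t *\<^sub>R b))\<^sup>2 / 2)) has_real_derivative
       F x * exp ((t *\<^sub>R b) \<bullet> x - (norm (t *\<^sub>R b))\<^sup>2 / 2) * (b \<bullet> x - t * (norm b)\<^sup>2)) (at t)"
      unfolding eq inner_scaleR_left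
      by (auto intro!: derivative_eq_intros simp: power2_eq_square)
  qed (auto intro: integrable_gauss_exp)
  have eq: "(\<lambda>\<tau>. \<integral>x. F (x + \<tau> *\<^sub>R b) \<partial>gauss) = (\<lambda>\<tau>. \<integral>x. F x * exp ((\<tau> *\<^sub>R b) \<bullet> x - (norm (\<tau> *\<^sub>R b))\<^sup>2 / 2) \<partial>gauss)"
    by (intro ext cameron_martin) simp
  have "(\<integral>x. F' (x + 0 *\<^sub>R b) \<partial>gauss) =
      (\<integral>x. F x * exp ((0 *\<^sub>R b) \<bullet> x - (norm (0 *\<^sub>R b))\<^sup>2 / 2) * (b \<bullet> x - 0 * (norm b)\<^sup>2) \<partial>gauss)"
    by (rule DERIV_unique [OF D1 [unfolded eq] D2])
  then show ?thesis
    by (simp add: inner_commute mult.commute)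
qed

section \<open>The heat flow behind complex hypercontractivity\<close>

text \<open>Exponential growth in the first space variable, uniformly in time and in the second space variable:
  enough for differentiation under the Gaussian integral, and stable under sums and products.\<close>

definition dominated :: "(real \<Rightarrow> 'a::euclidean_space \<Rightarrow> 'a \<Rightarrow> 'b::{real_normed_vector,second_countable_topology}) \<Rightarrow> bool" where
  "dominated F \<longleftrightarrow>
     (\<forall>t. (\<lambda>z. F t (fst z) (snd z)) \<in> borel_measurable (borel \<Otimes>\<^sub>M borel)) \<and>
     (\<exists>C\<ge>0. \<exists>K\<ge>0. \<forall>t\<in>{0..1}. \<forall>\<xi> \<eta>. norm (F t \<xi> \<eta>) \<le> C * exp (K * norm \<xi>))"

lemma dominatedI:
  assumes "\<And>t. (\<lambda>z. F t (fst z) (snd z)) \<in> borel_measurable (borel \<Otimes>\<^sub>M borel)"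
    and "0 \<le> C" "0 \<le> K" "\<And>t \<xi> \<eta>. t \<in> {0..1} \<Longrightarrow> norm (F t \<xi> \<eta>) \<le> C * exp (K * norm \<xi>)"
  shows "dominated F"
  using assms unfolding dominated_def by blast

lemma dominatedE:
  assumes "dominated F"
  obtains C K where "0 \<le> C" "0 \<le> K" "\<And>t \<xi> \<eta>. t \<in> {0..1} \<Longrightarrow> norm (F t \<xi> \<eta>) \<le> C * exp (K * norm \<xi>)"
  using assms unfolding dominated_def by blast

lemma dominated_measurable_pair:
  "dominated F \<Longrightarrow> (\<lambda>z. F t (fst z) (snd z)) \<in> borel_measurable (borel \<Otimes>\<^sub>M borel)"
  unfolding dominated_def by blast

lemma dominated_measurable1:
  fixes F :: "real \<Rightarrow> 'a::euclidean_space \<Rightarrow> 'a \<Rightarrow> 'b::{real_normed_vector,second_countable_topology}"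
  assumes "dominated F"
  shows "(\<lambda>\<xi>. F t \<xi> \<eta>) \<in> borel_measurable borel"
proof -
  have "(\<lambda>\<xi>. (\<xi>, \<eta>)) \<in> borel \<rightarrow>\<^sub>M (borel \<Otimes>\<^sub>M borel)" by simp
  from measurable_compose [OF this dominated_measurable_pair [OF assms]] show ?thesis by simp
qed

lemma dominated_mult:
  fixes F G :: "real \<Rightarrow> 'a::euclidean_space \<Rightarrow> 'a \<Rightarrow> real"
  assumes "dominated F" "dominated G"
  shows "dominated (\<lambda>t \<xi> \<eta>. F t \<xi> \<eta> * G t \<xi> \<eta>)"
proof -
  note [measurable] = dominated_measurable_pair [OF assms(1)] dominated_measurable_pair [OF assms(2)]
  obtain C K where CK: "0 \<le> C" "0 \<le> K" "\<And>t \<xi> \<eta>. t \<in> {0..1} \<Longrightarrow> norm (F t \<xi> \<eta>) \<le> C * exp (K * norm \<xi>)"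
    using dominatedE [OF assms(1)] by blast
  obtain D L where DL: "0 \<le> D" "0 \<le> L" "\<And>t \<xi> \<eta>. t \<in> {0..1} \<Longrightarrow> norm (G t \<xi> \<eta>) \<le> D * exp (L * norm \<xi>)"
    using dominatedE [OF assms(2)] by blast
  show ?thesis
  proof (rule dominatedI [where C = "C * D" and K = "K + L"])
    fix t :: real and \<xi> \<eta> :: 'a assume t: "t \<in> {0..1}"
    have "norm (F t \<xi> \<eta> * G t \<xi> \<eta>) \<le> (C * exp (K * norm \<xi>)) * (D * exp (L * norm \<xi>))"
      unfolding norm_mult using CK DL t by (intro mult_mono) auto
    then show "norm (F t \<xi> \<eta> * G t \<xi> \<eta>) \<le> C * D * exp ((K + L) * norm \<xi>)"
      by (simp add: exp_add algebra_simps)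
  qed (use CK DL in auto)
qed

lemma dominated_inner:
  fixes F G :: "real \<Rightarrow> 'a::euclidean_space \<Rightarrow> 'a \<Rightarrow> complex"
  assumes "dominated F" "dominated G"
  shows "dominated (\<lambda>t \<xi> \<eta>. inner (F t \<xi> \<eta>) (G t \<xi> \<eta>))"
proof -
  note [measurable] = dominated_measurable_pair [OF assms(1)] dominated_measurable_pair [OF assms(2)]
  obtain C K where CK: "0 \<le> C" "0 \<le> K" "\<And>t \<xi> \<eta>. t \<in> {0..1} \<Longrightarrow> norm (F t \<xi> \<eta>) \<le> C * exp (K * norm \<xi>)"
    using dominatedE [OF assms(1)] by blast
  obtain D L where DL: "0 \<le> D" "0 \<le> L" "\<And>t \<xi> \<eta>. t \<in> {0..1} \<Longrightarrow> norm (G t \<xi> \<eta>) \<le> D * exp (L * norm \<xi>)"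
    using dominatedE [OF assms(2)] by blast
  show ?thesis
  proof (rule dominatedI [where C = "C * D" and K = "K + L"])
    fix t :: real and \<xi> \<eta> :: 'a assume t: "t \<in> {0..1}"
    have "norm (inner (F t \<xi> \<eta>) (G t \<xi> \<eta>)) \<le> norm (F t \<xi> \<eta>) * norm (G t \<xi> \<eta>)"
      by (simp add: Cauchy_Schwarz_ineq2)
    also have "\<dots> \<le> (C * exp (K * norm \<xi>)) * (D * exp (L * norm \<xi>))"
      using CK DL t by (intro mult_mono) auto
    finally show "norm (inner (F t \<xi> \<eta>) (G t \<xi> \<eta>)) \<le> C * D * exp ((K + L) * norm \<xi>)"
      by (simp add: exp_add algebra_simps)
  qed (use CK DL in auto)
qed

lemma dominated_add:
  assumes "dominated F" "dominated G"
  shows "dominated (\<lambda>t \<xi> \<eta>. F t \<xi> \<eta> + G t \<xi> \<eta>)"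
proof -
  note [measurable] = dominated_measurable_pair [OF assms(1)] dominated_measurable_pair [OF assms(2)]
  obtain C K where CK: "0 \<le> C" "0 \<le> K" "\<And>t \<xi> \<eta>. t \<in> {0..1} \<Longrightarrow> norm (F t \<xi> \<eta>) \<le> C * exp (K * norm \<xi>)"
    using dominatedE [OF assms(1)] by blast
  obtain D L where DL: "0 \<le> D" "0 \<le> L" "\<And>t \<xi> \<eta>. t \<in> {0..1} \<Longrightarrow> norm (G t \<xi> \<eta>) \<le> D * exp (L * norm \<xi>)"
    using dominatedE [OF assms(2)] by blast
  show ?thesis
  proof (rule dominatedI [where C = "C + D" and K = "K + L"])
    fix t :: real and \<xi> \<eta> :: 'a assume t: "t \<in> {0..1}"
    have "C * exp (K * norm \<xi>) \<le> C * exp ((K + L) * norm \<xi>)" "D * exp (L * norm \<xi>) \<le> D * exp ((K + L) * norm \<xi>)"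
      using CK DL by (intro mult_left_mono iffD2[OF exp_le_cancel_iff] mult_right_mono; simp)+
    then show "norm (F t \<xi> \<eta> + G t \<xi> \<eta>) \<le> (C + D) * exp ((K + L) * norm \<xi>)"
      using CK(3)[OF t, of \<xi> \<eta>] DL(3)[OF t, of \<xi> \<eta>] norm_triangle_ineq[of "F t \<xi> \<eta>" "G t \<xi> \<eta>"]
      by (simp add: distrib_right)
  qed (use CK DL in auto)
qed

lemma dominated_bounded:
  assumes "\<And>t. (\<lambda>z. F t (fst z) (snd z)) \<in> borel_measurable (borel \<Otimes>\<^sub>M borel)"
    and "\<And>t \<xi> \<eta>. t \<in> {0..1} \<Longrightarrow> norm (F t \<xi> \<eta>) \<le> C"
  shows "dominated F"
  by (rule dominatedI [where C = C and K = 0])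
     (use assms order_trans [OF norm_ge_zero assms(2)[of 0]] in auto)

lemma dominated_const: "dominated (\<lambda>t \<xi> \<eta>. c)"
  by (rule dominated_bounded [where C = "norm c"]) auto

lemma dominated_sum:
  "(\<And>i. i \<in> I \<Longrightarrow> dominated (F i)) \<Longrightarrow> dominated (\<lambda>t \<xi> \<eta>. \<Sum>i\<in>I. F i t \<xi> \<eta>)"
  by (induction I rule: infinite_finite_induct) (auto intro: dominated_add dominated_const)

lemma dominated_cmult:
  fixes F :: "real \<Rightarrow> 'a::euclidean_space \<Rightarrow> 'a \<Rightarrow> real"
  shows "dominated F \<Longrightarrow> dominated (\<lambda>t \<xi> \<eta>. c * F t \<xi> \<eta>)"
  by (intro dominated_mult dominated_const)

lemma dominated_diff:
  fixes F :: "real \<Rightarrow> 'a::euclidean_space \<Rightarrow> 'a \<Rightarrow> real"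
  shows "dominated F \<Longrightarrow> dominated G \<Longrightarrow> dominated (\<lambda>t \<xi> \<eta>. F t \<xi> \<eta> - G t \<xi> \<eta>)"
  using dominated_add [of F "\<lambda>t \<xi> \<eta>. (-1) * G t \<xi> \<eta>"] dominated_cmult [of G "-1"] by simp

lemma dominated_integrable:
  fixes F :: "real \<Rightarrow> 'a::euclidean_space \<Rightarrow> 'a \<Rightarrow> real"
  assumes "dominated F" "t \<in> {0..1}"
  shows "integrable gauss (\<lambda>\<xi>. F t \<xi> \<eta>)"
proof -
  obtain C K where CK: "0 \<le> C" "0 \<le> K" "\<And>t \<xi> \<eta>. t \<in> {0..1} \<Longrightarrow> norm (F t \<xi> \<eta>) \<le> C * exp (K * norm \<xi>)"
    using dominatedE [OF assms(1)] by blast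
  show ?thesis
    by (rule integrable_gauss_bound [OF dominated_measurable1 [OF assms(1)]]) (use CK assms in blast)
qed

text \<open>Integrating out the first variable leaves a bound by a constant. The idle variable keeps
  the result inside the class, so that inner integrals of the mixed norm can be treated like the
  other functions.\<close>

lemma dominated_integral:
  fixes F :: "real \<Rightarrow> 'a::euclidean_space \<Rightarrow> 'a \<Rightarrow> real"
  assumes "dominated F"
  shows "dominated (\<lambda>t \<xi> \<eta>. \<integral>x. F t x \<eta> \<partial>gauss)"
proof -
  obtain C K where CK: "0 \<le> C" "0 \<le> K" "\<And>t \<xi> \<eta>. t \<in> {0..1} \<Longrightarrow> norm (F t \<xi> \<eta>) \<le> C * exp (K * norm \<xi>)"
    using dominatedE [OF assms(1)] by blast
  have m: "(\<lambda>\<eta>. \<integral>x. F t x \<eta> \<partial>gauss) \<in> borel_measurable borel" for t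
  proof -
    have "case_prod (\<lambda>\<eta> x. F t x \<eta>) \<in> borel_measurable (borel \<Otimes>\<^sub>M gauss)"
    proof -
      have "(\<lambda>z. F t (snd z) (fst z)) \<in> borel_measurable (borel \<Otimes>\<^sub>M borel)"
        using measurable_compose [OF measurable_pair_swap' dominated_measurable_pair [OF assms, of t]]
        by (simp add: case_prod_beta)
      moreover have "sets (borel \<Otimes>\<^sub>M gauss :: ('a \<times> 'a) measure) = sets (borel \<Otimes>\<^sub>M borel)"
        by (rule sets_pair_measure_cong) simp_all
      ultimately show ?thesis
        by (simp add: case_prod_beta cong: measurable_cong_sets)
    qed
    then show ?thesis by (rule gauss.borel_measurable_lebesgue_integral)
  qed
  show ?thesis
  proof (rule dominated_bounded [where C = "\<integral>x. C * exp (K * norm x) \<partial>(gauss :: 'a measure)"])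
    show "(\<lambda>z. \<integral>x. F t x (snd z) \<partial>gauss) \<in> borel_measurable (borel \<Otimes>\<^sub>M borel)" for t
      by (rule measurable_compose [OF measurable_snd m])
    show "norm (\<integral>x. F t x \<eta> \<partial>gauss) \<le> (\<integral>x. C * exp (K * norm x) \<partial>(gauss :: 'a measure))"
      if "t \<in> {0..1}" for t and \<xi> \<eta> :: 'a
    proof -
      have "norm (\<integral>x. F t x \<eta> \<partial>gauss) \<le> (\<integral>x. norm (F t x \<eta>) \<partial>gauss)"
        by (rule integral_norm_bound)
      also have "\<dots> \<le> (\<integral>x. C * exp (K * norm x) \<partial>(gauss :: 'a measure))"
        using CK(3)[OF that] that assms
        by (intro integral_mono integrable_norm dominated_integrable integrable_mult_right integrable_gauss_exp) auto
      finally show ?thesis .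
    qed
  qed
qed

lemma dominated_integral_bound:
  fixes F :: "real \<Rightarrow> 'a::euclidean_space \<Rightarrow> 'a \<Rightarrow> real"
  assumes "dominated F"
  obtains C where "0 \<le> C" "\<And>t \<eta>. t \<in> {0..1} \<Longrightarrow> \<bar>\<integral>x. F t x \<eta> \<partial>gauss\<bar> \<le> C"
proof -
  obtain C K where CK: "0 \<le> C" "0 \<le> K" "\<And>t \<xi> \<eta>. t \<in> {0..1} \<Longrightarrow> norm (\<integral>x. F t x \<eta> \<partial>gauss) \<le> C * exp (K * norm (\<xi>::'a))"
    using dominatedE [OF dominated_integral [OF assms]] by metis
  show ?thesis
    by (rule that [of C]) (use CK(3)[of _ _ 0] CK(1) in auto)
qed

lemma dominated_integral_measurable:
  fixes F :: "real \<Rightarrow> 'a::euclidean_space \<Rightarrow> 'a \<Rightarrow> real"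
  assumes "dominated F"
  shows "(\<lambda>\<eta>. \<integral>x. F t x \<eta> \<partial>gauss) \<in> borel_measurable borel"
proof -
  have "(\<lambda>\<eta>. (0::'a, \<eta>::'a)) \<in> borel \<rightarrow>\<^sub>M (borel \<Otimes>\<^sub>M borel)" by simp
  from measurable_compose [OF this dominated_measurable_pair [OF dominated_integral [OF assms], of t]] show ?thesis by simp
qed

text \<open>The summand \<epsilon>^2 keeps the base positive: the formula holds for every real
  exponent, also where \<open>g\<close> vanishes.\<close>

lemma DERIV_norm_sq_powr:
  fixes g :: "real \<Rightarrow> complex"
  assumes "(g has_vector_derivative g') (at t)" "0 < \<epsilon>"
  shows "((\<lambda>t. ((cmod (g t))\<^sup>2 + \<epsilon>\<^sup>2) powr s) has_real_derivative
     2 * s * ((cmod (g t))\<^sup>2 + \<epsilon>\<^sup>2) powr (s - 1) * inner (g t) g') (at t)"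
proof -
  have "((\<lambda>t. inner (g t) (g t)) has_vector_derivative (inner (g t) g' + inner g' (g t))) (at t)"
    by (rule bounded_bilinear.has_vector_derivative [OF bounded_bilinear_inner assms(1) assms(1)])
  then have "((\<lambda>t. (cmod (g t))\<^sup>2 + \<epsilon>\<^sup>2) has_real_derivative (2 * inner (g t) g')) (at t)"
    by (auto simp: has_real_derivative_iff_has_vector_derivative power2_norm_eq_inner inner_commute
        intro!: derivative_eq_intros)
  from DERIV_fun_powr [OF this, of s] show ?thesis
    using \<open>0 < \<epsilon>\<close> by (simp add: add_nonneg_pos mult.assoc mult.left_commute)
qed

section \<open>The interpolating flow and its derivatives\<close>

locale mehler_flow =
  fixes S :: "'a::euclidean_space set" and c :: "'a \<Rightarrow> complex" and p \<epsilon> :: real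
  assumes finite_S: "finite S" and p: "1 < p" "p < 2" and eps: "0 < \<epsilon>"
begin

definition \<kappa> :: real where "\<kappa> = sqrt (p - 1)"

lemma kappa: "0 < \<kappa>" "\<kappa>\<^sup>2 = p - 1"
  using p by (auto simp: \<kappa>_def)

text \<open>A heat flow with constant mean. The growth p t |a|^2/2 makes up for the loss t |a|^2/2
  in the real exponential and for the damping (p - 1) t |a|^2/2 by the phase: averaged over both
  Gaussian variables, the value is exp(|a|^2/2) at every time.\<close>

definition wave :: "'a \<Rightarrow> real \<Rightarrow> 'a \<Rightarrow> 'a \<Rightarrow> complex" where
  "wave a t \<xi> \<eta> = exp (of_real (p * t * (norm a)\<^sup>2 / 2 + sqrt (1 - t) * (a \<bullet> \<xi>)) + \<i> * of_real (\<kappa> * sqrt t * (a \<bullet> \<eta>)))"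

text \<open>The weight \<open>w\<close> serves the derivatives: differentiation in direction b
  multiplies each term by a factor common to all terms times a . b, so every space derivative is
  again of this form.\<close>

definition comb :: "('a \<Rightarrow> real) \<Rightarrow> real \<Rightarrow> 'a \<Rightarrow> 'a \<Rightarrow> complex" where
  "comb w t \<xi> \<eta> = (\<Sum>a\<in>S. of_real (w a) * c a * wave a t \<xi> \<eta>)"

lemma wave_measurable: "(\<lambda>z. wave a t (fst z) (snd z)) \<in> borel_measurable (borel \<Otimes>\<^sub>M borel)"
proof -
  have "continuous_on UNIV (\<lambda>z. wave a t (fst z) (snd z))"
    unfolding wave_def by (intro continuous_intros)
  then show ?thesis unfolding borel_prod by (rule borel_measurable_continuous_onI)
qed

text \<open>The second variable enters through a phase only; hence a bound that is uniform in
  it.\<close>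

lemma dominated_comb: "dominated (comb w)"
  unfolding comb_def
proof (rule dominated_sum)
  fix a assume "a \<in> S"
  show "dominated (\<lambda>t \<xi> \<eta>. complex_of_real (w a) * c a * wave a t \<xi> \<eta>)"
  proof (rule dominatedI [where C = "norm (of_real (w a) * c a) * exp (p * (norm a)\<^sup>2 / 2)" and K = "norm a"])
    show "(\<lambda>z. complex_of_real (w a) * c a * wave a t (fst z) (snd z)) \<in> borel_measurable (borel \<Otimes>\<^sub>M borel)" for t
      by (intro borel_measurable_times wave_measurable borel_measurable_const)
    fix t :: real and \<xi> \<eta> :: 'a assume t: "t \<in> {0..1}"
    have "p * t * (norm a)\<^sup>2 / 2 \<le> p * (norm a)\<^sup>2 / 2"
      using t p by (simp add: mult_left_le mult_right_mono)
    moreover have "sqrt (1 - t) * (a \<bullet> \<xi>) \<le> norm a * norm \<xi>"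
    proof -
      have "\<bar>sqrt (1 - t) * (a \<bullet> \<xi>)\<bar> \<le> 1 * (norm a * norm \<xi>)"
        unfolding abs_mult using t by (intro mult_mono Cauchy_Schwarz_ineq2) auto
      then show ?thesis by simp
    qed
    ultimately have "cmod (wave a t \<xi> \<eta>) \<le> exp (p * (norm a)\<^sup>2 / 2 + norm a * norm \<xi>)"
      by (simp add: wave_def)
    then show "cmod (complex_of_real (w a) * c a * wave a t \<xi> \<eta>) \<le>
        norm (of_real (w a) * c a) * exp (p * (norm a)\<^sup>2 / 2) * exp (norm a * norm \<xi>)"
      unfolding norm_mult mult.assoc by (intro mult_left_mono) (auto simp: exp_add)
  qed auto
qed

lemma comb_has_vector_derivative:
  assumes "\<And>a. a \<in> S \<Longrightarrow> ((\<lambda>\<tau>. wave a (t \<tau>) (\<xi> \<tau>) (\<eta> \<tau>)) has_vector_derivative (v a * wave a (t \<tau>) (\<xi> \<tau>) (\<eta> \<tau>))) (at \<tau>)"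
  shows "((\<lambda>\<tau>. comb w (t \<tau>) (\<xi> \<tau>) (\<eta> \<tau>)) has_vector_derivative
     (\<Sum>a\<in>S. of_real (w a) * c a * (v a * wave a (t \<tau>) (\<xi> \<tau>) (\<eta> \<tau>)))) (at \<tau>)"
  unfolding comb_def using assms
  by (intro has_vector_derivative_sum has_vector_derivative_mult_right) auto

lemma exp_has_vector_derivative:
  fixes g :: "real \<Rightarrow> complex"
  assumes "(g has_vector_derivative g') (at \<tau>)"
  shows "((\<lambda>\<tau>. exp (g \<tau>)) has_vector_derivative (g' * exp (g \<tau>))) (at \<tau>)"
  using field_vector_diff_chain_at [OF assms, of exp "exp (g \<tau>)"] DERIV_exp by (simp add: comp_def)

lemma comb_deriv_xi:
  "((\<lambda>\<tau>. comb w t (\<xi> + \<tau> *\<^sub>R b) \<eta>) has_vector_derivative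
     of_real (sqrt (1 - t)) * comb (\<lambda>a. w a * (a \<bullet> b)) t (\<xi> + \<tau> *\<^sub>R b) \<eta>) (at \<tau>)"
proof -
  have "((\<lambda>\<tau>. comb w t (\<xi> + \<tau> *\<^sub>R b) \<eta>) has_vector_derivative
     (\<Sum>a\<in>S. of_real (w a) * c a * (of_real (sqrt (1 - t) * (a \<bullet> b)) * wave a t (\<xi> + \<tau> *\<^sub>R b) \<eta>))) (at \<tau>)"
  proof (rule comb_has_vector_derivative [where t = "\<lambda>_. t" and \<eta> = "\<lambda>_. \<eta>"])
    fix a assume "a \<in> S"
    show "((\<lambda>\<tau>. wave a t (\<xi> + \<tau> *\<^sub>R b) \<eta>) has_vector_derivative
       of_real (sqrt (1 - t) * (a \<bullet> b)) * wave a t (\<xi> + \<tau> *\<^sub>R b) \<eta>) (at \<tau>)"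
      unfolding wave_def
      by (rule exp_has_vector_derivative) (auto intro!: derivative_eq_intros simp: inner_simps)
  qed
  then show ?thesis by (simp add: comb_def sum_distrib_left algebra_simps)
qed

lemma comb_deriv_eta:
  "((\<lambda>\<tau>. comb w t \<xi> (\<eta> + \<tau> *\<^sub>R b)) has_vector_derivative
     \<i> * of_real (\<kappa> * sqrt t) * comb (\<lambda>a. w a * (a \<bullet> b)) t \<xi> (\<eta> + \<tau> *\<^sub>R b)) (at \<tau>)"
proof -
  have "((\<lambda>\<tau>. comb w t \<xi> (\<eta> + \<tau> *\<^sub>R b)) has_vector_derivative
     (\<Sum>a\<in>S. of_real (w a) * c a * ((\<i> * of_real (\<kappa> * sqrt t * (a \<bullet> b))) * wave a t \<xi> (\<eta> + \<tau> *\<^sub>R b)))) (at \<tau>)"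
  proof (rule comb_has_vector_derivative [where t = "\<lambda>_. t" and \<xi> = "\<lambda>_. \<xi>"])
    fix a assume "a \<in> S"
    show "((\<lambda>\<tau>. wave a t \<xi> (\<eta> + \<tau> *\<^sub>R b)) has_vector_derivative
       (\<i> * of_real (\<kappa> * sqrt t * (a \<bullet> b))) * wave a t \<xi> (\<eta> + \<tau> *\<^sub>R b)) (at \<tau>)"
      unfolding wave_def
      by (rule exp_has_vector_derivative) (auto intro!: derivative_eq_intros simp: inner_simps)
  qed
  then show ?thesis by (simp add: comb_def sum_distrib_left algebra_simps)
qed

lemma comb_deriv_t:
  assumes "0 < t" "t < 1"
  shows "((\<lambda>t. comb (\<lambda>_. 1) t \<xi> \<eta>) has_vector_derivative
     (\<Sum>b\<in>Basis. of_real (p / 2) * comb (\<lambda>a. (a \<bullet> b)\<^sup>2) t \<xi> \<eta>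
        - of_real ((\<xi> \<bullet> b) / (2 * sqrt (1 - t))) * comb (\<lambda>a. a \<bullet> b) t \<xi> \<eta>
        + \<i> * of_real (\<kappa> * (\<eta> \<bullet> b) / (2 * sqrt t)) * comb (\<lambda>a. a \<bullet> b) t \<xi> \<eta>)) (at t)"
proof -
  \<comment> \<open>The logarithmic derivative of \<open>wave\<close> in time. It is then split over
    \<open>Basis\<close>, so that each summand can be matched with an integration by parts in a
    single direction.\<close>
  let ?v = "\<lambda>a. of_real (p * (norm a)\<^sup>2 / 2 - (a \<bullet> \<xi>) / (2 * sqrt (1 - t))) + \<i> * of_real (\<kappa> * (a \<bullet> \<eta>) / (2 * sqrt t))"
  have *: "((\<lambda>t. comb (\<lambda>_. 1) t \<xi> \<eta>) has_vector_derivative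
     (\<Sum>a\<in>S. of_real 1 * c a * (?v a * wave a t \<xi> \<eta>))) (at t)"
  proof (rule comb_has_vector_derivative [where \<xi> = "\<lambda>_. \<xi>" and \<eta> = "\<lambda>_. \<eta>" and w = "\<lambda>_. 1" and t = "\<lambda>t. t"])
    fix a assume "a \<in> S"
    have "((\<lambda>t. p * t * (norm a)\<^sup>2 / 2 + sqrt (1 - t) * (a \<bullet> \<xi>)) has_real_derivative
       (p * (norm a)\<^sup>2 / 2 - (a \<bullet> \<xi>) / (2 * sqrt (1 - t)))) (at t)"
      using assms by (auto intro!: derivative_eq_intros simp: field_simps)
    then have 1: "((\<lambda>t. complex_of_real (p * t * (norm a)\<^sup>2 / 2 + sqrt (1 - t) * (a \<bullet> \<xi>))) has_vector_derivative
       of_real (p * (norm a)\<^sup>2 / 2 - (a \<bullet> \<xi>) / (2 * sqrt (1 - t)))) (at t)"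
      by (rule has_vector_derivative_of_real)
    have "((\<lambda>t. \<kappa> * sqrt t * (a \<bullet> \<eta>)) has_real_derivative (\<kappa> * (a \<bullet> \<eta>) / (2 * sqrt t))) (at t)"
      using assms by (auto intro!: derivative_eq_intros simp: field_simps)
    then have 2: "((\<lambda>t. complex_of_real (\<kappa> * sqrt t * (a \<bullet> \<eta>))) has_vector_derivative of_real (\<kappa> * (a \<bullet> \<eta>) / (2 * sqrt t))) (at t)"
      by (rule has_vector_derivative_of_real)
    show "((\<lambda>t. wave a t \<xi> \<eta>) has_vector_derivative ?v a * wave a t \<xi> \<eta>) (at t)"
      unfolding wave_def
      by (rule exp_has_vector_derivative) (intro has_vector_derivative_add has_vector_derivative_mult_right 1 2)
  qed
  have ex: "?v a = (\<Sum>b\<in>Basis. of_real (p / 2) * of_real ((a \<bullet> b)\<^sup>2) - of_real ((\<xi> \<bullet> b) / (2 * sqrt (1 - t))) * of_real (a \<bullet> b)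
      + \<i> * of_real (\<kappa> * (\<eta> \<bullet> b) / (2 * sqrt t)) * of_real (a \<bullet> b))" for a
  proof -
    have "(norm a)\<^sup>2 = (\<Sum>b\<in>Basis. (a \<bullet> b)\<^sup>2)"
      unfolding power2_norm_eq_inner by (subst euclidean_inner) (simp add: power2_eq_square)
    moreover have "a \<bullet> \<xi> = (\<Sum>b\<in>Basis. (\<xi> \<bullet> b) * (a \<bullet> b))" "a \<bullet> \<eta> = (\<Sum>b\<in>Basis. (\<eta> \<bullet> b) * (a \<bullet> b))"
      by (subst euclidean_inner, simp add: mult.commute)+
    ultimately show ?thesis
      by (simp add: sum.distrib sum_subtractf sum_distrib_left sum_divide_distrib algebra_simps)
  qed
  have "(\<Sum>a\<in>S. of_real 1 * c a * (?v a * wave a t \<xi> \<eta>)) =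
    (\<Sum>b\<in>Basis. of_real (p / 2) * comb (\<lambda>a. (a \<bullet> b)\<^sup>2) t \<xi> \<eta>
        - of_real ((\<xi> \<bullet> b) / (2 * sqrt (1 - t))) * comb (\<lambda>a. a \<bullet> b) t \<xi> \<eta>
        + \<i> * of_real (\<kappa> * (\<eta> \<bullet> b) / (2 * sqrt t)) * comb (\<lambda>a. a \<bullet> b) t \<xi> \<eta>)"
    unfolding ex comb_def sum_distrib_left sum_distrib_right sum_subtractf [symmetric] sum.distrib [symmetric]
    by (subst sum.swap, intro sum.cong refl) (simp add: algebra_simps)
  with * show ?thesis by simp
qed

end

lemma measure_gauss_UNIV [simp]: "measure gauss UNIV = 1"
  using gauss.prob_space by simp

lemma borel_measurable_gauss_eq: "borel_measurable gauss = borel_measurable borel"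
  by (rule measurable_cong_sets) simp_all

lemma dominated_abs:
  fixes F :: "real \<Rightarrow> 'a::euclidean_space \<Rightarrow> 'a \<Rightarrow> real"
  assumes "dominated F"
  shows "dominated (\<lambda>t \<xi> \<eta>. \<bar>F t \<xi> \<eta>\<bar>)"
  using assms unfolding dominated_def by (auto intro!: borel_measurable_abs)

lemma dominated_inner_xi: "dominated (\<lambda>t \<xi> \<eta>. \<xi> \<bullet> b)"
proof (rule dominatedI [where C = "norm b" and K = 1])
  fix \<xi> :: 'a
  have le: "norm \<xi> \<le> exp (1 * norm \<xi>)"
    using exp_ge_add_one_self [of "norm \<xi>"] unfolding mult_1 by linarith
  have "norm (\<xi> \<bullet> b) \<le> norm \<xi> * norm b"
    by (simp add: Cauchy_Schwarz_ineq2)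
  also have "\<dots> \<le> exp (1 * norm \<xi>) * norm b"
    using le by (intro mult_right_mono) auto
  finally show "norm (\<xi> \<bullet> b) \<le> norm b * exp (1 * norm \<xi>)" by (simp add: mult.commute)
qed auto

text \<open>The power is monotone in x or antitone, according to the sign of s, so one of the two
  end point values dominates. Exponents of both signs occur in the flow.\<close>

lemma powr_le_endpoints:
  assumes "0 < m" "m \<le> (x::real)" "x \<le> C"
  shows "x powr s \<le> m powr s + C powr s"
proof (cases "0 \<le> s")
  case True
  then have "x powr s \<le> C powr s" using assms by (intro powr_mono2) auto
  then show ?thesis using powr_ge_zero[of m s] by linarith
next
  case False
  then have "x powr s \<le> m powr s" using assms by (intro powr_mono2') auto
  then show ?thesis using powr_ge_zero[of C s] by linarith
qed

section \<open>The regularised integrand, its derivatives and the mixed norm\<close>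

context mehler_flow
begin

abbreviation "h \<equiv> comb (\<lambda>_. 1)"
abbreviation "hd1 b \<equiv> comb (\<lambda>a. a \<bullet> b)"
abbreviation "hd2 b \<equiv> comb (\<lambda>a. (a \<bullet> b)\<^sup>2)"

definition sq :: "real \<Rightarrow> 'a \<Rightarrow> 'a \<Rightarrow> real" where
  "sq t \<xi> \<eta> = (cmod (h t \<xi> \<eta>))\<^sup>2 + \<epsilon>\<^sup>2"

definition Nf :: "real \<Rightarrow> 'a \<Rightarrow> 'a \<Rightarrow> real" where
  "Nf t \<xi> \<eta> = sq t \<xi> \<eta> powr (p / 2)"

text \<open>Up to constant factors, \<open>Px b\<close> and \<open>Iy b\<close> are the derivatives of \<open>Nf\<close> in direction \<open>b\<close> with respect to
  the first and the second space variable, \<open>Pxx b\<close> and \<open>Iyy b\<close> the second derivatives, and \<open>Tt b\<close> the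
  part of the time derivative that comes from the heat equation.\<close>

definition Px :: "'a \<Rightarrow> real \<Rightarrow> 'a \<Rightarrow> 'a \<Rightarrow> real" where
  "Px b t \<xi> \<eta> = sq t \<xi> \<eta> powr (p / 2 - 1) * inner (h t \<xi> \<eta>) (hd1 b t \<xi> \<eta>)"

definition Pxx :: "'a \<Rightarrow> real \<Rightarrow> 'a \<Rightarrow> 'a \<Rightarrow> real" where
  "Pxx b t \<xi> \<eta> = (p - 2) * sq t \<xi> \<eta> powr (p / 2 - 2) * (inner (h t \<xi> \<eta>) (hd1 b t \<xi> \<eta>))\<^sup>2
     + sq t \<xi> \<eta> powr (p / 2 - 1) * (inner (hd1 b t \<xi> \<eta>) (hd1 b t \<xi> \<eta>) + inner (h t \<xi> \<eta>) (hd2 b t \<xi> \<eta>))"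

definition Iy :: "'a \<Rightarrow> real \<Rightarrow> 'a \<Rightarrow> 'a \<Rightarrow> real" where
  "Iy b t \<xi> \<eta> = sq t \<xi> \<eta> powr (p / 2 - 1) * inner (\<i> * h t \<xi> \<eta>) (hd1 b t \<xi> \<eta>)"

definition Iyy :: "'a \<Rightarrow> real \<Rightarrow> 'a \<Rightarrow> 'a \<Rightarrow> real" where
  "Iyy b t \<xi> \<eta> = (2 - p) * sq t \<xi> \<eta> powr (p / 2 - 2) * (inner (\<i> * h t \<xi> \<eta>) (hd1 b t \<xi> \<eta>))\<^sup>2
     + sq t \<xi> \<eta> powr (p / 2 - 1) * (inner (h t \<xi> \<eta>) (hd2 b t \<xi> \<eta>) - inner (hd1 b t \<xi> \<eta>) (hd1 b t \<xi> \<eta>))"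

definition Tt :: "'a \<Rightarrow> real \<Rightarrow> 'a \<Rightarrow> 'a \<Rightarrow> real" where
  "Tt b t \<xi> \<eta> = sq t \<xi> \<eta> powr (p / 2 - 1) * (p / 2 * inner (h t \<xi> \<eta>) (hd2 b t \<xi> \<eta>))"

lemma sq_ge: "\<epsilon>\<^sup>2 \<le> sq t \<xi> \<eta>" and sq_pos: "0 < sq t \<xi> \<eta>"
  using eps by (auto simp: sq_def add_nonneg_pos)

lemma dominated_sq: "dominated sq"
proof -
  have "dominated (\<lambda>t \<xi> \<eta>. inner (h t \<xi> \<eta>) (h t \<xi> \<eta>) + \<epsilon>\<^sup>2)"
    by (intro dominated_add dominated_inner dominated_comb dominated_const)
  then show ?thesis by (simp add: sq_def [abs_def] power2_norm_eq_inner)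
qed

text \<open>Negative exponents are controlled by the floor \<epsilon>^2 and exponents up to 1 by
  \<open>sq\<close> itself. All exponents of the flow, from p/2 - 2 to p/2, are below 1.\<close>

lemma dominated_sq_powr:
  assumes "s \<le> 1"
  shows "dominated (\<lambda>t \<xi> \<eta>. sq t \<xi> \<eta> powr s)"
proof -
  note [measurable] = dominated_measurable_pair [OF dominated_sq]
  have "dominated (\<lambda>t \<xi> \<eta>. sq t \<xi> \<eta> + (1 + (\<epsilon>\<^sup>2) powr s))"
    by (intro dominated_add dominated_sq dominated_const)
  then obtain C K where CK: "0 \<le> C" "0 \<le> K" "\<And>t \<xi> \<eta>. t \<in> {0..1} \<Longrightarrow> norm (sq t \<xi> \<eta> + (1 + (\<epsilon>\<^sup>2) powr s)) \<le> C * exp (K * norm \<xi>)"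
    using dominatedE by blast
  have le: "sq t \<xi> \<eta> powr s \<le> sq t \<xi> \<eta> + (1 + (\<epsilon>\<^sup>2) powr s)" for t \<xi> \<eta>
  proof -
    have "sq t \<xi> \<eta> powr s \<le> (\<epsilon>\<^sup>2) powr s + (max 1 (sq t \<xi> \<eta>)) powr s"
      using eps by (intro powr_le_endpoints sq_ge) auto
    also have "(max 1 (sq t \<xi> \<eta>)) powr s \<le> (max 1 (sq t \<xi> \<eta>)) powr 1"
      using assms by (intro powr_mono) auto
    also have "\<dots> \<le> 1 + sq t \<xi> \<eta>" using sq_pos[of t \<xi> \<eta>] by simp
    finally show ?thesis by simp
  qed
  show ?thesis
  proof (rule dominatedI [OF _ CK(1,2)])
    show "norm (sq t \<xi> \<eta> powr s) \<le> C * exp (K * norm \<xi>)" if "t \<in> {0..1}" for t \<xi> \<eta>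
      using le[of t \<xi> \<eta>] CK(3)[OF that, of \<xi> \<eta>] by simp
  qed simp
qed

lemma dominated_ih: "dominated (\<lambda>t \<xi> \<eta>. \<i> * h t \<xi> \<eta>)"
proof -
  note [measurable] = dominated_measurable_pair [OF dominated_comb[of "\<lambda>_. 1"]]
  have "(\<lambda>z. \<i> * h t (fst z) (snd z)) \<in> borel_measurable (borel \<Otimes>\<^sub>M borel)" for t
    by simp
  then show ?thesis using dominated_comb[of "\<lambda>_. 1"] unfolding dominated_def by (simp add: norm_mult)
qed

lemma dominated_Nf: "dominated Nf"
  unfolding Nf_def [abs_def] using p by (intro dominated_sq_powr) simp

lemma dominated_Px: "dominated (Px b)"
  unfolding Px_def [abs_def] using p
  by (intro dominated_mult dominated_inner dominated_sq_powr dominated_comb) simp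

lemma dominated_Iy: "dominated (Iy b)"
  unfolding Iy_def [abs_def] using p
  by (intro dominated_mult dominated_inner dominated_sq_powr dominated_comb dominated_ih) simp

lemma dominated_Pxx: "dominated (Pxx b)"
  unfolding Pxx_def [abs_def] power2_eq_square using p
  by (intro dominated_add dominated_mult dominated_inner dominated_sq_powr dominated_comb dominated_const) simp_all

lemma dominated_Iyy: "dominated (Iyy b)"
  unfolding Iyy_def [abs_def] power2_eq_square using p
  by (intro dominated_add dominated_diff dominated_mult dominated_inner dominated_sq_powr dominated_comb dominated_const dominated_ih) simp_all

lemma dominated_Tt: "dominated (Tt b)"
  unfolding Tt_def [abs_def] using p
  by (intro dominated_mult dominated_inner dominated_sq_powr dominated_comb dominated_const) simp_all

lemma inner_i_mult: "inner z (\<i> * w) = - inner (\<i> * z) w" for z w :: complex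
  by (simp add: inner_complex_def)

lemma inner_of_real_mult: "inner z (complex_of_real x * w) = x * inner z w"
  by (simp add: inner_complex_def algebra_simps)

lemma inner_of_real_mult_left: "inner (complex_of_real x * z) w = x * inner z w"
  by (simp add: inner_complex_def algebra_simps)

lemma inner_has_real_derivative:
  fixes f g :: "real \<Rightarrow> complex"
  assumes "(f has_vector_derivative f') (at t)" "(g has_vector_derivative g') (at t)"
  shows "((\<lambda>t. inner (f t) (g t)) has_real_derivative (inner (f t) g' + inner f' (g t))) (at t)"
  using bounded_bilinear.has_vector_derivative [OF bounded_bilinear_inner assms]
  by (simp add: has_real_derivative_iff_has_vector_derivative)

lemma sq_powr_deriv_xi:
  "((\<lambda>\<tau>. sq t (\<xi> + \<tau> *\<^sub>R b) \<eta> powr s) has_real_derivative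
     sqrt (1 - t) * (2 * s * sq t (\<xi> + \<tau> *\<^sub>R b) \<eta> powr (s - 1) * inner (h t (\<xi> + \<tau> *\<^sub>R b) \<eta>) (hd1 b t (\<xi> + \<tau> *\<^sub>R b) \<eta>))) (at \<tau>)"
  using DERIV_norm_sq_powr [OF comb_deriv_xi eps, of "\<lambda>_. 1" t \<xi> b \<eta> s \<tau>]
  by (simp add: sq_def inner_of_real_mult algebra_simps)

lemma sq_powr_deriv_eta:
  "((\<lambda>\<tau>. sq t \<xi> (\<eta> + \<tau> *\<^sub>R b) powr s) has_real_derivative
     - \<kappa> * sqrt t * (2 * s * sq t \<xi> (\<eta> + \<tau> *\<^sub>R b) powr (s - 1) * inner (\<i> * h t \<xi> (\<eta> + \<tau> *\<^sub>R b)) (hd1 b t \<xi> (\<eta> + \<tau> *\<^sub>R b)))) (at \<tau>)"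
  using DERIV_norm_sq_powr [OF comb_deriv_eta eps, of "\<lambda>_. 1" t \<xi> \<eta> b s \<tau>]
  by (simp add: sq_def inner_of_real_mult inner_i_mult mult.assoc algebra_simps del: of_real_mult)

lemma Px_deriv:
  "((\<lambda>\<tau>. Px b t (\<xi> + \<tau> *\<^sub>R b) \<eta>) has_real_derivative sqrt (1 - t) * Pxx b t (\<xi> + \<tau> *\<^sub>R b) \<eta>) (at \<tau>)"
proof -
  note d = DERIV_mult [OF sq_powr_deriv_xi [of t \<xi> b \<eta> "p/2 - 1" \<tau>]
      inner_has_real_derivative [OF comb_deriv_xi [of "\<lambda>_. 1" t \<xi> b \<eta> \<tau>] comb_deriv_xi [of "\<lambda>a. a \<bullet> b" t \<xi> b \<eta> \<tau>]]]
  show ?thesis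
    unfolding Px_def Pxx_def
    by (rule DERIV_cong [OF d]) (simp add: inner_of_real_mult inner_of_real_mult_left algebra_simps power2_eq_square)
qed

lemma Nf_deriv_eta:
  "((\<lambda>\<tau>. Nf t \<xi> (\<eta> + \<tau> *\<^sub>R b)) has_real_derivative - (p * \<kappa> * sqrt t) * Iy b t \<xi> (\<eta> + \<tau> *\<^sub>R b)) (at \<tau>)"
  unfolding Nf_def Iy_def
  by (rule DERIV_cong [OF sq_powr_deriv_eta]) simp

text \<open>Each derivative in \<eta> brings a factor i. It stands in both entries of the inner
  product with \<open>hd2\<close> and leaves its sign, but squares to -1 in the term with |hd1|^2;
  this opposite sign, compared with \<open>Pxx\<close>, is what \<open>pointwise_sign\<close>
  exploits.\<close>

lemma Iy_deriv:
  "((\<lambda>\<tau>. Iy b t \<xi> (\<eta> + \<tau> *\<^sub>R b)) has_real_derivative \<kappa> * sqrt t * Iyy b t \<xi> (\<eta> + \<tau> *\<^sub>R b)) (at \<tau>)"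
proof -
  note d = DERIV_mult [OF sq_powr_deriv_eta [of t \<xi> \<eta> b "p/2 - 1" \<tau>]
      inner_has_real_derivative [OF has_vector_derivative_mult_right [OF comb_deriv_eta [of "\<lambda>_. 1" t \<xi> \<eta> b \<tau>], of \<i>]
          comb_deriv_eta [of "\<lambda>a. a \<bullet> b" t \<xi> \<eta> b \<tau>]]]
  have neg: "inner (\<i> * (\<i> * (complex_of_real r * x))) y = - (r * inner x y)" for r x y
    by (simp add: inner_complex_def algebra_simps)
  have neg2: "inner (\<i> * x) (\<i> * (complex_of_real r * y)) = r * inner x y" for r x y
    by (simp add: inner_complex_def algebra_simps)
  show ?thesis
    unfolding Iy_def Iyy_def
    by (rule DERIV_cong [OF d])
       (simp add: mult.assoc neg neg2 inner_of_real_mult_left algebra_simps power2_eq_square del: of_real_mult)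
qed

text \<open>The time derivative before any integration by parts. Its coefficients 1/sqrt(1 - t) and
  1/sqrt t are singular at the ends of the interval and disappear only under the integrals.\<close>

definition Nf' :: "real \<Rightarrow> 'a \<Rightarrow> 'a \<Rightarrow> real" where
  "Nf' t \<xi> \<eta> = (\<Sum>b\<in>Basis. p * Tt b t \<xi> \<eta> - p / (2 * sqrt (1 - t)) * ((\<xi> \<bullet> b) * Px b t \<xi> \<eta>)
      - p * \<kappa> / (2 * sqrt t) * ((\<eta> \<bullet> b) * Iy b t \<xi> \<eta>))"

lemma Nf_deriv_t:
  assumes "0 < t" "t < 1"
  shows "((\<lambda>t. Nf t \<xi> \<eta>) has_real_derivative Nf' t \<xi> \<eta>) (at t)"
proof -
  have i: "inner (h t \<xi> \<eta>) (\<Sum>b\<in>Basis. of_real (p / 2) * hd2 b t \<xi> \<eta>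
        - of_real ((\<xi> \<bullet> b) / (2 * sqrt (1 - t))) * hd1 b t \<xi> \<eta>
        + \<i> * of_real (\<kappa> * (\<eta> \<bullet> b) / (2 * sqrt t)) * hd1 b t \<xi> \<eta>)
     = (\<Sum>b\<in>Basis. p / 2 * inner (h t \<xi> \<eta>) (hd2 b t \<xi> \<eta>)
        - (\<xi> \<bullet> b) / (2 * sqrt (1 - t)) * inner (h t \<xi> \<eta>) (hd1 b t \<xi> \<eta>)
        - (\<kappa> * (\<eta> \<bullet> b) / (2 * sqrt t)) * inner (\<i> * h t \<xi> \<eta>) (hd1 b t \<xi> \<eta>))"
    unfolding inner_sum_right inner_add_right inner_diff_right mult.assoc inner_i_mult
    by (simp only: inner_of_real_mult) simp
  show ?thesis
    unfolding Nf_def Nf'_def sq_def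
    by (rule DERIV_cong [OF DERIV_norm_sq_powr [OF comb_deriv_t [OF assms] eps]], subst i)
       (simp add: Tt_def Px_def Iy_def sq_def sum_distrib_left algebra_simps)
qed

definition Gf :: "real \<Rightarrow> 'a \<Rightarrow> real" where
  "Gf t \<eta> = (\<integral>\<xi>. Nf t \<xi> \<eta> \<partial>gauss)"

text \<open>The outer exponent q / p of the mixed norm, for the conjugate exponent q = p / (p -
  1).\<close>

definition r where "r = 1 / (p - 1)"

definition Qf :: "real \<Rightarrow> real" where
  "Qf t = (\<integral>\<eta>. Gf t \<eta> powr r \<partial>gauss)"

definition m where "m = (\<epsilon>\<^sup>2) powr (p / 2)"

lemma m_pos: "0 < m" using eps by (simp add: m_def)

lemma Gf_ge: "t \<in> {0..1} \<Longrightarrow> m \<le> Gf t \<eta>"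
proof -
  assume t: "t \<in> {0..1}"
  have "(\<integral>\<xi>. m \<partial>(gauss :: 'a measure)) \<le> Gf t \<eta>"
    unfolding Gf_def Nf_def m_def using p
    by (intro integral_mono dominated_integrable [OF dominated_Nf t, unfolded Nf_def] powr_mono2 sq_ge) auto
  then show ?thesis by simp
qed

lemma Gf_pos: "t \<in> {0..1} \<Longrightarrow> 0 < Gf t \<eta>"
  using Gf_ge[of t \<eta>] m_pos by linarith

lemma Gf_bound: obtains M where "m \<le> M" "\<And>t \<eta>. t \<in> {0..1} \<Longrightarrow> Gf t \<eta> \<le> M"
proof -
  obtain C where "0 \<le> C" "\<And>t \<eta>. t \<in> {0..1} \<Longrightarrow> \<bar>\<integral>x. Nf t x \<eta> \<partial>gauss\<bar> \<le> C"
    using dominated_integral_bound [OF dominated_Nf] by blast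
  then show ?thesis using that [of C] Gf_ge[of 0] unfolding Gf_def
    by (meson abs_le_D1 atLeastAtMost_iff order_trans zero_le_one order_refl)
qed

lemma Gf_measurable [measurable]: "Gf t \<in> borel_measurable borel"
  unfolding Gf_def [abs_def] by (rule dominated_integral_measurable [OF dominated_Nf])

lemma Gf_powr_bound: obtains M where "0 \<le> M" "\<And>t \<eta>. t \<in> {0..1} \<Longrightarrow> Gf t \<eta> powr s \<le> M"
proof -
  obtain M where M: "m \<le> M" "\<And>t \<eta>. t \<in> {0..1} \<Longrightarrow> Gf t \<eta> \<le> M" using Gf_bound by blast
  show ?thesis
    by (rule that [of "m powr s + M powr s"]) (auto intro!: powr_le_endpoints Gf_ge M m_pos)
qed

lemma continuous_Nf: "continuous_on {0..1} (\<lambda>t. Nf t \<xi> \<eta>)"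
  unfolding Nf_def sq_def comb_def wave_def using eps
  by (intro continuous_intros) (auto simp: add_nonneg_pos sum_power2_gt_zero_iff add_nonneg_eq_0_iff)

lemma continuous_Gf: "continuous_on {0..1} (\<lambda>t. Gf t \<eta>)"
proof -
  obtain C K where CK: "0 \<le> C" "0 \<le> K" "\<And>t \<xi> \<eta>. t \<in> {0..1} \<Longrightarrow> norm (Nf t \<xi> \<eta>) \<le> C * exp (K * norm \<xi>)"
    using dominatedE [OF dominated_Nf] by blast
  show ?thesis
    unfolding Gf_def
    by (rule continuous_on_integral_dominated [where g = "\<lambda>\<xi>. C * exp (K * norm \<xi>)"])
       (use CK in \<open>auto intro: continuous_Nf integrable_gauss_exp dominated_measurable1 [OF dominated_Nf] simp: borel_measurable_gauss_eq\<close>)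
qed

lemma continuous_Qf: "continuous_on {0..1} Qf"
proof -
  obtain M where M: "0 \<le> M" "\<And>t \<eta>. t \<in> {0..1} \<Longrightarrow> Gf t \<eta> powr r \<le> M" using Gf_powr_bound by blast
  show ?thesis
    unfolding Qf_def [abs_def]
  proof (rule continuous_on_integral_dominated [where g = "\<lambda>_. M"])
    show "continuous_on {0..1} (\<lambda>t. Gf t x powr r)" for x
      using Gf_pos[of _ x] by (intro continuous_intros continuous_Gf) force
  qed (use M in auto)
qed

end

section \<open>The time derivative of the mixed norm\<close>

context mehler_flow
begin

definition Iint :: "'a \<Rightarrow> real \<Rightarrow> 'a \<Rightarrow> real" where
  "Iint b t \<eta> = (\<integral>\<xi>. Iy b t \<xi> \<eta> \<partial>gauss)"

definition IIint :: "'a \<Rightarrow> real \<Rightarrow> 'a \<Rightarrow> real" where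
  "IIint b t \<eta> = (\<integral>\<xi>. Iyy b t \<xi> \<eta> \<partial>gauss)"

definition Gf' :: "real \<Rightarrow> 'a \<Rightarrow> real" where
  "Gf' t \<eta> = (\<integral>\<xi>. Nf' t \<xi> \<eta> \<partial>gauss)"

lemma Iint_measurable [measurable]: "Iint b t \<in> borel_measurable borel"
  unfolding Iint_def [abs_def] by (rule dominated_integral_measurable [OF dominated_Iy])

lemma IIint_measurable [measurable]: "IIint b t \<in> borel_measurable borel"
  unfolding IIint_def [abs_def] by (rule dominated_integral_measurable [OF dominated_Iyy])

text \<open>The factor sqrt(1 - t) gained here cancels the coefficient 1/sqrt(1 - t) in
  \<open>Nf'\<close>; \<open>Iint_ibp\<close> does the same for 1/sqrt t in the second
  variable.\<close>

lemma Px_ibp: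
  assumes "t \<in> {0..1}"
  shows "(\<integral>\<xi>. (\<xi> \<bullet> b) * Px b t \<xi> \<eta> \<partial>gauss) = sqrt (1 - t) * (\<integral>\<xi>. Pxx b t \<xi> \<eta> \<partial>gauss)"
proof -
  obtain C K where CK: "0 \<le> C" "0 \<le> K" "\<And>t \<xi> \<eta>. t \<in> {0..1} \<Longrightarrow> norm (\<bar>Px b t \<xi> \<eta>\<bar> + \<bar>Pxx b t \<xi> \<eta>\<bar>) \<le> C * exp (K * norm \<xi>)"
    using dominatedE [OF dominated_add [OF dominated_abs dominated_abs, OF dominated_Px dominated_Pxx]] by blast
  have "(\<integral>\<xi>. (\<xi> \<bullet> b) * Px b t \<xi> \<eta> \<partial>gauss) = (\<integral>\<xi>. sqrt (1 - t) * Pxx b t \<xi> \<eta> \<partial>gauss)"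
  proof (rule gauss_integration_by_parts [OF Px_deriv _ _ _ _ CK(2)])
    fix \<xi>
    have *: "\<bar>Px b t \<xi> \<eta>\<bar> + \<bar>Pxx b t \<xi> \<eta>\<bar> \<le> C * exp (K * norm \<xi>)"
      using CK(3)[OF assms, of \<xi> \<eta>] by simp
    then show "\<bar>Px b t \<xi> \<eta>\<bar> \<le> C * exp (K * norm \<xi>)" by linarith
    have "\<bar>sqrt (1 - t)\<bar> * \<bar>Pxx b t \<xi> \<eta>\<bar> \<le> 1 * \<bar>Pxx b t \<xi> \<eta>\<bar>"
      using assms by (intro mult_right_mono) auto
    then show "\<bar>sqrt (1 - t) * Pxx b t \<xi> \<eta>\<bar> \<le> C * exp (K * norm \<xi>)"
      unfolding abs_mult using * by linarith
  qed (intro borel_measurable_times borel_measurable_const dominated_measurable1 dominated_Px dominated_Pxx)+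
  then show ?thesis by simp
qed

lemma Gf'_eq:
  assumes t: "0 < t" "t < 1"
  shows "Gf' t \<eta> = (\<Sum>b\<in>Basis. (\<integral>\<xi>. p * Tt b t \<xi> \<eta> - p / 2 * Pxx b t \<xi> \<eta> \<partial>gauss)
     - p * \<kappa> / (2 * sqrt t) * ((\<eta> \<bullet> b) * Iint b t \<eta>))"
proof -
  have t': "t \<in> {0..1}" using t by auto
  note i = dominated_integrable [OF _ t']
  have iP: "integrable gauss (\<lambda>\<xi>. (\<xi> \<bullet> b) * Px b t \<xi> \<eta>)" for b
    by (rule i [OF dominated_mult [OF dominated_inner_xi dominated_Px]])
  have "Gf' t \<eta> = (\<Sum>b\<in>Basis. p * (\<integral>\<xi>. Tt b t \<xi> \<eta> \<partial>gauss) - p / (2 * sqrt (1 - t)) * (\<integral>\<xi>. (\<xi> \<bullet> b) * Px b t \<xi> \<eta> \<partial>gauss)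
      - p * \<kappa> / (2 * sqrt t) * ((\<eta> \<bullet> b) * Iint b t \<eta>))"
    unfolding Gf'_def Nf'_def Iint_def using i [OF dominated_Tt] i [OF dominated_Iy] iP
    by (subst Bochner_Integration.integral_sum) auto
  also have "\<dots> = (\<Sum>b\<in>Basis. p * (\<integral>\<xi>. Tt b t \<xi> \<eta> \<partial>gauss) - p / 2 * (\<integral>\<xi>. Pxx b t \<xi> \<eta> \<partial>gauss)
      - p * \<kappa> / (2 * sqrt t) * ((\<eta> \<bullet> b) * Iint b t \<eta>))"
    using t by (simp add: Px_ibp [OF t'])
  also have "\<dots> = (\<Sum>b\<in>Basis. (\<integral>\<xi>. p * Tt b t \<xi> \<eta> - p / 2 * Pxx b t \<xi> \<eta> \<partial>gauss)
     - p * \<kappa> / (2 * sqrt t) * ((\<eta> \<bullet> b) * Iint b t \<eta>))"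
    using i [OF dominated_Tt] i [OF dominated_Pxx] by simp
  finally show ?thesis .
qed

text \<open>Linear growth in \<eta> and the singular coefficients prevent a bound as in
  \<open>dominated\<close>. A bound for times in [d, 1 - d] suffices to differentiate at interior
  times.\<close>

lemma Nf'_bound:
  assumes "0 < d"
  obtains C K D L where "0 \<le> C" "0 \<le> D"
    "\<And>t \<xi> \<eta>. d \<le> t \<Longrightarrow> t \<le> 1 - d \<Longrightarrow> \<bar>Nf' t \<xi> \<eta>\<bar> \<le> C * exp (K * norm \<xi>) + D * norm \<eta> * exp (L * norm \<xi>)"
proof -
  let ?W = "\<lambda>t \<xi> \<eta>. \<Sum>b\<in>Basis. p * \<bar>Tt b t \<xi> \<eta>\<bar> + p / (2 * sqrt d) * \<bar>(\<xi> \<bullet> b) * Px b t \<xi> \<eta>\<bar>"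
  let ?V = "\<lambda>t \<xi> \<eta>. \<Sum>b\<in>Basis. \<bar>Iy b t \<xi> \<eta>\<bar>"
  have W: "dominated ?W"
    by (intro dominated_sum dominated_add dominated_mult dominated_abs dominated_const dominated_Tt dominated_inner_xi dominated_Px)
  have V: "dominated ?V"
    by (intro dominated_sum dominated_abs dominated_Iy)
  obtain C K where CK: "0 \<le> C" "0 \<le> K" "\<And>t \<xi> \<eta>. t \<in> {0..1} \<Longrightarrow> norm (?W t \<xi> \<eta>) \<le> C * exp (K * norm \<xi>)"
    using dominatedE [OF W] by blast
  obtain D L where DL: "0 \<le> D" "0 \<le> L" "\<And>t \<xi> \<eta>. t \<in> {0..1} \<Longrightarrow> norm (?V t \<xi> \<eta>) \<le> D * exp (L * norm \<xi>)"
    using dominatedE [OF V] by blast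
  show ?thesis
  proof (rule that [of C "p * \<kappa> / (2 * sqrt d) * D" K L])
    show "0 \<le> p * \<kappa> / (2 * sqrt d) * D" using p kappa DL assms by auto
    fix t \<xi> \<eta> assume t: "d \<le> t" "t \<le> 1 - d"
    have t': "t \<in> {0..1}" using t assms by auto
    have s1: "0 \<le> p / (2 * sqrt (1 - t))" "p / (2 * sqrt (1 - t)) \<le> p / (2 * sqrt d)"
      using t assms p by (auto intro!: divide_left_mono)
    have s2: "0 \<le> p * \<kappa> / (2 * sqrt t)" "p * \<kappa> / (2 * sqrt t) \<le> p * \<kappa> / (2 * sqrt d)"
      using t assms p kappa by (auto intro!: divide_left_mono)
    have "\<bar>Nf' t \<xi> \<eta>\<bar> \<le> (\<Sum>b\<in>Basis. \<bar>p * Tt b t \<xi> \<eta> - p / (2 * sqrt (1 - t)) * ((\<xi> \<bullet> b) * Px b t \<xi> \<eta>)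
      - p * \<kappa> / (2 * sqrt t) * ((\<eta> \<bullet> b) * Iy b t \<xi> \<eta>)\<bar>)"
      unfolding Nf'_def by (rule sum_abs)
    also have "\<dots> \<le> (\<Sum>b\<in>Basis. (p * \<bar>Tt b t \<xi> \<eta>\<bar> + p / (2 * sqrt d) * \<bar>(\<xi> \<bullet> b) * Px b t \<xi> \<eta>\<bar>)
      + p * \<kappa> / (2 * sqrt d) * (norm \<eta> * \<bar>Iy b t \<xi> \<eta>\<bar>))"
    proof (rule sum_mono)
      fix b :: 'a assume b: "b \<in> Basis"
      have "\<bar>p / (2 * sqrt (1 - t)) * ((\<xi> \<bullet> b) * Px b t \<xi> \<eta>)\<bar> \<le> p / (2 * sqrt d) * \<bar>(\<xi> \<bullet> b) * Px b t \<xi> \<eta>\<bar>"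
        unfolding abs_mult [of "p / (2 * sqrt (1 - t))"] using s1 by (intro mult_right_mono) auto
      moreover have "\<bar>p * \<kappa> / (2 * sqrt t) * ((\<eta> \<bullet> b) * Iy b t \<xi> \<eta>)\<bar> \<le> p * \<kappa> / (2 * sqrt d) * (norm \<eta> * \<bar>Iy b t \<xi> \<eta>\<bar>)"
        unfolding abs_mult [of "p * \<kappa> / (2 * sqrt t)"] abs_mult [of "\<eta> \<bullet> b"] using s2 Basis_le_norm [OF b, of \<eta>] kappa p assms
        by (intro mult_mono) auto
      moreover have "\<bar>p * Tt b t \<xi> \<eta>\<bar> = p * \<bar>Tt b t \<xi> \<eta>\<bar>" using p by (simp add: abs_mult)
      ultimately show "\<bar>p * Tt b t \<xi> \<eta> - p / (2 * sqrt (1 - t)) * ((\<xi> \<bullet> b) * Px b t \<xi> \<eta>)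
        - p * \<kappa> / (2 * sqrt t) * ((\<eta> \<bullet> b) * Iy b t \<xi> \<eta>)\<bar> \<le> (p * \<bar>Tt b t \<xi> \<eta>\<bar> + p / (2 * sqrt d) * \<bar>(\<xi> \<bullet> b) * Px b t \<xi> \<eta>\<bar>)
        + p * \<kappa> / (2 * sqrt d) * (norm \<eta> * \<bar>Iy b t \<xi> \<eta>\<bar>)"
        by linarith
    qed
    also have "\<dots> = ?W t \<xi> \<eta> + p * \<kappa> / (2 * sqrt d) * norm \<eta> * ?V t \<xi> \<eta>"
      by (simp add: sum.distrib sum_distrib_left mult.assoc)
    also have "\<dots> \<le> C * exp (K * norm \<xi>) + p * \<kappa> / (2 * sqrt d) * norm \<eta> * (D * exp (L * norm \<xi>))"
      using CK(3)[OF t', of \<xi> \<eta>] DL(3)[OF t', of \<xi> \<eta>] p kappa assms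
      by (intro add_mono mult_left_mono) auto
    finally show "\<bar>Nf' t \<xi> \<eta>\<bar> \<le> C * exp (K * norm \<xi>) + p * \<kappa> / (2 * sqrt d) * D * norm \<eta> * exp (L * norm \<xi>)"
      by (simp add: algebra_simps)
  qed (use CK in auto)
qed

lemma Nf'_measurable [measurable]: "(\<lambda>\<xi>. Nf' t \<xi> \<eta>) \<in> borel_measurable borel"
proof -
  note [measurable] = dominated_measurable1 [OF dominated_Tt] dominated_measurable1 [OF dominated_Px]
    dominated_measurable1 [OF dominated_Iy]
  show ?thesis unfolding Nf'_def by measurable
qed

lemma Gf'_bound:
  assumes "0 < d"
  obtains C D where "0 \<le> C" "0 \<le> D"
    "\<And>t \<eta>. d \<le> t \<Longrightarrow> t \<le> 1 - d \<Longrightarrow> \<bar>Gf' t \<eta>\<bar> \<le> C + D * norm \<eta>"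
proof -
  obtain C K D L where CK: "0 \<le> C" "0 \<le> D"
    "\<And>t \<xi> \<eta>. d \<le> t \<Longrightarrow> t \<le> 1 - d \<Longrightarrow> \<bar>Nf' t \<xi> \<eta>\<bar> \<le> C * exp (K * norm \<xi>) + D * norm \<eta> * exp (L * norm \<xi>)"
    using Nf'_bound [OF assms] by metis
  let ?e = "\<lambda>K. \<integral>\<xi>. exp (K * norm \<xi>) \<partial>(gauss :: 'a measure)"
  show ?thesis
  proof (rule that [of "C * ?e K" "D * ?e L"])
    fix t \<eta> assume t: "d \<le> t" "t \<le> 1 - d"
    have "\<bar>Gf' t \<eta>\<bar> \<le> (\<integral>\<xi>. C * exp (K * norm \<xi>) + D * norm \<eta> * exp (L * norm \<xi>) \<partial>(gauss :: 'a measure))"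
      unfolding Gf'_def
    proof (rule integral_abs_bound_integral)
      show g: "integrable (gauss :: 'a measure) (\<lambda>\<xi>. C * exp (K * norm \<xi>) + D * norm \<eta> * exp (L * norm \<xi>))"
        by (intro Bochner_Integration.integrable_add integrable_mult_right integrable_gauss_exp)
      show "integrable gauss (\<lambda>\<xi>. Nf' t \<xi> \<eta>)"
        by (rule Bochner_Integration.integrable_bound [OF g]) (use CK t in \<open>auto intro!: AE_I2 order_trans [OF _ abs_ge_self] simp: borel_measurable_gauss_eq\<close>)
    qed (use CK t in auto)
    also have "\<dots> = C * ?e K + D * norm \<eta> * ?e L"
      by (subst Bochner_Integration.integral_add) (auto intro: integrable_gauss_exp)
    finally show "\<bar>Gf' t \<eta>\<bar> \<le> C * ?e K + D * ?e L * norm \<eta>" by (simp add: algebra_simps)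
  qed (use CK in auto)
qed

lemma Gf_deriv_t:
  assumes t: "0 < t" "t < 1"
  shows "((\<lambda>t. Gf t \<eta>) has_real_derivative Gf' t \<eta>) (at t)"
proof -
  \<comment> \<open>Half the distance to the nearer end of the interval: every time within
    \<open>d\<close> of \<open>t\<close> lies in [d, 1 - d].\<close>
  define d where "d = min t (1 - t) / 2"
  have d: "0 < d" "d < t" "t < 1 - d" using t by (auto simp: d_def min_def field_simps)
  obtain C K D L where CK: "0 \<le> C" "0 \<le> D"
    "\<And>t \<xi> \<eta>. d \<le> t \<Longrightarrow> t \<le> 1 - d \<Longrightarrow> \<bar>Nf' t \<xi> \<eta>\<bar> \<le> C * exp (K * norm \<xi>) + D * norm \<eta> * exp (L * norm \<xi>)"
    using Nf'_bound [OF d(1)] by metis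
  have near: "d \<le> s \<and> s \<le> 1 - d" if "\<bar>s - t\<bar> < d" for s
    using that by (auto simp: d_def min_def abs_if field_simps split: if_splits)
  have near': "s \<in> {0..1}" "0 < s" "s < 1" if "\<bar>s - t\<bar> < d" for s
    using near [OF that] d by auto
  show ?thesis
    unfolding Gf_def Gf'_def
  proof (rule has_real_derivative_integral [OF d(1)])
    show "\<bar>Nf' s \<xi> \<eta>\<bar> \<le> C * exp (K * norm \<xi>) + D * norm \<eta> * exp (L * norm \<xi>)" if "\<bar>s - t\<bar> < d" for s \<xi>
      using CK near [OF that] by blast
    show "integrable (gauss :: 'a measure) (\<lambda>\<xi>. C * exp (K * norm \<xi>) + D * norm \<eta> * exp (L * norm \<xi>))"
      by (intro Bochner_Integration.integrable_add integrable_mult_right integrable_gauss_exp)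
  qed (auto intro: Nf_deriv_t dominated_integrable [OF dominated_Nf] near' simp: borel_measurable_gauss_eq)
qed

lemma Gf'_measurable:
  assumes "0 < t" "t < 1"
  shows "Gf' t \<in> borel_measurable borel"
proof -
  have [measurable]: "(\<lambda>\<eta>. \<integral>\<xi>. p * Tt b t \<xi> \<eta> - p / 2 * Pxx b t \<xi> \<eta> \<partial>gauss) \<in> borel_measurable borel" for b
    by (intro dominated_integral_measurable [of "\<lambda>t \<xi> \<eta>. p * Tt b t \<xi> \<eta> - p / 2 * Pxx b t \<xi> \<eta>"] dominated_diff dominated_cmult dominated_Tt dominated_Pxx)
  show ?thesis
    unfolding Gf'_eq [OF assms, abs_def] by measurable
qed

lemma norm_le_exp: "norm x \<le> exp (1 * norm x)"
  using exp_ge_add_one_self [of "norm x"] unfolding mult_1 by linarith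

lemma r_pos: "1 < r" using p by (simp add: r_def field_simps)

lemma Qf_deriv:
  assumes t: "0 < t" "t < 1"
  shows "(Qf has_real_derivative (\<integral>\<eta>. r * Gf t \<eta> powr (r - 1) * Gf' t \<eta> \<partial>gauss)) (at t)"
proof -
  define d where "d = min t (1 - t) / 2"
  have d: "0 < d" "d < t" "t < 1 - d" using t by (auto simp: d_def min_def field_simps)
  obtain C D where CD: "0 \<le> C" "0 \<le> D"
    "\<And>t \<eta>. d \<le> t \<Longrightarrow> t \<le> 1 - d \<Longrightarrow> \<bar>Gf' t \<eta>\<bar> \<le> C + D * norm \<eta>"
    using Gf'_bound [OF d(1)] by metis
  obtain M where M: "0 \<le> M" "\<And>t \<eta>. t \<in> {0..1} \<Longrightarrow> Gf t \<eta> powr (r - 1) \<le> M" using Gf_powr_bound by blast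
  obtain M' where M': "0 \<le> M'" "\<And>t \<eta>. t \<in> {0..1} \<Longrightarrow> Gf t \<eta> powr r \<le> M'" using Gf_powr_bound by blast
  have near: "d \<le> s \<and> s \<le> 1 - d" if "\<bar>s - t\<bar> < d" for s
    using that by (auto simp: d_def min_def abs_if field_simps split: if_splits)
  have near': "s \<in> {0..1}" "0 < s" "s < 1" if "\<bar>s - t\<bar> < d" for s
    using near [OF that] d by auto
  show ?thesis
    unfolding Qf_def [abs_def]
  proof (rule has_real_derivative_integral [OF d(1), where g = "\<lambda>\<eta>. r * M * (C + D * norm \<eta>)" and f' = "\<lambda>t \<eta>. r * Gf t \<eta> powr (r - 1) * Gf' t \<eta>"])
    fix s \<eta> assume s: "\<bar>s - t\<bar> < d"
    note n = near' [OF s]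
    show "((\<lambda>t. Gf t \<eta> powr r) has_real_derivative r * Gf s \<eta> powr (r - 1) * Gf' s \<eta>) (at s)"
      using DERIV_fun_powr [OF Gf_deriv_t [OF n(2,3)] Gf_pos [OF n(1)], of \<eta> r] by simp
    have "r * Gf s \<eta> powr (r - 1) * \<bar>Gf' s \<eta>\<bar> \<le> r * M * (C + D * norm \<eta>)"
      using CD near [OF s] M n r_pos by (intro mult_mono) auto
    then show "\<bar>r * Gf s \<eta> powr (r - 1) * Gf' s \<eta>\<bar> \<le> r * M * (C + D * norm \<eta>)"
      using r_pos by (simp add: abs_mult)
  next
    fix s assume s: "\<bar>s - t\<bar> < d"
    show "integrable gauss (\<lambda>\<eta>. Gf s \<eta> powr r)"
      by (rule integrable_gauss_bound [where C = M' and K = 0]) (use M' near' [OF s] in auto)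
  next
    have "integrable gauss (norm :: 'a \<Rightarrow> real)"
      by (rule integrable_gauss_bound [where C = 1 and K = 1]) (use norm_le_exp in auto)
    then show "integrable gauss (\<lambda>\<eta>. r * M * (C + D * norm (\<eta> :: 'a)))" by simp
    show "(\<lambda>\<eta>. r * Gf t \<eta> powr (r - 1) * Gf' t \<eta>) \<in> borel_measurable gauss"
      using Gf'_measurable [OF t] by (simp add: borel_measurable_gauss_eq)
  qed
qed

end

section \<open>Monotonicity of the mixed norm\<close>

context mehler_flow
begin

lemma Gf_deriv_eta:
  assumes t: "t \<in> {0..1}"
  shows "((\<lambda>\<tau>. Gf t (\<eta> + \<tau> *\<^sub>R b)) has_real_derivative - (p * \<kappa> * sqrt t) * Iint b t (\<eta> + \<tau> *\<^sub>R b)) (at \<tau>)"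
proof -
  have [measurable]: "(\<lambda>\<xi>. Iy b t \<xi> \<eta>) \<in> borel_measurable borel" for \<eta>
    by (rule dominated_measurable1 [OF dominated_Iy])
  obtain C K where CK: "0 \<le> C" "0 \<le> K" "\<And>t \<xi> \<eta>. t \<in> {0..1} \<Longrightarrow> norm (- (p * \<kappa> * sqrt 1) * Iy b t \<xi> \<eta>) \<le> C * exp (K * norm \<xi>)"
    using dominatedE [OF dominated_cmult [OF dominated_Iy]] by metis
  have "((\<lambda>\<tau>. Gf t (\<eta> + \<tau> *\<^sub>R b)) has_real_derivative (\<integral>\<xi>. - (p * \<kappa> * sqrt t) * Iy b t \<xi> (\<eta> + \<tau> *\<^sub>R b) \<partial>gauss)) (at \<tau>)"
    unfolding Gf_def
  proof (rule has_real_derivative_integral [where e = 1 and g = "\<lambda>\<xi>. C * exp (K * norm \<xi>)"])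
    fix \<sigma> \<xi>
    have "\<bar>- (p * \<kappa> * sqrt t) * Iy b t \<xi> (\<eta> + \<sigma> *\<^sub>R b)\<bar> \<le> \<bar>- (p * \<kappa> * sqrt 1) * Iy b t \<xi> (\<eta> + \<sigma> *\<^sub>R b)\<bar>"
      using t p kappa unfolding abs_mult by (intro mult_right_mono) (auto simp: abs_mult)
    also have "\<dots> \<le> C * exp (K * norm \<xi>)" using CK(3)[OF t] by simp
    finally show "\<bar>- (p * \<kappa> * sqrt t) * Iy b t \<xi> (\<eta> + \<sigma> *\<^sub>R b)\<bar> \<le> C * exp (K * norm \<xi>)" .
  qed (use Nf_deriv_eta dominated_integrable [OF dominated_Nf t] in
      \<open>auto intro: integrable_gauss_exp simp: borel_measurable_gauss_eq\<close>)
  then show ?thesis unfolding Iint_def by simp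
qed

lemma Iint_deriv:
  assumes t: "t \<in> {0..1}"
  shows "((\<lambda>\<tau>. Iint b t (\<eta> + \<tau> *\<^sub>R b)) has_real_derivative \<kappa> * sqrt t * IIint b t (\<eta> + \<tau> *\<^sub>R b)) (at \<tau>)"
proof -
  have [measurable]: "(\<lambda>\<xi>. Iyy b t \<xi> \<eta>) \<in> borel_measurable borel" for \<eta>
    by (rule dominated_measurable1 [OF dominated_Iyy])
  obtain C K where CK: "0 \<le> C" "0 \<le> K" "\<And>t \<xi> \<eta>. t \<in> {0..1} \<Longrightarrow> norm (\<kappa> * sqrt 1 * Iyy b t \<xi> \<eta>) \<le> C * exp (K * norm \<xi>)"
    using dominatedE [OF dominated_cmult [OF dominated_Iyy]] by metis
  have "((\<lambda>\<tau>. Iint b t (\<eta> + \<tau> *\<^sub>R b)) has_real_derivative (\<integral>\<xi>. \<kappa> * sqrt t * Iyy b t \<xi> (\<eta> + \<tau> *\<^sub>R b) \<partial>gauss)) (at \<tau>)"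
    unfolding Iint_def
  proof (rule has_real_derivative_integral [where e = 1 and g = "\<lambda>\<xi>. C * exp (K * norm \<xi>)"])
    fix \<sigma> \<xi>
    have "\<bar>\<kappa> * sqrt t * Iyy b t \<xi> (\<eta> + \<sigma> *\<^sub>R b)\<bar> \<le> \<bar>\<kappa> * sqrt 1 * Iyy b t \<xi> (\<eta> + \<sigma> *\<^sub>R b)\<bar>"
      using t kappa unfolding abs_mult by (intro mult_right_mono) (auto simp: abs_mult)
    also have "\<dots> \<le> C * exp (K * norm \<xi>)" using CK(3)[OF t] by simp
    finally show "\<bar>\<kappa> * sqrt t * Iyy b t \<xi> (\<eta> + \<sigma> *\<^sub>R b)\<bar> \<le> C * exp (K * norm \<xi>)" .
  qed (use Iy_deriv dominated_integrable [OF dominated_Iy t] in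
      \<open>auto intro: integrable_gauss_exp simp: borel_measurable_gauss_eq\<close>)
  then show ?thesis unfolding IIint_def by simp
qed

text \<open>Up to the factor sqrt t, the derivative in direction b of the function G^(r - 1) I on
  which the second integration by parts acts. The first summand comes from the outer power and is
  the only one with an unfavourable sign.\<close>

definition Zf :: "'a \<Rightarrow> real \<Rightarrow> 'a \<Rightarrow> real" where
  "Zf b t \<eta> = (r - 1) * Gf t \<eta> powr (r - 2) * (- (p * \<kappa>) * Iint b t \<eta>) * Iint b t \<eta> + Gf t \<eta> powr (r - 1) * (\<kappa> * IIint b t \<eta>)"

lemma Zf_measurable [measurable]: "Zf b t \<in> borel_measurable borel"
  unfolding Zf_def [abs_def] by measurable

lemma Gf_Iint_bound:
  obtains C where "0 \<le> C" "\<And>t \<eta>. t \<in> {0..1} \<Longrightarrow> \<bar>Gf t \<eta> powr (r - 1) * Iint b t \<eta>\<bar> \<le> C"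
    "\<And>t \<eta>. t \<in> {0..1} \<Longrightarrow> \<bar>Zf b t \<eta>\<bar> \<le> C"
proof -
  obtain M1 where M1: "0 \<le> M1" "\<And>t \<eta>. t \<in> {0..1} \<Longrightarrow> Gf t \<eta> powr (r - 1) \<le> M1" using Gf_powr_bound by blast
  obtain M2 where M2: "0 \<le> M2" "\<And>t \<eta>. t \<in> {0..1} \<Longrightarrow> Gf t \<eta> powr (r - 2) \<le> M2" using Gf_powr_bound by blast
  obtain D where D: "0 \<le> D" "\<And>t \<eta>. t \<in> {0..1} \<Longrightarrow> \<bar>Iint b t \<eta>\<bar> \<le> D"
    using dominated_integral_bound [OF dominated_Iy] unfolding Iint_def by metis
  obtain E where E: "0 \<le> E" "\<And>t \<eta>. t \<in> {0..1} \<Longrightarrow> \<bar>IIint b t \<eta>\<bar> \<le> E"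
    using dominated_integral_bound [OF dominated_Iyy] unfolding IIint_def by metis
  have 1: "\<bar>Gf t \<eta> powr (r - 1) * Iint b t \<eta>\<bar> \<le> M1 * D" if "t \<in> {0..1}" for t \<eta>
    unfolding abs_mult using M1 D that by (intro mult_mono) auto
  have 2: "\<bar>Zf b t \<eta>\<bar> \<le> (r - 1) * M2 * (p * \<kappa> * D) * D + M1 * (\<kappa> * E)" if "t \<in> {0..1}" for t \<eta>
  proof -
    have "\<bar>(r - 1) * Gf t \<eta> powr (r - 2) * (- (p * \<kappa>) * Iint b t \<eta>) * Iint b t \<eta>\<bar> \<le> (r - 1) * M2 * (p * \<kappa> * D) * D"
      unfolding abs_mult using M2 D that r_pos p kappa by (intro mult_mono) (auto simp: abs_mult)
    moreover have "\<bar>Gf t \<eta> powr (r - 1) * (\<kappa> * IIint b t \<eta>)\<bar> \<le> M1 * (\<kappa> * E)"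
      unfolding abs_mult using M1 E that kappa by (intro mult_mono) auto
    ultimately show ?thesis unfolding Zf_def by linarith
  qed
  show ?thesis
    by (rule that [of "max (M1 * D) ((r - 1) * M2 * (p * \<kappa> * D) * D + M1 * (\<kappa> * E))"])
       (use 1 2 M1 D in \<open>auto simp: le_max_iff_disj\<close>)
qed

lemma Iint_ibp:
  assumes t: "t \<in> {0..1}"
  shows "(\<integral>\<eta>. (\<eta> \<bullet> b) * (Gf t \<eta> powr (r - 1) * Iint b t \<eta>) \<partial>gauss) = sqrt t * (\<integral>\<eta>. Zf b t \<eta> \<partial>gauss)"
proof -
  obtain C where C: "0 \<le> C" "\<And>t \<eta>. t \<in> {0..1} \<Longrightarrow> \<bar>Gf t \<eta> powr (r - 1) * Iint b t \<eta>\<bar> \<le> C"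
    "\<And>t \<eta>. t \<in> {0..1} \<Longrightarrow> \<bar>Zf b t \<eta>\<bar> \<le> C"
    using Gf_Iint_bound [of b] by metis
  have "(\<integral>\<eta>. (\<eta> \<bullet> b) * (Gf t \<eta> powr (r - 1) * Iint b t \<eta>) \<partial>gauss) = (\<integral>\<eta>. sqrt t * Zf b t \<eta> \<partial>gauss)"
  proof (rule gauss_integration_by_parts [where C = C and K = 0])
    fix \<eta> \<tau>
    show "((\<lambda>\<tau>. Gf t (\<eta> + \<tau> *\<^sub>R b) powr (r - 1) * Iint b t (\<eta> + \<tau> *\<^sub>R b)) has_real_derivative sqrt t * Zf b t (\<eta> + \<tau> *\<^sub>R b)) (at \<tau>)"
      by (rule DERIV_cong [OF DERIV_mult [OF DERIV_fun_powr [OF Gf_deriv_eta [OF t] Gf_pos [OF t]] Iint_deriv [OF t]]])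
         (simp add: Zf_def algebra_simps)
  next
    fix \<eta>
    show "\<bar>Gf t \<eta> powr (r - 1) * Iint b t \<eta>\<bar> \<le> C * exp (0 * norm \<eta>)" using C t by simp
    have "\<bar>sqrt t\<bar> * \<bar>Zf b t \<eta>\<bar> \<le> 1 * \<bar>Zf b t \<eta>\<bar>" using t by (intro mult_right_mono) auto
    then show "\<bar>sqrt t * Zf b t \<eta>\<bar> \<le> C * exp (0 * norm \<eta>)" using C(3)[OF t, of \<eta>] by (simp add: abs_mult)
  qed auto
  then show ?thesis by simp
qed

text \<open>The terms with \<open>hd2\<close> cancel because p = 1 + (p - 1). For the rest let u and
  v be the inner products of h and i h with its derivative: since h and i h are orthogonal of equal
  length, u^2 + v^2 = |h|^2 |hd1|^2, and enlarging |h|^2 by \<epsilon>^2 goes in the right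
  direction.\<close>

lemma pointwise_sign:
  "2 * Tt b t \<xi> \<eta> - Pxx b t \<xi> \<eta> - (p - 1) * Iyy b t \<xi> \<eta>
     \<le> - (2 - p) * p * (sq t \<xi> \<eta> powr (p / 2 - 2) * (inner (\<i> * h t \<xi> \<eta>) (hd1 b t \<xi> \<eta>))\<^sup>2)"
proof -
  define X where "X = sq t \<xi> \<eta> powr (p / 2 - 2)"
  define u where "u = inner (h t \<xi> \<eta>) (hd1 b t \<xi> \<eta>)"
  define v where "v = inner (\<i> * h t \<xi> \<eta>) (hd1 b t \<xi> \<eta>)"
  define D where "D = inner (hd1 b t \<xi> \<eta>) (hd1 b t \<xi> \<eta>)"
  have X: "sq t \<xi> \<eta> powr (p / 2 - 1) = X * sq t \<xi> \<eta>"
    using sq_pos [of t \<xi> \<eta>] unfolding X_def by (simp add: powr_diff powr_numeral power2_eq_square)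
  have X0: "0 \<le> X" by (simp add: X_def)
  have "u\<^sup>2 + v\<^sup>2 = (cmod (h t \<xi> \<eta>))\<^sup>2 * D"
    unfolding u_def v_def D_def cmod_power2 by (simp add: inner_complex_def power2_eq_square algebra_simps)
  also have "\<dots> \<le> sq t \<xi> \<eta> * D"
    unfolding sq_def D_def by (intro mult_right_mono) auto
  finally have uv: "u\<^sup>2 + v\<^sup>2 \<le> sq t \<xi> \<eta> * D" .
  have "2 * Tt b t \<xi> \<eta> - Pxx b t \<xi> \<eta> - (p - 1) * Iyy b t \<xi> \<eta> =
     (2 - p) * (X * (u\<^sup>2 - (p - 1) * v\<^sup>2 - sq t \<xi> \<eta> * D))"
    unfolding Tt_def Pxx_def Iyy_def X X_def [symmetric] u_def [symmetric] v_def [symmetric] D_def [symmetric]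
    by (simp add: algebra_simps)
  also have "\<dots> \<le> (2 - p) * (X * (- p * v\<^sup>2))"
    using uv p X0 by (intro mult_left_mono) (auto simp: algebra_simps)
  finally show ?thesis unfolding X_def v_def by (simp add: algebra_simps)
qed

lemma dominated_Jy: "dominated (\<lambda>t \<xi> \<eta>. sq t \<xi> \<eta> powr (p / 2 - 2) * (inner (\<i> * h t \<xi> \<eta>) (hd1 b t \<xi> \<eta>))\<^sup>2)"
  unfolding power2_eq_square using p
  by (intro dominated_mult dominated_inner dominated_sq_powr dominated_comb dominated_ih) simp_all

text \<open>Cauchy-Schwarz for the splitting of \<open>sq\<close> to the power p/2 - 1 into the
  powers p/4 - 1 and p/4.\<close>

lemma Iint_Cauchy_Schwarz:
  assumes t: "t \<in> {0..1}"
  shows "(Iint b t \<eta>)\<^sup>2 \<le> Gf t \<eta> * (\<integral>\<xi>. sq t \<xi> \<eta> powr (p / 2 - 2) * (inner (\<i> * h t \<xi> \<eta>) (hd1 b t \<xi> \<eta>))\<^sup>2 \<partial>gauss)"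
    (is "_ \<le> _ * ?J")
proof -
  \<comment> \<open>The minimiser of the quadratic J - 2 l I + l^2 G, which is the integral of a
    nonnegative function.\<close>
  define l where "l = Iint b t \<eta> / Gf t \<eta>"
  have G: "0 < Gf t \<eta>" by (rule Gf_pos [OF t])
  have "0 \<le> (\<integral>\<xi>. sq t \<xi> \<eta> powr (p / 2 - 2) * (inner (\<i> * h t \<xi> \<eta>) (hd1 b t \<xi> \<eta>) - l * sq t \<xi> \<eta>)\<^sup>2 \<partial>gauss)"
    by (intro integral_nonneg_AE AE_I2) simp
  also have "\<dots> = (\<integral>\<xi>. sq t \<xi> \<eta> powr (p / 2 - 2) * (inner (\<i> * h t \<xi> \<eta>) (hd1 b t \<xi> \<eta>))\<^sup>2
      - 2 * l * Iy b t \<xi> \<eta> + l\<^sup>2 * Nf t \<xi> \<eta> \<partial>gauss)"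
  proof (rule Bochner_Integration.integral_cong [OF refl])
    fix \<xi>
    have "sq t \<xi> \<eta> powr (p / 2 - 1) = sq t \<xi> \<eta> powr (p / 2 - 2) * sq t \<xi> \<eta>"
      "sq t \<xi> \<eta> powr (p / 2) = sq t \<xi> \<eta> powr (p / 2 - 2) * (sq t \<xi> \<eta>)\<^sup>2"
      using sq_pos [of t \<xi> \<eta>] by (simp_all add: powr_diff powr_numeral power2_eq_square)
    then show "sq t \<xi> \<eta> powr (p / 2 - 2) * (inner (\<i> * h t \<xi> \<eta>) (hd1 b t \<xi> \<eta>) - l * sq t \<xi> \<eta>)\<^sup>2 =
       sq t \<xi> \<eta> powr (p / 2 - 2) * (inner (\<i> * h t \<xi> \<eta>) (hd1 b t \<xi> \<eta>))\<^sup>2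
      - 2 * l * Iy b t \<xi> \<eta> + l\<^sup>2 * Nf t \<xi> \<eta>"
      unfolding Iy_def Nf_def by (simp add: power2_eq_square algebra_simps)
  qed
  also have "\<dots> = ?J - 2 * l * Iint b t \<eta> + l\<^sup>2 * Gf t \<eta>"
    unfolding Iint_def Gf_def
    using dominated_integrable [OF dominated_Jy t, of \<eta> b] dominated_integrable [OF dominated_Iy t, of b \<eta>] dominated_integrable [OF dominated_Nf t, of \<eta>]
    by (subst Bochner_Integration.integral_add) auto
  also have "\<dots> = ?J - (Iint b t \<eta>)\<^sup>2 / Gf t \<eta>"
    using G by (simp add: l_def power2_eq_square field_simps)
  finally show ?thesis using G by (simp add: field_simps)
qed

text \<open>Differentiating the outer power costs (r - 1)(p - 1) I^2, up to common factors, and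
  \<open>pointwise_sign\<close> gains (2 - p) G J. As (r - 1)(p - 1) = 2 - p, Cauchy-Schwarz
  balances the two exactly.\<close>

lemma integrand_sign:
  assumes t: "t \<in> {0..1}"
  shows "Gf t \<eta> powr (r - 1) * (\<integral>\<xi>. p * Tt b t \<xi> \<eta> - p / 2 * Pxx b t \<xi> \<eta> \<partial>gauss) - p * \<kappa> / 2 * Zf b t \<eta> \<le> 0"
proof -
  define J where "J = (\<integral>\<xi>. sq t \<xi> \<eta> powr (p / 2 - 2) * (inner (\<i> * h t \<xi> \<eta>) (hd1 b t \<xi> \<eta>))\<^sup>2 \<partial>gauss)"
  define a where "a = (\<integral>\<xi>. p * Tt b t \<xi> \<eta> - p / 2 * Pxx b t \<xi> \<eta> \<partial>gauss)"
  define X where "X = Gf t \<eta> powr (r - 2)"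
  have G: "0 < Gf t \<eta>" by (rule Gf_pos [OF t])
  have X: "Gf t \<eta> powr (r - 1) = X * Gf t \<eta>" "0 \<le> X"
    using G unfolding X_def by (simp_all add: powr_diff powr_numeral power2_eq_square)
  note i = dominated_integrable [OF dominated_Tt t, of b \<eta>] dominated_integrable [OF dominated_Pxx t, of b \<eta>]
    dominated_integrable [OF dominated_Iyy t, of b \<eta>] dominated_integrable [OF dominated_Jy t, of \<eta> b]
  have "a - p / 2 * ((p - 1) * IIint b t \<eta>) = (\<integral>\<xi>. p / 2 * (2 * Tt b t \<xi> \<eta> - Pxx b t \<xi> \<eta> - (p - 1) * Iyy b t \<xi> \<eta>) \<partial>gauss)"
    unfolding a_def IIint_def using i by (simp add: algebra_simps)
  also have "\<dots> \<le> (\<integral>\<xi>. p / 2 * (- (2 - p) * p * (sq t \<xi> \<eta> powr (p / 2 - 2) * (inner (\<i> * h t \<xi> \<eta>) (hd1 b t \<xi> \<eta>))\<^sup>2)) \<partial>gauss)"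
    using i p by (intro integral_mono mult_left_mono pointwise_sign integrable_mult_right Bochner_Integration.integrable_diff) auto
  also have "\<dots> = - p / 2 * ((2 - p) * p * J)"
    unfolding J_def integral_mult_right_zero by (simp add: algebra_simps)
  finally have a: "a - p / 2 * ((p - 1) * IIint b t \<eta>) \<le> - p / 2 * ((2 - p) * p * J)" .
  have rk: "(r - 1) * (p - 1) = 2 - p" using p by (simp add: r_def field_simps)
  have CS: "(Iint b t \<eta>)\<^sup>2 \<le> Gf t \<eta> * J"
    unfolding J_def by (rule Iint_Cauchy_Schwarz [OF t])
  have "Gf t \<eta> powr (r - 1) * a - p * \<kappa> / 2 * Zf b t \<eta> =
     X * Gf t \<eta> * (a - p / 2 * (\<kappa>\<^sup>2 * IIint b t \<eta>)) + p / 2 * p * (((r - 1) * \<kappa>\<^sup>2) * X * (Iint b t \<eta>)\<^sup>2)"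
    unfolding Zf_def X(1) X_def [symmetric] by (simp add: algebra_simps power2_eq_square)
  also have "\<dots> \<le> X * Gf t \<eta> * (- p / 2 * ((2 - p) * p * J)) + p / 2 * p * ((2 - p) * X * (Gf t \<eta> * J))"
    unfolding kappa(2) rk using a CS X G p by (intro add_mono mult_left_mono) auto
  also have "\<dots> = 0" by (simp add: algebra_simps)
  finally show ?thesis unfolding a_def .
qed

lemma Qf_deriv_nonpos:
  assumes t: "0 < t" "t < 1"
  shows "(\<integral>\<eta>. r * Gf t \<eta> powr (r - 1) * Gf' t \<eta> \<partial>gauss) \<le> 0"
proof -
  have t': "t \<in> {0..1}" using t by auto
  let ?a = "\<lambda>b \<eta>. \<integral>\<xi>. p * Tt b t \<xi> \<eta> - p / 2 * Pxx b t \<xi> \<eta> \<partial>gauss"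
  have dom: "dominated (\<lambda>t \<xi> \<eta>. p * Tt b t \<xi> \<eta> - p / 2 * Pxx b t \<xi> \<eta>)" for b
    by (intro dominated_diff dominated_cmult dominated_Tt dominated_Pxx)
  have ia: "integrable gauss (\<lambda>\<eta>. Gf t \<eta> powr (r - 1) * ?a b \<eta>)" for b
  proof -
    obtain M1 where M1: "0 \<le> M1" "\<And>t \<eta>. t \<in> {0..1} \<Longrightarrow> Gf t \<eta> powr (r - 1) \<le> M1" using Gf_powr_bound by blast
    obtain D where D: "0 \<le> D" "\<And>t \<eta>. t \<in> {0..1} \<Longrightarrow> \<bar>\<integral>\<xi>. p * Tt b t \<xi> \<eta> - p / 2 * Pxx b t \<xi> \<eta> \<partial>gauss\<bar> \<le> D"
      using dominated_integral_bound [OF dom [of b]] by metis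
    have [measurable]: "?a b \<in> borel_measurable borel"
      by (rule dominated_integral_measurable [OF dom])
    show ?thesis
    proof (rule integrable_gauss_bound [where C = "M1 * D" and K = 0])
      fix \<eta>
      have "\<bar>Gf t \<eta> powr (r - 1)\<bar> * \<bar>?a b \<eta>\<bar> \<le> M1 * D"
        using M1 D t' by (intro mult_mono) auto
      then show "norm (Gf t \<eta> powr (r - 1) * ?a b \<eta>) \<le> M1 * D * exp (0 * norm \<eta>)"
        by (simp add: abs_mult)
    qed measurable
  qed
  have iI: "integrable gauss (\<lambda>\<eta>. (\<eta> \<bullet> b) * (Gf t \<eta> powr (r - 1) * Iint b t \<eta>))" "integrable gauss (Zf b t)" for b
  proof -
    obtain C where C: "0 \<le> C" "\<And>t \<eta>. t \<in> {0..1} \<Longrightarrow> \<bar>Gf t \<eta> powr (r - 1) * Iint b t \<eta>\<bar> \<le> C"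
      "\<And>t \<eta>. t \<in> {0..1} \<Longrightarrow> \<bar>Zf b t \<eta>\<bar> \<le> C"
      using Gf_Iint_bound [of b] by metis
    show "integrable gauss (Zf b t)"
      by (rule integrable_gauss_bound [where C = C and K = 0]) (use C t' in auto)
    show "integrable gauss (\<lambda>\<eta>. (\<eta> \<bullet> b) * (Gf t \<eta> powr (r - 1) * Iint b t \<eta>))"
    proof (rule integrable_gauss_bound [where C = "norm b * C" and K = 1])
      fix \<eta>
      have "\<bar>\<eta> \<bullet> b\<bar> \<le> norm b * exp (1 * norm \<eta>)"
        using Cauchy_Schwarz_ineq2 [of \<eta> b] mult_left_mono [OF norm_le_exp [of \<eta>] norm_ge_zero [of b]]
        by (simp add: mult.commute)
      then have "\<bar>\<eta> \<bullet> b\<bar> * \<bar>Gf t \<eta> powr (r - 1) * Iint b t \<eta>\<bar> \<le> (norm b * exp (1 * norm \<eta>)) * C"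
        using C t' by (intro mult_mono) auto
      then show "norm ((\<eta> \<bullet> b) * (Gf t \<eta> powr (r - 1) * Iint b t \<eta>)) \<le> norm b * C * exp (1 * norm \<eta>)"
        unfolding real_norm_def abs_mult [of "\<eta> \<bullet> b"] by (simp only: mult_ac)
    qed simp
  qed
  have "(\<integral>\<eta>. r * Gf t \<eta> powr (r - 1) * Gf' t \<eta> \<partial>gauss) =
     (\<integral>\<eta>. (\<Sum>b\<in>Basis. r * (Gf t \<eta> powr (r - 1) * ?a b \<eta>) - r * (p * \<kappa> / (2 * sqrt t)) * ((\<eta> \<bullet> b) * (Gf t \<eta> powr (r - 1) * Iint b t \<eta>))) \<partial>gauss)"
    unfolding Gf'_eq [OF t] sum_distrib_left
    by (intro Bochner_Integration.integral_cong sum.cong refl) (simp only: right_diff_distrib mult_ac)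
  also have "\<dots> = (\<Sum>b\<in>Basis. r * (\<integral>\<eta>. Gf t \<eta> powr (r - 1) * ?a b \<eta> \<partial>gauss) - r * (p * \<kappa> / (2 * sqrt t)) * (sqrt t * (\<integral>\<eta>. Zf b t \<eta> \<partial>gauss)))"
    using ia iI by (subst Bochner_Integration.integral_sum) (auto simp: Iint_ibp [OF t'])
  also have "\<dots> = (\<Sum>b\<in>Basis. (\<integral>\<eta>. r * (Gf t \<eta> powr (r - 1) * ?a b \<eta> - p * \<kappa> / 2 * Zf b t \<eta>) \<partial>gauss))"
    using ia iI t by (intro sum.cong) (auto simp: algebra_simps)
  also have "\<dots> \<le> (\<Sum>b\<in>(Basis::'a set). 0)"
  proof (rule sum_mono)
    fix b :: 'a
    have "(\<integral>\<eta>. r * (Gf t \<eta> powr (r - 1) * ?a b \<eta> - p * \<kappa> / 2 * Zf b t \<eta>) \<partial>gauss) \<le> (\<integral>\<eta>. 0 \<partial>(gauss :: 'a measure))"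
      using ia iI r_pos integrand_sign [OF t'] by (intro integral_mono) (auto simp: mult_le_0_iff)
    then show "(\<integral>\<eta>. r * (Gf t \<eta> powr (r - 1) * ?a b \<eta> - p * \<kappa> / 2 * Zf b t \<eta>) \<partial>gauss) \<le> 0" by simp
  qed
  finally show ?thesis by simp
qed

theorem Qf_mono: "Qf 1 \<le> Qf 0"
  \<comment> \<open>The derivative is known on the open interval, where the coefficients 1/sqrt t
    and 1/sqrt(1 - t) are finite; continuity covers the end points.\<close>
  by (rule DERIV_nonpos_imp_decreasing_open) (use Qf_deriv Qf_deriv_nonpos continuous_Qf in auto)

end

section \<open>Complex hypercontractivity and Gaussian functions\<close>

text \<open>At t = 0 nothing depends on \<eta> and at t = 1 nothing depends on \<xi>, so each mixed
  norm collapses to a single integral. The regularisation is dropped on the left by monotonicity and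
  sent to 0 on the right.\<close>

lemma complex_hypercontractivity:
  fixes S :: "'a::euclidean_space set"
  assumes S: "finite S" and p: "1 < p" "p < 2"
  shows "(\<integral>\<eta>. cmod (\<Sum>a\<in>S. c a * exp (of_real (p * (norm a)\<^sup>2 / 2) + \<i> * of_real (sqrt (p - 1) * (a \<bullet> \<eta>)))) powr (p / (p - 1)) \<partial>gauss)
     \<le> (\<integral>\<xi>. cmod (\<Sum>a\<in>S. c a * exp (of_real (a \<bullet> \<xi>))) powr p \<partial>gauss) powr (1 / (p - 1))"
proof -
  define q where "q = p / (p - 1)"
  define h1 where "h1 \<eta> = (\<Sum>a\<in>S. c a * exp (of_real (p * (norm a)\<^sup>2 / 2) + \<i> * of_real (sqrt (p - 1) * (a \<bullet> \<eta>))))" for \<eta>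
  define f where "f \<xi> = (\<Sum>a\<in>S. c a * exp (of_real (a \<bullet> \<xi>)))" for \<xi>
  define eps where "eps n = 1 / real (Suc n)" for n
  have flow: "mehler_flow S p (eps n)" for n
    by standard (use assms in \<open>auto simp: eps_def\<close>)
  note flow_defs = mehler_flow.Nf_def[OF flow] mehler_flow.sq_def[OF flow] mehler_flow.comb_def[OF flow] mehler_flow.wave_def[OF flow]
  have N1: "mehler_flow.Nf S c p (eps n) 1 \<xi> \<eta> = ((cmod (h1 \<eta>))\<^sup>2 + (eps n)\<^sup>2) powr (p / 2)" for n \<xi> \<eta>
    unfolding flow_defs h1_def by (simp add: mehler_flow.\<kappa>_def[OF flow])
  have N0: "mehler_flow.Nf S c p (eps n) 0 \<xi> \<eta> = ((cmod (f \<xi>))\<^sup>2 + (eps n)\<^sup>2) powr (p / 2)" for n \<xi> \<eta>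
    unfolding flow_defs f_def by simp
  have Q1: "mehler_flow.Qf S c p (eps n) 1 = (\<integral>\<eta>. ((cmod (h1 \<eta>))\<^sup>2 + (eps n)\<^sup>2) powr (q / 2) \<partial>gauss)" for n
    unfolding mehler_flow.Qf_def[OF flow] mehler_flow.Gf_def[OF flow] N1 mehler_flow.r_def[OF flow]
    by (simp add: powr_powr mult.commute q_def)
  have Q0: "mehler_flow.Qf S c p (eps n) 0 = (\<integral>\<xi>. ((cmod (f \<xi>))\<^sup>2 + (eps n)\<^sup>2) powr (p / 2) \<partial>gauss) powr (1 / (p - 1))" for n
    unfolding mehler_flow.Qf_def[OF flow] mehler_flow.Gf_def[OF flow] N0 mehler_flow.r_def[OF flow]
    by simp
  have [measurable]: "h1 \<in> borel_measurable borel" "f \<in> borel_measurable borel"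
    unfolding h1_def f_def by (intro borel_measurable_continuous_onI continuous_intros)+
  have sqp: "(x\<^sup>2) powr (s / 2) = x powr s" if "0 \<le> x" for x s :: real
    using that by (cases "x = 0") (simp_all add: powr_numeral [symmetric] powr_powr del: powr_numeral)
  have bound1: "cmod (h1 \<eta>) \<le> (\<Sum>a\<in>S. cmod (c a) * exp (p * (norm a)\<^sup>2 / 2))" for \<eta>
    unfolding h1_def by (rule norm_sum [THEN order_trans]) (simp add: norm_mult)
  let ?M = "\<Sum>a\<in>S. cmod (c a) * exp (p * (norm a)\<^sup>2 / 2)"
  have q: "0 < q" using p by (simp add: q_def)
  have M0: "0 \<le> ?M" by (intro sum_nonneg) simp
  have eps1: "0 < eps n" "eps n \<le> 1" for n by (auto simp: eps_def)
  have step: "(\<integral>\<eta>. cmod (h1 \<eta>) powr q \<partial>gauss) \<le> (\<integral>\<xi>. ((cmod (f \<xi>))\<^sup>2 + (eps n)\<^sup>2) powr (p / 2) \<partial>gauss) powr (1 / (p - 1))" for n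
  proof -
    have "(\<integral>\<eta>. cmod (h1 \<eta>) powr q \<partial>gauss) \<le> (\<integral>\<eta>. ((cmod (h1 \<eta>))\<^sup>2 + (eps n)\<^sup>2) powr (q / 2) \<partial>gauss)"
    proof (rule integral_mono)
      fix \<eta>
      have "cmod (h1 \<eta>) powr q = ((cmod (h1 \<eta>))\<^sup>2) powr (q / 2)"
        by (rule sqp [symmetric]) simp
      also have "\<dots> \<le> ((cmod (h1 \<eta>))\<^sup>2 + (eps n)\<^sup>2) powr (q / 2)"
        using q by (intro powr_mono2) auto
      finally show "cmod (h1 \<eta>) powr q \<le> ((cmod (h1 \<eta>))\<^sup>2 + (eps n)\<^sup>2) powr (q / 2)" .
    next
      show "integrable gauss (\<lambda>\<eta>. cmod (h1 \<eta>) powr q)"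
        by (rule integrable_gauss_bound [where C = "?M powr q" and K = 0])
           (use bound1 q in \<open>auto intro: powr_mono2\<close>)
      show "integrable gauss (\<lambda>\<eta>. ((cmod (h1 \<eta>))\<^sup>2 + (eps n)\<^sup>2) powr (q / 2))"
        by (rule integrable_gauss_bound [where C = "(?M\<^sup>2 + (eps n)\<^sup>2) powr (q / 2)" and K = 0])
           (use bound1 q in \<open>auto intro!: powr_mono2 power_mono\<close>)
    qed
    also have "\<dots> \<le> (\<integral>\<xi>. ((cmod (f \<xi>))\<^sup>2 + (eps n)\<^sup>2) powr (p / 2) \<partial>gauss) powr (1 / (p - 1))"
      using mehler_flow.Qf_mono [OF flow, of c n] unfolding Q1 Q0 .
    finally show ?thesis .
  qed
  \<comment> \<open>The largest regularisation, \<open>eps 0\<close> = 1, dominates all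
    others.\<close>
  have dom: "integrable gauss (\<lambda>\<xi>. ((cmod (f \<xi>))\<^sup>2 + 1) powr (p / 2))"
  proof -
    have "integrable gauss (\<lambda>\<xi>. mehler_flow.Nf S c p (eps 0) 0 \<xi> 0)"
      by (rule dominated_integrable [OF mehler_flow.dominated_Nf [OF flow]]) auto
    then show ?thesis unfolding N0 by (simp add: eps_def)
  qed
  have "(\<lambda>n. \<integral>\<xi>. ((cmod (f \<xi>))\<^sup>2 + (eps n)\<^sup>2) powr (p / 2) \<partial>gauss) \<longlonglongrightarrow> (\<integral>\<xi>. cmod (f \<xi>) powr p \<partial>gauss)"
  proof (rule integral_dominated_convergence [OF _ _ dom])
    have "eps \<longlonglongrightarrow> 0" unfolding eps_def using LIMSEQ_inverse_real_of_nat by (simp add: inverse_eq_divide)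
    then have "(\<lambda>n. ((cmod (f \<xi>))\<^sup>2 + (eps n)\<^sup>2) powr (p / 2)) \<longlonglongrightarrow> ((cmod (f \<xi>))\<^sup>2 + 0\<^sup>2) powr (p / 2)" for \<xi>
      using p by (intro tendsto_powr' tendsto_intros) auto
    then show "AE \<xi> in gauss. (\<lambda>n. ((cmod (f \<xi>))\<^sup>2 + (eps n)\<^sup>2) powr (p / 2)) \<longlonglongrightarrow> cmod (f \<xi>) powr p"
      by (simp add: sqp)
    show "AE \<xi> in gauss. norm (((cmod (f \<xi>))\<^sup>2 + (eps n)\<^sup>2) powr (p / 2)) \<le> ((cmod (f \<xi>))\<^sup>2 + 1) powr (p / 2)" for n
      using p eps1[of n] by (auto intro!: AE_I2 powr_mono2 simp: power_le_one)
  qed auto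
  then have "(\<lambda>n. (\<integral>\<xi>. ((cmod (f \<xi>))\<^sup>2 + (eps n)\<^sup>2) powr (p / 2) \<partial>gauss) powr (1 / (p - 1)))
     \<longlonglongrightarrow> (\<integral>\<xi>. cmod (f \<xi>) powr p \<partial>gauss) powr (1 / (p - 1))"
    using p by (intro tendsto_powr' tendsto_const) (auto intro!: always_eventually)
  from LIMSEQ_le_const [OF this] step show ?thesis unfolding h1_def f_def q_def by blast
qed

section \<open>Gaussian bumps and their Fourier integrals\<close>

lemma lborel_integral_scale:
  fixes f :: "'a::euclidean_space \<Rightarrow> 'b::{banach, second_countable_topology}"
  assumes [measurable]: "f \<in> borel_measurable borel" and "c \<noteq> 0"
  shows "(\<integral>x. f (c *\<^sub>R x) \<partial>lborel) = (\<bar>c\<bar> powr (- real DIM('a))) *\<^sub>R (\<integral>x. f x \<partial>lborel)"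
proof -
  have "(\<integral>x. f x \<partial>lborel) =
      (\<integral>x. f x \<partial>(density (distr lborel borel (\<lambda>x. 0 + c *\<^sub>R x)) (\<lambda>_. ennreal (\<Prod>j\<in>(Basis::'a set). \<bar>c\<bar>))))"
    using lborel_affine_euclidean [where c = "\<lambda>_. c" and t = "0 :: 'a"] \<open>c \<noteq> 0\<close>
    by (simp add: scaleR_sum_right [symmetric] euclidean_representation flip: scaleR_scaleR)
  also have "\<dots> = (\<bar>c\<bar> ^ DIM('a)) *\<^sub>R (\<integral>x. f (c *\<^sub>R x) \<partial>lborel)"
    by (subst integral_density) (auto simp: integral_distr prod_nonneg)
  finally show ?thesis
    using \<open>c \<noteq> 0\<close> by (simp add: powr_minus powr_realpow)
qed

definition bump :: "real \<Rightarrow> 'a::euclidean_space \<Rightarrow> 'a \<Rightarrow> real" where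
  "bump \<mu> a u = exp (- \<mu> * (norm (u - a))\<^sup>2 / 2)"

lemma bump_measurable [measurable]: "bump \<mu> a \<in> borel_measurable borel"
  unfolding bump_def [abs_def] by measurable

lemma integrable_bump:
  assumes "0 < \<mu>"
  shows "integrable lborel (bump \<mu> (a :: 'a::euclidean_space))"
proof -
  have "integrable (lborel :: 'a measure) (\<lambda>x. exp (- (\<mu> / 2) * (norm x)\<^sup>2))"
    by (rule integrable_gaussian) (use assms in simp)
  then have "integrable (distr lborel borel ((+) (- a))) (\<lambda>x. exp (- (\<mu> / 2) * (norm x)\<^sup>2))"
    by (simp add: lborel_distr_plus)
  then show ?thesis
    by (subst (asm) integrable_distr_eq) (auto simp: bump_def [abs_def])
qed

lemma fourier_bump:
  fixes a \<xi> :: "'a::euclidean_space"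
  assumes "0 < \<mu>"
  shows "(\<integral>u. of_real (bump \<mu> a u) * exp (- \<i> * of_real (u \<bullet> \<xi>)) \<partial>lborel) =
     of_real ((2 * pi / \<mu>) powr (real DIM('a) / 2) * exp (- (norm \<xi>)\<^sup>2 / (2 * \<mu>))) * exp (- \<i> * of_real (a \<bullet> \<xi>))"
proof -
  let ?d = "real DIM('a)"
  let ?\<zeta> = "- (1 / sqrt \<mu>) *\<^sub>R \<xi>"
  have "(\<integral>u. of_real (bump \<mu> a u) * exp (- \<i> * of_real (u \<bullet> \<xi>)) \<partial>lborel) =
    (\<integral>u. of_real (bump \<mu> a u) * exp (- \<i> * of_real (u \<bullet> \<xi>)) \<partial>(distr lborel borel ((+) a)))"
    by (simp add: lborel_distr_plus)
  also have "\<dots> = (\<integral>u. exp (- \<i> * of_real (a \<bullet> \<xi>)) * (of_real (exp (- \<mu> * (norm u)\<^sup>2 / 2)) * cis (- (u \<bullet> \<xi>))) \<partial>lborel)"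
    by (subst integral_distr)
       (auto intro!: Bochner_Integration.integral_cong simp: bump_def cis_conv_exp inner_simps exp_add [symmetric] exp_of_real [symmetric] algebra_simps simp del: exp_of_real)
  also have "\<dots> = exp (- \<i> * of_real (a \<bullet> \<xi>)) * (\<integral>u. of_real (exp (- \<mu> * (norm u)\<^sup>2 / 2)) * cis (- (u \<bullet> \<xi>)) \<partial>lborel)"
    by (rule integral_mult_right_zero)
  also have "(\<integral>u. of_real (exp (- \<mu> * (norm u)\<^sup>2 / 2)) * cis (- (u \<bullet> \<xi>)) \<partial>lborel) =
     (\<integral>u. (\<lambda>x. of_real (exp (- (norm x)\<^sup>2 / 2)) * cis (?\<zeta> \<bullet> x)) (sqrt \<mu> *\<^sub>R u) \<partial>lborel)"
    using assms by (intro Bochner_Integration.integral_cong) (auto simp: power_mult_distrib inner_commute)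
  also have "\<dots> = (\<bar>sqrt \<mu>\<bar> powr (- ?d)) *\<^sub>R (\<integral>x. of_real (exp (- (norm x)\<^sup>2 / 2)) * cis (?\<zeta> \<bullet> x) \<partial>(lborel :: 'a measure))"
    by (rule lborel_integral_scale) (use assms in auto)
  also have "(\<integral>x. of_real (exp (- (norm x)\<^sup>2 / 2)) * cis (?\<zeta> \<bullet> x) \<partial>(lborel :: 'a measure)) =
     (\<integral>x. (2 * pi) powr (?d / 2) *\<^sub>R (gauss_density x *\<^sub>R cis (?\<zeta> \<bullet> x)) \<partial>(lborel :: 'a measure))"
    by (intro Bochner_Integration.integral_cong) (auto simp: gauss_density_def scaleR_conv_of_real powr_minus field_simps)
  also have "\<dots> = (2 * pi) powr (?d / 2) *\<^sub>R (\<integral>x. cis (?\<zeta> \<bullet> x) \<partial>gauss)"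
    unfolding integral_scaleR_right by (subst integral_gauss) auto
  also have "\<dots> = (2 * pi) powr (?d / 2) *\<^sub>R of_real (exp (- (norm \<xi>)\<^sup>2 / (2 * \<mu>)))"
    unfolding char_gauss using assms by (simp add: power_mult_distrib power_divide)
  also have "(\<bar>sqrt \<mu>\<bar> powr (- ?d)) *\<^sub>R ((2 * pi) powr (?d / 2) *\<^sub>R complex_of_real (exp (- (norm \<xi>)\<^sup>2 / (2 * \<mu>)))) =
     of_real ((2 * pi / \<mu>) powr (?d / 2) * exp (- (norm \<xi>)\<^sup>2 / (2 * \<mu>)))"
  proof -
    have "\<bar>sqrt \<mu>\<bar> powr (- ?d) * (2 * pi) powr (?d / 2) = (2 * pi / \<mu>) powr (?d / 2)"
      using assms by (simp add: powr_half_sqrt [symmetric] powr_powr powr_divide powr_minus_divide)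
    then show ?thesis by (simp add: scaleR_conv_of_real flip: of_real_mult)
  qed
  finally show ?thesis by (simp add: mult.commute)
qed

section \<open>The Fourier transform of functions with integrable transform\<close>

text \<open>The \<open>p\<close>-th power of the \<open>L\<^sup>p\<close> norm.\<close>

definition normp :: "real \<Rightarrow> ('a::euclidean_space \<Rightarrow> complex) \<Rightarrow> ennreal" where
  "normp p f = (\<integral>\<^sup>+ u. ennreal (cmod (f u) powr p) \<partial>lebesgue)"

lemma L2_normsq_normp: "L2_normsq = normp 2"
  by (simp add: fun_eq_iff L2_normsq_def normp_def powr_numeral)

lemma normp_lborel:
  assumes [measurable]: "f \<in> borel_measurable borel"
  shows "normp p f = (\<integral>\<^sup>+ u. ennreal (cmod (f u) powr p) \<partial>lborel)"
  unfolding normp_def by (rule nn_integral_completion) measurable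

lemma fourier_integral_lborel:
  fixes f :: "'a::euclidean_space \<Rightarrow> complex"
  assumes [measurable]: "f \<in> borel_measurable borel"
  shows "fourier_integral f x = of_real ((2 * pi) powr (- real DIM('a) / 2)) *
     (\<integral>u. f u * exp (- \<i> * of_real (u \<bullet> x)) \<partial>lborel)"
proof -
  have [measurable]: "(\<lambda>u. exp (- \<i> * complex_of_real (u \<bullet> x))) \<in> borel_measurable borel"
    by (intro borel_measurable_continuous_onI continuous_intros)
  show ?thesis unfolding fourier_integral_def by (subst integral_completion) auto
qed

lemma fourier_kernel_measurable [measurable]:
  "(\<lambda>u. exp (- \<i> * complex_of_real (u \<bullet> x))) \<in> borel_measurable borel"
  by (intro borel_measurable_continuous_onI continuous_intros)

lemma norm_fourier_kernel [simp]: "cmod (exp (- \<i> * complex_of_real y)) = 1"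
  by simp

lemma integrable_fourier_kernel:
  fixes f :: "'a::euclidean_space \<Rightarrow> complex"
  assumes "integrable lebesgue f"
  shows "integrable lebesgue (\<lambda>u. f u * exp (- \<i> * complex_of_real (u \<bullet> x)))"
proof (rule Bochner_Integration.integrable_bound [OF assms])
  have "(\<lambda>u. exp (- \<i> * complex_of_real (u \<bullet> x))) \<in> borel_measurable lebesgue"
    by (intro measurable_completion) simp
  then show "(\<lambda>u. f u * exp (- \<i> * complex_of_real (u \<bullet> x))) \<in> borel_measurable lebesgue"
    using assms by (intro borel_measurable_times) auto
qed (auto simp: norm_mult)

lemma fourier_integral_diff:
  assumes "integrable lebesgue f" "integrable lebesgue g"
  shows "fourier_integral (\<lambda>u. f u - g u) x = fourier_integral f x - fourier_integral g x"
  using integrable_fourier_kernel [OF assms(1), of x] integrable_fourier_kernel [OF assms(2), of x]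
  by (simp add: fourier_integral_def left_diff_distrib right_diff_distrib)

lemma norm_fourier_integral_le:
  fixes f :: "'a::euclidean_space \<Rightarrow> complex"
  shows "cmod (fourier_integral f x) \<le> (2 * pi) powr (- real DIM('a) / 2) * (\<integral>u. cmod (f u) \<partial>lebesgue)"
  unfolding fourier_integral_def norm_mult
  using integral_norm_bound [of lebesgue "\<lambda>u. f u * exp (- \<i> * complex_of_real (u \<bullet> x))"]
  by (simp add: norm_mult mult_left_mono)

lemma fourier_integral_continuous:
  fixes f :: "'a::euclidean_space \<Rightarrow> complex"
  assumes "integrable lebesgue f"
  shows "continuous_on UNIV (fourier_integral f)"
proof -
  have "continuous_on UNIV (\<lambda>x. \<integral>u. f u * exp (- \<i> * of_real (u \<bullet> x)) \<partial>lebesgue)"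
    unfolding continuous_on_sequentially comp_def
  proof (intro allI ballI impI, elim conjE)
    fix X :: "nat \<Rightarrow> 'a" and x assume X: "X \<longlonglongrightarrow> x"
    show "(\<lambda>n. \<integral>u. f u * exp (- \<i> * of_real (u \<bullet> X n)) \<partial>lebesgue) \<longlonglongrightarrow> (\<integral>u. f u * exp (- \<i> * of_real (u \<bullet> x)) \<partial>lebesgue)"
    proof (rule integral_dominated_convergence [where w = "\<lambda>u. cmod (f u)"])
      show "AE u in lebesgue. (\<lambda>n. f u * exp (- \<i> * of_real (u \<bullet> X n))) \<longlonglongrightarrow> f u * exp (- \<i> * of_real (u \<bullet> x))"
        using X by (intro AE_I2 tendsto_intros)
    qed (use integrable_fourier_kernel [OF assms] assms in \<open>auto simp: norm_mult intro: borel_measurable_integrable\<close>)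
  qed
  then show ?thesis unfolding fourier_integral_def [abs_def] by (intro continuous_intros)
qed

lemma fourier_integral_measurable:
  "integrable lebesgue f \<Longrightarrow> fourier_integral f \<in> borel_measurable borel"
  by (intro borel_measurable_continuous_onI fourier_integral_continuous)

lemma integrable_lebesgue_iff:
  fixes f :: "'a::euclidean_space \<Rightarrow> 'b::{banach, second_countable_topology}"
  assumes "f \<in> borel_measurable borel"
  shows "integrable lebesgue f \<longleftrightarrow> integrable lborel f"
  by (rule integrable_completion) (use assms in simp)

text \<open>Functions for which Fourier inversion holds everywhere; a subspace containing all Gaussians.\<close>

definition nice :: "('a::euclidean_space \<Rightarrow> complex) \<Rightarrow> bool" where
  "nice h \<longleftrightarrow> h \<in> borel_measurable borel \<and> integrable lebesgue h \<and> integrable lebesgue (fourier_integral h) \<and>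
     (\<forall>x. fourier_integral (fourier_integral h) x = h (- x))"

lemma nice_diff:
  assumes "nice f" "nice g"
  shows "nice (\<lambda>u. f u - g u)"
proof -
  have *: "fourier_integral (\<lambda>u. f u - g u) = (\<lambda>x. fourier_integral f x - fourier_integral g x)"
    using assms by (auto simp: nice_def fun_eq_iff fourier_integral_diff)
  show ?thesis
    using assms unfolding nice_def * by (auto simp: fourier_integral_diff)
qed

lemma nice_add:
  assumes "nice f" "nice g"
  shows "nice (\<lambda>u. f u + g u)"
proof -
  have "nice (\<lambda>u. 0 - g u)"
  proof -
    have "nice (\<lambda>u. g u - g u)" using assms by (intro nice_diff) auto
    then show ?thesis using nice_diff [of "\<lambda>u. 0" g] assms by simp
  qed
  from nice_diff [OF assms(1) this] show ?thesis by simp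
qed

lemma fourier_integral_cmult:
  "fourier_integral (\<lambda>u. c * f u) x = c * fourier_integral f x"
  by (simp add: fourier_integral_def mult.assoc mult.left_commute)

lemma nice_cmult:
  assumes "nice f"
  shows "nice (\<lambda>u. c * f u)"
proof -
  have *: "fourier_integral (\<lambda>u. c * f u) = (\<lambda>x. c * fourier_integral f x)" for f :: "'a \<Rightarrow> complex"
    by (rule ext) (rule fourier_integral_cmult)
  show ?thesis
    using assms unfolding nice_def * by auto
qed

lemma nice_zero: "nice (\<lambda>u. 0)"
  unfolding nice_def by (auto simp: fourier_integral_def [abs_def])

lemma nice_sum: "(\<And>i. i \<in> I \<Longrightarrow> nice (f i)) \<Longrightarrow> nice (\<lambda>u. \<Sum>i\<in>I. f i u)"
  by (induction I rule: infinite_finite_induct) (auto intro: nice_zero nice_add)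

lemma fourier_integral_bump:
  fixes a \<xi> :: "'a::euclidean_space"
  assumes "0 < \<mu>"
  shows "fourier_integral (\<lambda>u. of_real (bump \<mu> a u)) \<xi> =
     of_real (\<mu> powr (- real DIM('a) / 2) * bump (1 / \<mu>) 0 \<xi>) * exp (- \<i> * of_real (a \<bullet> \<xi>))"
proof -
  have "(2 * pi) powr (- real DIM('a) / 2) * (2 * pi / \<mu>) powr (real DIM('a) / 2) = \<mu> powr (- real DIM('a) / 2)"
    using assms by (simp add: powr_divide powr_minus_divide)
  then show ?thesis
    by (subst fourier_integral_lborel, simp, subst fourier_bump [OF assms])
       (simp add: bump_def mult.assoc [symmetric] of_real_mult [symmetric] del: of_real_mult)
qed

lemma nice_bump:
  fixes a :: "'a::euclidean_space"
  assumes "0 < \<mu>"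
  shows "nice (\<lambda>u. complex_of_real (bump \<mu> a u))"
proof -
  let ?d = "real DIM('a)"
  have m: "(\<lambda>\<xi>. of_real (bump (1 / \<mu>) 0 \<xi>) * exp (- \<i> * of_real (a \<bullet> \<xi>))) \<in> borel_measurable borel"
    using fourier_kernel_measurable [of a] by (intro borel_measurable_times) (auto simp: inner_commute)
  have Fb: "fourier_integral (\<lambda>u. complex_of_real (bump \<mu> a u)) =
     (\<lambda>\<xi>. of_real (\<mu> powr (- ?d / 2)) * (of_real (bump (1 / \<mu>) 0 \<xi>) * exp (- \<i> * of_real (a \<bullet> \<xi>))))"
    by (simp add: fun_eq_iff fourier_integral_bump [OF assms])
  have ib: "integrable lborel (\<lambda>u. complex_of_real (bump \<nu> b u))" if "0 < \<nu>" for \<nu> and b :: 'a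
    using integrable_bump [OF that, of b] by (rule integrable_of_real)
  have ib': "integrable lborel (\<lambda>\<xi>. of_real (bump (1 / \<mu>) 0 \<xi>) * exp (- \<i> * of_real (a \<bullet> \<xi>)))"
    by (rule Bochner_Integration.integrable_bound [OF ib [of "1 / \<mu>" 0]]) (use m assms in \<open>auto simp: norm_mult\<close>)
  \<comment> \<open>The phase that stems from the centre of the bump becomes a translation under the
    second transform.\<close>
  have *: "fourier_integral (\<lambda>\<xi>. of_real (bump (1 / \<mu>) 0 \<xi>) * exp (- \<i> * of_real (a \<bullet> \<xi>))) x =
      fourier_integral (\<lambda>\<xi>. of_real (bump (1 / \<mu>) 0 \<xi>)) (a + x)" for x
    unfolding fourier_integral_def
    by (simp add: inner_add_right inner_commute exp_add [symmetric] mult.assoc algebra_simps exp_minus exp_diff)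
       (simp add: exp_add divide_simps)
  have FF: "fourier_integral (fourier_integral (\<lambda>u. complex_of_real (bump \<mu> a u))) x = of_real (bump \<mu> a (- x))" for x
  proof -
    have "fourier_integral (\<lambda>\<xi>. of_real (bump (1 / \<mu>) 0 \<xi>)) (a + x) = of_real ((1 / \<mu>) powr (- ?d / 2) * bump \<mu> 0 (a + x))"
      using fourier_integral_bump [of "1 / \<mu>" 0 "a + x"] assms by simp
    moreover have "bump \<mu> 0 (a + x) = bump \<mu> a (- x)"
    proof -
      have "norm (- x - a) = norm (a + x)"
        by (subst norm_minus_cancel [symmetric]) (simp add: algebra_simps)
      then show ?thesis by (simp add: bump_def)
    qed
    moreover have "\<mu> powr (- ?d / 2) * (1 / \<mu>) powr (- ?d / 2) = 1"
      using assms by (simp add: powr_mult [symmetric])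
    ultimately show ?thesis
      unfolding Fb fourier_integral_cmult * by (simp only: of_real_mult [symmetric] mult.assoc [symmetric]) simp
  qed
  show ?thesis
    unfolding nice_def using ib [OF assms] ib' m FF
    by (auto simp: integrable_lebesgue_iff Fb)
qed

text \<open>By inversion the function is, up to reflection, the Fourier integral of an integrable
  function.\<close>

lemma nice_bounded:
  fixes h :: "'a::euclidean_space \<Rightarrow> complex"
  assumes "nice h"
  obtains M where "0 \<le> M" "\<And>u. cmod (h u) \<le> M"
proof -
  have "cmod (h u) \<le> (2 * pi) powr (- real DIM('a) / 2) * (\<integral>u. cmod (fourier_integral h u) \<partial>lebesgue)" for u
    using norm_fourier_integral_le [of "fourier_integral h" "- u"] assms by (simp add: nice_def)
  then show ?thesis using that [of "(2 * pi) powr (- real DIM('a) / 2) * (\<integral>u. cmod (fourier_integral h u) \<partial>lebesgue)"]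
    by (auto intro!: integral_nonneg_AE)
qed

text \<open>The Fourier integral commutes with the reflection x to -x, so inversion for
  \<open>h\<close> carries over to its transform.\<close>

lemma nice_fourier:
  assumes "nice h"
  shows "nice (fourier_integral h)"
proof -
  have "fourier_integral (\<lambda>x. h (- x)) y = fourier_integral h (- y)" for y
  proof -
    have [measurable]: "h \<in> borel_measurable borel" using assms by (simp add: nice_def)
    have "(\<integral>u. h (- u) * exp (- \<i> * complex_of_real (u \<bullet> y)) \<partial>lborel) =
      (\<integral>u. (\<lambda>u. h u * exp (- \<i> * complex_of_real (u \<bullet> - y))) ((-1) *\<^sub>R u) \<partial>lborel)"
      by simp
    also have "\<dots> = (\<bar>-1\<bar> powr (- real DIM('a))) *\<^sub>R (\<integral>u. h u * exp (- \<i> * complex_of_real (u \<bullet> - y)) \<partial>lborel)"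
      by (rule lborel_integral_scale) auto
    finally show ?thesis
      by (simp add: fourier_integral_lborel)
  qed
  moreover have "fourier_integral (fourier_integral h) = (\<lambda>x. h (- x))"
    using assms by (auto simp: nice_def)
  moreover have "integrable lebesgue (\<lambda>x. h (- x))"
  proof -
    have [measurable]: "h \<in> borel_measurable borel" using assms by (simp add: nice_def)
    have 0: "distr lborel borel (\<lambda>x. - x) = (lborel :: 'a measure)"
      using lborel_affine_euclidean [where c = "\<lambda>_. -1" and t = "0::'a"]
      by (simp add: sum_negf euclidean_representation density_1 one_ennreal_def[symmetric])
    have "integrable lborel h" using assms by (simp add: nice_def integrable_lebesgue_iff)
    then have "integrable (distr lborel borel (\<lambda>x. - x)) h" by (simp add: 0)
    then have "integrable lborel (\<lambda>x. h (- x))"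
      by (subst (asm) integrable_distr_eq) auto
    then show ?thesis by (simp add: integrable_lebesgue_iff)
  qed
  ultimately show ?thesis
    using assms by (auto simp: nice_def intro: fourier_integral_measurable)
qed

lemma nice_integrable_powr:
  assumes "nice h" "1 \<le> p"
  shows "integrable lborel (\<lambda>u. cmod (h u) powr p)"
proof -
  have [measurable]: "h \<in> borel_measurable borel" using assms by (simp add: nice_def)
  obtain M where M: "0 \<le> M" "\<And>u. cmod (h u) \<le> M" using nice_bounded [OF assms(1)] by blast
  have "integrable lborel h" using assms by (simp add: nice_def integrable_lebesgue_iff)
  then have i: "integrable lborel (\<lambda>u. M powr (p - 1) * cmod (h u))" by simp
  have "cmod (h u) powr p \<le> M powr (p - 1) * cmod (h u)" for u
  proof -
    have "cmod (h u) powr p = cmod (h u) powr (p - 1) * cmod (h u)"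
      by (cases "h u = 0") (simp_all add: powr_diff)
    also have "\<dots> \<le> M powr (p - 1) * cmod (h u)"
      using M assms by (intro mult_right_mono powr_mono2) auto
    finally show ?thesis .
  qed
  then show ?thesis
    by (intro Bochner_Integration.integrable_bound [OF i]) auto
qed

lemma nice_normp:
  assumes "nice h" "1 \<le> p"
  shows "normp p h = ennreal (\<integral>u. cmod (h u) powr p \<partial>lborel)"
proof -
  have "h \<in> borel_measurable borel" using assms by (simp add: nice_def)
  then show ?thesis
    using nice_integrable_powr [OF assms] by (simp add: normp_lborel nn_integral_eq_integral)
qed

text \<open>Let k be the conjugate of the transform. Fubini moves the transform from h to k in the
  integral of k times the transform of h, and inversion shows that the transform of k is the
  conjugate of h.\<close>

lemma nice_plancherel:
  fixes h :: "'a::euclidean_space \<Rightarrow> complex"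
  assumes "nice h"
  shows "normp 2 (fourier_integral h) = normp 2 h"
proof -
  define k where "k x = cnj (fourier_integral h x)" for x
  define C where "C = complex_of_real ((2 * pi) powr (- real DIM('a) / 2))"
  have [measurable]: "h \<in> borel_measurable borel" and [measurable]: "fourier_integral h \<in> borel_measurable borel"
    using assms nice_fourier [OF assms] by (auto simp: nice_def)
  have [measurable]: "k \<in> borel_measurable borel" unfolding k_def
    by (intro measurable_compose [OF _ borel_measurable_continuous_onI[OF continuous_on_cnj[OF continuous_on_id]]]) simp
  have ih: "integrable lborel h" and ik: "integrable lborel k"
    using assms unfolding k_def by (auto simp: nice_def integrable_lebesgue_iff)
  have km [measurable]: "(\<lambda>z. exp (- \<i> * complex_of_real (fst z \<bullet> snd z))) \<in> borel_measurable (borel \<Otimes>\<^sub>M (borel :: 'a measure))"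
    unfolding borel_prod by (intro borel_measurable_continuous_onI continuous_intros)
  let ?f = "\<lambda>x u. k x * (h u * exp (- \<i> * complex_of_real (u \<bullet> x)))"
  have int: "integrable (lborel \<Otimes>\<^sub>M lborel) (case_prod ?f)"
  proof (rule lborel_pair.Fubini_integrable)
    show "case_prod ?f \<in> borel_measurable (lborel \<Otimes>\<^sub>M lborel)"
      using km by (simp add: case_prod_beta inner_commute)
    have "(\<integral>u. norm (case_prod ?f (x, u)) \<partial>lborel) = cmod (k x) * (\<integral>u. cmod (h u) \<partial>lborel)" for x
      by (simp add: norm_mult)
    then show "integrable lborel (\<lambda>x. \<integral>u. norm (case_prod ?f (x, u)) \<partial>lborel)"
      using ik by simp
    have "integrable lborel (\<lambda>u. h u * exp (- \<i> * complex_of_real (u \<bullet> x)))" for x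
      by (rule Bochner_Integration.integrable_bound [OF ih]) (auto simp: norm_mult)
    then show "AE x in lborel. integrable lborel (\<lambda>u. case_prod ?f (x, u))"
      by simp
  qed
  have kh: "C * (\<integral>x. k x * exp (- \<i> * complex_of_real (u \<bullet> x)) \<partial>lborel) = cnj (h u)" for u
  proof -
    have "(\<integral>x. k x * exp (- \<i> * complex_of_real (u \<bullet> x)) \<partial>lborel) =
       (\<integral>x. cnj (fourier_integral h x * exp (- \<i> * complex_of_real (x \<bullet> - u))) \<partial>lborel)"
      by (simp add: k_def exp_cnj inner_commute)
    also have "\<dots> = cnj (\<integral>x. fourier_integral h x * exp (- \<i> * complex_of_real (x \<bullet> - u)) \<partial>lborel)"
      by (rule integral_bounded_linear' [OF bounded_linear_cnj bounded_linear_cnj]) simp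
    finally have "C * (\<integral>x. k x * exp (- \<i> * complex_of_real (u \<bullet> x)) \<partial>lborel) = cnj (fourier_integral (fourier_integral h) (- u))"
      by (simp add: fourier_integral_lborel [of "fourier_integral h"] C_def)
    then show ?thesis using assms by (simp add: nice_def)
  qed
  have "(\<integral>x. k x * fourier_integral h x \<partial>lborel) = (\<integral>x. \<integral>u. C * ?f x u \<partial>lborel \<partial>lborel)"
    unfolding fourier_integral_lborel [OF \<open>h \<in> borel_measurable borel\<close>] C_def [symmetric]
    by (simp only: integral_mult_right_zero mult.left_commute [of _ C])
  also have "\<dots> = C * (\<integral>x. \<integral>u. ?f x u \<partial>lborel \<partial>lborel)" by simp
  also have "\<dots> = C * (\<integral>u. \<integral>x. ?f x u \<partial>lborel \<partial>lborel)"
    using lborel_pair.Fubini_integral [OF int] by simp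
  also have "\<dots> = (\<integral>u. h u * (C * (\<integral>x. k x * exp (- \<i> * complex_of_real (u \<bullet> x)) \<partial>lborel)) \<partial>lborel)"
    by (simp add: mult.left_commute)
  also have "\<dots> = (\<integral>u. h u * cnj (h u) \<partial>lborel)" unfolding kh ..
  finally have "(\<integral>x. complex_of_real ((cmod (fourier_integral h x))\<^sup>2) \<partial>lborel) = (\<integral>x. complex_of_real ((cmod (h x))\<^sup>2) \<partial>lborel)"
    unfolding k_def complex_norm_square by (simp only: mult.commute)
  then have "(\<integral>x. (cmod (fourier_integral h x))\<^sup>2 \<partial>lborel) = (\<integral>x. (cmod (h x))\<^sup>2 \<partial>lborel)"
    by (simp only: integral_complex_of_real of_real_eq_iff)
  then show ?thesis
    by (simp add: nice_normp assms nice_fourier powr_numeral)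
qed

section \<open>The sharp Hausdorff--Young inequality\<close>

definition gauss_comb :: "real \<Rightarrow> 'a::euclidean_space set \<Rightarrow> ('a \<Rightarrow> complex) \<Rightarrow> 'a \<Rightarrow> complex" where
  "gauss_comb \<mu> S c u = (\<Sum>a\<in>S. c a * of_real (bump \<mu> a u))"

text \<open>The width is common to one combination but differs between members, so sums leave the
  set. Where differences of members are needed, they are taken in the class
  \<open>nice\<close>.\<close>

definition gauss_combs :: "('a::euclidean_space \<Rightarrow> complex) set" where
  "gauss_combs = {gauss_comb \<mu> S c | \<mu> S c. 0 < \<mu> \<and> finite S}"

lemma nice_gauss_comb: "0 < \<mu> \<Longrightarrow> nice (gauss_comb \<mu> S c)"
  unfolding gauss_comb_def [abs_def] by (intro nice_sum nice_cmult nice_bump)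

lemma nice_gauss_combs: "h \<in> gauss_combs \<Longrightarrow> nice h"
  by (auto simp: gauss_combs_def nice_gauss_comb)

text \<open>The \<open>q\<close>-th power of the sharp constant in the Hausdorff--Young inequality, \<open>q\<close> the conjugate exponent of \<open>p\<close>.\<close>

definition beckner :: "real \<Rightarrow> nat \<Rightarrow> real" where
  "beckner p d = (2 * pi * (p - 1) / p * (p / (2 * pi)) powr (1 / (p - 1))) powr (real d / 2)"

lemma exp_neg_half_eq: "exp (- (norm x)\<^sup>2 / 2) = (2 * pi) powr (real DIM('a) / 2) * gauss_density x" for x :: "'a::euclidean_space"
  by (simp add: gauss_density_def powr_minus)

lemma fourier_gauss_comb:
  fixes \<xi> :: "'a::euclidean_space"
  assumes "0 < \<mu>"
  shows "fourier_integral (gauss_comb \<mu> S c) \<xi> =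
     of_real (\<mu> powr (- real DIM('a) / 2) * bump (1 / \<mu>) 0 \<xi>) * (\<Sum>a\<in>S. c a * exp (- \<i> * of_real (a \<bullet> \<xi>)))"
proof (cases "finite S")
  case True
  have "fourier_integral (gauss_comb \<mu> S c) \<xi> = (\<Sum>a\<in>S. c a * fourier_integral (\<lambda>u. of_real (bump \<mu> a u)) \<xi>)"
    using True
  proof (induction S rule: finite_induct)
    case empty
    then show ?case by (simp add: gauss_comb_def [abs_def] fourier_integral_def)
  next
    case (insert a S)
    have i: "integrable lebesgue (\<lambda>u. c a * complex_of_real (bump \<mu> a u))" "integrable lebesgue (\<lambda>u. 0 - gauss_comb \<mu> S c u)"
      using nice_cmult [OF nice_bump [OF assms], of "c a" a] nice_diff [OF nice_zero nice_gauss_comb [OF assms], of S c] by (auto simp: nice_def)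
    have "fourier_integral (\<lambda>u. 0 - gauss_comb \<mu> S c u) \<xi> = - fourier_integral (gauss_comb \<mu> S c) \<xi>"
      using fourier_integral_cmult [of "-1" "gauss_comb \<mu> S c" \<xi>] by simp
    then show ?case
      using insert fourier_integral_diff [OF i, of \<xi>]
      by (simp add: gauss_comb_def [abs_def] fourier_integral_cmult)
  qed
  then show ?thesis
    by (simp add: fourier_integral_bump [OF assms] sum_distrib_left mult_ac)
qed (simp add: gauss_comb_def [abs_def] fourier_integral_def)

text \<open>The substitutions x = sqrt(p \<mu>) u and \<eta> = - \<xi> / (\<kappa> s) turn the p-th
  power of the Gaussian factor of the combination and the q-th power of that of its transform into
  the same standard Gaussian weight.\<close>

lemma hausdorff_young_gauss_comb:
  fixes S :: "'a::euclidean_space set"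
  assumes S: "finite S" and p: "1 < p" "p < 2" and \<mu>: "0 < \<mu>"
  shows "(\<integral>\<xi>. cmod (fourier_integral (gauss_comb \<mu> S c) \<xi>) powr (p / (p - 1)) \<partial>lborel)
     \<le> beckner p DIM('a) * (\<integral>u. cmod (gauss_comb \<mu> S c u) powr p \<partial>lborel) powr (1 / (p - 1))"
proof -
  define d where "d = real DIM('a)"
  define q where "q = p / (p - 1)"
  define \<kappa> where "\<kappa> = sqrt (p - 1)"
  \<comment> \<open>Chosen so that p |s a|^2 / 2 = \<mu> |a|^2 / 2: the growth factor in
    \<open>complex_hypercontractivity\<close> then cancels the factor exp(- \<mu> |a|^2 / 2) that
    splits off from the bump with centre a.\<close>
  define s where "s = sqrt (\<mu> / p)"
  have s: "0 < s" "s\<^sup>2 = \<mu> / p" and q: "1 < q" and \<kappa>: "0 < \<kappa>" "\<kappa>\<^sup>2 = p - 1"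
    using \<mu> p by (auto simp: s_def q_def \<kappa>_def)
  define f where "f x = (\<Sum>a\<in>S. c a * of_real (exp (- \<mu> * (norm a)\<^sup>2 / 2)) * exp (of_real ((s *\<^sub>R a) \<bullet> x)))" for x
  define h1 where "h1 x = (\<Sum>a\<in>S. c a * exp (\<i> * of_real (\<kappa> * s * (a \<bullet> x))))" for x
  have [measurable]: "f \<in> borel_measurable borel" "h1 \<in> borel_measurable borel"
    unfolding f_def h1_def by (intro borel_measurable_continuous_onI continuous_intros)+
  have inj: "inj_on (\<lambda>a. s *\<^sub>R a) S" using s by (auto simp: inj_on_def)
  let ?c' = "\<lambda>b. c ((1 / s) *\<^sub>R b) * of_real (exp (- \<mu> * (norm ((1 / s) *\<^sub>R b))\<^sup>2 / 2))"
  have hyper: "(\<integral>\<eta>. cmod (h1 \<eta>) powr q \<partial>gauss) \<le> (\<integral>\<xi>. cmod (f \<xi>) powr p \<partial>gauss) powr (1 / (p - 1))"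
  proof -
    have "(\<Sum>b\<in>(\<lambda>a. s *\<^sub>R a) ` S. ?c' b * exp (of_real (p * (norm b)\<^sup>2 / 2) + \<i> * of_real (sqrt (p - 1) * (b \<bullet> \<eta>)))) = h1 \<eta>" for \<eta>
    proof -
      have "complex_of_real (exp (- \<mu> * (norm a)\<^sup>2 / 2)) * exp (of_real (p * (norm (s *\<^sub>R a))\<^sup>2 / 2) + \<i> * of_real (sqrt (p - 1) * ((s *\<^sub>R a) \<bullet> \<eta>)))
         = exp (\<i> * of_real (\<kappa> * s * (a \<bullet> \<eta>)))" for a
      proof -
        have "p * (norm (s *\<^sub>R a))\<^sup>2 / 2 = \<mu> * (norm a)\<^sup>2 / 2"
          using p s by (simp add: power_mult_distrib)
        then show ?thesis
          unfolding exp_of_real [symmetric] exp_add [symmetric] by (simp add: \<kappa>_def mult.assoc)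
      qed
      then show ?thesis
        unfolding h1_def using s by (subst sum.reindex [OF inj]) (simp add: mult.assoc)
    qed
    moreover have "(\<Sum>b\<in>(\<lambda>a. s *\<^sub>R a) ` S. ?c' b * exp (of_real (b \<bullet> \<xi>))) = f \<xi>" for \<xi>
      unfolding f_def using s by (subst sum.reindex [OF inj]) simp
    ultimately show ?thesis
      using complex_hypercontractivity [OF finite_imageI [OF S, of "\<lambda>a. s *\<^sub>R a"] p, of ?c'] by (simp add: q_def)
  qed
  have I1: "(\<integral>u. cmod (gauss_comb \<mu> S c u) powr p \<partial>lborel) =
     (p * \<mu>) powr (- d / 2) * (2 * pi) powr (d / 2) * (\<integral>\<xi>. cmod (f \<xi>) powr p \<partial>gauss)"
  proof -
    let ?g = "\<lambda>x. exp (- (norm x)\<^sup>2 / 2) * cmod (f x) powr p"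
    have "gauss_comb \<mu> S c u = of_real (exp (- \<mu> * (norm u)\<^sup>2 / 2)) * f (sqrt (p * \<mu>) *\<^sub>R u)" for u
    proof -
      have ss: "s * sqrt (p * \<mu>) = \<mu>"
        unfolding s_def using p \<mu> by (simp add: real_sqrt_mult [symmetric] power2_eq_square [symmetric])
      have "bump \<mu> a u = exp (- \<mu> * (norm u)\<^sup>2 / 2) * (exp (- \<mu> * (norm a)\<^sup>2 / 2) * exp ((s *\<^sub>R a) \<bullet> (sqrt (p * \<mu>) *\<^sub>R u)))" for a
      proof -
        have "(s *\<^sub>R a) \<bullet> (sqrt (p * \<mu>) *\<^sub>R u) = (s * sqrt (p * \<mu>)) * (a \<bullet> u)"
          by (simp add: mult_ac)
        also have "\<dots> = \<mu> * (a \<bullet> u)" unfolding ss ..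
        finally have e: "(s *\<^sub>R a) \<bullet> (sqrt (p * \<mu>) *\<^sub>R u) = \<mu> * (a \<bullet> u)" .
        show ?thesis
          unfolding e bump_def power2_norm_eq_inner exp_add [symmetric] by (simp add: inner_simps inner_commute field_simps)
      qed
      then show ?thesis
        unfolding gauss_comb_def f_def sum_distrib_left by (intro sum.cong refl) (simp only: exp_of_real of_real_mult mult_ac)
    qed
    then have "cmod (gauss_comb \<mu> S c u) powr p = ?g (sqrt (p * \<mu>) *\<^sub>R u)" for u
      using p \<mu> by (simp add: norm_mult powr_mult exp_powr_real power_mult_distrib mult_ac)
    then have "(\<integral>u. cmod (gauss_comb \<mu> S c u) powr p \<partial>lborel) = (\<integral>u. ?g (sqrt (p * \<mu>) *\<^sub>R u) \<partial>lborel)"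
      by simp
    also have "\<dots> = \<bar>sqrt (p * \<mu>)\<bar> powr (- d) *\<^sub>R (\<integral>x. ?g x \<partial>lborel)"
      unfolding d_def by (rule lborel_integral_scale) (use p \<mu> in auto)
    also have "(\<integral>x. ?g x \<partial>lborel) = (2 * pi) powr (d / 2) * (\<integral>\<xi>. cmod (f \<xi>) powr p \<partial>gauss)"
      unfolding exp_neg_half_eq d_def by (subst integral_gauss) (auto simp: mult.assoc)
    also have "\<bar>sqrt (p * \<mu>)\<bar> powr (- d) = (p * \<mu>) powr (- d / 2)"
      using p \<mu> by (simp add: powr_half_sqrt [symmetric] powr_powr)
    finally show ?thesis by (simp add: mult.assoc)
  qed
  have I2: "(\<integral>\<xi>. cmod (fourier_integral (gauss_comb \<mu> S c) \<xi>) powr q \<partial>lborel) =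
     \<mu> powr (- (d * q) / 2) * ((1 / (\<kappa> * s)) powr (- d) * (2 * pi) powr (d / 2) * (\<integral>\<eta>. cmod (h1 \<eta>) powr q \<partial>gauss))"
  proof -
    let ?g = "\<lambda>x. exp (- (norm x)\<^sup>2 / 2) * cmod (h1 x) powr q"
    have "cmod (fourier_integral (gauss_comb \<mu> S c) \<xi>) powr q = \<mu> powr (- (d * q) / 2) * ?g ((- (1 / (\<kappa> * s))) *\<^sub>R \<xi>)" for \<xi>
    proof -
      have qm: "q * (1 / \<mu>) = (1 / (\<kappa> * s))\<^sup>2"
        unfolding power_divide power_mult_distrib \<kappa> s q_def using p \<mu> by (simp add: field_simps)
      have "q * ((1 / \<mu>) * (norm \<xi>)\<^sup>2 / 2) = q * (1 / \<mu>) * (norm \<xi>)\<^sup>2 / 2"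
        by simp
      also have "\<dots> = (norm ((- (1 / (\<kappa> * s))) *\<^sub>R \<xi>))\<^sup>2 / 2"
        unfolding qm norm_scaleR power_mult_distrib power2_abs by simp
      finally have e: "q * ((1 / \<mu>) * (norm \<xi>)\<^sup>2 / 2) = (norm ((- (1 / (\<kappa> * s))) *\<^sub>R \<xi>))\<^sup>2 / 2" .
      have "(\<Sum>a\<in>S. c a * exp (- \<i> * of_real (a \<bullet> \<xi>))) = h1 ((- (1 / (\<kappa> * s))) *\<^sub>R \<xi>)"
        unfolding h1_def using \<kappa> s by (intro sum.cong refl) simp
      then have "cmod (fourier_integral (gauss_comb \<mu> S c) \<xi>) powr q =
         (\<mu> powr (- d / 2)) powr q * (bump (1 / \<mu>) 0 \<xi>) powr q * cmod (h1 ((- (1 / (\<kappa> * s))) *\<^sub>R \<xi>)) powr q"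
        unfolding fourier_gauss_comb [OF \<mu>] by (simp add: norm_mult powr_mult d_def bump_def)
      moreover have "(bump (1 / \<mu>) 0 \<xi>) powr q = exp (- (norm ((- (1 / (\<kappa> * s))) *\<^sub>R \<xi>))\<^sup>2 / 2)"
        unfolding bump_def exp_powr_real using e by (simp add: mult.commute)
      ultimately show ?thesis by (simp only: powr_powr) (simp add: mult_ac)
    qed
    then have "(\<integral>\<xi>. cmod (fourier_integral (gauss_comb \<mu> S c) \<xi>) powr q \<partial>lborel) =
       \<mu> powr (- (d * q) / 2) * (\<integral>\<xi>. ?g ((- (1 / (\<kappa> * s))) *\<^sub>R \<xi>) \<partial>lborel)"
      by simp
    also have "(\<integral>\<xi>. ?g ((- (1 / (\<kappa> * s))) *\<^sub>R \<xi>) \<partial>lborel) = \<bar>- (1 / (\<kappa> * s))\<bar> powr (- d) *\<^sub>R (\<integral>x. ?g x \<partial>lborel)"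
      unfolding d_def by (rule lborel_integral_scale) (use \<kappa> s in auto)
    also have "(\<integral>x. ?g x \<partial>lborel) = (2 * pi) powr (d / 2) * (\<integral>\<xi>. cmod (h1 \<xi>) powr q \<partial>gauss)"
      unfolding exp_neg_half_eq d_def by (subst integral_gauss) (auto simp: mult.assoc)
    finally show ?thesis using \<kappa> s by (simp add: mult.assoc)
  qed
  define X where "X = (\<integral>\<xi>. cmod (f \<xi>) powr p \<partial>gauss)"
  have X: "0 \<le> X" unfolding X_def by (intro integral_nonneg_AE) simp
  define A where "A = (p * \<mu>) powr (- d / 2) * (2 * pi) powr (d / 2)"
  define B where "B = \<mu> powr (- (d * q) / 2) * ((1 / (\<kappa> * s)) powr (- d) * (2 * pi) powr (d / 2))"
  \<comment> \<open>\<open>A\<close> and \<open>B\<close> collect Jacobians and normalisations of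
    the two sides. Compared through logarithms, the terms with \<mu> cancel and the sharp constant
    remains.\<close>
  have BA: "B = beckner p DIM('a) * A powr (1 / (p - 1))"
  proof -
    have ks: "(1 / (\<kappa> * s)) powr (- d) = ((p - 1) * (\<mu> / p)) powr (d / 2)"
    proof -
      have "((p - 1) * (\<mu> / p)) powr (d / 2) = ((\<kappa> * s) powr 2) powr (d / 2)"
        using \<kappa> s by (simp add: powr_numeral power_mult_distrib)
      also have "\<dots> = (\<kappa> * s) powr d" by (simp only: powr_powr) simp
      finally show ?thesis using \<kappa> s by (simp add: powr_divide powr_minus_divide)
    qed
    have q1: "q = 1 + 1 / (p - 1)" using p by (simp add: q_def field_simps)
    define lm lp lk where "lm = ln \<mu>" and "lp = ln p" and "lk = ln (p - 1)"
    define l2 where "l2 = ln 2 + ln pi"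
    have l2: "ln (2 * pi) = l2" by (simp add: l2_def ln_mult)
    have e1: "ln ((p - 1) * (\<mu> / p)) = lk + lm - lp"
      unfolding lm_def lp_def lk_def using p \<mu> by (subst ln_mult) (simp_all add: ln_div)
    have e2: "ln (2 * pi * (p - 1) / p) = l2 + lk - lp"
      unfolding l2 [symmetric] lp_def lk_def using p by (simp only: ln_div ln_mult) (simp add: ln_div ln_mult)
    have e3: "ln (p / (2 * pi)) = lp - l2"
      unfolding l2 [symmetric] lp_def using p by (simp add: ln_div)
    have e4: "ln (p * \<mu>) = lp + lm"
      unfolding lm_def lp_def using p \<mu> by (simp add: ln_mult)
    have lB: "ln B = - (d * q) / 2 * lm + (d / 2 * (lk + lm - lp) + d / 2 * l2)"
      unfolding B_def ks e1 [symmetric] l2 [symmetric] using p \<mu>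
      by (subst ln_mult, simp, simp, subst ln_mult) (simp_all add: ln_powr lm_def)
    have lb: "ln (beckner p DIM('a)) = d / 2 * ((l2 + lk - lp) + 1 / (p - 1) * (lp - l2))"
      unfolding beckner_def d_def [symmetric] e2 [symmetric] e3 [symmetric] using p
      by (simp only: ln_powr, subst ln_mult) (simp_all add: ln_powr)
    have lA: "ln (A powr (1 / (p - 1))) = 1 / (p - 1) * (- d / 2 * (lp + lm) + d / 2 * l2)"
      unfolding A_def l2 [symmetric] e4 [symmetric] using p \<mu> by (simp only: ln_powr, subst ln_mult) (simp_all add: ln_powr)
    have "ln (beckner p DIM('a) * A powr (1 / (p - 1))) = ln (beckner p DIM('a)) + ln (A powr (1 / (p - 1)))"
      using p \<mu> by (intro ln_mult_pos) (auto simp: beckner_def A_def)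
    also have "\<dots> = ln B"
    proof -
      have "d / 2 * ((l2 + lk - lp) + w * (lp - l2)) + w * (- d / 2 * (lp + lm) + d / 2 * l2) =
         - (d * (1 + w)) / 2 * lm + (d / 2 * (lk + lm - lp) + d / 2 * l2)" for w
        by (simp add: field_simps)
      then show ?thesis unfolding lB lb lA q1 .
    qed
    finally have "ln B = ln (beckner p DIM('a) * A powr (1 / (p - 1)))" ..
    then show ?thesis
      using p \<mu> \<kappa> s by (subst (asm) ln_inj_iff) (auto simp: B_def beckner_def A_def)
  qed
  have "0 \<le> B" by (simp add: B_def)
  then have BX: "B * (\<integral>\<eta>. cmod (h1 \<eta>) powr q \<partial>gauss) \<le> B * X powr (1 / (p - 1))"
    using hyper unfolding X_def by (intro mult_left_mono) auto
  have AX: "A powr (1 / (p - 1)) * X powr (1 / (p - 1)) = (A * X) powr (1 / (p - 1))"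
    using X by (simp add: powr_mult A_def)
  have J1: "(\<integral>u. cmod (gauss_comb \<mu> S c u) powr p \<partial>lborel) = A * X"
    unfolding I1 A_def X_def ..
  have J2: "(\<integral>\<xi>. cmod (fourier_integral (gauss_comb \<mu> S c) \<xi>) powr q \<partial>lborel) = B * (\<integral>\<eta>. cmod (h1 \<eta>) powr q \<partial>gauss)"
    unfolding I2 B_def by (simp only: mult.assoc)
  have "B * X powr (1 / (p - 1)) = beckner p DIM('a) * (A * X) powr (1 / (p - 1))"
    unfolding BA AX [symmetric] by (simp only: mult.assoc)
  then show ?thesis
    using BX unfolding q_def [symmetric] J1 J2 by simp
qed

section \<open>Density of Gaussian combinations\<close>

lemma powr_add_le:
  fixes x y :: real
  assumes "0 \<le> x" "0 \<le> y" "0 \<le> p"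
  shows "(x + y) powr p \<le> 2 powr p * (x powr p + y powr p)"
proof -
  have "(x + y) powr p \<le> (2 * max x y) powr p"
    using assms by (intro powr_mono2) auto
  also have "\<dots> = 2 powr p * (max x y) powr p"
    using assms by (subst powr_mult) auto
  also have "\<dots> \<le> 2 powr p * (x powr p + y powr p)"
    by (intro mult_left_mono) (auto simp: max_def)
  finally show ?thesis .
qed

text \<open>A crude constant in place of Minkowski's inequality. It serves all nonnegative exponents
  and suffices where only convergence to 0 matters; where constants must survive,
  \<open>normp_perturb\<close> is used.\<close>

lemma normp_triangle:
  assumes [measurable]: "f \<in> borel_measurable lebesgue" "g \<in> borel_measurable lebesgue" "h \<in> borel_measurable lebesgue" and "0 \<le> p"
  shows "normp p (\<lambda>u. f u - h u) \<le> ennreal (2 powr p) * (normp p (\<lambda>u. f u - g u) + normp p (\<lambda>u. g u - h u))"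
proof -
  have "cmod (f u - h u) powr p \<le> 2 powr p * (cmod (f u - g u) powr p + cmod (g u - h u) powr p)" for u
  proof -
    have "cmod (f u - h u) \<le> cmod (f u - g u) + cmod (g u - h u)"
      using norm_triangle_ineq [of "f u - g u" "g u - h u"] by simp
    then have "cmod (f u - h u) powr p \<le> (cmod (f u - g u) + cmod (g u - h u)) powr p"
      using \<open>0 \<le> p\<close> by (intro powr_mono2) auto
    also have "\<dots> \<le> 2 powr p * (cmod (f u - g u) powr p + cmod (g u - h u) powr p)"
      using \<open>0 \<le> p\<close> by (intro powr_add_le) auto
    finally show ?thesis .
  qed
  then have "normp p (\<lambda>u. f u - h u) \<le> (\<integral>\<^sup>+u. ennreal (2 powr p) * (ennreal (cmod (f u - g u) powr p) + ennreal (cmod (g u - h u) powr p)) \<partial>lebesgue)"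
    unfolding normp_def by (intro nn_integral_mono) (auto simp: ennreal_mult[symmetric] ennreal_plus[symmetric] simp del: ennreal_plus)
  also have "\<dots> = ennreal (2 powr p) * (normp p (\<lambda>u. f u - g u) + normp p (\<lambda>u. g u - h u))"
    unfolding normp_def by (subst nn_integral_cmult, simp, subst nn_integral_add) auto
  finally show ?thesis .
qed

lemma normp_dominated_convergence:
  fixes f :: "nat \<Rightarrow> 'a::euclidean_space \<Rightarrow> complex" and G :: "'a \<Rightarrow> real"
  assumes [measurable]: "\<And>n. f n \<in> borel_measurable lebesgue" "g \<in> borel_measurable lebesgue" "G \<in> borel_measurable lebesgue"
    and "0 < p"
    and lim: "AE u in lebesgue. (\<lambda>n. f n u) \<longlonglongrightarrow> g u"
    and bound: "\<And>n u. cmod (f n u) \<le> G u" "\<And>u. cmod (g u) \<le> G u"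
    and G: "(\<integral>\<^sup>+u. ennreal (G u powr p) \<partial>lebesgue) < \<infinity>"
  shows "(\<lambda>n. normp p (\<lambda>u. f n u - g u)) \<longlonglongrightarrow> 0"
proof -
  have "(\<lambda>n. \<integral>\<^sup>+ u. ennreal (cmod (f n u - g u) powr p) \<partial>lebesgue) \<longlonglongrightarrow> (\<integral>\<^sup>+ u. 0 \<partial>(lebesgue :: 'a measure))"
  proof (rule nn_integral_dominated_convergence [where w = "\<lambda>u. ennreal (2 powr p) * ennreal (G u powr p)"])
    show "AE u in lebesgue. ennreal (cmod (f n u - g u) powr p) \<le> ennreal (2 powr p) * ennreal (G u powr p)" for n
    proof (rule AE_I2)
      fix u
      have G0: "0 \<le> G u" using bound(2)[of u] norm_ge_zero order_trans by blast
      have "cmod (f n u - g u) \<le> 2 * G u"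
        using norm_triangle_ineq4 [of "f n u" "g u"] bound(1)[of n u] bound(2)[of u] by linarith
      then have "cmod (f n u - g u) powr p \<le> (2 * G u) powr p"
        using \<open>0 < p\<close> by (intro powr_mono2) auto
      then show "ennreal (cmod (f n u - g u) powr p) \<le> ennreal (2 powr p) * ennreal (G u powr p)"
        using G0 by (simp add: powr_mult ennreal_mult[symmetric])
    qed
    show "(\<integral>\<^sup>+u. ennreal (2 powr p) * ennreal (G u powr p) \<partial>lebesgue) < \<infinity>"
      using G by (subst nn_integral_cmult) (auto simp: ennreal_mult_less_top)
    show "AE u in lebesgue. (\<lambda>n. ennreal (cmod (f n u - g u) powr p)) \<longlonglongrightarrow> 0"
      using lim
    proof eventually_elim
      case (elim u)
      have "(\<lambda>n. cmod (f n u - g u)) \<longlonglongrightarrow> 0"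
        using tendsto_norm [OF tendsto_diff [OF elim tendsto_const [of "g u"]]] by simp
      then have "(\<lambda>n. cmod (f n u - g u) powr p) \<longlonglongrightarrow> 0 powr p"
        using \<open>0 < p\<close> by (intro tendsto_powr' tendsto_const) auto
      then show ?case using tendsto_ennrealI by fastforce
    qed
  qed auto
  then show ?thesis by (simp add: normp_def)
qed

text \<open>One function has to be close in both norms: Hausdorff-Young is an inequality in the
  first, while the transform follows limits in the second only.\<close>

definition approximable :: "real \<Rightarrow> ('a::euclidean_space \<Rightarrow> complex) \<Rightarrow> bool" where
  "approximable p f \<longleftrightarrow> (\<forall>e>0. \<exists>h\<in>gauss_combs. normp p (\<lambda>u. h u - f u) < ennreal e \<and> normp 2 (\<lambda>u. h u - f u) < ennreal e)"

lemma nice_measurable_lebesgue: "nice h \<Longrightarrow> h \<in> borel_measurable lebesgue"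
  by (auto simp: nice_def intro: measurable_completion)

lemma approximable_limit:
  fixes f :: "'a::euclidean_space \<Rightarrow> complex"
  assumes p: "0 < p"
    and m: "\<And>n. F n \<in> borel_measurable lebesgue" "f \<in> borel_measurable lebesgue"
    and a: "\<And>n. approximable p (F n)"
    and lim: "(\<lambda>n. normp p (\<lambda>u. F n u - f u)) \<longlonglongrightarrow> 0" "(\<lambda>n. normp 2 (\<lambda>u. F n u - f u)) \<longlonglongrightarrow> 0"
  shows "approximable p f"
  unfolding approximable_def
proof (intro allI impI)
  fix e :: real assume e: "0 < e"
  define C where "C = 2 powr p + 2 powr 2"
  have C: "0 < C" "2 powr p \<le> C" "2 powr 2 \<le> C" by (auto simp: C_def add_pos_pos)
  \<comment> \<open>\<open>C\<close> bounds the constant of \<open>normp_triangle\<close> for both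
    exponents, and C (\<delta> + \<delta>) = e / 2.\<close>
  define \<delta> where "\<delta> = e / (4 * C)"
  have \<delta>: "0 < \<delta>" using e C by (simp add: \<delta>_def)
  have "\<forall>\<^sub>F n in sequentially. normp p (\<lambda>u. F n u - f u) < ennreal \<delta> \<and> normp 2 (\<lambda>u. F n u - f u) < ennreal \<delta>"
    using \<delta> lim by (intro eventually_conj order_tendstoD(2)) auto
  then obtain n where n: "normp p (\<lambda>u. F n u - f u) < ennreal \<delta>" "normp 2 (\<lambda>u. F n u - f u) < ennreal \<delta>"
    by (auto simp: eventually_sequentially)
  obtain h where h: "h \<in> gauss_combs" "normp p (\<lambda>u. h u - F n u) < ennreal \<delta>" "normp 2 (\<lambda>u. h u - F n u) < ennreal \<delta>"
    using a [of n] \<delta> unfolding approximable_def by blast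
  have hm: "h \<in> borel_measurable lebesgue" by (rule nice_measurable_lebesgue [OF nice_gauss_combs [OF h(1)]])
  have key: "normp s (\<lambda>u. h u - f u) < ennreal e"
    if "0 \<le> s" "2 powr s \<le> C" "normp s (\<lambda>u. h u - F n u) < ennreal \<delta>" "normp s (\<lambda>u. F n u - f u) < ennreal \<delta>" for s
  proof -
    have "normp s (\<lambda>u. h u - f u) \<le> ennreal (2 powr s) * (normp s (\<lambda>u. h u - F n u) + normp s (\<lambda>u. F n u - f u))"
      by (rule normp_triangle [OF hm m that(1)])
    also have "\<dots> \<le> ennreal C * (ennreal \<delta> + ennreal \<delta>)"
      using that by (intro mult_mono add_mono ennreal_leI) auto
    also have "\<dots> = ennreal (e / 2)"
      using \<delta> C by (simp add: ennreal_plus[symmetric] ennreal_mult[symmetric] del: ennreal_plus) (simp add: \<delta>_def)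
    also have "\<dots> < ennreal e" using e by (simp add: ennreal_less_iff)
    finally show ?thesis .
  qed
  show "\<exists>h\<in>gauss_combs. normp p (\<lambda>u. h u - f u) < ennreal e \<and> normp 2 (\<lambda>u. h u - f u) < ennreal e"
    using h n C p by (intro bexI [of _ h] conjI key) auto
qed

lemma nn_integral_exp_sq_powr:
  assumes "0 < c" "0 < p" "0 \<le> A"
  shows "(\<integral>\<^sup>+u. ennreal ((A * exp (- c * (norm (u :: 'a::euclidean_space))\<^sup>2)) powr p) \<partial>lebesgue) < \<infinity>"
proof -
  have "(\<integral>\<^sup>+u. ennreal ((A * exp (- c * (norm (u :: 'a))\<^sup>2)) powr p) \<partial>lebesgue) =
     (\<integral>\<^sup>+u. ennreal (A powr p) * ennreal (exp (- (p * c) * (norm (u :: 'a))\<^sup>2)) \<partial>lborel)"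
    using assms
    by (subst nn_integral_completion) (auto intro!: nn_integral_cong simp: powr_mult exp_powr_real ennreal_mult[symmetric] mult_ac)
  also have "\<dots> = ennreal (A powr p) * (\<integral>\<^sup>+u. ennreal (exp (- (p * c) * (norm (u :: 'a))\<^sup>2)) \<partial>lborel)"
    by (rule nn_integral_cmult) simp
  also have "\<dots> < \<infinity>"
    using nn_integral_gaussian [of "p * c", where 'a = 'a] assms by (simp add: ennreal_mult_less_top)
  finally show ?thesis .
qed

text \<open>Convolution with a normalised Gaussian of variance 1/\<mu>. The bump is centred at the
  integration variable, so the integral reads as a continuous combination of bumps in
  \<open>x\<close>.\<close>

definition mollify :: "real \<Rightarrow> ('a::euclidean_space \<Rightarrow> complex) \<Rightarrow> 'a \<Rightarrow> complex" where
  "mollify \<mu> g x = of_real ((\<mu> / (2 * pi)) powr (real DIM('a) / 2)) * (\<integral>u. g u * of_real (bump \<mu> u x) \<partial>lborel)"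

lemma bump_measurable_center: "(\<lambda>u. bump \<mu> (s u) x) \<in> borel_measurable M" if "s \<in> borel_measurable M"
  unfolding bump_def using that by measurable

text \<open>Riemann sums: replacing the centre u by the simple function \<open>s n u\<close> leaves
  finitely many centres and one width. The sums converge pointwise, under a common Gaussian
  majorant, because |s n u| \<le> 2 |u| keeps the relevant centres in a fixed ball.\<close>

lemma approximable_mollify:
  fixes g :: "'a::euclidean_space \<Rightarrow> complex"
  assumes [measurable]: "g \<in> borel_measurable borel"
    and supp: "\<And>u. B < norm u \<Longrightarrow> g u = 0" and M: "\<And>u. cmod (g u) \<le> M"
    and \<mu>: "0 < \<mu>" and p: "0 < p" and B: "0 \<le> B"
  shows "mollify \<mu> g \<in> borel_measurable lebesgue" "approximable p (mollify \<mu> g)"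
proof -
  define C where "C = (\<mu> / (2 * pi)) powr (real DIM('a) / 2)"
  obtain s where s: "\<And>i. simple_function (borel :: 'a measure) (s i)"
      "\<And>x. (\<lambda>i. s i x) \<longlonglongrightarrow> x" "\<And>i x. dist (s i x) 0 \<le> 2 * dist x 0"
    using borel_measurable_implies_sequence_metric [of "\<lambda>x :: 'a. x" borel 0] by auto
  have [measurable]: "s n \<in> borel_measurable borel" for n by (rule borel_measurable_simple_function [OF s(1)])
  have fin: "finite (range (s n))" for n using s(1)[of n] by (simp add: simple_function_def)
  have ig: "integrable lborel g"
  proof (rule Bochner_Integration.integrable_bound)
    show "integrable lborel (\<lambda>u::'a. M * indicator (cball 0 B) u)"
      using emeasure_lborel_cball_finite [of 0 B] by (intro integrable_mult_right integrable_real_indicator) auto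
    show "AE u in lborel. norm (g u) \<le> norm (M * indicator (cball 0 B) u)"
      using M supp by (intro AE_I2) (auto simp: indicator_def not_le intro: order_trans [OF _ abs_ge_self])
  qed simp
  have bump_le: "bump \<mu> a x \<le> 1" for a x :: 'a using \<mu> by (simp add: bump_def)
  have bump0: "0 \<le> bump \<mu> a x" for a x :: 'a by (simp add: bump_def)
  have gb: "cmod (g u * complex_of_real (bump \<mu> a x)) \<le> cmod (g u)" for u and a x :: 'a
  proof -
    have "\<bar>bump \<mu> a x\<bar> \<le> 1" using bump0 [of a x] bump_le [of a x] by linarith
    then show ?thesis
      using mult_left_mono [of "\<bar>bump \<mu> a x\<bar>" 1 "cmod (g u)"] by (simp add: norm_mult)
  qed
  define h where "h n x = complex_of_real C * (\<integral>u. g u * of_real (bump \<mu> (s n u) x) \<partial>lborel)" for n x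
  have int: "integrable lborel (\<lambda>u. g u * of_real (bump \<mu> (t u) x))" if [measurable]: "t \<in> borel_measurable borel" for t :: "'a \<Rightarrow> 'a" and x
  proof (rule Bochner_Integration.integrable_bound [OF ig])
    show "AE u in lborel. norm (g u * complex_of_real (bump \<mu> (t u) x)) \<le> norm (g u)"
      by (intro AE_I2 gb)
  qed (use bump_measurable_center [of t borel] that in auto)
  have comb: "h n = gauss_comb \<mu> (range (s n)) (\<lambda>a. of_real C * (\<integral>u. g u * indicator (s n -` {a}) u \<partial>lborel))" for n
  proof
    fix x
    have vim [measurable]: "s n -` {a} \<in> sets borel" for a
      using measurable_sets [of "s n" borel borel "{a}"] by simp
    have "(\<integral>u. g u * of_real (bump \<mu> (s n u) x) \<partial>lborel) = (\<integral>u. (\<Sum>a\<in>range (s n). g u * indicator (s n -` {a}) u * of_real (bump \<mu> a x)) \<partial>lborel)"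
    proof (rule Bochner_Integration.integral_cong [OF refl])
      fix u
      have "(\<Sum>a\<in>range (s n). g u * indicator (s n -` {a}) u * complex_of_real (bump \<mu> a x)) =
         (\<Sum>a\<in>{s n u}. g u * indicator (s n -` {a}) u * complex_of_real (bump \<mu> a x))"
        by (rule sum.mono_neutral_right) (use fin in \<open>auto simp: indicator_def\<close>)
      then show "g u * complex_of_real (bump \<mu> (s n u) x) = (\<Sum>a\<in>range (s n). g u * indicator (s n -` {a}) u * of_real (bump \<mu> a x))"
        by simp
    qed
    also have "\<dots> = (\<Sum>a\<in>range (s n). (\<integral>u. g u * indicator (s n -` {a}) u \<partial>lborel) * of_real (bump \<mu> a x))"
    proof -
      have "integrable lborel (\<lambda>u. g u * indicator (s n -` {a}) u)" for a
        by (rule Bochner_Integration.integrable_bound [OF ig]) (auto simp: indicator_def)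
      then show ?thesis by (subst Bochner_Integration.integral_sum) auto
    qed
    finally show "h n x = gauss_comb \<mu> (range (s n)) (\<lambda>a. of_real C * (\<integral>u. g u * indicator (s n -` {a}) u \<partial>lborel)) x"
      by (simp add: h_def gauss_comb_def sum_distrib_left mult.assoc)
  qed
  have hc: "h n \<in> gauss_combs" for n
    unfolding comb gauss_combs_def using \<mu> fin [of n] by blast
  have hm: "h n \<in> borel_measurable lebesgue" for n
    by (rule nice_measurable_lebesgue [OF nice_gauss_combs [OF hc]])
  have lim: "(\<lambda>n. h n x) \<longlonglongrightarrow> mollify \<mu> g x" for x
    unfolding h_def mollify_def C_def [symmetric]
  proof (intro tendsto_mult_left integral_dominated_convergence [where w = "\<lambda>u. cmod (g u)"])
    show "AE u in lborel. (\<lambda>n. g u * complex_of_real (bump \<mu> (s n u) x)) \<longlonglongrightarrow> g u * complex_of_real (bump \<mu> u x)"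
      unfolding bump_def by (intro AE_I2 tendsto_intros s(2)) auto
    show "AE u in lborel. norm (g u * complex_of_real (bump \<mu> (s n u) x)) \<le> cmod (g u)" for n
      by (intro AE_I2 gb)
  qed (use int [of "\<lambda>u. u"] int [of "s _"] ig in \<open>auto intro: borel_measurable_integrable\<close>)
  show mm: "mollify \<mu> g \<in> borel_measurable lebesgue"
    by (rule borel_measurable_LIMSEQ_metric [OF hm lim])
  \<comment> \<open>For a centre y with |y| \<le> 2 B, the inequality |x|^2 \<le> 2 |x - y|^2 + 2
    |y|^2 times \<mu> / 4 bounds the bump by exp(2 \<mu> B^2) exp(- \<mu> |x|^2 / 4).\<close>
  define A where "A = C * ((\<integral>u. cmod (g u) \<partial>lborel) * exp (2 * \<mu> * B\<^sup>2))"
  have A: "0 \<le> A" by (auto simp: A_def C_def intro!: mult_nonneg_nonneg integral_nonneg_AE)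
  have bnd: "cmod (h n x) \<le> A * exp (- (\<mu> / 4) * (norm x)\<^sup>2)" for n x
  proof -
    have pt: "cmod (g u * complex_of_real (bump \<mu> (s n u) x)) \<le> cmod (g u) * (exp (2 * \<mu> * B\<^sup>2) * exp (- (\<mu> / 4) * (norm x)\<^sup>2))" for u
    proof (cases "norm u \<le> B")
      case True
      have sn: "norm (s n u) \<le> 2 * B" using s(3)[of n u] True by simp
      have "(norm x)\<^sup>2 \<le> (norm (x - s n u) + norm (s n u))\<^sup>2"
        by (intro power_mono) (use norm_triangle_ineq [of "x - s n u" "s n u"] in auto)
      also have "\<dots> \<le> 2 * (norm (x - s n u))\<^sup>2 + 2 * (norm (s n u))\<^sup>2"
        using zero_le_power2 [of "norm (x - s n u) - norm (s n u)"] by (simp add: power2_eq_square algebra_simps)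
      also have "(norm (s n u))\<^sup>2 \<le> (2 * B)\<^sup>2"
        using sn by (intro power_mono) auto
      finally have "(norm x)\<^sup>2 / 4 - 2 * B\<^sup>2 \<le> (norm (x - s n u))\<^sup>2 / 2"
        by (simp add: power_mult_distrib)
      then have "\<mu> * ((norm x)\<^sup>2 / 4 - 2 * B\<^sup>2) \<le> \<mu> * ((norm (x - s n u))\<^sup>2 / 2)"
        using \<mu> by (intro mult_left_mono) auto
      then have "bump \<mu> (s n u) x \<le> exp (2 * \<mu> * B\<^sup>2) * exp (- (\<mu> / 4) * (norm x)\<^sup>2)"
        unfolding bump_def exp_add [symmetric] by (simp add: algebra_simps)
      then show ?thesis unfolding norm_mult using bump0 by (intro mult_left_mono) auto
    qed (use supp in auto)
    have "cmod (\<integral>u. g u * complex_of_real (bump \<mu> (s n u) x) \<partial>lborel) \<le> (\<integral>u. cmod (g u * complex_of_real (bump \<mu> (s n u) x)) \<partial>lborel)"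
      by (rule integral_norm_bound)
    also have "\<dots> \<le> (\<integral>u. cmod (g u) * (exp (2 * \<mu> * B\<^sup>2) * exp (- (\<mu> / 4) * (norm x)\<^sup>2)) \<partial>lborel)"
      using int [of "s n" x] ig pt by (intro integral_mono integrable_norm integrable_mult_left) auto
    also have "\<dots> = (\<integral>u. cmod (g u) \<partial>lborel) * (exp (2 * \<mu> * B\<^sup>2) * exp (- (\<mu> / 4) * (norm x)\<^sup>2))"
      by (rule integral_mult_left_zero)
    finally have "C * cmod (\<integral>u. g u * complex_of_real (bump \<mu> (s n u) x) \<partial>lborel) \<le>
       C * ((\<integral>u. cmod (g u) \<partial>lborel) * (exp (2 * \<mu> * B\<^sup>2) * exp (- (\<mu> / 4) * (norm x)\<^sup>2)))"
      by (rule mult_left_mono) (simp add: C_def)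
    then show ?thesis unfolding h_def A_def norm_mult by (simp add: C_def mult.assoc)
  qed
  have bnd': "cmod (mollify \<mu> g x) \<le> A * exp (- (\<mu> / 4) * (norm x)\<^sup>2)" for x
    using Lim_norm_ubound [OF _ lim [of x]] bnd [of _ x] by (auto intro: always_eventually)
  have conv: "(\<lambda>n. normp r (\<lambda>u. h n u - mollify \<mu> g u)) \<longlonglongrightarrow> 0" if "0 < r" for r
    by (rule normp_dominated_convergence [OF hm mm _ that AE_I2 [OF lim] bnd bnd' nn_integral_exp_sq_powr])
       (use \<mu> that A in \<open>auto intro!: measurable_completion\<close>)
  show "approximable p (mollify \<mu> g)"
    unfolding approximable_def
  proof (intro allI impI)
    fix e :: real assume "0 < e"
    then have "\<forall>\<^sub>F n in sequentially. normp p (\<lambda>u. h n u - mollify \<mu> g u) < ennreal e \<and> normp 2 (\<lambda>u. h n u - mollify \<mu> g u) < ennreal e"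
      using conv [of p] conv [of 2] p by (intro eventually_conj order_tendstoD(2)) auto
    then show "\<exists>h\<in>gauss_combs. normp p (\<lambda>u. h u - mollify \<mu> g u) < ennreal e \<and> normp 2 (\<lambda>u. h u - mollify \<mu> g u) < ennreal e"
      using hc by (auto simp: eventually_sequentially)
  qed
qed

text \<open>In this form the mollification averages over displacements of order 1/sqrt \<mu>, from
  which its limit for continuous functions can be read off.\<close>

lemma mollify_gauss:
  fixes g :: "'a::euclidean_space \<Rightarrow> complex"
  assumes [measurable]: "g \<in> borel_measurable borel" and \<mu>: "0 < \<mu>"
  shows "mollify \<mu> g x = (\<integral>v. g (x + (1 / sqrt \<mu>) *\<^sub>R v) \<partial>gauss)"
proof -
  let ?d = "real DIM('a)"
  let ?f = "\<lambda>v. g (x + (1 / sqrt \<mu>) *\<^sub>R v) * of_real (exp (- (norm v)\<^sup>2 / 2))"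
  have "(\<integral>u. g u * of_real (bump \<mu> u x) \<partial>lborel) = (\<integral>u. g u * of_real (bump \<mu> x u) \<partial>(distr lborel borel ((+) x)))"
    by (simp add: lborel_distr_plus bump_def norm_minus_commute)
  also have "\<dots> = (\<integral>u. ?f (sqrt \<mu> *\<^sub>R u) \<partial>lborel)"
    using \<mu> by (subst integral_distr) (auto simp: bump_def power_mult_distrib intro!: Bochner_Integration.integral_cong)
  also have "\<dots> = (\<bar>sqrt \<mu>\<bar> powr (- ?d)) *\<^sub>R (\<integral>u. ?f u \<partial>lborel)"
    by (rule lborel_integral_scale) (use \<mu> in auto)
  also have "(\<integral>u. ?f u \<partial>lborel) = (\<integral>u. (2 * pi) powr (?d / 2) *\<^sub>R (gauss_density u *\<^sub>R g (x + (1 / sqrt \<mu>) *\<^sub>R u)) \<partial>lborel)"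
    unfolding exp_neg_half_eq by (simp add: scaleR_conv_of_real mult_ac)
  also have "\<dots> = (2 * pi) powr (?d / 2) *\<^sub>R (\<integral>v. g (x + (1 / sqrt \<mu>) *\<^sub>R v) \<partial>gauss)"
    unfolding integral_scaleR_right by (subst integral_gauss) auto
  finally have *: "(\<integral>u. g u * of_real (bump \<mu> u x) \<partial>lborel) =
     of_real (\<bar>sqrt \<mu>\<bar> powr (- ?d) * (2 * pi) powr (?d / 2)) * (\<integral>v. g (x + (1 / sqrt \<mu>) *\<^sub>R v) \<partial>gauss)"
    by (simp add: scaleR_conv_of_real)
  have "(\<mu> / (2 * pi)) powr (?d / 2) * (\<bar>sqrt \<mu>\<bar> powr (- ?d) * (2 * pi) powr (?d / 2)) = 1"
    using \<mu> by (simp add: powr_half_sqrt [symmetric] powr_powr powr_divide powr_minus_divide)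
  then show ?thesis
    unfolding mollify_def * by (simp only: mult.assoc [symmetric] of_real_mult [symmetric]) simp
qed

text \<open>Mollifications converge pointwise as \<mu> grows. Convergence in the norms requires a
  majorant that is independent of \<mu> \<ge> 1: decay at the displaced point is traded against
  growth in the displacement v, which the Gaussian measure absorbs.\<close>

lemma approximable_continuous:
  fixes g :: "'a::euclidean_space \<Rightarrow> complex"
  assumes cont: "continuous_on UNIV g"
    and supp: "\<And>u. B < norm u \<Longrightarrow> g u = 0" and M: "\<And>u. cmod (g u) \<le> M" and p: "0 < p"
  shows "approximable p g"
proof -
  have gm [measurable]: "g \<in> borel_measurable borel" by (rule borel_measurable_continuous_onI [OF cont])
  define B' where "B' = max B 0"
  have B': "0 \<le> B'" "\<And>u. B' < norm u \<Longrightarrow> g u = 0" using supp by (auto simp: B'_def)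
  have M0: "0 \<le> M" using M[of 0] norm_ge_zero order_trans by blast
  define \<mu> where "\<mu> n = real (Suc n)" for n
  have \<mu>: "0 < \<mu> n" "1 \<le> \<mu> n" for n by (auto simp: \<mu>_def)
  have r: "mollify (\<mu> n) g \<in> borel_measurable lebesgue" "approximable p (mollify (\<mu> n) g)" for n
    using approximable_mollify [OF gm B'(2) M \<mu>(1) p B'(1)] by auto
  have lim: "(\<lambda>n. mollify (\<mu> n) g x) \<longlonglongrightarrow> g x" for x
  proof -
    have "(\<lambda>n. \<integral>v. g (x + (1 / sqrt (\<mu> n)) *\<^sub>R v) \<partial>gauss) \<longlonglongrightarrow> (\<integral>v. g x \<partial>(gauss :: 'a measure))"
    proof (rule integral_dominated_convergence [where w = "\<lambda>_. M"])
      have "(\<lambda>n. 1 / sqrt (\<mu> n)) \<longlonglongrightarrow> 0"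
      proof -
        have "(\<lambda>n. sqrt (inverse (real (Suc n)))) \<longlonglongrightarrow> sqrt 0"
          by (intro tendsto_real_sqrt LIMSEQ_inverse_real_of_nat)
        then show ?thesis by (simp add: \<mu>_def real_sqrt_inverse inverse_eq_divide real_sqrt_divide)
      qed
      then have "(\<lambda>n. x + (1 / sqrt (\<mu> n)) *\<^sub>R v) \<longlonglongrightarrow> x + 0 *\<^sub>R v" for v
        by (intro tendsto_intros)
      then show "AE v in gauss. (\<lambda>n. g (x + (1 / sqrt (\<mu> n)) *\<^sub>R v)) \<longlonglongrightarrow> g x"
        using cont by (intro AE_I2) (auto simp: continuous_on_eq_continuous_at intro!: isCont_tendsto_compose [of _ g])
    qed (use M in auto)
    then show ?thesis by (simp add: mollify_gauss [OF gm \<mu>(1)])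
  qed
  define C where "C = (\<integral>v. M * exp (B'\<^sup>2 / 8) * exp ((1/8) * (norm v)\<^sup>2) \<partial>(gauss :: 'a measure))"
  have i8: "integrable (gauss :: 'a measure) (\<lambda>v. exp ((1/8) * (norm v)\<^sup>2))"
    by (rule integrable_gauss_exp_sq) simp
  have C0: "0 \<le> C" unfolding C_def using M0 by (intro integral_nonneg_AE) auto
  \<comment> \<open>A bounded function of bounded support lies below a multiple of exp(- |y|^2 / 8).
    Half of this rate is passed on to x, and the price exp(|v|^2 / 8) is integrable for the Gaussian
    measure.\<close>
  have gle: "cmod (g y) \<le> M * exp (B'\<^sup>2 / 8) * exp (- (norm y)\<^sup>2 / 8)" for y
  proof (cases "norm y \<le> B'")
    case True
    then have "(norm y)\<^sup>2 \<le> B'\<^sup>2" by (intro power_mono) auto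
    then have "1 \<le> exp (B'\<^sup>2 / 8) * exp (- (norm y)\<^sup>2 / 8)"
      unfolding exp_add [symmetric] by simp
    then have "M * 1 \<le> M * (exp (B'\<^sup>2 / 8) * exp (- (norm y)\<^sup>2 / 8))"
      using M0 by (intro mult_left_mono)
    then show ?thesis using M[of y] by (simp add: mult.assoc)
  qed (use B' M0 in auto)
  have bnd: "cmod (mollify (\<mu> n) g x) \<le> C * exp (- (1/16) * (norm x)\<^sup>2)" for n x
  proof -
    let ?w = "\<lambda>v. M * exp (B'\<^sup>2 / 8) * exp ((1/8) * (norm v)\<^sup>2) * exp (- (1/16) * (norm x)\<^sup>2)"
    have pt: "cmod (g (x + (1 / sqrt (\<mu> n)) *\<^sub>R v)) \<le> ?w v" for v :: 'a
    proof -
      define y where "y = x + (1 / sqrt (\<mu> n)) *\<^sub>R v"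
      have "norm ((1 / sqrt (\<mu> n)) *\<^sub>R v) \<le> 1 * norm v"
        unfolding norm_scaleR using \<mu>[of n] by (intro mult_right_mono) auto
      then have yx: "norm (x - y) \<le> norm v" by (simp add: y_def)
      have "(norm x)\<^sup>2 \<le> (norm y + norm (x - y))\<^sup>2"
        by (intro power_mono) (use norm_triangle_ineq [of y "x - y"] in auto)
      also have "\<dots> \<le> 2 * (norm y)\<^sup>2 + 2 * (norm (x - y))\<^sup>2"
        using zero_le_power2 [of "norm y - norm (x - y)"] by (simp add: power2_eq_square algebra_simps)
      also have "(norm (x - y))\<^sup>2 \<le> (norm v)\<^sup>2" using yx by (intro power_mono) auto
      finally have "- (norm y)\<^sup>2 / 8 \<le> (1/8) * (norm v)\<^sup>2 + - (1/16) * (norm x)\<^sup>2" by simp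
      then have "exp (- (norm y)\<^sup>2 / 8) \<le> exp ((1/8) * (norm v)\<^sup>2) * exp (- (1/16) * (norm x)\<^sup>2)"
        unfolding exp_add [symmetric] by simp
      then have "M * exp (B'\<^sup>2 / 8) * exp (- (norm y)\<^sup>2 / 8) \<le> M * exp (B'\<^sup>2 / 8) * (exp ((1/8) * (norm v)\<^sup>2) * exp (- (1/16) * (norm x)\<^sup>2))"
        using M0 by (intro mult_left_mono) auto
      then show ?thesis using gle [of y] unfolding y_def [symmetric] by (simp add: mult.assoc)
    qed
    have "cmod (\<integral>v. g (x + (1 / sqrt (\<mu> n)) *\<^sub>R v) \<partial>gauss) \<le> (\<integral>v. cmod (g (x + (1 / sqrt (\<mu> n)) *\<^sub>R v)) \<partial>gauss)"
      by (rule integral_norm_bound)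
    also have "\<dots> \<le> (\<integral>v. ?w v \<partial>(gauss :: 'a measure))"
    proof (rule integral_mono)
      show "integrable gauss (\<lambda>v. cmod (g (x + (1 / sqrt (\<mu> n)) *\<^sub>R v)))"
        by (rule integrable_gauss_bound [where C = M and K = 0]) (use M in auto)
      show "integrable (gauss :: 'a measure) ?w"
        using i8 by (intro integrable_mult_left integrable_mult_right)
    qed (rule pt)
    also have "\<dots> = C * exp (- (1/16) * (norm x)\<^sup>2)"
      unfolding C_def by (rule integral_mult_left_zero)
    finally show ?thesis by (simp add: mollify_gauss [OF gm \<mu>(1)])
  qed
  have bnd': "cmod (g x) \<le> C * exp (- (1/16) * (norm x)\<^sup>2)" for x
    using Lim_norm_ubound [OF _ lim [of x]] bnd [of _ x] by (auto intro: always_eventually)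
  have conv: "(\<lambda>n. normp r (\<lambda>u. mollify (\<mu> n) g u - g u)) \<longlonglongrightarrow> 0" if "0 < r" for r
    by (rule normp_dominated_convergence [OF r(1) _ _ that AE_I2 [OF lim] bnd bnd' nn_integral_exp_sq_powr])
       (use that C0 in \<open>auto intro!: measurable_completion\<close>)
  show ?thesis
    using p by (intro approximable_limit [OF p r(1) _ r(2) conv conv]) (auto intro!: measurable_completion)
qed

lemma nn_integral_indicator_ball_finite:
  "0 < p \<Longrightarrow> 0 \<le> A \<Longrightarrow> (\<integral>\<^sup>+u. ennreal ((A * indicator (cball (0::'a::euclidean_space) R) u) powr p) \<partial>lebesgue) < \<infinity>"
proof -
  assume p: "0 < p" "0 \<le> A"
  have "(\<integral>\<^sup>+u. ennreal ((A * indicator (cball (0::'a) R) u) powr p) \<partial>lebesgue) =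
     (\<integral>\<^sup>+u. ennreal (A powr p) * indicator (cball (0::'a) R) u \<partial>lborel)"
    using p by (subst nn_integral_completion) (auto intro!: nn_integral_cong simp: indicator_def)
  also have "\<dots> = ennreal (A powr p) * emeasure lborel (cball (0::'a) R)"
    by (rule nn_integral_cmult_indicator) simp
  also have "\<dots> < \<infinity>"
    using emeasure_lborel_cball_finite [of "0::'a" R] by (simp add: ennreal_mult_less_top)
  finally show ?thesis .
qed

text \<open>Measurability supplies continuous functions that converge almost everywhere, without
  control of size or support. The radial retraction \<open>clip\<close> and the cut-off
  \<open>cut\<close> restore both and leave the limit unchanged, since \<open>f\<close> satisfies
  the bounds already.\<close>

lemma approximable_bounded:
  fixes f :: "'a::euclidean_space \<Rightarrow> complex"
  assumes f: "f \<in> borel_measurable lebesgue"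
    and supp: "\<And>u. R < norm u \<Longrightarrow> f u = 0" and bd: "\<And>u. cmod (f u) \<le> R" and p: "0 < p" and R: "0 < R"
  shows "approximable p f"
proof -
  have "f measurable_on UNIV"
    by (rule lebesgue_measurable_imp_measurable_on [OF f]) simp
  then obtain N G where N: "negligible N" and G: "\<And>n. continuous_on UNIV (G n)"
    and lim: "\<And>x. x \<notin> N \<Longrightarrow> (\<lambda>n. G n x) \<longlonglongrightarrow> f x"
    unfolding measurable_on_def by auto
  define clip where "clip z = (R / max R (cmod z)) *\<^sub>R z" for z :: complex
  have clip_cont: "isCont clip z" for z unfolding clip_def using R by (intro continuous_intros) auto
  have clip_le: "cmod (clip z) \<le> R" for z
    using R by (auto simp: clip_def max_def field_simps)
  have clip_id: "clip z = z" if "cmod z \<le> R" for z using that R by (simp add: clip_def max_def)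
  define cut where "cut u = max 0 (min 1 (R + 1 - norm (u :: 'a)))" for u
  have cut: "0 \<le> cut u" "cut u \<le> 1" "norm u \<le> R \<Longrightarrow> cut u = 1" "R + 1 < norm u \<Longrightarrow> cut u = 0" for u
    by (auto simp: cut_def)
  define F where "F n u = cut u *\<^sub>R clip (G n u)" for n u
  have F_cont: "continuous_on UNIV (F n)" for n
  proof -
    have "continuous_on UNIV clip" using clip_cont by (simp add: continuous_at_imp_continuous_on)
    then have "continuous_on UNIV (\<lambda>u. clip (G n u))"
      by (rule continuous_on_compose2 [OF _ G]) auto
    moreover have "continuous_on UNIV cut" unfolding cut_def by (intro continuous_intros)
    ultimately show ?thesis unfolding F_def by (intro continuous_intros)
  qed
  have F_le: "cmod (F n u) \<le> R" for n u
    unfolding F_def norm_scaleR using mult_mono [of "\<bar>cut u\<bar>" 1 "cmod (clip (G n u))" R] cut[of u] clip_le R by auto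
  have F0: "F n u = 0" if "R + 1 < norm u" for n u using cut(4) [OF that] by (simp add: F_def)
  have Fm: "F n \<in> borel_measurable lebesgue" for n
    by (intro measurable_completion) (simp add: borel_measurable_continuous_onI [OF F_cont])
  have ind: "(\<lambda>u. R * indicator (cball 0 (R + 1)) u) \<in> borel_measurable (lebesgue :: 'a measure)"
    by (intro measurable_completion borel_measurable_times borel_measurable_const borel_measurable_indicator) simp
  have Flim: "AE u in lebesgue. (\<lambda>n. F n u) \<longlonglongrightarrow> f u"
  proof (rule AE_I')
    show "N \<in> null_sets lebesgue" using N by (simp add: negligible_iff_null_sets)
    show "{u \<in> space lebesgue. \<not> (\<lambda>n. F n u) \<longlonglongrightarrow> f u} \<subseteq> N"
    proof (rule subsetI, rule ccontr)
      fix u assume u: "u \<in> {u \<in> space lebesgue. \<not> (\<lambda>n. F n u) \<longlonglongrightarrow> f u}" "u \<notin> N"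
      have "(\<lambda>n. F n u) \<longlonglongrightarrow> cut u *\<^sub>R clip (f u)"
        unfolding F_def by (intro tendsto_intros isCont_tendsto_compose [OF clip_cont] lim u(2))
      also have "cut u *\<^sub>R clip (f u) = f u"
        using clip_id [OF bd [of u]] cut(3) [of u] supp [of u] by (cases "norm u \<le> R") auto
      finally show False using u by simp
    qed
  qed
  have conv: "(\<lambda>n. normp r (\<lambda>u. F n u - f u)) \<longlonglongrightarrow> 0" if r: "0 < r" for r
  proof (rule normp_dominated_convergence [OF Fm f ind r Flim])
    show "cmod (F n u) \<le> R * indicator (cball 0 (R + 1)) u" for n u
      using F_le [of n u] F0 [of u n] by (auto simp: indicator_def)
    show "cmod (f u) \<le> R * indicator (cball 0 (R + 1)) u" for u
      using bd [of u] supp [of u] R by (auto simp: indicator_def)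
    show "(\<integral>\<^sup>+u. ennreal ((R * indicator (cball (0::'a) (R + 1)) u) powr r) \<partial>lebesgue) < \<infinity>"
      by (rule nn_integral_indicator_ball_finite) (use r R in auto)
  qed
  show ?thesis
    using p approximable_continuous [OF F_cont F0 F_le p]
    by (intro approximable_limit [OF p Fm f _ conv conv]) auto
qed

theorem approximable_L2_Lp:
  fixes f :: "'a::euclidean_space \<Rightarrow> complex"
  assumes f [measurable]: "f \<in> borel_measurable lebesgue" and fin: "normp p f < \<infinity>" "normp 2 f < \<infinity>" and p: "0 < p"
  shows "approximable p f"
proof -
  \<comment> \<open>Argument and value are truncated at the same level, because
    \<open>approximable_bounded\<close> has one parameter for both.\<close>
  define A where "A n = {u. norm u \<le> real (Suc n) \<and> cmod (f u) \<le> real (Suc n)}" for n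
  define F where "F n u = (if u \<in> A n then f u else 0)" for n u
  have nm [measurable]: "(norm :: 'a \<Rightarrow> real) \<in> borel_measurable lebesgue"
    by (intro measurable_completion) simp
  have Am [measurable]: "A n \<in> sets lebesgue" for n
  proof -
    have "{u \<in> space lebesgue. norm u \<le> real (Suc n) \<and> cmod (f u) \<le> real (Suc n)} \<in> sets lebesgue"
      by measurable
    then show ?thesis by (simp add: A_def)
  qed
  have Fm: "F n \<in> borel_measurable lebesgue" for n
    unfolding F_def [abs_def] by measurable
  have lim: "(\<lambda>n. F n u) \<longlonglongrightarrow> f u" for u
  proof (rule tendsto_eventually)
    obtain N where N: "norm u \<le> real N" "cmod (f u) \<le> real N"
      using real_arch_simple [of "max (norm u) (cmod (f u))"] by auto
    then show "\<forall>\<^sub>F n in sequentially. F n u = f u"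
      by (intro eventually_sequentiallyI [of N]) (auto simp: F_def A_def)
  qed
  have cm: "(\<lambda>u. cmod (f u)) \<in> borel_measurable lebesgue" by measurable
  have conv: "(\<lambda>n. normp r (\<lambda>u. F n u - f u)) \<longlonglongrightarrow> 0" if r: "0 < r" "normp r f < \<infinity>" for r
    by (rule normp_dominated_convergence [OF Fm f cm r(1) AE_I2 [OF lim]])
       (use r(2) in \<open>auto simp: F_def normp_def\<close>)
  have "approximable p (F n)" for n
    by (rule approximable_bounded [OF Fm, of "real (Suc n)"]) (use p in \<open>auto simp: F_def A_def\<close>)
  then show ?thesis
    using p fin by (intro approximable_limit [OF p Fm f _ conv conv]) auto
qed

section \<open>Passage to the limit in norms\<close>

lemma powr_add_perturb:
  fixes a b t p :: real
  assumes "0 \<le> a" "0 \<le> b" "0 < t" "0 \<le> p"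
  shows "(a + b) powr p \<le> (1 + t) powr p * a powr p + (1 + 1 / t) powr p * b powr p"
proof (cases "b \<le> t * a")
  case True
  then have "(a + b) powr p \<le> ((1 + t) * a) powr p"
    using assms by (intro powr_mono2) (auto simp: algebra_simps)
  also have "\<dots> = (1 + t) powr p * a powr p" using assms by (simp add: powr_mult)
  finally show ?thesis by (simp add: add_increasing2)
next
  case False
  then have "(a + b) powr p \<le> ((1 + 1 / t) * b) powr p"
    using assms by (intro powr_mono2) (auto simp: field_simps)
  also have "\<dots> = (1 + 1 / t) powr p * b powr p" using assms by (subst powr_mult) auto
  finally show ?thesis by (simp add: add_increasing)
qed

text \<open>The factor (1 + t)^p of the main term tends to 1 with t, so a small perturbation changes
  the norm by little. This carries equalities and the sharp constant through the
  approximation.\<close>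

lemma normp_perturb:
  assumes "0 < p" "0 \<le> A" "0 < e"
  obtains \<delta> where "0 < \<delta>"
    "\<And>f g :: 'a::euclidean_space \<Rightarrow> complex. f \<in> borel_measurable lebesgue \<Longrightarrow> g \<in> borel_measurable lebesgue \<Longrightarrow>
        normp p g \<le> ennreal A \<Longrightarrow> normp p (\<lambda>u. f u - g u) \<le> ennreal \<delta> \<Longrightarrow> normp p f \<le> ennreal (A + e)"
proof -
  have "((\<lambda>t. (1 + t) powr p * A) \<longlongrightarrow> (1 + 0) powr p * A) (at_right 0)"
    by (intro tendsto_intros) auto
  then have "\<forall>\<^sub>F t in at_right 0. (1 + t) powr p * A < A + e / 2"
    using \<open>0 < e\<close> by (intro order_tendstoD(2)) auto
  then have "\<forall>\<^sub>F t in at_right 0. (1 + t) powr p * A < A + e / 2 \<and> 0 < t"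
    using eventually_at_right_less [of "0::real"] by (rule eventually_conj)
  then obtain t where t: "0 < t" "(1 + t) powr p * A < A + e / 2"
    using eventually_happens' [of "at_right (0::real)"] by (auto simp: trivial_limit_at_right_real)
  \<comment> \<open>Large when \<open>t\<close> is small, but \<open>t\<close> is fixed by now;
    \<delta> = e / (2 C) absorbs it.\<close>
  define C where "C = (1 + 1 / t) powr p"
  have "0 < 1 + 1 / t" using t by (simp add: add_pos_pos)
  then have C: "0 < C" unfolding C_def powr_gt_zero by linarith
  show ?thesis
  proof (rule that [of "e / (2 * C)"])
    fix f g :: "'a \<Rightarrow> complex"
    assume m [measurable]: "f \<in> borel_measurable lebesgue" "g \<in> borel_measurable lebesgue"
      and A: "normp p g \<le> ennreal A" and d: "normp p (\<lambda>u. f u - g u) \<le> ennreal (e / (2 * C))"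
    have "cmod (f u) powr p \<le> (1 + t) powr p * cmod (g u) powr p + C * cmod (f u - g u) powr p" for u
    proof -
      have "cmod (f u) \<le> cmod (g u) + cmod (f u - g u)"
        using norm_triangle_ineq [of "g u" "f u - g u"] by simp
      then have "cmod (f u) powr p \<le> (cmod (g u) + cmod (f u - g u)) powr p"
        using assms by (intro powr_mono2) auto
      also have "\<dots> \<le> (1 + t) powr p * cmod (g u) powr p + C * cmod (f u - g u) powr p"
        unfolding C_def using t assms by (intro powr_add_perturb) auto
      finally show ?thesis .
    qed
    then have "normp p f \<le> (\<integral>\<^sup>+u. ennreal ((1 + t) powr p) * ennreal (cmod (g u) powr p) + ennreal C * ennreal (cmod (f u - g u) powr p) \<partial>lebesgue)"
      unfolding normp_def using C
      by (intro nn_integral_mono) (auto simp: ennreal_mult[symmetric] ennreal_plus[symmetric] simp del: ennreal_plus)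
    also have "\<dots> = ennreal ((1 + t) powr p) * normp p g + ennreal C * normp p (\<lambda>u. f u - g u)"
      unfolding normp_def by (subst nn_integral_add, simp, simp, subst nn_integral_cmult, simp, subst nn_integral_cmult) auto
    also have "\<dots> \<le> ennreal ((1 + t) powr p) * ennreal A + ennreal C * ennreal (e / (2 * C))"
      using A d by (intro add_mono mult_left_mono) auto
    also have "\<dots> = ennreal ((1 + t) powr p * A + e / 2)"
      using C assms by (simp add: ennreal_mult[symmetric] ennreal_plus[symmetric] del: ennreal_plus)
    also have "\<dots> \<le> ennreal (A + e)"
      using t by (intro ennreal_leI) simp
    finally show "normp p f \<le> ennreal (A + e)" .
  qed (use assms C in simp)
qed

lemma normp_minus_commute: "normp p (\<lambda>u. f u - g u) = normp p (\<lambda>u. g u - f u)"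
  by (simp add: normp_def norm_minus_commute)

lemma normp_limit_le_eventually:
  assumes p: "0 < p" and m: "\<And>n. F n \<in> borel_measurable lebesgue" "f \<in> borel_measurable lebesgue"
    and lim: "(\<lambda>n. normp p (\<lambda>u. F n u - f u)) \<longlonglongrightarrow> 0" and A: "0 \<le> A" "normp p f \<le> ennreal A" and e: "0 < e"
  shows "\<forall>\<^sub>F n in sequentially. normp p (F n) \<le> ennreal (A + e)"
proof -
  obtain \<delta> where d: "0 < \<delta>"
    "\<And>f g :: 'a \<Rightarrow> complex. f \<in> borel_measurable lebesgue \<Longrightarrow> g \<in> borel_measurable lebesgue \<Longrightarrow>
        normp p g \<le> ennreal A \<Longrightarrow> normp p (\<lambda>u. f u - g u) \<le> ennreal \<delta> \<Longrightarrow> normp p f \<le> ennreal (A + e)"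
    using normp_perturb [OF p A(1) e] by blast
  have "\<forall>\<^sub>F n in sequentially. normp p (\<lambda>u. F n u - f u) < ennreal \<delta>"
    using lim d(1) by (intro order_tendstoD(2)) auto
  then show ?thesis by eventually_elim (rule d(2) [OF m A(2)], simp)
qed

lemma normp_limit_le:
  assumes p: "0 < p" and m: "\<And>n. F n \<in> borel_measurable lebesgue" "f \<in> borel_measurable lebesgue"
    and lim: "(\<lambda>n. normp p (\<lambda>u. F n u - f u)) \<longlonglongrightarrow> 0" and A: "0 \<le> A"
    and le: "\<And>e. 0 < e \<Longrightarrow> \<forall>\<^sub>F n in sequentially. normp p (F n) \<le> ennreal (A + e)"
  shows "normp p f \<le> ennreal A"
proof (rule ennreal_le_epsilon)
  fix e :: real assume e: "0 < e"
  obtain \<delta> where d: "0 < \<delta>"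
    "\<And>f g :: 'a \<Rightarrow> complex. f \<in> borel_measurable lebesgue \<Longrightarrow> g \<in> borel_measurable lebesgue \<Longrightarrow>
        normp p g \<le> ennreal (A + e / 2) \<Longrightarrow> normp p (\<lambda>u. f u - g u) \<le> ennreal \<delta> \<Longrightarrow> normp p f \<le> ennreal (A + e / 2 + e / 2)"
    using normp_perturb [OF p, of "A + e / 2" "e / 2"] A e by auto
  have "\<forall>\<^sub>F n in sequentially. normp p (\<lambda>u. F n u - f u) < ennreal \<delta>"
    using lim d(1) by (intro order_tendstoD(2)) auto
  moreover have "\<forall>\<^sub>F n in sequentially. normp p (F n) \<le> ennreal (A + e / 2)"
    using le [of "e / 2"] e by simp
  ultimately have "\<forall>\<^sub>F n in sequentially. normp p f \<le> ennreal (A + e / 2 + e / 2)"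
  proof eventually_elim
    case (elim n)
    show ?case
      by (rule d(2) [OF m(2) m(1) elim(2)]) (use elim(1) in \<open>simp add: normp_minus_commute [of p f]\<close>)
  qed
  then have "normp p f \<le> ennreal (A + e)" by (auto simp: eventually_sequentially add.commute)
  then show "normp p f \<le> ennreal A + ennreal e" using A e by (simp add: ennreal_plus)
qed

lemma normp_eq_of_limits:
  assumes p: "0 < p" and m: "\<And>n. F n \<in> borel_measurable lebesgue" "f \<in> borel_measurable lebesgue"
    "\<And>n. G n \<in> borel_measurable lebesgue" "g \<in> borel_measurable lebesgue"
    and lim: "(\<lambda>n. normp p (\<lambda>u. F n u - f u)) \<longlonglongrightarrow> 0" "(\<lambda>n. normp p (\<lambda>u. G n u - g u)) \<longlonglongrightarrow> 0"
    and fin: "normp p f < \<infinity>" "normp p g < \<infinity>" and eq: "\<And>n. normp p (F n) = normp p (G n)"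
  shows "normp p f = normp p g"
proof (rule antisym)
  have *: "normp p f = ennreal (enn2real (normp p f))" "normp p g = ennreal (enn2real (normp p g))"
    using fin by (simp_all add: ennreal_enn2real_if less_top[symmetric])
  show "normp p f \<le> normp p g"
    by (subst *(2), rule normp_limit_le [OF p m(1,2) lim(1)], simp, subst eq,
        rule normp_limit_le_eventually [OF p m(3,4) lim(2)]) (use * in auto)
  show "normp p g \<le> normp p f"
    by (subst *(1), rule normp_limit_le [OF p m(3,4) lim(2)], simp, subst eq [symmetric],
        rule normp_limit_le_eventually [OF p m(1,2) lim(1)]) (use * in auto)
qed

section \<open>Almost everywhere convergence and completeness\<close>

lemma normp_2_AE_subseq:
  fixes f :: "nat \<Rightarrow> 'a::euclidean_space \<Rightarrow> complex"
  assumes [measurable]: "\<And>n. f n \<in> borel_measurable lebesgue" "g \<in> borel_measurable lebesgue"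
    and lim: "(\<lambda>n. normp 2 (\<lambda>u. f n u - g u)) \<longlonglongrightarrow> 0"
  obtains r where "strict_mono r" "AE u in lebesgue. (\<lambda>n. f (r n) u) \<longlonglongrightarrow> g u"
proof -
  have "\<forall>\<^sub>F n in sequentially. normp 2 (\<lambda>u. f n u - g u) < 1"
    using lim by (rule order_tendstoD(2)) simp
  then obtain N where N: "\<And>n. n \<ge> N \<Longrightarrow> normp 2 (\<lambda>u. f n u - g u) < 1" by (auto simp: eventually_sequentially)
  \<comment> \<open>The shift by \<open>N\<close> discards terms whose distance to \<open>g\<close>
    may be infinite, so that the squares are integrable and an L^1 result applies.\<close>
  define d where "d n u = (cmod (f (n + N) u - g u))\<^sup>2" for n u
  have nn: "(\<integral>\<^sup>+u. ennreal (d n u) \<partial>lebesgue) = normp 2 (\<lambda>u. f (n + N) u - g u)" for n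
    unfolding normp_def d_def by (simp add: powr_numeral)
  have int: "integrable lebesgue (d n)" for n
    using N [of "n + N"] unfolding d_def
    by (intro integrableI_nonneg) (auto simp: nn [unfolded d_def] intro: less_trans)
  have "(\<lambda>n. \<integral>u. norm (d n u) \<partial>lebesgue) \<longlonglongrightarrow> 0"
  proof -
    have "ennreal (\<integral>u. norm (d n u) \<partial>lebesgue) = normp 2 (\<lambda>u. f (n + N) u - g u)" for n
      using int [of n] unfolding nn [symmetric] by (subst nn_integral_eq_integral) (auto simp: d_def [abs_def])
    then have "(\<lambda>n. ennreal (\<integral>u. norm (d n u) \<partial>lebesgue)) \<longlonglongrightarrow> ennreal 0"
      using LIMSEQ_ignore_initial_segment [OF lim, of N] by simp
    then show ?thesis by (subst (asm) tendsto_ennreal_iff) (auto intro!: always_eventually integral_nonneg_AE)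
  qed
  from tendsto_L1_AE_subseq [OF int this] obtain r where r: "strict_mono r" "AE u in lebesgue. (\<lambda>n. d (r n) u) \<longlonglongrightarrow> 0"
    by blast
  show ?thesis
  proof (rule that)
    show "strict_mono (\<lambda>n. r n + N)" using r(1) by (auto simp: strict_mono_def)
    show "AE u in lebesgue. (\<lambda>n. f (r n + N) u) \<longlonglongrightarrow> g u"
      using r(2)
    proof eventually_elim
      case (elim u)
      then have "(\<lambda>n. sqrt (d (r n) u)) \<longlonglongrightarrow> sqrt 0" by (rule tendsto_real_sqrt)
      then have "(\<lambda>n. norm (f (r n + N) u - g u)) \<longlonglongrightarrow> 0" by (simp add: d_def)
      then show ?case by (simp add: tendsto_norm_zero_iff LIM_zero_iff)
    qed
  qed
qed

lemma normp_Fatou: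
  fixes f :: "nat \<Rightarrow> 'a::euclidean_space \<Rightarrow> complex"
  assumes [measurable]: "\<And>n. f n \<in> borel_measurable lebesgue" "g \<in> borel_measurable lebesgue" and p: "0 < p"
    and lim: "AE u in lebesgue. (\<lambda>n. f n u) \<longlonglongrightarrow> g u"
    and le: "\<forall>\<^sub>F n in sequentially. normp p (f n) \<le> C"
  shows "normp p g \<le> C"
proof -
  have "normp p g = (\<integral>\<^sup>+u. liminf (\<lambda>n. ennreal (cmod (f n u) powr p)) \<partial>lebesgue)"
    unfolding normp_def
  proof (rule nn_integral_cong_AE)
    show "AE u in lebesgue. ennreal (cmod (g u) powr p) = liminf (\<lambda>n. ennreal (cmod (f n u) powr p))"
      using lim
    proof eventually_elim
      case (elim u)
      have "(\<lambda>n. cmod (f n u) powr p) \<longlonglongrightarrow> cmod (g u) powr p"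
        using p elim by (intro tendsto_powr' tendsto_norm tendsto_const) auto
      then have "(\<lambda>n. ennreal (cmod (f n u) powr p)) \<longlonglongrightarrow> ennreal (cmod (g u) powr p)"
        by (rule tendsto_ennrealI)
      then show ?case by (intro lim_imp_Liminf [symmetric]) auto
    qed
  qed
  also have "\<dots> \<le> liminf (\<lambda>n. normp p (f n))"
    unfolding normp_def by (rule nn_integral_liminf) simp
  also have "\<dots> \<le> limsup (\<lambda>n. normp p (f n))" by (rule Liminf_le_Limsup) simp
  also have "\<dots> \<le> C" by (rule Limsup_bounded [OF le])
  finally show ?thesis .
qed

lemma ennreal_tendsto_0I:
  fixes x :: "nat \<Rightarrow> ennreal"
  assumes "\<And>e. 0 < e \<Longrightarrow> \<forall>\<^sub>F n in sequentially. x n \<le> ennreal e"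
  shows "x \<longlonglongrightarrow> 0"
proof (rule order_tendstoI)
  fix a :: ennreal assume a: "0 < a"
  obtain e where e: "0 < e" "ennreal e < a"
  proof (cases "a = \<infinity>")
    case True
    then show ?thesis using that [of 1] by simp
  next
    case False
    then obtain r where r: "a = ennreal r" "0 \<le> r" by (cases a) auto
    then show ?thesis using a that [of "r / 2"] by (simp add: ennreal_less_iff)
  qed
  show "\<forall>\<^sub>F n in sequentially. x n < a"
    using assms [OF e(1)] by eventually_elim (use e(2) in \<open>auto intro: le_less_trans\<close>)
qed simp

text \<open>Multiplication by the square integrable weight \<open>w\<close> turns the sequence into
  a Cauchy sequence in L^1, which has an almost everywhere Cauchy subsequence. Division by
  \<open>w\<close> gives the candidate for the limit, and Fatou's lemma shows convergence of the
  whole sequence in L^2.\<close>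

lemma L2_complete:
  fixes f :: "nat \<Rightarrow> 'a::euclidean_space \<Rightarrow> complex"
  assumes m [measurable]: "\<And>n. f n \<in> borel_measurable lebesgue" and fin: "\<And>n. normp 2 (f n) < \<infinity>"
    and cauchy: "\<And>e. 0 < e \<Longrightarrow> \<exists>N. \<forall>i\<ge>N. \<forall>j\<ge>N. normp 2 (\<lambda>u. f i u - f j u) < ennreal e"
  obtains g where "g \<in> borel_measurable lebesgue" "(\<lambda>n. normp 2 (\<lambda>u. f n u - g u)) \<longlonglongrightarrow> 0"
proof -
  define w where "w u = exp (- 1 * (norm (u :: 'a))\<^sup>2)" for u
  have wm [measurable]: "w \<in> borel_measurable lebesgue"
    unfolding w_def by (intro measurable_completion) simp
  have w0: "0 < w u" for u by (simp add: w_def)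
  have w2: "integrable lebesgue (\<lambda>u. (w u)\<^sup>2)"
  proof -
    have "(\<lambda>u. (w u)\<^sup>2) = (\<lambda>u. exp (- 2 * (norm u)\<^sup>2))"
      by (auto simp: w_def fun_eq_iff exp_double [symmetric])
    moreover have "integrable lebesgue (\<lambda>u::'a. exp (- 2 * (norm u)\<^sup>2))"
      using integrable_gaussian [of 2, where 'a = 'a] by (subst integrable_lebesgue_iff) auto
    ultimately show ?thesis by simp
  qed
  have sq_int: "integrable lebesgue (\<lambda>u. (cmod (h u))\<^sup>2)" "(\<integral>u. (cmod (h u))\<^sup>2 \<partial>lebesgue) = enn2real (normp 2 h)"
    if [measurable]: "h \<in> borel_measurable lebesgue" and "normp 2 h < \<infinity>" for h :: "'a \<Rightarrow> complex"
  proof -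
    have eq: "(\<integral>\<^sup>+u. ennreal ((cmod (h u))\<^sup>2) \<partial>lebesgue) = normp 2 h" by (simp add: normp_def powr_numeral)
    show "integrable lebesgue (\<lambda>u. (cmod (h u))\<^sup>2)"
      by (rule integrableI_nonneg) (use that eq in auto)
    show "(\<integral>u. (cmod (h u))\<^sup>2 \<partial>lebesgue) = enn2real (normp 2 h)"
      by (subst integral_eq_nn_integral) (auto simp: eq)
  qed
  \<comment> \<open>Inequality of the means with a free parameter: the second term becomes small for
    large \<open>K\<close>, after which the first is small if z is small in L^2.\<close>
  have pt: "cmod (z * of_real (w u)) \<le> K * (cmod z)\<^sup>2 + (w u)\<^sup>2 / K" if "0 < K" for K z u
  proof -
    have "0 \<le> K * (cmod z - w u / K)\<^sup>2" using that by simp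
    also have "\<dots> = K * (cmod z)\<^sup>2 + (w u)\<^sup>2 / K - 2 * (cmod z * w u)"
      using that by (simp add: power2_eq_square field_simps)
    finally have "2 * (cmod z * w u) \<le> K * (cmod z)\<^sup>2 + (w u)\<^sup>2 / K" by simp
    moreover have "0 \<le> cmod z * w u" using w0 [of u] by simp
    ultimately have "cmod z * w u \<le> K * (cmod z)\<^sup>2 + (w u)\<^sup>2 / K" by linarith
    then show ?thesis using w0 [of u] by (simp add: norm_mult)
  qed
  have int: "integrable lebesgue (\<lambda>u. h u * of_real (w u))"
    if [measurable]: "h \<in> borel_measurable lebesgue" and "normp 2 h < \<infinity>" for h :: "'a \<Rightarrow> complex"
  proof (rule Bochner_Integration.integrable_bound)
    show "integrable lebesgue (\<lambda>u. 1 * (cmod (h u))\<^sup>2 + (w u)\<^sup>2 / 1)"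
      using sq_int(1) [OF that] w2 by simp
    show "AE u in lebesgue. norm (h u * complex_of_real (w u)) \<le> norm (1 * (cmod (h u))\<^sup>2 + (w u)\<^sup>2 / 1)"
      using pt [of 1] by (intro AE_I2 order_trans [OF _ abs_ge_self [folded real_norm_def]]) auto
  qed simp
  have fin2: "normp 2 (\<lambda>u. f i u - f j u) < \<infinity>" for i j
  proof -
    have "normp 2 (\<lambda>u. f i u - f j u) \<le> ennreal (2 powr 2) * (normp 2 (\<lambda>u. f i u - 0) + normp 2 (\<lambda>u. 0 - f j u))"
      by (rule normp_triangle) auto
    also have "\<dots> < \<infinity>"
      using fin [of i] fin [of j] normp_minus_commute [of 2 "\<lambda>_. 0" "f j"] by (simp add: ennreal_mult_less_top)
    finally show ?thesis .
  qed
  define W where "W = (\<integral>u. (w u)\<^sup>2 \<partial>lebesgue)"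
  have W0: "0 \<le> W" by (auto simp: W_def intro: integral_nonneg_AE)
  obtain r where r: "strict_mono r" "AE u in lebesgue. Cauchy (\<lambda>i. f (r i) u * of_real (w u))"
  proof (rule cauchy_L1_AE_cauchy_subseq [of lebesgue "\<lambda>i u. f i u * of_real (w u)"])
    show "integrable lebesgue (\<lambda>u. f i u * of_real (w u))" for i by (rule int [OF m fin])
    fix e :: real assume e: "0 < e"
    define V where "V = W + 1"
    have V: "0 < V" using W0 by (simp add: V_def)
    \<comment> \<open>Then K (e / (2 K)) and V / K are both e / 2. \<open>V\<close> exceeds the
      integral of w^2, which makes it positive and the estimate strict.\<close>
    define K where "K = 2 * V / e"
    have K: "0 < K" using e V by (simp add: K_def)
    obtain N where N: "\<And>i j. i \<ge> N \<Longrightarrow> j \<ge> N \<Longrightarrow> normp 2 (\<lambda>u. f i u - f j u) < ennreal (e / (2 * K))"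
      using cauchy [of "e / (2 * K)"] e K by auto
    show "\<exists>N. \<forall>i\<ge>N. \<forall>j\<ge>N. (\<integral>u. norm (f i u * complex_of_real (w u) - f j u * complex_of_real (w u)) \<partial>lebesgue) < e"
    proof (intro exI allI impI)
      fix i j assume ij: "i \<ge> N" "j \<ge> N"
      have "(\<integral>u. norm (f i u * complex_of_real (w u) - f j u * complex_of_real (w u)) \<partial>lebesgue) =
         (\<integral>u. norm ((f i u - f j u) * complex_of_real (w u)) \<partial>lebesgue)"
        by (simp add: left_diff_distrib)
      also have "\<dots> \<le> (\<integral>u. K * (cmod (f i u - f j u))\<^sup>2 + (w u)\<^sup>2 / K \<partial>lebesgue)"
        using pt [OF K] sq_int(1) [OF _ fin2 [of i j]] w2
        by (intro integral_mono integrable_norm int fin2) auto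
      also have "\<dots> = K * enn2real (normp 2 (\<lambda>u. f i u - f j u)) + W / K"
        using sq_int [OF _ fin2 [of i j]] w2 by (simp add: W_def)
      also have "\<dots> < K * (e / (2 * K)) + V / K"
      proof (intro add_strict_mono mult_strict_left_mono divide_strict_right_mono K)
        show "enn2real (normp 2 (\<lambda>u. f i u - f j u)) < e / (2 * K)"
          using N [OF ij] by (cases "normp 2 (\<lambda>u. f i u - f j u)") (auto simp: ennreal_less_iff)
      qed (simp add: V_def)
      also have "\<dots> = e" using V e by (simp add: K_def field_simps)
      finally show "(\<integral>u. norm (f i u * complex_of_real (w u) - f j u * complex_of_real (w u)) \<partial>lebesgue) < e" .
    qed
  qed blast
  define g where "g u = lim (\<lambda>i. f (r i) u)" for u
  have gm [measurable]: "g \<in> borel_measurable lebesgue"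
    unfolding g_def by measurable
  have glim: "AE u in lebesgue. (\<lambda>i. f (r i) u) \<longlonglongrightarrow> g u"
    using r(2)
  proof eventually_elim
    case (elim u)
    then obtain l where "(\<lambda>i. f (r i) u * of_real (w u)) \<longlonglongrightarrow> l"
      using Cauchy_convergent_iff convergent_def by blast
    then have "(\<lambda>i. f (r i) u * of_real (w u) / of_real (w u)) \<longlonglongrightarrow> l / of_real (w u)"
      using w0 [of u] by (intro tendsto_divide tendsto_const) auto
    then have "(\<lambda>i. f (r i) u) \<longlonglongrightarrow> l / of_real (w u)" using w0 [of u] by simp
    then show ?case unfolding g_def by (simp add: limI)
  qed
  have "(\<lambda>n. normp 2 (\<lambda>u. f n u - g u)) \<longlonglongrightarrow> 0"
  proof (rule ennreal_tendsto_0I)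
    fix e :: real assume e: "0 < e"
    obtain N where N: "\<And>i j. i \<ge> N \<Longrightarrow> j \<ge> N \<Longrightarrow> normp 2 (\<lambda>u. f i u - f j u) < ennreal e"
      using cauchy [OF e] by auto
    have "normp 2 (\<lambda>u. f n u - g u) \<le> ennreal e" if "n \<ge> N" for n
    proof (rule normp_Fatou [where f = "\<lambda>k u. f n u - f (r k) u"])
      show "AE u in lebesgue. (\<lambda>k. f n u - f (r k) u) \<longlonglongrightarrow> f n u - g u"
        using glim by eventually_elim (intro tendsto_intros)
      show "\<forall>\<^sub>F k in sequentially. normp 2 (\<lambda>u. f n u - f (r k) u) \<le> ennreal e"
        using N [OF that] seq_suble [OF r(1)]
        by (intro eventually_sequentiallyI [of N]) (meson less_imp_le order_trans)
    qed auto
    then show "\<forall>\<^sub>F n in sequentially. normp 2 (\<lambda>u. f n u - g u) \<le> ennreal e"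
      by (rule eventually_sequentiallyI)
  qed
  then show ?thesis using that gm by blast
qed

section \<open>The Plancherel transform\<close>

lemma L2_functions_iff: "f \<in> L2_functions \<longleftrightarrow> f \<in> borel_measurable lebesgue \<and> normp 2 f < \<infinity>"
  by (simp add: L2_functions_def L2_normsq_normp)

lemma nice_L2: "nice h \<Longrightarrow> h \<in> L2_functions"
  by (simp add: L2_functions_iff nice_measurable_lebesgue nice_normp)

lemma nice_integrable: "nice h \<Longrightarrow> integrable lebesgue h"
  by (simp add: nice_def)

lemma normp_tendsto_triangle:
  assumes m: "\<And>n. F n \<in> borel_measurable lebesgue" "\<And>n. G n \<in> borel_measurable lebesgue" "\<And>n. H n \<in> borel_measurable lebesgue"
    and p: "0 \<le> p"
    and lim: "(\<lambda>n. normp p (\<lambda>u. F n u - G n u)) \<longlonglongrightarrow> 0" "(\<lambda>n. normp p (\<lambda>u. G n u - H n u)) \<longlonglongrightarrow> 0"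
  shows "(\<lambda>n. normp p (\<lambda>u. F n u - H n u)) \<longlonglongrightarrow> 0"
proof (rule ennreal_tendsto_0I)
  fix e :: real assume e: "0 < e"
  define d where "d = e / (2 * 2 powr p)"
  have d: "0 < d" using e by (simp add: d_def)
  have "\<forall>\<^sub>F n in sequentially. normp p (\<lambda>u. F n u - G n u) < ennreal d" "\<forall>\<^sub>F n in sequentially. normp p (\<lambda>u. G n u - H n u) < ennreal d"
    using lim d by (auto intro!: order_tendstoD(2))
  then show "\<forall>\<^sub>F n in sequentially. normp p (\<lambda>u. F n u - H n u) \<le> ennreal e"
  proof eventually_elim
    case (elim n)
    have "normp p (\<lambda>u. F n u - H n u) \<le> ennreal (2 powr p) * (normp p (\<lambda>u. F n u - G n u) + normp p (\<lambda>u. G n u - H n u))"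
      by (rule normp_triangle [OF m p])
    also have "\<dots> \<le> ennreal (2 powr p) * (ennreal d + ennreal d)"
      using elim by (intro mult_left_mono add_mono) auto
    also have "\<dots> = ennreal e"
      using d by (simp add: ennreal_plus[symmetric] ennreal_mult[symmetric] del: ennreal_plus) (simp add: d_def)
    finally show ?case .
  qed
qed

lemma normp_uminus [simp]: "normp p (\<lambda>u. - f u) = normp p f"
  by (simp add: normp_def)

lemma gauss_combs_sequence:
  fixes f :: "'a::euclidean_space \<Rightarrow> complex"
  assumes "f \<in> L2_functions" "normp p f < \<infinity>" "0 < p"
  obtains h where "\<And>n. h n \<in> gauss_combs" "(\<lambda>n. normp p (\<lambda>u. h n u - f u)) \<longlonglongrightarrow> 0"
    "(\<lambda>n. normp 2 (\<lambda>u. h n u - f u)) \<longlonglongrightarrow> 0"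
proof -
  have "approximable p f"
    using assms by (intro approximable_L2_Lp) (auto simp: L2_functions_iff)
  then have "\<forall>n. \<exists>h\<in>gauss_combs. normp p (\<lambda>u. h u - f u) < ennreal (1 / real (Suc n)) \<and> normp 2 (\<lambda>u. h u - f u) < ennreal (1 / real (Suc n))"
    unfolding approximable_def by simp
  then obtain h where h: "\<And>n. h n \<in> gauss_combs" "\<And>n. normp p (\<lambda>u. h n u - f u) < ennreal (1 / real (Suc n))"
    "\<And>n. normp 2 (\<lambda>u. h n u - f u) < ennreal (1 / real (Suc n))"
    by metis
  have lim: "x \<longlonglongrightarrow> 0" if "\<And>n. x n < ennreal (1 / real (Suc n))" for x :: "nat \<Rightarrow> ennreal"
  proof (rule ennreal_tendsto_0I)
    fix e :: real assume "0 < e"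
    then obtain N where N: "1 / real (Suc N) < e" using nat_approx_posE by blast
    show "\<forall>\<^sub>F n in sequentially. x n \<le> ennreal e"
    proof (intro eventually_sequentiallyI [of N])
      fix n assume "N \<le> n"
      then have "1 / real (Suc n) \<le> 1 / real (Suc N)" by (simp add: frac_le)
      then show "x n \<le> ennreal e" using that [of n] N
        by (meson ennreal_leI less_imp_le order_trans)
    qed
  qed
  show ?thesis by (rule that [OF h(1) lim [OF h(2)] lim [OF h(3)]])
qed

lemma normp_2_Cauchy:
  assumes m: "\<And>n. f n \<in> borel_measurable lebesgue" "g \<in> borel_measurable lebesgue"
    and lim: "(\<lambda>n. normp 2 (\<lambda>u. f n u - g u)) \<longlonglongrightarrow> 0" and e: "0 < e"
  shows "\<exists>N. \<forall>i\<ge>N. \<forall>j\<ge>N. normp 2 (\<lambda>u. f i u - f j u) < ennreal e"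
proof -
  have "\<forall>\<^sub>F n in sequentially. normp 2 (\<lambda>u. f n u - g u) < ennreal (e / 16)"
    using lim e by (intro order_tendstoD(2)) auto
  then obtain N where N: "\<And>n. n \<ge> N \<Longrightarrow> normp 2 (\<lambda>u. f n u - g u) < ennreal (e / 16)"
    by (auto simp: eventually_sequentially)
  show ?thesis
  proof (intro exI allI impI)
    fix i j assume ij: "i \<ge> N" "j \<ge> N"
    have "normp 2 (\<lambda>u. f i u - f j u) \<le> ennreal (2 powr 2) * (normp 2 (\<lambda>u. f i u - g u) + normp 2 (\<lambda>u. g u - f j u))"
      by (rule normp_triangle [OF m(1) m(2) m(1)]) simp
    also have "\<dots> \<le> ennreal (2 powr 2) * (ennreal (e / 16) + ennreal (e / 16))"
      using N [OF ij(1)] N [OF ij(2)] by (intro mult_left_mono add_mono) (auto simp: normp_minus_commute [of 2 g])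
    also have "\<dots> = ennreal (e / 2)"
    proof -
      have 1: "ennreal (e / 16) + ennreal (e / 16) = ennreal (e / 8)"
        using e by (subst ennreal_plus [symmetric]) auto
      have 2: "ennreal (2 powr 2) * ennreal (e / 8) = ennreal (e / 2)"
        using e by (subst ennreal_mult [symmetric]) auto
      show ?thesis unfolding 1 2 ..
    qed
    also have "\<dots> < ennreal e" using e by (simp add: ennreal_less_iff)
    finally show "normp 2 (\<lambda>u. f i u - f j u) < ennreal e" .
  qed
qed

lemma normp_2_finite_limit:
  assumes m: "f \<in> borel_measurable lebesgue" "\<And>n. F n \<in> borel_measurable lebesgue"
    and fin: "\<And>n. normp 2 (F n) < \<infinity>" and lim: "(\<lambda>n. normp 2 (\<lambda>u. F n u - f u)) \<longlonglongrightarrow> 0"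
  shows "normp 2 f < \<infinity>"
proof -
  have "\<forall>\<^sub>F n in sequentially. normp 2 (\<lambda>u. F n u - f u) < 1"
    using lim by (intro order_tendstoD(2)) auto
  then obtain n where n: "normp 2 (\<lambda>u. F n u - f u) < 1" by (auto simp: eventually_sequentially)
  have "normp 2 (\<lambda>u. f u - 0) \<le> ennreal (2 powr 2) * (normp 2 (\<lambda>u. f u - F n u) + normp 2 (\<lambda>u. F n u - 0))"
    by (rule normp_triangle [OF m(1) m(2)]) auto
  also have "\<dots> < \<infinity>"
    using fin [of n] less_trans [OF n, of \<infinity>] by (simp add: ennreal_mult_less_top normp_minus_commute [of 2 f])
  finally show ?thesis by simp
qed

lemma integral_cmod_normp:
  assumes "f \<in> borel_measurable lebesgue"
  shows "(\<integral>u. cmod (f u) \<partial>lebesgue) = enn2real (normp 1 f)"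
  using assms by (subst integral_eq_nn_integral) (auto simp: normp_def)

text \<open>Approximation in L^1 and L^2 at once: the first makes the Fourier integrals converge
  pointwise, the second makes them Cauchy in L^2, and Fatou's lemma identifies the L^2 limit with
  the Fourier integral of \<open>f\<close>.\<close>

lemma plancherel_L1_L2:
  fixes f :: "'a::euclidean_space \<Rightarrow> complex"
  assumes f: "integrable lebesgue f" "f \<in> L2_functions"
  shows "normp 2 (fourier_integral f) = normp 2 f"
proof -
  have fm: "f \<in> borel_measurable lebesgue" "normp 2 f < \<infinity>" using f(2) by (auto simp: L2_functions_iff)
  have "normp 1 f < \<infinity>"
    using f(1) by (simp add: normp_def integrable_iff_bounded)
  then obtain h where h: "\<And>n. h n \<in> gauss_combs" "(\<lambda>n. normp 1 (\<lambda>u. h n u - f u)) \<longlonglongrightarrow> 0"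
    "(\<lambda>n. normp 2 (\<lambda>u. h n u - f u)) \<longlonglongrightarrow> 0"
    using gauss_combs_sequence [OF f(2), of 1] by auto
  have nh: "nice (h n)" for n by (rule nice_gauss_combs [OF h(1)])
  have hm: "h n \<in> borel_measurable lebesgue" for n by (rule nice_measurable_lebesgue [OF nh])
  have Fhm: "fourier_integral (h n) \<in> borel_measurable lebesgue" for n
    by (rule nice_measurable_lebesgue [OF nice_fourier [OF nh]])
  have Ffm: "fourier_integral f \<in> borel_measurable lebesgue"
    using fourier_integral_measurable [OF f(1)] by (intro measurable_completion) simp
  have pw: "(\<lambda>n. fourier_integral (h n) x) \<longlonglongrightarrow> fourier_integral f x" for x
  proof -
    have le: "cmod (fourier_integral (h n) x - fourier_integral f x) \<le> (2 * pi) powr (- real DIM('a) / 2) * enn2real (normp 1 (\<lambda>u. h n u - f u))" for n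
      using norm_fourier_integral_le [of "\<lambda>u. h n u - f u" x] fourier_integral_diff [OF nice_integrable [OF nh] f(1), of n x]
        integral_cmod_normp [of "\<lambda>u. h n u - f u"] hm [of n] fm(1) by simp
    have "(\<lambda>n. enn2real (normp 1 (\<lambda>u. h n u - f u))) \<longlonglongrightarrow> enn2real 0"
      using tendsto_enn2real [of "\<lambda>n. normp 1 (\<lambda>u. h n u - f u)" 0 sequentially] h(2) by simp
    then have "(\<lambda>n. (2 * pi) powr (- real DIM('a) / 2) * enn2real (normp 1 (\<lambda>u. h n u - f u))) \<longlonglongrightarrow> 0"
      using tendsto_mult_right_zero by fastforce
    then have "(\<lambda>n. fourier_integral (h n) x - fourier_integral f x) \<longlonglongrightarrow> 0"
      by (rule Lim_null_comparison [rotated]) (use le in \<open>auto intro: always_eventually\<close>)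
    then show ?thesis by (simp add: LIM_zero_iff)
  qed
  have lim: "(\<lambda>n. normp 2 (\<lambda>u. fourier_integral (h n) u - fourier_integral f u)) \<longlonglongrightarrow> 0"
  proof (rule ennreal_tendsto_0I)
    fix e :: real assume e: "0 < e"
    obtain N where N: "\<And>i j. i \<ge> N \<Longrightarrow> j \<ge> N \<Longrightarrow> normp 2 (\<lambda>u. h i u - h j u) < ennreal e"
      using normp_2_Cauchy [OF hm fm(1) h(3) e] by blast
    have "normp 2 (\<lambda>u. fourier_integral (h n) u - fourier_integral f u) \<le> ennreal e" if "n \<ge> N" for n
    proof (rule normp_Fatou [where f = "\<lambda>k u. fourier_integral (h n) u - fourier_integral (h k) u"])
      show "AE u in lebesgue. (\<lambda>k. fourier_integral (h n) u - fourier_integral (h k) u) \<longlonglongrightarrow> fourier_integral (h n) u - fourier_integral f u"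
        using pw by (intro AE_I2 tendsto_intros)
      show "\<forall>\<^sub>F k in sequentially. normp 2 (\<lambda>u. fourier_integral (h n) u - fourier_integral (h k) u) \<le> ennreal e"
      proof (intro eventually_sequentiallyI [of N])
        fix k assume k: "N \<le> k"
        have "(\<lambda>u. fourier_integral (h n) u - fourier_integral (h k) u) = fourier_integral (\<lambda>u. h n u - h k u)"
          by (simp add: fun_eq_iff fourier_integral_diff [OF nice_integrable [OF nh] nice_integrable [OF nh]])
        then have "normp 2 (\<lambda>u. fourier_integral (h n) u - fourier_integral (h k) u) = normp 2 (\<lambda>u. h n u - h k u)"
          using nice_plancherel [OF nice_diff [OF nh nh]] by simp
        then show "normp 2 (\<lambda>u. fourier_integral (h n) u - fourier_integral (h k) u) \<le> ennreal e"
          using N [OF that k] by simp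
      qed
    qed (use Fhm Ffm in auto)
    then show "\<forall>\<^sub>F n in sequentially. normp 2 (\<lambda>u. fourier_integral (h n) u - fourier_integral f u) \<le> ennreal e"
      by (intro eventually_sequentiallyI [of N])
  qed
  have finF: "normp 2 (fourier_integral (h n)) < \<infinity>" for n
    using nice_L2 [OF nice_fourier [OF nh]] by (auto simp: L2_functions_iff)
  show ?thesis
    by (rule normp_eq_of_limits [OF _ Fhm Ffm hm fm(1) lim h(3) normp_2_finite_limit [OF Ffm Fhm finF lim] fm(2) nice_plancherel [OF nh]]) simp
qed

lemma L2_functions_diff:
  assumes "f \<in> L2_functions" "g \<in> L2_functions"
  shows "(\<lambda>u. f u - g u) \<in> L2_functions"
proof -
  have m [measurable]: "f \<in> borel_measurable lebesgue" "g \<in> borel_measurable lebesgue" using assms by (auto simp: L2_functions_iff)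
  have "normp 2 (\<lambda>u. f u - g u) \<le> ennreal (2 powr 2) * (normp 2 (\<lambda>u. f u - 0) + normp 2 (\<lambda>u. 0 - g u))"
    by (rule normp_triangle) auto
  also have "\<dots> < \<infinity>"
    using assms by (simp add: L2_functions_iff ennreal_mult_less_top)
  finally show ?thesis by (simp add: L2_functions_iff)
qed

text \<open>The definition provides some approximating sequence; Plancherel's theorem for the
  differences shows that any other one has the same limit. Gaussian combinations may thus compute
  every transform.\<close>

lemma has_fourier_transform_limit:
  assumes ft: "has_fourier_transform \<Psi> \<Phi>"
    and g: "\<And>n. g n \<in> L2_functions" "\<And>n. integrable lebesgue (g n)" "(\<lambda>n. normp 2 (\<lambda>u. g n u - \<Psi> u)) \<longlonglongrightarrow> 0"
  shows "(\<lambda>n. normp 2 (\<lambda>x. fourier_integral (g n) x - \<Phi> x)) \<longlonglongrightarrow> 0"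
proof -
  obtain f where f: "\<And>n. f n \<in> L2_functions" "\<And>n. integrable lebesgue (f n)"
      "(\<lambda>n. normp 2 (\<lambda>u. f n u - \<Psi> u)) \<longlonglongrightarrow> 0" "(\<lambda>n. normp 2 (\<lambda>x. fourier_integral (f n) x - \<Phi> x)) \<longlonglongrightarrow> 0"
    and P: "\<Psi> \<in> L2_functions" "\<Phi> \<in> L2_functions"
    using ft unfolding has_fourier_transform_def L2_normsq_normp by blast
  have Fm: "fourier_integral h \<in> borel_measurable lebesgue" if "integrable lebesgue h" for h :: "'a \<Rightarrow> complex"
    using fourier_integral_measurable [OF that] by (intro measurable_completion) simp
  have "(\<lambda>n. normp 2 (\<lambda>u. g n u - f n u)) \<longlonglongrightarrow> 0"
    by (rule normp_tendsto_triangle [where G = "\<lambda>n. \<Psi>"])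
       (use f g P in \<open>auto simp: L2_functions_iff normp_minus_commute [of 2 \<Psi>]\<close>)
  moreover have "normp 2 (\<lambda>x. fourier_integral (g n) x - fourier_integral (f n) x) = normp 2 (\<lambda>u. g n u - f n u)" for n
  proof -
    have "(\<lambda>x. fourier_integral (g n) x - fourier_integral (f n) x) = fourier_integral (\<lambda>u. g n u - f n u)"
      using f g by (simp add: fun_eq_iff fourier_integral_diff)
    then show ?thesis
      using plancherel_L1_L2 [OF Bochner_Integration.integrable_diff [OF g(2) f(2)] L2_functions_diff [OF g(1) f(1)]] by simp
  qed
  ultimately have "(\<lambda>n. normp 2 (\<lambda>x. fourier_integral (g n) x - fourier_integral (f n) x)) \<longlonglongrightarrow> 0" by simp
  then show ?thesis
    by (rule normp_tendsto_triangle [where G = "\<lambda>n. fourier_integral (f n)", rotated 4])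
       (use f g P in \<open>auto simp: L2_functions_iff intro: Fm\<close>)
qed

text \<open>Transforms of approximating Gaussian combinations are Cauchy by Plancherel's theorem and
  converge by \<open>L2_complete\<close>. This gives a meaning to the choice in
  \<open>fourier_transform\<close>.\<close>

lemma has_fourier_transform_exists:
  fixes \<Psi> :: "'a::euclidean_space \<Rightarrow> complex"
  assumes P: "\<Psi> \<in> L2_functions"
  obtains \<Phi> where "has_fourier_transform \<Psi> \<Phi>"
proof -
  have Pm: "\<Psi> \<in> borel_measurable lebesgue" "normp 2 \<Psi> < \<infinity>" using P by (auto simp: L2_functions_iff)
  obtain h where h: "\<And>n. h n \<in> gauss_combs" "(\<lambda>n. normp 2 (\<lambda>u. h n u - \<Psi> u)) \<longlonglongrightarrow> 0"
    using gauss_combs_sequence [OF P Pm(2)] by auto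
  have nh: "nice (h n)" for n by (rule nice_gauss_combs [OF h(1)])
  have hm: "h n \<in> borel_measurable lebesgue" for n by (rule nice_measurable_lebesgue [OF nh])
  have Fh: "fourier_integral (h n) \<in> borel_measurable lebesgue" "normp 2 (fourier_integral (h n)) < \<infinity>" for n
    using nice_L2 [OF nice_fourier [OF nh]] by (auto simp: L2_functions_iff)
  have eq: "normp 2 (\<lambda>u. fourier_integral (h n) u - fourier_integral (h k) u) = normp 2 (\<lambda>u. h n u - h k u)" for n k
  proof -
    have "(\<lambda>u. fourier_integral (h n) u - fourier_integral (h k) u) = fourier_integral (\<lambda>u. h n u - h k u)"
      by (simp add: fun_eq_iff fourier_integral_diff [OF nice_integrable [OF nh] nice_integrable [OF nh]])
    then show ?thesis using nice_plancherel [OF nice_diff [OF nh nh]] by simp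
  qed
  obtain \<Phi> where F: "\<Phi> \<in> borel_measurable lebesgue" "(\<lambda>n. normp 2 (\<lambda>u. fourier_integral (h n) u - \<Phi> u)) \<longlonglongrightarrow> 0"
    using L2_complete [of "\<lambda>n. fourier_integral (h n)", OF Fh] normp_2_Cauchy [OF hm Pm(1) h(2)] unfolding eq by blast
  have "\<Phi> \<in> L2_functions"
    using F(1) normp_2_finite_limit [OF F(1) Fh F(2)] by (simp add: L2_functions_iff)
  then have "has_fourier_transform \<Psi> \<Phi>"
    unfolding has_fourier_transform_def L2_normsq_normp
    using P h(2) F(2) nice_L2 [OF nh] nice_integrable [OF nh] by blast
  then show ?thesis by (rule that)
qed

lemma has_fourier_transform_fourier_transform:
  "\<Psi> \<in> L2_functions \<Longrightarrow> has_fourier_transform \<Psi> (fourier_transform \<Psi>)"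
  unfolding fourier_transform_def by (metis has_fourier_transform_exists someI_ex)

lemma has_fourier_transform_L2:
  "has_fourier_transform \<Psi> \<Phi> \<Longrightarrow> \<Psi> \<in> L2_functions" "has_fourier_transform \<Psi> \<Phi> \<Longrightarrow> \<Phi> \<in> L2_functions"
  by (auto simp: has_fourier_transform_def)

lemma has_fourier_transform_plancherel:
  assumes "has_fourier_transform \<Psi> \<Phi>"
  shows "normp 2 \<Phi> = normp 2 \<Psi>"
proof -
  obtain f where f: "\<And>n. f n \<in> L2_functions" "\<And>n. integrable lebesgue (f n)"
      "(\<lambda>n. normp 2 (\<lambda>u. f n u - \<Psi> u)) \<longlonglongrightarrow> 0" "(\<lambda>n. normp 2 (\<lambda>x. fourier_integral (f n) x - \<Phi> x)) \<longlonglongrightarrow> 0"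
    and P: "\<Psi> \<in> L2_functions" "\<Phi> \<in> L2_functions"
    using assms unfolding has_fourier_transform_def L2_normsq_normp by blast
  have Fm: "fourier_integral (f n) \<in> borel_measurable lebesgue" for n
    using fourier_integral_measurable [OF f(2)] by (intro measurable_completion) simp
  show ?thesis
    by (rule normp_eq_of_limits [OF _ Fm _ _ _ f(4) f(3)])
       (use f(1) P plancherel_L1_L2 [OF f(2) f(1)] in \<open>auto simp: L2_functions_iff\<close>)
qed

text \<open>Combined with Plancherel's theorem, a change of the function and the resulting change of
  its transform have equal norms: the error control of the Shannon case.\<close>

lemma has_fourier_transform_diff:
  assumes ft: "has_fourier_transform \<Psi> \<Phi>" "has_fourier_transform \<Psi>' \<Phi>'"
  shows "has_fourier_transform (\<lambda>u. \<Psi> u - \<Psi>' u) (\<lambda>u. \<Phi> u - \<Phi>' u)"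
proof -
  obtain f where f: "\<And>n. f n \<in> L2_functions" "\<And>n. integrable lebesgue (f n)"
      "(\<lambda>n. normp 2 (\<lambda>u. f n u - \<Psi> u)) \<longlonglongrightarrow> 0" "(\<lambda>n. normp 2 (\<lambda>x. fourier_integral (f n) x - \<Phi> x)) \<longlonglongrightarrow> 0"
    and P: "\<Psi> \<in> L2_functions" "\<Phi> \<in> L2_functions"
    using ft(1) unfolding has_fourier_transform_def L2_normsq_normp by blast
  obtain g where g: "\<And>n. g n \<in> L2_functions" "\<And>n. integrable lebesgue (g n)"
      "(\<lambda>n. normp 2 (\<lambda>u. g n u - \<Psi>' u)) \<longlonglongrightarrow> 0" "(\<lambda>n. normp 2 (\<lambda>x. fourier_integral (g n) x - \<Phi>' x)) \<longlonglongrightarrow> 0"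
    and P': "\<Psi>' \<in> L2_functions" "\<Phi>' \<in> L2_functions"
    using ft(2) unfolding has_fourier_transform_def L2_normsq_normp by blast
  have sub: "(\<lambda>n. normp 2 (\<lambda>u. (F n u - G n u) - (A u - B u))) \<longlonglongrightarrow> 0"
    if "\<And>n. F n \<in> borel_measurable lebesgue" "\<And>n. G n \<in> borel_measurable lebesgue" "A \<in> borel_measurable lebesgue" "B \<in> borel_measurable lebesgue"
      "(\<lambda>n. normp 2 (\<lambda>u. F n u - A u)) \<longlonglongrightarrow> 0" "(\<lambda>n. normp 2 (\<lambda>u. G n u - B u)) \<longlonglongrightarrow> 0"
    for F G :: "nat \<Rightarrow> 'a \<Rightarrow> complex" and A B :: "'a \<Rightarrow> complex"
  proof -
    note [measurable] = that(1-4)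
    have "(\<lambda>n. normp 2 (\<lambda>u. (F n u - A u) - (G n u - B u))) \<longlonglongrightarrow> 0"
      by (rule normp_tendsto_triangle [where G = "\<lambda>n u. 0"])
         (use that(5,6) in \<open>auto simp: normp_minus_commute [of 2 B]\<close>)
    then show ?thesis by (simp add: algebra_simps)
  qed
  have Fm: "fourier_integral h \<in> borel_measurable lebesgue" if "integrable lebesgue h" for h :: "'a \<Rightarrow> complex"
    using fourier_integral_measurable [OF that] by (intro measurable_completion) simp
  have "(\<lambda>n. normp 2 (\<lambda>u. (f n u - g n u) - (\<Psi> u - \<Psi>' u))) \<longlonglongrightarrow> 0"
    by (rule sub) (use f g P P' in \<open>auto simp: L2_functions_iff\<close>)
  moreover have "(\<lambda>n. normp 2 (\<lambda>x. fourier_integral (\<lambda>u. f n u - g n u) x - (\<Phi> x - \<Phi>' x))) \<longlonglongrightarrow> 0"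
    unfolding fourier_integral_diff [OF f(2) g(2)]
    by (rule sub) (use f g P P' Fm in \<open>auto simp: L2_functions_iff\<close>)
  ultimately show ?thesis
    unfolding has_fourier_transform_def L2_normsq_normp
    using f g P P' L2_functions_diff [OF f(1) g(1)] L2_functions_diff [OF P(1) P'(1)] L2_functions_diff [OF P(2) P'(2)] by (intro conjI exI [of _ "\<lambda>n u. f n u - g n u"]) auto
qed

section \<open>Reflection, inversion and the extension of Hausdorff-Young\<close>

lemma lebesgue_reflect: "distr lebesgue lebesgue uminus = (lebesgue :: 'a::euclidean_space measure)"
  and uminus_measurable_lebesgue [measurable]: "uminus \<in> lebesgue \<rightarrow>\<^sub>M (lebesgue :: 'a measure)"
proof -
  have eq: "(\<lambda>x. 0 + (\<Sum>j\<in>Basis. (- 1 * (x \<bullet> j)) *\<^sub>R j)) = (uminus :: 'a \<Rightarrow> 'a)"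
    by (auto simp: fun_eq_iff sum_negf euclidean_representation)
  show "uminus \<in> lebesgue \<rightarrow>\<^sub>M (lebesgue :: 'a measure)"
    using lebesgue_affine_measurable [of "\<lambda>_. -1" "0 :: 'a"] unfolding eq by simp
  show "distr lebesgue lebesgue uminus = (lebesgue :: 'a measure)"
    using lebesgue_affine_euclidean [of "\<lambda>_. -1" "0 :: 'a"] unfolding eq
    by (simp add: density_1 one_ennreal_def [symmetric])
qed

lemma nn_integral_lebesgue_reflect:
  assumes "f \<in> borel_measurable lebesgue"
  shows "(\<integral>\<^sup>+x. f (- x) \<partial>lebesgue) = (\<integral>\<^sup>+x. f x \<partial>(lebesgue :: 'a::euclidean_space measure))"
  by (subst (2) lebesgue_reflect [symmetric], subst nn_integral_distr) (use assms in auto)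

lemma normp_reflect:
  fixes f :: "'a::euclidean_space \<Rightarrow> complex"
  assumes [measurable]: "f \<in> borel_measurable lebesgue"
  shows "normp p (\<lambda>x. f (- x)) = normp p f"
  unfolding normp_def by (rule nn_integral_lebesgue_reflect) simp

lemma measurable_reflect:
  fixes f :: "'a::euclidean_space \<Rightarrow> complex"
  assumes "f \<in> borel_measurable lebesgue"
  shows "(\<lambda>x. f (- x)) \<in> borel_measurable lebesgue"
  by (rule measurable_compose [OF uminus_measurable_lebesgue assms])

text \<open>Inversion is exact for Gaussian combinations and passes to the limit. A statement about
  the pair (\<Psi>, \<Phi>) can thereby be used for \<Phi> and the reflected \<Psi>.\<close>

lemma has_fourier_transform_inversion:
  fixes \<Psi> :: "'a::euclidean_space \<Rightarrow> complex"
  assumes ft: "has_fourier_transform \<Psi> \<Phi>"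
  shows "has_fourier_transform \<Phi> (\<lambda>x. \<Psi> (- x))"
proof -
  have P: "\<Psi> \<in> L2_functions" "\<Phi> \<in> L2_functions" using has_fourier_transform_L2 [OF ft] by auto
  then have Pm: "\<Psi> \<in> borel_measurable lebesgue" "normp 2 \<Psi> < \<infinity>" by (auto simp: L2_functions_iff)
  obtain h where h: "\<And>n. h n \<in> gauss_combs" "(\<lambda>n. normp 2 (\<lambda>u. h n u - \<Psi> u)) \<longlonglongrightarrow> 0"
    using gauss_combs_sequence [OF P(1) Pm(2)] by auto
  have nh: "nice (h n)" for n by (rule nice_gauss_combs [OF h(1)])
  have "(\<lambda>n. normp 2 (\<lambda>x. fourier_integral (h n) x - \<Phi> x)) \<longlonglongrightarrow> 0"
    by (rule has_fourier_transform_limit [OF ft nice_L2 [OF nh] nice_integrable [OF nh] h(2)])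
  moreover have "normp 2 (\<lambda>x. fourier_integral (fourier_integral (h n)) x - \<Psi> (- x)) = normp 2 (\<lambda>u. h n u - \<Psi> u)" for n
  proof -
    have [measurable]: "h n \<in> borel_measurable lebesgue" by (rule nice_measurable_lebesgue [OF nh])
    have "(\<lambda>x. fourier_integral (fourier_integral (h n)) x - \<Psi> (- x)) = (\<lambda>x. (\<lambda>u. h n u - \<Psi> u) (- x))"
      using nh [of n] by (simp add: nice_def)
    then show ?thesis using normp_reflect [of "\<lambda>u. h n u - \<Psi> u" 2] Pm by simp
  qed
  moreover have "(\<lambda>x. \<Psi> (- x)) \<in> L2_functions"
    using Pm by (simp add: L2_functions_iff normp_reflect measurable_reflect)
  ultimately show ?thesis
    unfolding has_fourier_transform_def L2_normsq_normp
    using P h(2) nice_L2 [OF nice_fourier [OF nh]] nice_integrable [OF nice_fourier [OF nh]] by (intro conjI exI [of _ "\<lambda>n. fourier_integral (h n)"]) auto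
qed

text \<open>The transforms are known to converge in L^2 only, hence Fatou's lemma along an almost
  everywhere convergent subsequence. On the other side the functions converge in L^p, so the bound
  holds with A + e, and e tends to 0.\<close>

theorem hausdorff_young:
  fixes \<Psi> :: "'a::euclidean_space \<Rightarrow> complex"
  assumes ft: "has_fourier_transform \<Psi> \<Phi>" and p: "1 < p" "p < 2" and A: "0 \<le> A" "normp p \<Psi> \<le> ennreal A"
  shows "normp (p / (p - 1)) \<Phi> \<le> ennreal (beckner p DIM('a) * A powr (1 / (p - 1)))"
proof -
  define q where "q = p / (p - 1)"
  define w where "w = 1 / (p - 1)"
  have w: "0 < w" using p by (simp add: w_def)
  have q: "1 \<le> q" using p by (simp add: q_def)
  have b: "0 \<le> beckner p DIM('a)" by (simp add: beckner_def)
  have P: "\<Psi> \<in> L2_functions" "\<Phi> \<in> L2_functions" using has_fourier_transform_L2 [OF ft] by auto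
  have Pm: "\<Psi> \<in> borel_measurable lebesgue" "\<Phi> \<in> borel_measurable lebesgue" using P by (auto simp: L2_functions_iff)
  have "normp p \<Psi> < \<infinity>" using A by (auto intro: le_less_trans)
  then obtain h where h: "\<And>n. h n \<in> gauss_combs" "(\<lambda>n. normp p (\<lambda>u. h n u - \<Psi> u)) \<longlonglongrightarrow> 0"
    "(\<lambda>n. normp 2 (\<lambda>u. h n u - \<Psi> u)) \<longlonglongrightarrow> 0"
    using gauss_combs_sequence [OF P(1), of p] p by auto
  have nh: "nice (h n)" for n by (rule nice_gauss_combs [OF h(1)])
  have hm: "h n \<in> borel_measurable lebesgue" for n by (rule nice_measurable_lebesgue [OF nh])
  have Fhm: "fourier_integral (h n) \<in> borel_measurable lebesgue" for n
    by (rule nice_measurable_lebesgue [OF nice_fourier [OF nh]])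
  have "(\<lambda>n. normp 2 (\<lambda>x. fourier_integral (h n) x - \<Phi> x)) \<longlonglongrightarrow> 0"
    by (rule has_fourier_transform_limit [OF ft nice_L2 [OF nh] nice_integrable [OF nh] h(3)])
  then obtain r where r: "strict_mono r" "AE u in lebesgue. (\<lambda>n. fourier_integral (h (r n)) u) \<longlonglongrightarrow> \<Phi> u"
    using normp_2_AE_subseq [of "\<lambda>n. fourier_integral (h n)", OF Fhm Pm(2)] by blast
  have HY: "normp q (fourier_integral (h n)) \<le> ennreal (beckner p DIM('a) * B powr w)" if "normp p (h n) \<le> ennreal B" "0 \<le> B" for n B
  proof -
    obtain \<mu> S c where hc: "h n = gauss_comb \<mu> S c" "0 < \<mu>" "finite S"
      using h(1) [of n] by (auto simp: gauss_combs_def)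
    have le: "(\<integral>\<xi>. cmod (fourier_integral (h n) \<xi>) powr q \<partial>lborel) \<le> beckner p DIM('a) * (\<integral>u. cmod (h n u) powr p \<partial>lborel) powr w"
      unfolding hc(1) q_def w_def by (rule hausdorff_young_gauss_comb [OF hc(3) p hc(2)])
    have "(\<integral>u. cmod (h n u) powr p \<partial>lborel) \<le> B"
      using that p unfolding nice_normp [OF nh less_imp_le [OF p(1)]] by (simp add: ennreal_le_iff)
    then have "(\<integral>u. cmod (h n u) powr p \<partial>lborel) powr w \<le> B powr w"
      using w by (intro powr_mono2) (auto intro: integral_nonneg_AE)
    then have "(\<integral>\<xi>. cmod (fourier_integral (h n) \<xi>) powr q \<partial>lborel) \<le> beckner p DIM('a) * B powr w"
      using le mult_left_mono [OF _ b] order_trans by blast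
    then show ?thesis
      unfolding nice_normp [OF nice_fourier [OF nh] q] by (rule ennreal_leI)
  qed
  have le: "normp q \<Phi> \<le> ennreal (beckner p DIM('a) * (A + e) powr w)" if e: "0 < e" for e
  proof (rule normp_Fatou [OF Fhm Pm(2) _ r(2)])
    have "\<forall>\<^sub>F n in sequentially. normp p (h n) \<le> ennreal (A + e)"
      by (rule normp_limit_le_eventually [OF _ hm Pm(1) h(2) A e]) (use p in simp)
    then have "\<forall>\<^sub>F n in sequentially. normp p (h (r n)) \<le> ennreal (A + e)"
      by (rule eventually_subseq [OF r(1)])
    then show "\<forall>\<^sub>F n in sequentially. normp q (fourier_integral (h (r n))) \<le> ennreal (beckner p DIM('a) * (A + e) powr w)"
      by eventually_elim (use A e in \<open>auto intro: HY\<close>)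
  qed (use q in simp)
  have "((\<lambda>e. beckner p DIM('a) * (A + e) powr w) \<longlongrightarrow> beckner p DIM('a) * (A + 0) powr w) (at_right 0)"
    using w A by (intro tendsto_intros tendsto_powr') (auto simp: eventually_at_right_less intro!: eventually_mono [OF eventually_at_right_less])
  then have "((\<lambda>e. ennreal (beckner p DIM('a) * (A + e) powr w)) \<longlongrightarrow> ennreal (beckner p DIM('a) * A powr w)) (at_right 0)"
    by (intro tendsto_ennrealI) simp
  then have "normp q \<Phi> \<le> ennreal (beckner p DIM('a) * A powr w)"
    by (rule tendsto_lowerbound) (auto intro!: eventually_mono [OF eventually_at_right_less] le simp: trivial_limit_at_right_real)
  then show ?thesis by (simp add: q_def w_def)
qed

lemma fourier_transform_sup_bound:
  fixes \<Psi> :: "'a::euclidean_space \<Rightarrow> complex"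
  assumes ft: "has_fourier_transform \<Psi> \<Phi>" and A: "0 \<le> A" "normp 1 \<Psi> \<le> ennreal A"
  shows "AE x in lebesgue. cmod (\<Phi> x) \<le> (2 * pi) powr (- real DIM('a) / 2) * A"
proof -
  have P: "\<Psi> \<in> L2_functions" "\<Phi> \<in> L2_functions" using has_fourier_transform_L2 [OF ft] by auto
  have Pm [measurable]: "\<Psi> \<in> borel_measurable lebesgue" "\<Phi> \<in> borel_measurable lebesgue" using P by (auto simp: L2_functions_iff)
  have i: "integrable lebesgue \<Psi>"
    using le_less_trans [OF A(2), of \<infinity>] by (auto simp: integrable_iff_bounded normp_def)
  have [measurable]: "fourier_integral \<Psi> \<in> borel_measurable lebesgue"
    using fourier_integral_measurable [OF i] by (intro measurable_completion) simp
  \<comment> \<open>As \<Psi> is integrable, the constant sequence is admissible; the transform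
    therefore agrees almost everywhere with the Fourier integral.\<close>
  have "(\<lambda>n::nat. normp 2 (\<lambda>x. fourier_integral \<Psi> x - \<Phi> x)) \<longlonglongrightarrow> 0"
    by (rule has_fourier_transform_limit [OF ft]) (use P i in \<open>auto simp: normp_def\<close>)
  then have "normp 2 (\<lambda>x. fourier_integral \<Psi> x - \<Phi> x) = 0" by (simp add: LIMSEQ_const_iff)
  then have "AE x in lebesgue. fourier_integral \<Psi> x = \<Phi> x"
    unfolding normp_def by (subst (asm) nn_integral_0_iff_AE) auto
  then show ?thesis
  proof eventually_elim
    case (elim x)
    have "(\<integral>u. cmod (\<Psi> u) \<partial>lebesgue) \<le> A"
      unfolding integral_cmod_normp [OF Pm(1)] using A by (simp add: enn2real_leI)
    then have "(2 * pi) powr (- real DIM('a) / 2) * (\<integral>u. cmod (\<Psi> u) \<partial>lebesgue) \<le> (2 * pi) powr (- real DIM('a) / 2) * A"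
      by (rule mult_left_mono) simp
    from order_trans [OF norm_fourier_integral_le [of \<Psi> x] this] show ?case using elim by simp
  qed
qed

section \<open>Monotonicity of Renyi entropy powers in the index\<close>

lemma normp_eq_0_imp:
  assumes "f \<in> borel_measurable lebesgue" "normp p f = 0"
  shows "normp q f = 0"
proof -
  have "AE u in lebesgue. f u = 0"
    using assms unfolding normp_def by (subst (asm) nn_integral_0_iff_AE) auto
  then have "normp q f = (\<integral>\<^sup>+u. 0 \<partial>(lebesgue :: 'a measure))"
    unfolding normp_def by (intro nn_integral_cong_AE) (auto elim: eventually_mono)
  then show ?thesis by simp
qed

lemma normp_0: "f \<in> borel_measurable lebesgue \<Longrightarrow> normp 0 f = emeasure lebesgue {u. f u \<noteq> 0}"
proof -
  assume [measurable]: "f \<in> borel_measurable lebesgue"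
  have "{u \<in> space lebesgue. f u \<noteq> 0} \<in> sets lebesgue" by measurable
  then have "(\<integral>\<^sup>+u. indicator {u. f u \<noteq> 0} u \<partial>lebesgue) = emeasure lebesgue {u. f u \<noteq> 0}"
    by (intro nn_integral_indicator) simp
  then show ?thesis unfolding normp_def
    by (subst (asm) nn_integral_cong [where v = "\<lambda>u. ennreal (cmod (f u) powr 0)"]) (auto simp: indicator_def)
qed

lemma renyi_entropy_normp:
  assumes "f \<in> borel_measurable lebesgue" "l \<noteq> 1"
  shows "renyi_entropy l f = ereal (1 / (1 - l)) * eln (normp (2 * l) f)"
  using assms normp_0 [OF assms(1)] by (auto simp: renyi_entropy_def normp_def one_ereal_def [symmetric])

text \<open>The sign of 1 / (1 - l) decides what a divergent integral means: an infinite power for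
  indices below 1, power 0 for indices above 1.\<close>

lemma renyi_power_infinite:
  fixes f :: "'a::euclidean_space \<Rightarrow> complex"
  assumes "f \<in> borel_measurable lebesgue" "l < 1" "normp (2 * l) f = \<infinity>"
  shows "renyi_power l f = \<infinity>"
  using assms by (simp add: renyi_power_def renyi_entropy_normp eln_def eexp_def)

lemma renyi_power_zero:
  fixes f :: "'a::euclidean_space \<Rightarrow> complex"
  assumes "f \<in> borel_measurable lebesgue" "1 < l" "normp (2 * l) f = \<infinity>"
  shows "renyi_power l f = 0"
  using assms by (simp add: renyi_power_def renyi_entropy_normp eln_def eexp_def)

lemma renyi_power_finite:
  fixes f :: "'a::euclidean_space \<Rightarrow> complex"
  assumes "f \<in> borel_measurable lebesgue" "l \<noteq> 1" "normp (2 * l) f = ennreal A" "0 < A"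
  shows "renyi_power l f = ennreal (A powr (1 / (real DIM('a) * (1 - l))))"
proof -
  have "renyi_entropy l f = ereal (1 / (1 - l) * ln A)"
    using assms by (simp add: renyi_entropy_normp eln_def)
  then have "renyi_power l f = ennreal (exp (1 / real DIM('a) * (1 / (1 - l) * ln A)))"
    by (simp add: renyi_power_def eexp_def)
  also have "1 / real DIM('a) * (1 / (1 - l) * ln A) = 1 / (real DIM('a) * (1 - l)) * ln A"
    by (simp add: divide_simps)
  finally show ?thesis using assms by (simp add: powr_def)
qed

text \<open>The value 0 is excluded by the normalisation in L^2. Either the integral diverges or the
  power has a closed formula with a positive base.\<close>

lemma normp_cases:
  assumes f: "f \<in> borel_measurable lebesgue" "normp 2 f = 1"
  obtains "normp p f = \<infinity>" | A where "0 < A" "normp p f = ennreal A"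
proof (cases "normp p f")
  case (real A)
  have "normp p f \<noteq> 0" using normp_eq_0_imp [OF f(1), of p 2] f(2) by auto
  then show ?thesis using real that(2) [of A] by (cases "A = 0") auto
next
  case top
  then show ?thesis using that(1) by simp
qed

lemma renyi_power_pos:
  fixes f :: "'a::euclidean_space \<Rightarrow> complex"
  assumes f: "f \<in> borel_measurable lebesgue" "normp 2 f = 1" and l: "l < 1"
  shows "renyi_power l f \<noteq> 0"
  using normp_cases [OF f, of "2 * l"]
proof cases
  case 1
  then show ?thesis using renyi_power_infinite [OF f(1) l] by simp
next
  case (2 A)
  then show ?thesis using renyi_power_finite [OF f(1) _ 2(2,1)] l by (simp add: ennreal_eq_0_iff not_le)
qed

text \<open>Log-convexity of the integrals in the exponent. Young's inequality for the integrands
  divided by \<open>A\<close> and \<open>B\<close> gives a bound whose integral is t + (1 - t) =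
  1.\<close>

lemma Hoelder_normp:
  assumes [measurable]: "f \<in> borel_measurable lebesgue" and t: "0 \<le> t" "t \<le> 1"
    and A: "0 < A" "normp a f = ennreal A" and B: "0 < B" "normp b f = ennreal B"
  shows "normp (t * a + (1 - t) * b) f \<le> ennreal (A powr t * B powr (1 - t))"
proof -
  have "ennreal (cmod (f u) powr (t * a + (1 - t) * b)) \<le>
     ennreal (A powr t * B powr (1 - t)) * (ennreal (t / A) * ennreal (cmod (f u) powr a) + ennreal ((1 - t) / B) * ennreal (cmod (f u) powr b))" for u
  proof (cases "f u = 0")
    case False
    define x where "x = cmod (f u)"
    have x: "0 < x" using False by (simp add: x_def)
    have "(x powr a / A) powr t * (x powr b / B) powr (1 - t) \<le> t * (x powr a / A) + (1 - t) * (x powr b / B)"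
      using t x A B by (intro Youngs_inequality_0) auto
    also have "(x powr a / A) powr t * (x powr b / B) powr (1 - t) = x powr (t * a + (1 - t) * b) / (A powr t * B powr (1 - t))"
      using x A B by (simp add: powr_divide powr_powr powr_add mult.commute)
    finally have "x powr (t * a + (1 - t) * b) \<le> (A powr t * B powr (1 - t)) * (t / A * x powr a + (1 - t) / B * x powr b)"
      using A B by (simp add: field_simps)
    then show ?thesis
      unfolding x_def [symmetric] using t A B
      by (simp add: ennreal_mult[symmetric] ennreal_plus[symmetric] ennreal_leI del: ennreal_plus)
  qed simp
  then have "normp (t * a + (1 - t) * b) f \<le> (\<integral>\<^sup>+u. ennreal (A powr t * B powr (1 - t)) * (ennreal (t / A) * ennreal (cmod (f u) powr a) + ennreal ((1 - t) / B) * ennreal (cmod (f u) powr b)) \<partial>lebesgue)"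
    unfolding normp_def by (rule nn_integral_mono)
  also have "\<dots> = ennreal (A powr t * B powr (1 - t)) * (ennreal (t / A) * normp a f + ennreal ((1 - t) / B) * normp b f)"
    unfolding normp_def by (subst nn_integral_cmult, simp, subst nn_integral_add, simp, simp, subst nn_integral_cmult, simp, subst nn_integral_cmult) auto
  also have "ennreal (t / A) * normp a f + ennreal ((1 - t) / B) * normp b f = 1"
    unfolding A(2) B(2) using t A(1) B(1) by (simp add: ennreal_mult[symmetric] ennreal_plus[symmetric] del: ennreal_plus)
  finally show ?thesis by simp
qed

text \<open>2 a is a convex combination of 2 b and 2, and the integral at exponent 2 equals 1;
  Hoelder's inequality then compares the integrals at 2 a and 2 b directly.\<close>

lemma renyi_power_antimono_below_1:
  fixes f :: "'a::euclidean_space \<Rightarrow> complex"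
  assumes f: "f \<in> borel_measurable lebesgue" "normp 2 f = 1" and ab: "b \<le> a" "a < 1"
  shows "renyi_power a f \<le> renyi_power b f"
  using normp_cases [OF f, of "2 * b"]
proof cases
  case 1
  then show ?thesis using renyi_power_infinite [OF f(1), of b] ab by simp
next
  case (2 B)
  define t where "t = (1 - a) / (1 - b)"
  have t: "0 < t" "t \<le> 1" "t * (1 - b) = 1 - a" using ab by (auto simp: t_def)
  have "t * (2 * b) + (1 - t) * 2 = 2 * (1 - t * (1 - b))" by (simp add: algebra_simps)
  then have e: "t * (2 * b) + (1 - t) * 2 = 2 * a" unfolding t(3) by simp
  have le: "normp (2 * a) f \<le> ennreal (B powr t)"
    using Hoelder_normp [OF f(1) _ t(2) 2, of 1 2] t f(2) unfolding e by simp
  obtain A where A: "0 < A" "normp (2 * a) f = ennreal A"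
    using normp_cases [OF f, of "2 * a"] le by (metis ennreal_neq_top infinity_ennreal_def neq_top_trans)
  have "A \<le> B powr t" using le A by (simp add: ennreal_le_iff)
  then have "A powr (1 / (real DIM('a) * (1 - a))) \<le> (B powr t) powr (1 / (real DIM('a) * (1 - a)))"
    using A ab by (intro powr_mono2) auto
  also have "\<dots> = B powr (1 / (real DIM('a) * (1 - b)))"
    unfolding powr_powr t(3) [symmetric] using t(1) by simp
  finally show ?thesis
    using renyi_power_finite [OF f(1) _ A(2,1)] renyi_power_finite [OF f(1) _ 2(2,1)] ab by (simp add: ennreal_leI)
qed

text \<open>Here 2 lies between 2 b and 2 a, so 1 is bounded by a product of powers of both
  integrals; the negative exponent 1 / (1 - a) puts one of them on the other side.\<close>

lemma renyi_power_antimono_across_1: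
  fixes f :: "'a::euclidean_space \<Rightarrow> complex"
  assumes f: "f \<in> borel_measurable lebesgue" "normp 2 f = 1" and ab: "b < 1" "1 < a"
  shows "renyi_power a f \<le> renyi_power b f"
  using normp_cases [OF f, of "2 * b"]
proof cases
  case 1
  then show ?thesis using renyi_power_infinite [OF f(1), of b] ab by simp
next
  case (2 B)
  show ?thesis
    using normp_cases [OF f, of "2 * a"]
  proof cases
    case 1
    then show ?thesis using renyi_power_zero [OF f(1), of a] ab by simp
  next
    case A: (2 A)
    define t where "t = (a - 1) / (a - b)"
    have t: "0 < t" "t \<le> 1" "t * (a - b) = a - 1" "(1 - t) * (a - b) = 1 - b" using ab by (auto simp: t_def field_simps)
    have "t * (2 * b) + (1 - t) * (2 * a) = 2 * (a - t * (a - b))" by (simp add: algebra_simps)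
    then have e: "t * (2 * b) + (1 - t) * (2 * a) = 2" unfolding t(3) by simp
    have "1 \<le> ennreal (B powr t * A powr (1 - t))"
      using Hoelder_normp [OF f(1) _ t(2) 2 A] t f(2) unfolding e by simp
    then have "1 \<le> B powr t * A powr (1 - t)" by simp
    then have "1 powr ((a - b) / (real DIM('a) * (1 - b) * (a - 1))) \<le> (B powr t * A powr (1 - t)) powr ((a - b) / (real DIM('a) * (1 - b) * (a - 1)))"
      using ab by (intro powr_mono2) auto
    also have "\<dots> = B powr (t * (a - b) / (real DIM('a) * (1 - b) * (a - 1))) * A powr ((1 - t) * (a - b) / (real DIM('a) * (1 - b) * (a - 1)))"
      using 2 A by (simp add: powr_mult powr_powr)
    also have "\<dots> = B powr (1 / (real DIM('a) * (1 - b))) * A powr (1 / (real DIM('a) * (a - 1)))"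
      unfolding t(3,4) using ab by simp
    also have "A powr (1 / (real DIM('a) * (a - 1))) = 1 / A powr (1 / (real DIM('a) * (1 - a)))"
    proof -
      have "1 / (real DIM('a) * (a - 1)) = - (1 / (real DIM('a) * (1 - a)))"
        using ab by (simp add: field_simps)
      then show ?thesis by (simp only: powr_minus_divide)
    qed
    finally have "A powr (1 / (real DIM('a) * (1 - a))) \<le> B powr (1 / (real DIM('a) * (1 - b)))"
      using A by (simp add: field_simps)
    then show ?thesis
      using renyi_power_finite [OF f(1) _ A(2,1)] renyi_power_finite [OF f(1) _ 2(2,1)] ab by (simp add: ennreal_leI)
  qed
qed

section \<open>Comparison with the Shannon entropy\<close>

lemma shannon_pos_finite:
  fixes f :: "'a::euclidean_space \<Rightarrow> complex"
  assumes [measurable]: "f \<in> borel_measurable lebesgue" and b: "b < 1" and fin: "normp (2 * b) f < \<infinity>"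
  shows "shannon_pos f < \<infinity>"
proof -
  have pt: "ennreal (- ((cmod (f u))\<^sup>2 * ln ((cmod (f u))\<^sup>2))) \<le> ennreal (1 / (1 - b)) * ennreal (cmod (f u) powr (2 * b))" for u
  proof (cases "f u = 0")
    case False
    define x where "x = (cmod (f u))\<^sup>2"
    have x: "0 < x" using False by (simp add: x_def)
    have xb: "cmod (f u) powr (2 * b) = x powr b"
      unfolding x_def using False by (simp add: powr_powr powr_numeral [symmetric] del: powr_numeral)
    \<comment> \<open>From ln y \<le> y - 1 at y = x^(b - 1). Multiplied by x, it bounds - x ln x by
      x^b / (1 - b).\<close>
    have "(b - 1) * ln x \<le> x powr (b - 1)"
      using ln_le_minus_one [of "x powr (b - 1)"] x by (simp add: ln_powr)
    then have "x * ((b - 1) * ln x) \<le> x * x powr (b - 1)"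
      using x by (intro mult_left_mono) auto
    also have "\<dots> = x powr b" using x by (simp add: powr_diff)
    finally have "- (x * ln x) \<le> 1 / (1 - b) * x powr b"
      using b by (simp add: field_simps)
    then show ?thesis
      unfolding xb x_def [symmetric] using b by (simp add: ennreal_mult[symmetric] ennreal_leI)
  qed simp
  have "shannon_pos f \<le> (\<integral>\<^sup>+u. ennreal (1 / (1 - b)) * ennreal (cmod (f u) powr (2 * b)) \<partial>lebesgue)"
    unfolding shannon_pos_def by (rule nn_integral_mono) (rule pt)
  also have "\<dots> = ennreal (1 / (1 - b)) * normp (2 * b) f"
    unfolding normp_def by (rule nn_integral_cmult) simp
  also have "\<dots> < \<infinity>" using fin by (simp add: ennreal_mult_less_top)
  finally show ?thesis .
qed

lemma shannon_integrable:
  fixes f :: "'a::euclidean_space \<Rightarrow> complex"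
  assumes [measurable]: "f \<in> borel_measurable lebesgue" and fin: "shannon_pos f < \<infinity>" "shannon_neg f < \<infinity>"
  shows "integrable lebesgue (\<lambda>u. (cmod (f u))\<^sup>2 * ln ((cmod (f u))\<^sup>2))" (is "integrable _ ?g")
    and "(\<integral>u. (cmod (f u))\<^sup>2 * ln ((cmod (f u))\<^sup>2) \<partial>lebesgue) = enn2real (shannon_neg f) - enn2real (shannon_pos f)"
proof -
  show i: "integrable lebesgue ?g"
    using fin unfolding shannon_pos_def shannon_neg_def real_integrable_def by auto
  show "(\<integral>u. ?g u \<partial>lebesgue) = enn2real (shannon_neg f) - enn2real (shannon_pos f)"
    unfolding shannon_pos_def shannon_neg_def by (rule real_lebesgue_integral_def [OF i])
qed

lemma renyi_power_1_finite:
  fixes f :: "'a::euclidean_space \<Rightarrow> complex"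
  assumes "shannon_pos f < \<infinity>" "shannon_neg f < \<infinity>"
  shows "renyi_power 1 f = ennreal (exp ((enn2real (shannon_pos f) - enn2real (shannon_neg f)) / real DIM('a)))"
proof -
  have e: "enn2ereal x = ereal (enn2real x)" if "x < \<infinity>" for x
    using that by (cases x) (auto simp: enn2ereal_ennreal)
  show ?thesis
    unfolding renyi_power_def renyi_entropy_def using e [OF assms(1)] e [OF assms(2)]
    by (simp add: eexp_def)
qed

lemma renyi_power_1_zero:
  assumes "shannon_pos f < \<infinity>" "shannon_neg f = \<infinity>"
  shows "renyi_power 1 f = 0"
proof -
  have "enn2ereal (shannon_pos f) - enn2ereal (shannon_neg f) = - \<infinity>"
    using assms by (cases "shannon_pos f") (auto simp: enn2ereal_ennreal)
  then show ?thesis by (simp add: renyi_power_def renyi_entropy_def eexp_def)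
qed

lemma renyi_power_1_infinite:
  assumes "shannon_pos f = \<infinity>" "shannon_neg f < \<infinity>"
  shows "renyi_power 1 f = \<infinity>"
proof -
  have "enn2ereal (shannon_pos f) - enn2ereal (shannon_neg f) = \<infinity>"
    using assms by (cases "shannon_neg f") (auto simp: enn2ereal_ennreal)
  then show ?thesis by (simp add: renyi_power_def renyi_entropy_def eexp_def)
qed

text \<open>Jensen's inequality by the tangent ln y \<le> y - 1 at y = x^(b - 1) / B, where x =
  |f|^2; this y has mean 1 for the density x. If the power at \<open>b\<close> is infinite, the
  Shannon integral may fail to exist, hence the disjunction.\<close>

lemma renyi_power_antimono_at_1:
  fixes f :: "'a::euclidean_space \<Rightarrow> complex"
  assumes f: "f \<in> borel_measurable lebesgue" "normp 2 f = 1" and b: "b < 1"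
  shows "renyi_power b f = \<infinity> \<or> shannon_pos f < \<infinity> \<and> renyi_power 1 f \<le> renyi_power b f"
  using normp_cases [OF f, of "2 * b"]
proof cases
  case 1
  then show ?thesis using renyi_power_infinite [OF f(1), of b] b by simp
next
  case (2 B)
  have fin: "shannon_pos f < \<infinity>" by (rule shannon_pos_finite [OF f(1) b]) (use 2 in simp)
  have "renyi_power 1 f \<le> renyi_power b f"
  proof (cases "shannon_neg f = \<infinity>")
    case True
    then show ?thesis using renyi_power_1_zero [OF fin] by simp
  next
    case False
    then have fin2: "shannon_neg f < \<infinity>" by (simp add: less_top)
    note [measurable] = f(1)
    let ?X = "\<lambda>u. (cmod (f u))\<^sup>2"
    have iX: "integrable lebesgue ?X" "(\<integral>u. ?X u \<partial>lebesgue) = 1"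
      using f(2) unfolding normp_def by (auto simp: powr_numeral integral_eq_nn_integral intro!: integrableI_nonneg)
    have iB: "integrable lebesgue (\<lambda>u. cmod (f u) powr (2 * b))" "(\<integral>u. cmod (f u) powr (2 * b) \<partial>lebesgue) = B"
      using 2 unfolding normp_def by (auto simp: integral_eq_nn_integral intro!: integrableI_nonneg)
    note ig = shannon_integrable [OF f(1) fin fin2]
    have "(\<integral>u. (b - 1) * (?X u * ln (?X u)) \<partial>lebesgue) \<le> (\<integral>u. (ln B - 1) * ?X u + (1 / B) * cmod (f u) powr (2 * b) \<partial>lebesgue)"
    proof (rule integral_mono)
      fix u
      show "(b - 1) * (?X u * ln (?X u)) \<le> (ln B - 1) * ?X u + (1 / B) * cmod (f u) powr (2 * b)"
      proof (cases "f u = 0")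
        case False
        define x where "x = ?X u"
        have x: "0 < x" using False by (simp add: x_def)
        have xb: "cmod (f u) powr (2 * b) = x powr b"
          unfolding x_def using False by (simp add: powr_powr powr_numeral [symmetric] del: powr_numeral)
        have "ln (x powr (b - 1) / B) \<le> x powr (b - 1) / B - 1"
          using x 2 by (intro ln_le_minus_one) auto
        then have "(b - 1) * ln x \<le> (ln B - 1) + x powr (b - 1) / B"
          using x 2 by (simp add: ln_div ln_powr)
        then have "x * ((b - 1) * ln x) \<le> x * ((ln B - 1) + x powr (b - 1) / B)"
          using x by (intro mult_left_mono) auto
        also have "\<dots> = (ln B - 1) * x + (1 / B) * x powr b"
          using x 2 by (simp add: powr_diff field_simps)
        finally show ?thesis unfolding xb x_def [symmetric] by (simp add: mult_ac)
      qed simp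
    qed (use ig iX iB in auto)
    also have "\<dots> = (ln B - 1) * 1 + (1 / B) * B"
      using iX iB by simp
    also have "\<dots> = ln B" using 2 by simp
    finally have "(1 - b) * (enn2real (shannon_pos f) - enn2real (shannon_neg f)) \<le> ln B"
      using ig by (simp add: algebra_simps)
    then have "enn2real (shannon_pos f) - enn2real (shannon_neg f) \<le> ln B / (1 - b)"
      using b by (simp add: pos_le_divide_eq mult.commute)
    then have "(enn2real (shannon_pos f) - enn2real (shannon_neg f)) / real DIM('a) \<le> ln B / (1 - b) / real DIM('a)"
      by (rule divide_right_mono) simp
    also have "\<dots> = 1 / (real DIM('a) * (1 - b)) * ln B" by simp
    finally have "(enn2real (shannon_pos f) - enn2real (shannon_neg f)) / real DIM('a) \<le> 1 / (real DIM('a) * (1 - b)) * ln B" .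
    then have "exp ((enn2real (shannon_pos f) - enn2real (shannon_neg f)) / real DIM('a)) \<le> B powr (1 / (real DIM('a) * (1 - b)))"
      using 2 by (simp add: powr_def)
    then show ?thesis
      using renyi_power_1_finite [OF fin fin2] renyi_power_finite [OF f(1) _ 2(2,1)] b by (simp add: ennreal_leI)
  qed
  then show ?thesis using fin by simp
qed

lemma integrable_normp_powr:
  assumes [measurable]: "f \<in> borel_measurable lebesgue" and "normp p f < \<infinity>"
  shows "integrable lebesgue (\<lambda>u. cmod (f u) powr p)" "(\<integral>u. cmod (f u) powr p \<partial>lebesgue) = enn2real (normp p f)"
  using assms unfolding normp_def by (auto simp: integral_eq_nn_integral intro!: integrableI_nonneg)

lemma integrable_normp_2:
  assumes [measurable]: "f \<in> borel_measurable lebesgue" and "normp 2 f < \<infinity>"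
  shows "integrable lebesgue (\<lambda>u. (cmod (f u))\<^sup>2)" "(\<integral>u. (cmod (f u))\<^sup>2 \<partial>lebesgue) = enn2real (normp 2 f)"
  using integrable_normp_powr [OF assms] by (simp_all add: powr_numeral)

section \<open>The Shannon case\<close>

text \<open>Only large values are truncated: the part where the logarithm is negative is integrable
  as soon as \<open>shannon_pos\<close> is finite.\<close>

definition trunc_log :: "real \<Rightarrow> ('a::euclidean_space \<Rightarrow> complex) \<Rightarrow> 'a \<Rightarrow> real" where
  "trunc_log M f u = (cmod (f u))\<^sup>2 * ln (min (cmod (f u)) M)"

lemma neg_log_part:
  assumes "z \<noteq> (0 :: complex)"
  shows "(cmod z)\<^sup>2 * ln ((cmod z)\<^sup>2) = 2 * ((cmod z)\<^sup>2 * ln (cmod z))"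
  using assms by (simp add: ln_realpow)

lemma half_max: "max 0 (- (2 * y)) / 2 = max 0 (- y)" for y :: real
  by (auto simp: max_def)

lemma trunc_log_abs_bound:
  fixes f :: "'a::euclidean_space \<Rightarrow> complex"
  assumes M: "1 \<le> M"
  shows "(cmod (f u))\<^sup>2 * \<bar>ln (min (cmod (f u)) M)\<bar> \<le>
     max 0 (- ((cmod (f u))\<^sup>2 * ln ((cmod (f u))\<^sup>2))) / 2 + ln M * (cmod (f u))\<^sup>2"
proof (cases "f u = 0")
  case False
  define x where "x = cmod (f u)"
  have x: "0 < x" using False by (simp add: x_def)
  have lM: "0 \<le> ln M" using M by simp
  have "x\<^sup>2 * \<bar>ln (min x M)\<bar> \<le> max 0 (- (x\<^sup>2 * ln x)) + ln M * x\<^sup>2"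
  proof (cases "x \<le> 1")
    case True
    then have "\<bar>ln (min x M)\<bar> = - ln x" using x M by (simp add: min_def abs_if ln_less_zero_iff)
    moreover have "0 \<le> ln M * x\<^sup>2" using lM by simp
    ultimately show ?thesis by simp
  next
    case False
    then have "\<bar>ln (min x M)\<bar> \<le> ln M" using M by (auto simp: min_def)
    then have "x\<^sup>2 * \<bar>ln (min x M)\<bar> \<le> x\<^sup>2 * ln M" by (intro mult_left_mono) auto
    then show ?thesis by (simp add: mult.commute max_def)
  qed
  moreover have "max 0 (- (x\<^sup>2 * ln (x\<^sup>2))) / 2 = max 0 (- (x\<^sup>2 * ln x))"
    unfolding x_def neg_log_part [OF False] by (rule half_max)
  ultimately show ?thesis by (simp add: x_def)
qed simp

lemma integrable_shannon_pos_part: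
  fixes f :: "'a::euclidean_space \<Rightarrow> complex"
  assumes [measurable]: "f \<in> borel_measurable lebesgue" and "shannon_pos f < \<infinity>"
  shows "integrable lebesgue (\<lambda>u. max 0 (- ((cmod (f u))\<^sup>2 * ln ((cmod (f u))\<^sup>2))))"
    and "(\<integral>u. max 0 (- ((cmod (f u))\<^sup>2 * ln ((cmod (f u))\<^sup>2))) \<partial>lebesgue) = enn2real (shannon_pos f)"
proof -
  have e: "(\<integral>\<^sup>+u. ennreal (max 0 (- ((cmod (f u))\<^sup>2 * ln ((cmod (f u))\<^sup>2)))) \<partial>lebesgue) = shannon_pos f"
    unfolding shannon_pos_def by (intro nn_integral_cong) (auto simp: max_def ennreal_neg)
  show "integrable lebesgue (\<lambda>u. max 0 (- ((cmod (f u))\<^sup>2 * ln ((cmod (f u))\<^sup>2))))"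
    using assms(2) e by (intro integrableI_nonneg) auto
  show "(\<integral>u. max 0 (- ((cmod (f u))\<^sup>2 * ln ((cmod (f u))\<^sup>2))) \<partial>lebesgue) = enn2real (shannon_pos f)"
    by (subst integral_eq_nn_integral) (auto simp: e)
qed

lemma integrable_trunc_log_abs:
  fixes f :: "'a::euclidean_space \<Rightarrow> complex"
  assumes m [measurable]: "f \<in> borel_measurable lebesgue" and f: "normp 2 f = 1" "shannon_pos f < \<infinity>" and M: "1 \<le> M"
  shows "integrable lebesgue (\<lambda>u. (cmod (f u))\<^sup>2 * \<bar>ln (min (cmod (f u)) M)\<bar>)" "integrable lebesgue (trunc_log M f)"
proof -
  have "integrable lebesgue (\<lambda>u. max 0 (- ((cmod (f u))\<^sup>2 * ln ((cmod (f u))\<^sup>2))) / 2 + ln M * (cmod (f u))\<^sup>2)"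
    using integrable_shannon_pos_part(1) [OF m f(2)] integrable_normp_2(1) [OF m] f by simp
  then show i: "integrable lebesgue (\<lambda>u. (cmod (f u))\<^sup>2 * \<bar>ln (min (cmod (f u)) M)\<bar>)"
    by (rule Bochner_Integration.integrable_bound) (use trunc_log_abs_bound [OF M, of f] in \<open>auto intro!: AE_I2 order_trans [OF _ abs_ge_self]\<close>)
  show "integrable lebesgue (trunc_log M f)"
    by (rule Bochner_Integration.integrable_bound [OF i]) (auto simp: trunc_log_def [abs_def] abs_mult)
qed

text \<open>As M \<ge> 1, truncation leaves the set |f| \<le> 1 alone, so the negative part is the
  same for all M. The factor 1/2 stems from ln |f|^2 = 2 ln |f|.\<close>

lemma trunc_log_lower_bound:
  fixes f :: "'a::euclidean_space \<Rightarrow> complex"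
  assumes m [measurable]: "f \<in> borel_measurable lebesgue" and f: "normp 2 f = 1" "shannon_pos f < \<infinity>" and M: "1 \<le> M"
  shows "(\<integral>u. max 0 (trunc_log M f u) \<partial>lebesgue) - enn2real (shannon_pos f) / 2 = (\<integral>u. trunc_log M f u \<partial>lebesgue)"
proof -
  have i: "integrable lebesgue (\<lambda>u. max 0 (trunc_log M f u))"
    by (rule Bochner_Integration.integrable_bound [OF integrable_trunc_log_abs(2) [OF assms]])
       (auto simp: trunc_log_def [abs_def])
  have "trunc_log M f u = max 0 (trunc_log M f u) - max 0 (- ((cmod (f u))\<^sup>2 * ln ((cmod (f u))\<^sup>2))) / 2" for u
  proof (cases "f u = 0")
    case False
    define x where "x = cmod (f u)"
    have x: "0 < x" using False by (simp add: x_def)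
    have e: "max 0 (- (x\<^sup>2 * ln (x\<^sup>2))) / 2 = max 0 (- (x\<^sup>2 * ln x))"
      unfolding x_def neg_log_part [OF False] by (rule half_max)
    show ?thesis
    proof (cases "x \<le> 1")
      case True
      then have eq: "min x M = x" and le: "x\<^sup>2 * ln x \<le> 0" using x M by (auto simp: min_def mult_le_0_iff)
      show ?thesis unfolding trunc_log_def x_def [symmetric] e eq using le by (simp add: max_def)
    next
      case False
      then have "0 \<le> x\<^sup>2 * ln (min x M)" "0 \<le> x\<^sup>2 * ln x" using x M by (auto simp: min_def)
      then show ?thesis unfolding trunc_log_def x_def [symmetric] e by simp
    qed
  qed (simp add: trunc_log_def)
  then have "(\<integral>u. trunc_log M f u \<partial>lebesgue) = (\<integral>u. max 0 (trunc_log M f u) - max 0 (- ((cmod (f u))\<^sup>2 * ln ((cmod (f u))\<^sup>2))) / 2 \<partial>lebesgue)"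
    by (rule Bochner_Integration.integral_cong [OF refl])
  also have "\<dots> = (\<integral>u. max 0 (trunc_log M f u) \<partial>lebesgue) - enn2real (shannon_pos f) / 2"
    using i integrable_shannon_pos_part [OF m f(2)] by simp
  finally show ?thesis ..
qed

text \<open>A common bound for the truncated integrals bounds their positive parts, and Fatou's
  lemma carries this to the limit. Finiteness of the entropies thus comes out of the uncertainty
  relation itself.\<close>

lemma shannon_neg_finite:
  fixes f :: "'a::euclidean_space \<Rightarrow> complex"
  assumes m [measurable]: "f \<in> borel_measurable lebesgue" and f: "normp 2 f = 1" "shannon_pos f < \<infinity>"
    and le: "\<And>n. (\<integral>u. trunc_log (real (Suc n)) f u \<partial>lebesgue) \<le> R"
  shows "shannon_neg f < \<infinity>"
proof -
  have tm [measurable]: "trunc_log M f \<in> borel_measurable lebesgue" for M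
    unfolding trunc_log_def [abs_def] by measurable
  have lim: "(\<lambda>n. ennreal (2 * max 0 (trunc_log (real (Suc n)) f u))) \<longlonglongrightarrow> ennreal ((cmod (f u))\<^sup>2 * ln ((cmod (f u))\<^sup>2))" for u
  proof (rule tendsto_eventually)
    obtain N where N: "cmod (f u) \<le> real N" using real_arch_simple by blast
    show "\<forall>\<^sub>F n in sequentially. ennreal (2 * max 0 (trunc_log (real (Suc n)) f u)) = ennreal ((cmod (f u))\<^sup>2 * ln ((cmod (f u))\<^sup>2))"
    proof (rule eventually_sequentiallyI [of N])
      fix n assume "N \<le> n"
      then have "min (cmod (f u)) (real (Suc n)) = cmod (f u)" using N by simp
      then show "ennreal (2 * max 0 (trunc_log (real (Suc n)) f u)) = ennreal ((cmod (f u))\<^sup>2 * ln ((cmod (f u))\<^sup>2))"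
      proof (cases "f u = 0")
        case False
        have "ennreal (2 * max 0 y) = ennreal (2 * y)" for y :: real
          by (cases "0 \<le> y") (auto simp: ennreal_neg)
        with \<open>min (cmod (f u)) (real (Suc n)) = cmod (f u)\<close> show ?thesis
          unfolding neg_log_part [OF False] trunc_log_def by simp
      qed (simp add: trunc_log_def)
    qed
  qed
  have bd: "(\<integral>\<^sup>+u. ennreal (2 * max 0 (trunc_log (real (Suc n)) f u)) \<partial>lebesgue) \<le> ennreal (2 * (R + enn2real (shannon_pos f) / 2))" for n
  proof -
    have M: "1 \<le> real (Suc n)" by simp
    have i: "integrable lebesgue (\<lambda>u. 2 * max 0 (trunc_log (real (Suc n)) f u))"
      by (rule integrable_mult_right, rule Bochner_Integration.integrable_bound [OF integrable_trunc_log_abs(2) [OF m f M]])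
         (auto simp: trunc_log_def [abs_def])
    have "(\<integral>\<^sup>+u. ennreal (2 * max 0 (trunc_log (real (Suc n)) f u)) \<partial>lebesgue) = ennreal (2 * (\<integral>u. max 0 (trunc_log (real (Suc n)) f u) \<partial>lebesgue))"
      using nn_integral_eq_integral [OF i] by simp
    also have "\<dots> \<le> ennreal (2 * (R + enn2real (shannon_pos f) / 2))"
    proof (rule ennreal_leI)
      define I where "I = (\<integral>u. max 0 (trunc_log (real (Suc n)) f u) \<partial>lebesgue)"
      have "I - enn2real (shannon_pos f) / 2 \<le> R"
        unfolding I_def trunc_log_lower_bound [OF m f M] by (rule le)
      then show "2 * I \<le> 2 * (R + enn2real (shannon_pos f) / 2)" by simp
    qed
    finally show ?thesis .
  qed
  have "shannon_neg f = (\<integral>\<^sup>+u. liminf (\<lambda>n. ennreal (2 * max 0 (trunc_log (real (Suc n)) f u))) \<partial>lebesgue)"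
    unfolding shannon_neg_def using lim by (intro nn_integral_cong lim_imp_Liminf [symmetric]) auto
  also have "\<dots> \<le> liminf (\<lambda>n. \<integral>\<^sup>+u. ennreal (2 * max 0 (trunc_log (real (Suc n)) f u)) \<partial>lebesgue)"
    by (rule nn_integral_liminf) measurable
  also have "\<dots> \<le> limsup (\<lambda>n. \<integral>\<^sup>+u. ennreal (2 * max 0 (trunc_log (real (Suc n)) f u)) \<partial>lebesgue)"
    by (rule Liminf_le_Limsup) simp
  also have "\<dots> \<le> ennreal (2 * (R + enn2real (shannon_pos f) / 2))"
    by (rule Limsup_bounded) (use bd in auto)
  also have "\<dots> < \<infinity>" by simp
  finally show ?thesis .
qed

lemma trunc_log_limit:
  fixes f :: "'a::euclidean_space \<Rightarrow> complex"
  assumes m [measurable]: "f \<in> borel_measurable lebesgue" and f: "normp 2 f = 1" "shannon_pos f < \<infinity>" "shannon_neg f < \<infinity>"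
  shows "(\<lambda>n. \<integral>u. trunc_log (real (Suc n)) f u \<partial>lebesgue) \<longlonglongrightarrow> (enn2real (shannon_neg f) - enn2real (shannon_pos f)) / 2"
proof -
  let ?g = "\<lambda>u. (cmod (f u))\<^sup>2 * ln ((cmod (f u))\<^sup>2)"
  note ig = shannon_integrable [OF m f(2,3)]
  have "(\<lambda>n. \<integral>u. trunc_log (real (Suc n)) f u \<partial>lebesgue) \<longlonglongrightarrow> (\<integral>u. ?g u / 2 \<partial>lebesgue)"
  proof (rule integral_dominated_convergence [where w = "\<lambda>u. \<bar>?g u\<bar>"])
    show "AE u in lebesgue. (\<lambda>n. trunc_log (real (Suc n)) f u) \<longlonglongrightarrow> ?g u / 2"
    proof (intro AE_I2 tendsto_eventually)
      fix u
      obtain N where N: "cmod (f u) \<le> real N" using real_arch_simple by blast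
      show "\<forall>\<^sub>F n in sequentially. trunc_log (real (Suc n)) f u = ?g u / 2"
      proof (rule eventually_sequentiallyI [of N])
        fix n assume "N \<le> n"
        then have "min (cmod (f u)) (real (Suc n)) = cmod (f u)" using N by simp
        then show "trunc_log (real (Suc n)) f u = ?g u / 2"
          using neg_log_part [of "f u"] by (cases "f u = 0") (auto simp: trunc_log_def)
      qed
    qed
    show "AE u in lebesgue. norm (trunc_log (real (Suc n)) f u) \<le> \<bar>?g u\<bar>" for n
    proof (rule AE_I2)
      fix u
      show "norm (trunc_log (real (Suc n)) f u) \<le> \<bar>?g u\<bar>"
      proof (cases "f u = 0")
        case False
        define x where "x = cmod (f u)"
        have x: "0 < x" using False by (simp add: x_def)
        \<comment> \<open>Since n + 1 \<ge> 1, truncation moves the logarithm towards 0; the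
          integrand itself serves as majorant.\<close>
        have "\<bar>ln (min x (real (Suc n)))\<bar> \<le> \<bar>ln x\<bar>"
          using x by (auto simp: min_def)
        then have "x\<^sup>2 * \<bar>ln (min x (real (Suc n)))\<bar> \<le> x\<^sup>2 * \<bar>ln x\<bar>" by (intro mult_left_mono) auto
        also have "\<dots> \<le> \<bar>2 * (x\<^sup>2 * ln x)\<bar>" by (simp add: abs_mult)
        also have "2 * (x\<^sup>2 * ln x) = x\<^sup>2 * ln (x\<^sup>2)"
          unfolding x_def neg_log_part [OF False] ..
        finally show ?thesis unfolding trunc_log_def x_def [symmetric] real_norm_def abs_mult abs_power2 .
      qed (simp add: trunc_log_def)
    qed
    show "integrable lebesgue (\<lambda>u. \<bar>?g u\<bar>)" using ig by simp
  qed (auto simp: trunc_log_def [abs_def])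
  then show ?thesis using ig by simp
qed

text \<open>The value at \<open>s\<close> of the sharp constant for the exponent \<open>2 / (1 + s)\<close>.\<close>

lemma beckner_root:
  assumes s: "0 < s" "s < 1"
  defines "p \<equiv> 2 / (1 + s)"
  shows "beckner p d powr ((1 - s) / 2) = exp (real d / 4 * ((1 - s) * ln (pi * (1 - s)) - (1 + s) * ln (pi * (1 + s))))"
proof -
  have e1: "2 * pi * (p - 1) / p = pi * (1 - s)" unfolding p_def using s by (simp add: field_simps)
  have e2: "p / (2 * pi) = 1 / (pi * (1 + s))"
  proof -
    have "2 / c / (2 * pi) = 1 / (pi * c)" for c :: real by (cases "c = 0") (simp_all add: field_simps)
    then show ?thesis by (simp only: p_def)
  qed
  have e3: "1 / (p - 1) = (1 + s) / (1 - s)" unfolding p_def using s by (simp add: field_simps)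
  have pos: "0 < pi * (1 - s)" "0 < pi * (1 + s)" using s by auto
  have "ln (pi * (1 - s) * (1 / (pi * (1 + s))) powr ((1 + s) / (1 - s))) = ln (pi * (1 - s)) - (1 + s) / (1 - s) * ln (pi * (1 + s))"
    using pos s by (subst ln_mult) (simp_all add: ln_powr ln_div del: ln_mult_pos)
  moreover have "(1 - s) / 2 * (real d / 2 * (a - (1 + s) / (1 - s) * b)) = real d / 4 * ((1 - s) * a - (1 + s) * b)" for a b
    using s by (simp add: field_simps)
  ultimately have "(1 - s) / 2 * (real d / 2 * ln (pi * (1 - s) * (1 / (pi * (1 + s))) powr ((1 + s) / (1 - s)))) =
     real d / 4 * ((1 - s) * ln (pi * (1 - s)) - (1 + s) * ln (pi * (1 + s)))"
    by (simp only:)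
  then show ?thesis
    unfolding beckner_def e1 e2 e3 using pos s by (simp add: powr_def [of "_ powr _"] powr_def [of _ "(1 - s) / 2"] ln_powr)
qed

section \<open>The first-order perturbation\<close>

lemma exp_minus_one_bound: "\<bar>exp y - 1\<bar> \<le> \<bar>y\<bar> * max 1 (exp y)" for y :: real
proof (cases "0 \<le> y")
  case True
  have "1 - y \<le> exp (- y)" using exp_ge_add_one_self [of "- y"] by simp
  then have "(1 - y) * exp y \<le> exp (- y) * exp y" by (intro mult_right_mono) auto
  then have "exp y - 1 \<le> y * exp y" by (simp add: exp_minus algebra_simps)
  then show ?thesis using True by (simp add: max_def)
next
  case False
  have "exp y \<le> 1" using False by simp
  then have "\<bar>exp y - 1\<bar> = 1 - exp y" "max 1 (exp y) = 1" by (auto simp: max_def)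
  then show ?thesis using False exp_ge_add_one_self [of y] by (simp only:)
qed

text \<open>With \<open>w = (min x M) powr s\<close>, this is \<open>w\<^sup>2 / 2 - (w - 1)\<^sup>2 - 1 / 2\<close>, the perturbation left over
  from both sides of the dual Hausdorff--Young inequality; it is \<open>s * ln (min x M)\<close> to first order in \<open>s\<close>.\<close>

definition pert :: "real \<Rightarrow> real \<Rightarrow> real \<Rightarrow> real" where
  "pert M s x = ((min x M) powr s - 1) - ((min x M) powr s - 1)\<^sup>2 / 2"

lemma pert_measurable [measurable]: "pert M s \<in> borel_measurable borel"
  unfolding pert_def [abs_def] by measurable

text \<open>The majorant for s tending to 0. In the quadratic term one factor (min x M)^s - 1 is
  estimated to first order in s and the other by \<open>M\<close>, so that a single factor |ln (min
  x M)| remains, as \<open>integrable_trunc_log_abs\<close> requires.\<close>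

lemma pert_bound:
  assumes x: "0 < x" and M: "1 \<le> M" and s: "0 < s" "s \<le> 1"
  shows "\<bar>pert M s x / s\<bar> \<le> (M + M\<^sup>2 / 2) * \<bar>ln (min x M)\<bar>"
proof -
  define y where "y = (min x M) powr s - 1"
  define L where "L = \<bar>ln (min x M)\<bar>"
  have T: "0 < min x M" "min x M \<le> M" using x M by auto
  have "min x M \<noteq> 0" using x M by (auto simp: min_def)
  then have e: "(min x M) powr s = exp (s * ln (min x M))" by (simp add: powr_def)
  have Ts: "(min x M) powr s \<le> M"
  proof -
    have "(min x M) powr s \<le> M powr s" using T s by (intro powr_mono2) auto
    also have "\<dots> \<le> M powr 1" using M s by (intro powr_mono) auto
    finally show ?thesis using M by simp
  qed
  have "\<bar>y\<bar> \<le> \<bar>s * ln (min x M)\<bar> * max 1 (exp (s * ln (min x M)))"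
    unfolding y_def e by (rule exp_minus_one_bound)
  also have "\<dots> \<le> (s * L) * M"
    using Ts M s unfolding e [symmetric] L_def by (intro mult_mono) (auto simp: abs_mult)
  finally have y1: "\<bar>y\<bar> \<le> s * L * M" .
  have "-1 \<le> y" "y \<le> M - 1" using Ts powr_ge_zero [of "min x M" s] by (auto simp: y_def)
  then have y2: "\<bar>y\<bar> \<le> M" using M by auto
  have "\<bar>pert M s x\<bar> \<le> \<bar>y\<bar> + y\<^sup>2 / 2"
    unfolding pert_def y_def [symmetric] using abs_triangle_ineq4 [of y "y\<^sup>2 / 2"] by simp
  also have "y\<^sup>2 = \<bar>y\<bar> * \<bar>y\<bar>" by (simp add: power2_eq_square)
  also have "\<bar>y\<bar> * \<bar>y\<bar> \<le> (s * L * M) * M" using y1 y2 by (intro mult_mono) auto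
  finally have "\<bar>pert M s x\<bar> \<le> s * ((M + M\<^sup>2 / 2) * L)"
    using y1 by (simp add: algebra_simps power2_eq_square)
  then show ?thesis using s by (simp add: L_def abs_divide pos_divide_le_eq mult.commute)
qed

lemma pert_limit:
  assumes x: "0 < x" and M: "1 \<le> M" and s: "s \<longlonglongrightarrow> 0" "\<And>n. s n \<noteq> (0::real)"
  shows "(\<lambda>n. pert M (s n) x / s n) \<longlonglongrightarrow> ln (min x M)"
proof -
  define l where "l = ln (min x M)"
  have e: "(min x M) powr r = exp (r * l)" for r using x M by (simp add: powr_def l_def)
  have "((\<lambda>r. exp (r * l)) has_real_derivative l) (at 0)"
    by (auto intro!: derivative_eq_intros)
  then have "((\<lambda>r. (exp (r * l) - 1) / r) \<longlongrightarrow> l) (at 0)"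
    by (simp add: has_field_derivative_iff)
  then have 1: "(\<lambda>n. (exp (s n * l) - 1) / s n) \<longlonglongrightarrow> l"
    unfolding tendsto_at_iff_sequentially comp_def using s by auto
  have 2: "(\<lambda>n. exp (s n * l) - 1) \<longlonglongrightarrow> exp (0 * l) - 1"
    by (intro tendsto_intros s)
  have "(\<lambda>n. (exp (s n * l) - 1) / s n - (exp (s n * l) - 1) / s n * (exp (s n * l) - 1) / 2) \<longlonglongrightarrow> l - l * (exp (0 * l) - 1) / 2"
    by (intro tendsto_intros 1 2) auto
  moreover have "(y - y\<^sup>2 / 2) / r = y / r - y / r * y / 2" for y r :: real
    by (simp add: power2_eq_square diff_divide_distrib)
  ultimately show ?thesis
    unfolding pert_def e by (simp add: l_def)
qed

text \<open>The pairing of the two weighted functions is bounded below pointwise by squares of F,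
  \<Phi> and F - \<Phi>. The integrals of |F|^2 and |F - \<Phi>|^2 return to \<Psi> by Plancherel's
  theorem for norms, and what they leave there has the same form as the contribution of
  \<Phi>.\<close>

lemma perturbation_inequality:
  fixes \<Psi> :: "'a::euclidean_space \<Rightarrow> complex"
  assumes ft: "has_fourier_transform \<Psi> \<Phi>" and n2: "normp 2 \<Psi> = 1" and M: "1 \<le> M" and s: "0 < s" "s < 1"
  shows "(\<integral>u. (cmod (\<Psi> u))\<^sup>2 * pert M s (cmod (\<Psi> u)) \<partial>lebesgue) + (\<integral>u. (cmod (\<Phi> u))\<^sup>2 * pert M s (cmod (\<Phi> u)) \<partial>lebesgue)
     \<le> exp (real DIM('a) / 4 * ((1 - s) * ln (pi * (1 - s)) - (1 + s) * ln (pi * (1 + s)))) - 1"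
proof -
  define p where "p = 2 / (1 + s)"
  define q where "q = 2 / (1 - s)"
  have p: "1 < p" "p < 2" using s by (auto simp: p_def field_simps)
  have "p - 1 = (1 - s) / (1 + s)" using s by (simp add: p_def field_simps)
  moreover have "2 / a / (b / a) = 2 / b" if "a \<noteq> 0" for a b :: real
    using that by (cases "b = 0") (auto simp: field_simps)
  ultimately have q: "1 < q" "p / (p - 1) = q" using s by (simp add: q_def, simp only: p_def q_def)
  have pq: "1 / p + 1 / q = 1" using s by (simp add: p_def q_def field_simps)
  have P: "\<Psi> \<in> L2_functions" "\<Phi> \<in> L2_functions" using has_fourier_transform_L2 [OF ft] by auto
  have m2: "normp 2 \<Phi> = 1" using has_fourier_transform_plancherel [OF ft] n2 by simp
  have Pm [measurable]: "\<Psi> \<in> borel_measurable lebesgue" "\<Phi> \<in> borel_measurable lebesgue" using P by (auto simp: L2_functions_iff)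
  define w where "w f u = (min (cmod (f u)) M) powr s" for f :: "'a \<Rightarrow> complex" and u
  define g where "g f u = f u * of_real (w f u)" for f :: "'a \<Rightarrow> complex" and u
  have w: "0 \<le> w f u" "w f u \<le> M" for f u
  proof -
    show "0 \<le> w f u" by (simp add: w_def)
    have "w f u \<le> M powr s" unfolding w_def using s M by (intro powr_mono2) auto
    also have "\<dots> \<le> M powr 1" using M s by (intro powr_mono) auto
    finally show "w f u \<le> M" using M by simp
  qed
  have gm: "g f \<in> borel_measurable lebesgue" if [measurable]: "f \<in> borel_measurable lebesgue" for f :: "'a \<Rightarrow> complex"
    unfolding g_def w_def by measurable
  note [measurable] = gm [OF Pm(1)] gm [OF Pm(2)]
  \<comment> \<open>|g f| \<le> |f|^(1 + s) and (1 + s) p = 2: the weight dictates the exponent p,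
    for which the weighted function has norm at most 1.\<close>
  have gp: "normp p (g f) \<le> ennreal 1" if f: "f \<in> borel_measurable lebesgue" "normp 2 f = 1" for f :: "'a \<Rightarrow> complex"
  proof -
    have "cmod (g f u) powr p \<le> cmod (f u) powr 2" for u
    proof (cases "f u = 0")
      case False
      have "cmod (g f u) = cmod (f u) * w f u" using w(1) [of f u] by (simp add: g_def norm_mult)
      also have "\<dots> \<le> cmod (f u) * cmod (f u) powr s"
        unfolding w_def using s M by (intro mult_left_mono powr_mono2) auto
      also have "\<dots> = cmod (f u) powr (1 + s)" using False by (simp add: powr_add)
      finally have "cmod (g f u) powr p \<le> (cmod (f u) powr (1 + s)) powr p"
        using p by (intro powr_mono2) auto
      also have "(1 + s) * p = 2" using s nonzero_mult_div_cancel_left [of "1 + s" 2] by (simp only: p_def times_divide_eq_right)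
      then have "(cmod (f u) powr (1 + s)) powr p = cmod (f u) powr 2" unfolding powr_powr by (simp only:)
      finally show ?thesis .
    qed (simp add: g_def)
    then have "normp p (g f) \<le> normp 2 f" unfolding normp_def by (intro nn_integral_mono ennreal_leI)
    then show ?thesis using f by simp
  qed
  have g2: "g f \<in> L2_functions" if f: "f \<in> borel_measurable lebesgue" "normp 2 f = 1" for f :: "'a \<Rightarrow> complex"
  proof -
    note [measurable] = f(1)
    have "cmod (g f u) powr 2 \<le> M\<^sup>2 * cmod (f u) powr 2" for u
    proof -
      have "cmod (g f u) \<le> M * cmod (f u)"
        using w [of f u] mult_right_mono [of "w f u" M "cmod (f u)"] by (simp add: g_def norm_mult mult.commute)
      then have "(cmod (g f u))\<^sup>2 \<le> (M * cmod (f u))\<^sup>2" by (intro power_mono) auto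
      then show ?thesis by (simp add: powr_numeral power_mult_distrib)
    qed
    then have "normp 2 (g f) \<le> (\<integral>\<^sup>+u. ennreal (M\<^sup>2) * ennreal (cmod (f u) powr 2) \<partial>lebesgue)"
      unfolding normp_def by (intro nn_integral_mono) (auto simp: ennreal_mult[symmetric] intro!: ennreal_leI)
    also have "\<dots> = ennreal (M\<^sup>2) * normp 2 f" unfolding normp_def by (rule nn_integral_cmult) simp
    also have "\<dots> < \<infinity>" using f by (simp add: ennreal_mult_less_top)
    finally show ?thesis using gm [OF f(1)] by (simp add: L2_functions_iff)
  qed
  obtain F where F: "has_fourier_transform (g \<Psi>) F"
    using has_fourier_transform_exists [OF g2 [OF Pm(1) n2]] by blast
  have FL: "F \<in> L2_functions" by (rule has_fourier_transform_L2(2) [OF F])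
  have Fm [measurable]: "F \<in> borel_measurable lebesgue" using FL by (simp add: L2_functions_iff)
  define B where "B = beckner p DIM('a)"
  \<comment> \<open>The sharp constant instead of its q-th power: Young's inequality is then applied
    to F / K and g \<Phi>, both of norm at most 1.\<close>
  define K where "K = B powr (1 / q)"
  have B: "0 < B" using p by (auto simp: B_def beckner_def)
  have K: "0 < K" "K powr q = B" using B q by (auto simp: K_def powr_powr)
  have FB: "normp q F \<le> ennreal B"
    using hausdorff_young [OF F p _ gp [OF Pm(1) n2]] unfolding q(2) B_def by simp
  have iF: "integrable lebesgue (\<lambda>u. cmod (F u) powr q)" "(\<integral>u. cmod (F u) powr q \<partial>lebesgue) \<le> B"
    using integrable_normp_powr [OF Fm le_less_trans [OF FB ennreal_less_top [folded infinity_ennreal_def]]] FB B by (auto intro: enn2real_leI)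
  have iG: "integrable lebesgue (\<lambda>u. cmod (g \<Phi> u) powr p)" "(\<integral>u. cmod (g \<Phi> u) powr p \<partial>lebesgue) \<le> 1"
    using integrable_normp_powr [OF gm [OF Pm(2)] le_less_trans [OF gp [OF Pm(2) m2] ennreal_less_top [folded infinity_ennreal_def]]] gp [OF Pm(2) m2]
    by (auto intro: enn2real_leI)
  let ?sq = "\<lambda>f u. (cmod (f u))\<^sup>2"
  have iP: "integrable lebesgue (?sq \<Psi>)" "(\<integral>u. ?sq \<Psi> u \<partial>lebesgue) = 1"
    "integrable lebesgue (?sq \<Phi>)" "(\<integral>u. ?sq \<Phi> u \<partial>lebesgue) = 1"
    using integrable_normp_2 [OF Pm(1)] integrable_normp_2 [OF Pm(2)] n2 m2 by auto
  have iF2: "integrable lebesgue (?sq F)" "(\<integral>u. ?sq F u \<partial>lebesgue) = (\<integral>u. ?sq (g \<Psi>) u \<partial>lebesgue)" "integrable lebesgue (?sq (g \<Psi>))"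
    using integrable_normp_2 [OF Fm] integrable_normp_2 [OF gm [OF Pm(1)]] FL g2 [OF Pm(1) n2] has_fourier_transform_plancherel [OF F]
    by (auto simp: L2_functions_iff)
  have ftd: "has_fourier_transform (\<lambda>u. g \<Psi> u - \<Psi> u) (\<lambda>u. F u - \<Phi> u)"
    by (rule has_fourier_transform_diff [OF F ft])
  have iD: "integrable lebesgue (?sq (\<lambda>u. F u - \<Phi> u))" "(\<integral>u. ?sq (\<lambda>u. F u - \<Phi> u) u \<partial>lebesgue) = (\<integral>u. ?sq (\<lambda>u. g \<Psi> u - \<Psi> u) u \<partial>lebesgue)"
    "integrable lebesgue (?sq (\<lambda>u. g \<Psi> u - \<Psi> u))"
    using integrable_normp_2 [of "\<lambda>u. F u - \<Phi> u"] integrable_normp_2 [of "\<lambda>u. g \<Psi> u - \<Psi> u"] has_fourier_transform_L2 [OF ftd] has_fourier_transform_plancherel [OF ftd]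
    by (auto simp: L2_functions_iff)
  have ig: "integrable lebesgue (\<lambda>u. ?sq f u * b u)" if "f \<in> borel_measurable lebesgue" "normp 2 f = 1" "b \<in> borel_measurable lebesgue" "\<And>u. \<bar>b u\<bar> \<le> C"
    for f :: "'a \<Rightarrow> complex" and b C
  proof (rule Bochner_Integration.integrable_bound)
    show "integrable lebesgue (\<lambda>u. C * ?sq f u)" using integrable_normp_2 [OF that(1)] that(2) by simp
    show "AE u in lebesgue. norm (?sq f u * b u) \<le> norm (C * ?sq f u)"
    proof (rule AE_I2)
      fix u
      have "?sq f u * \<bar>b u\<bar> \<le> ?sq f u * C" using that(4) by (intro mult_left_mono) auto
      then have "?sq f u * \<bar>b u\<bar> \<le> \<bar>C * ?sq f u\<bar>"
        using abs_ge_self [of "C * ?sq f u"] by (simp only: mult.commute)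
      then show "norm (?sq f u * b u) \<le> norm (C * ?sq f u)"
        by (simp only: real_norm_def abs_mult [of "?sq f u"] abs_power2)
    qed
    show "(\<lambda>u. ?sq f u * b u) \<in> borel_measurable lebesgue"
      using that(1,3) by measurable
  qed
  have wm [measurable]: "w \<Psi> \<in> borel_measurable lebesgue" "w \<Phi> \<in> borel_measurable lebesgue"
    unfolding w_def [abs_def] by measurable
  have pertb: "\<bar>pert M s x\<bar> \<le> M + M\<^sup>2" if "0 \<le> x" for x
  proof -
    define y where "y = (min x M) powr s - 1"
    have "(min x M) powr s \<le> M powr s" using s M that by (intro powr_mono2) auto
    also have "\<dots> \<le> M powr 1" using M s by (intro powr_mono) auto
    finally have "(min x M) powr s \<le> M" using M by simp
    then have y: "\<bar>y\<bar> \<le> M" unfolding y_def using M powr_ge_zero [of "min x M" s] by linarith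
    then have "y\<^sup>2 \<le> M\<^sup>2" using M by (simp add: abs_le_square_iff [symmetric])
    moreover have "\<bar>y - y\<^sup>2 / 2\<bar> \<le> \<bar>y\<bar> + y\<^sup>2 / 2" using abs_triangle_ineq4 [of y "y\<^sup>2 / 2"] by simp
    ultimately show ?thesis
      unfolding pert_def y_def [symmetric] using y zero_le_power2 [of M] by linarith
  qed
  have ip: "integrable lebesgue (\<lambda>u. ?sq \<Psi> u * pert M s (cmod (\<Psi> u)))" "integrable lebesgue (\<lambda>u. ?sq \<Phi> u * pert M s (cmod (\<Phi> u)))"
    using ig [OF Pm(1) n2 _ pertb] ig [OF Pm(2) m2 _ pertb] by auto
  have iw: "integrable lebesgue (\<lambda>u. ?sq \<Phi> u * (w \<Phi> u - (w \<Phi> u - 1)\<^sup>2 / 2))"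
  proof -
    have "?sq \<Phi> u * (w \<Phi> u - (w \<Phi> u - 1)\<^sup>2 / 2) = ?sq \<Phi> u * pert M s (cmod (\<Phi> u)) + ?sq \<Phi> u" for u
      by (simp add: pert_def w_def algebra_simps)
    then show ?thesis using ip(2) iP(3) by simp
  qed
  \<comment> \<open>Expansion around \<Phi>. The product of the deviations F - \<Phi> and g \<Phi> -
    \<Phi> is of second order and is bounded by half the sum of their squares; the product of F and
    \<Phi> is polarised. The upper bound is Young's inequality.\<close>
  have lower: "(?sq F u + ?sq \<Phi> u) / 2 - ?sq (\<lambda>u. F u - \<Phi> u) u + ?sq \<Phi> u * (w \<Phi> u - (w \<Phi> u - 1)\<^sup>2 / 2) - ?sq \<Phi> u \<le> K * (cmod (F u) powr q / (K powr q) / q + cmod (g \<Phi> u) powr p / p)" for u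
  proof -
    have sq_diff: "(cmod (a - b))\<^sup>2 = (cmod a)\<^sup>2 + (cmod b)\<^sup>2 - 2 * inner a b" for a b :: complex
      unfolding power2_norm_eq_inner by (simp add: inner_diff_left inner_diff_right inner_commute)
    have sq_add: "(cmod (a + b))\<^sup>2 = (cmod a)\<^sup>2 + (cmod b)\<^sup>2 + 2 * inner a b" for a b :: complex
      unfolding power2_norm_eq_inner by (simp add: inner_add_left inner_add_right inner_commute)
    have f1: "inner (F u) (g \<Phi> u) = inner (F u - \<Phi> u) (g \<Phi> u - \<Phi> u) + inner (F u) (\<Phi> u) + inner (\<Phi> u) (g \<Phi> u) - ?sq \<Phi> u"
      unfolding power2_norm_eq_inner by (simp add: inner_diff_left inner_diff_right)
    have f2: "inner (F u) (\<Phi> u) = (?sq F u + ?sq \<Phi> u - ?sq (\<lambda>u. F u - \<Phi> u) u) / 2"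
      unfolding sq_diff by simp
    have gF: "g \<Phi> u = w \<Phi> u *\<^sub>R \<Phi> u" by (simp add: g_def scaleR_conv_of_real)
    then have f3: "inner (\<Phi> u) (g \<Phi> u) = ?sq \<Phi> u * w \<Phi> u" unfolding power2_norm_eq_inner by simp
    have f4: "- ((?sq (\<lambda>u. F u - \<Phi> u) u + ?sq \<Phi> u * (w \<Phi> u - 1)\<^sup>2) / 2) \<le> inner (F u - \<Phi> u) (g \<Phi> u - \<Phi> u)"
    proof -
      have "g \<Phi> u - \<Phi> u = (w \<Phi> u - 1) *\<^sub>R \<Phi> u" unfolding gF by (simp add: scaleR_diff_left)
      then have e: "(cmod (g \<Phi> u - \<Phi> u))\<^sup>2 = ?sq \<Phi> u * (w \<Phi> u - 1)\<^sup>2" by (simp add: power_mult_distrib)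
      have "0 \<le> (cmod ((F u - \<Phi> u) + (g \<Phi> u - \<Phi> u)))\<^sup>2" by simp
      also have "\<dots> = ?sq (\<lambda>u. F u - \<Phi> u) u + (cmod (g \<Phi> u - \<Phi> u))\<^sup>2 + 2 * inner (F u - \<Phi> u) (g \<Phi> u - \<Phi> u)"
        by (rule sq_add)
      finally have "0 \<le> ?sq (\<lambda>u. F u - \<Phi> u) u + (cmod (g \<Phi> u - \<Phi> u))\<^sup>2 + 2 * inner (F u - \<Phi> u) (g \<Phi> u - \<Phi> u)" .
      moreover have "- ((a + b) / 2) \<le> c" if "0 \<le> a + b + 2 * c" for a b c :: real
        using that by (simp add: field_simps)
      ultimately show ?thesis unfolding e by blast
    qed
    have "(A + P) / 2 - D + P * (W - V / 2) - P \<le> I"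
      if "I = X + Y + Z - P" "Y = (A + P - D) / 2" "Z = P * W" "- ((D + P * V) / 2) \<le> X" for A P D W V I X Y Z :: real
      using that by (simp add: field_simps)
    from this [OF f1 f2 f3 f4]
    have "(?sq F u + ?sq \<Phi> u) / 2 - ?sq (\<lambda>u. F u - \<Phi> u) u + ?sq \<Phi> u * (w \<Phi> u - (w \<Phi> u - 1)\<^sup>2 / 2) - ?sq \<Phi> u \<le> inner (F u) (g \<Phi> u)"
      .
    also have "\<dots> \<le> cmod (F u) * cmod (g \<Phi> u)" by (rule norm_cauchy_schwarz)
    also have "\<dots> = K * ((cmod (F u) / K) * cmod (g \<Phi> u))" using K by simp
    also have "\<dots> \<le> K * ((cmod (F u) / K) powr q / q + cmod (g \<Phi> u) powr p / p)"
      using K q p pq by (intro mult_left_mono Youngs_inequality) auto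
    also have "(cmod (F u) / K) powr q = cmod (F u) powr q / (K powr q)" using K by (simp add: powr_divide)
    finally show ?thesis .
  qed
  have "(\<integral>u. (?sq F u + ?sq \<Phi> u) / 2 - ?sq (\<lambda>u. F u - \<Phi> u) u + ?sq \<Phi> u * (w \<Phi> u - (w \<Phi> u - 1)\<^sup>2 / 2) - ?sq \<Phi> u \<partial>lebesgue)
     \<le> (\<integral>u. K * (cmod (F u) powr q / (K powr q) / q + cmod (g \<Phi> u) powr p / p) \<partial>lebesgue)"
    using iF iG iP iF2 iD iw lower by (intro integral_mono) auto
  also have "\<dots> = K * ((\<integral>u. cmod (F u) powr q \<partial>lebesgue) / B / q + (\<integral>u. cmod (g \<Phi> u) powr p \<partial>lebesgue) / p)"
    unfolding K(2) using iF iG by simp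
  also have "\<dots> \<le> K * (1 / q + 1 / p)"
  proof -
    have "(\<integral>u. cmod (F u) powr q \<partial>lebesgue) / B \<le> 1" using iF(2) B by simp
    then have "(\<integral>u. cmod (F u) powr q \<partial>lebesgue) / B / q \<le> 1 / q" using q by (intro divide_right_mono) auto
    moreover have "(\<integral>u. cmod (g \<Phi> u) powr p \<partial>lebesgue) / p \<le> 1 / p" using iG(2) p by (intro divide_right_mono) auto
    ultimately show ?thesis using K by (intro mult_left_mono) auto
  qed
  also have "\<dots> = K" using pq by (simp add: add.commute)
  finally have main: "(\<integral>u. (?sq F u + ?sq \<Phi> u) / 2 - ?sq (\<lambda>u. F u - \<Phi> u) u + ?sq \<Phi> u * (w \<Phi> u - (w \<Phi> u - 1)\<^sup>2 / 2) - ?sq \<Phi> u \<partial>lebesgue) \<le> K" .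
  have "(\<integral>u. (?sq F u + ?sq \<Phi> u) / 2 - ?sq (\<lambda>u. F u - \<Phi> u) u + ?sq \<Phi> u * (w \<Phi> u - (w \<Phi> u - 1)\<^sup>2 / 2) - ?sq \<Phi> u \<partial>lebesgue) =
     ((\<integral>u. ?sq F u \<partial>lebesgue) + 1) / 2 - (\<integral>u. ?sq (\<lambda>u. F u - \<Phi> u) u \<partial>lebesgue) + (\<integral>u. ?sq \<Phi> u * (w \<Phi> u - (w \<Phi> u - 1)\<^sup>2 / 2) \<partial>lebesgue) - 1"
    using iP iF2 iD iw by simp
  also have "(\<integral>u. ?sq \<Phi> u * (w \<Phi> u - (w \<Phi> u - 1)\<^sup>2 / 2) \<partial>lebesgue) = (\<integral>u. ?sq \<Phi> u * pert M s (cmod (\<Phi> u)) + ?sq \<Phi> u \<partial>lebesgue)"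
    by (intro Bochner_Integration.integral_cong refl) (simp add: pert_def w_def algebra_simps)
  also have "\<dots> = (\<integral>u. ?sq \<Phi> u * pert M s (cmod (\<Phi> u)) \<partial>lebesgue) + 1"
    using ip iP by simp
  also have "((\<integral>u. ?sq F u \<partial>lebesgue) + 1) / 2 - (\<integral>u. ?sq (\<lambda>u. F u - \<Phi> u) u \<partial>lebesgue) = (\<integral>u. ?sq (g \<Psi>) u / 2 - ?sq (\<lambda>u. g \<Psi> u - \<Psi> u) u \<partial>lebesgue) + 1 / 2"
    unfolding iF2(2) iD(2) using iF2 iD by simp
  \<comment> \<open>Plancherel's theorem has just replaced F by g \<Psi> and F - \<Phi> by g \<Psi>
    - \<Psi>. In terms of the weight the integrand is |\<Psi>|^2 (w^2 / 2 - (w - 1)^2), that is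
    \<open>pert\<close> plus 1/2.\<close>
  also have "(\<integral>u. ?sq (g \<Psi>) u / 2 - ?sq (\<lambda>u. g \<Psi> u - \<Psi> u) u \<partial>lebesgue) = (\<integral>u. ?sq \<Psi> u * pert M s (cmod (\<Psi> u)) + ?sq \<Psi> u / 2 \<partial>lebesgue)"
  proof (intro Bochner_Integration.integral_cong refl)
    fix u
    have gF: "g \<Psi> u = w \<Psi> u *\<^sub>R \<Psi> u" by (simp add: g_def scaleR_conv_of_real)
    have "g \<Psi> u - \<Psi> u = (w \<Psi> u - 1) *\<^sub>R \<Psi> u" unfolding gF by (simp add: scaleR_diff_left)
    then have e: "(cmod (g \<Psi> u - \<Psi> u))\<^sup>2 = ?sq \<Psi> u * (w \<Psi> u - 1)\<^sup>2" by (simp add: power_mult_distrib)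
    have e2: "?sq (g \<Psi>) u = ?sq \<Psi> u * (w \<Psi> u)\<^sup>2" unfolding gF by (simp add: power_mult_distrib)
    show "?sq (g \<Psi>) u / 2 - ?sq (\<lambda>u. g \<Psi> u - \<Psi> u) u = ?sq \<Psi> u * pert M s (cmod (\<Psi> u)) + ?sq \<Psi> u / 2"
    proof -
      have "pert M s (cmod (\<Psi> u)) = (w \<Psi> u - 1) - (w \<Psi> u - 1)\<^sup>2 / 2" by (simp add: pert_def w_def)
      moreover have "P * W\<^sup>2 / 2 - P * (W - 1)\<^sup>2 = P * ((W - 1) - (W - 1)\<^sup>2 / 2) + P / 2" for P W :: real
        by (simp add: power2_eq_square field_simps)
      ultimately show ?thesis unfolding e e2 by simp
    qed
  qed
  also have "\<dots> = (\<integral>u. ?sq \<Psi> u * pert M s (cmod (\<Psi> u)) \<partial>lebesgue) + 1 / 2"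
    using ip iP by simp
  finally have "(\<integral>u. ?sq \<Psi> u * pert M s (cmod (\<Psi> u)) \<partial>lebesgue) + (\<integral>u. ?sq \<Phi> u * pert M s (cmod (\<Phi> u)) \<partial>lebesgue) \<le> K - 1"
    using main by simp
  also have "K = exp (real DIM('a) / 4 * ((1 - s) * ln (pi * (1 - s)) - (1 + s) * ln (pi * (1 + s))))"
    using beckner_root [OF s, of "DIM('a)"] unfolding K_def B_def p_def q_def by simp
  finally show ?thesis .
qed

text \<open>Division of \<open>perturbation_inequality\<close> by s and the limit s to 0 with M
  fixed; boundedness of the weight makes this legitimate without any assumption on large values of
  the functions.\<close>

lemma trunc_log_uncertainty:
  fixes \<Psi> :: "'a::euclidean_space \<Rightarrow> complex"
  assumes ft: "has_fourier_transform \<Psi> \<Phi>" and n2: "normp 2 \<Psi> = 1" and fin: "shannon_pos \<Psi> < \<infinity>" "shannon_pos \<Phi> < \<infinity>" and M: "1 \<le> M"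
  shows "(\<integral>u. trunc_log M \<Psi> u \<partial>lebesgue) + (\<integral>u. trunc_log M \<Phi> u \<partial>lebesgue) \<le> - (real DIM('a) / 2 * (1 + ln pi))"
proof -
  \<comment> \<open>The offset 2 keeps all values strictly below 1, also at n = 0.\<close>
  define s where "s n = 1 / real (n + 2)" for n
  have s: "0 < s n" "s n < 1" for n by (auto simp: s_def)
  have slim: "s \<longlonglongrightarrow> 0"
    unfolding s_def using LIMSEQ_ignore_initial_segment [OF lim_1_over_n [where 'a = real], of 2] by simp
  have m2: "normp 2 \<Phi> = 1" using has_fourier_transform_plancherel [OF ft] n2 by simp
  have Pm: "\<Psi> \<in> borel_measurable lebesgue" "\<Phi> \<in> borel_measurable lebesgue"
    using has_fourier_transform_L2 [OF ft] by (auto simp: L2_functions_iff)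
  have lim: "(\<lambda>n. \<integral>u. (cmod (f u))\<^sup>2 * (pert M (s n) (cmod (f u)) / s n) \<partial>lebesgue) \<longlonglongrightarrow> (\<integral>u. trunc_log M f u \<partial>lebesgue)"
    if f [measurable]: "f \<in> borel_measurable lebesgue" and f2: "normp 2 f = 1" "shannon_pos f < \<infinity>" for f :: "'a \<Rightarrow> complex"
  proof (rule integral_dominated_convergence [where w = "\<lambda>u. (M + M\<^sup>2 / 2) * ((cmod (f u))\<^sup>2 * \<bar>ln (min (cmod (f u)) M)\<bar>)"])
    show "AE u in lebesgue. (\<lambda>n. (cmod (f u))\<^sup>2 * (pert M (s n) (cmod (f u)) / s n)) \<longlonglongrightarrow> trunc_log M f u"
    proof (rule AE_I2)
      fix u
      show "(\<lambda>n. (cmod (f u))\<^sup>2 * (pert M (s n) (cmod (f u)) / s n)) \<longlonglongrightarrow> trunc_log M f u"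
        unfolding trunc_log_def
      proof (cases "f u = 0")
        case False
        show "(\<lambda>n. (cmod (f u))\<^sup>2 * (pert M (s n) (cmod (f u)) / s n)) \<longlonglongrightarrow> (cmod (f u))\<^sup>2 * ln (min (cmod (f u)) M)"
          by (intro tendsto_mult_left pert_limit [OF _ M slim]) (use False s in \<open>auto simp: less_le\<close>)
      qed simp
    qed
    show "AE u in lebesgue. norm ((cmod (f u))\<^sup>2 * (pert M (s n) (cmod (f u)) / s n)) \<le> (M + M\<^sup>2 / 2) * ((cmod (f u))\<^sup>2 * \<bar>ln (min (cmod (f u)) M)\<bar>)" for n
    proof (rule AE_I2)
      fix u
      show "norm ((cmod (f u))\<^sup>2 * (pert M (s n) (cmod (f u)) / s n)) \<le> (M + M\<^sup>2 / 2) * ((cmod (f u))\<^sup>2 * \<bar>ln (min (cmod (f u)) M)\<bar>)"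
      proof (cases "f u = 0")
        case False
        have "(cmod (f u))\<^sup>2 * \<bar>pert M (s n) (cmod (f u)) / s n\<bar> \<le> (cmod (f u))\<^sup>2 * ((M + M\<^sup>2 / 2) * \<bar>ln (min (cmod (f u)) M)\<bar>)"
          using False s [of n] by (intro mult_left_mono pert_bound [OF _ M]) auto
        then show ?thesis by (simp only: real_norm_def abs_mult abs_power2 mult_ac)
      qed simp
    qed
    show "integrable lebesgue (\<lambda>u. (M + M\<^sup>2 / 2) * ((cmod (f u))\<^sup>2 * \<bar>ln (min (cmod (f u)) M)\<bar>))"
      by (intro integrable_mult_right integrable_trunc_log_abs(1) [OF f f2 M])
  qed (auto simp: trunc_log_def [abs_def])
  let ?k = "\<lambda>s. exp (real DIM('a) / 4 * ((1 - s) * ln (pi * (1 - s)) - (1 + s) * ln (pi * (1 + s))))"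
  \<comment> \<open>The origin of the constant: twice the negated derivative is d (1 + ln pi), that
    is ln(e pi) for each dimension.\<close>
  have "(?k has_real_derivative (- (real DIM('a) / 2 * (1 + ln pi)))) (at 0)"
    by (auto intro!: derivative_eq_intros simp: field_simps)
  then have "((\<lambda>s. (?k s - 1) / s) \<longlongrightarrow> - (real DIM('a) / 2 * (1 + ln pi))) (at 0)"
    by (simp add: has_field_derivative_iff)
  then have klim: "(\<lambda>n. (?k (s n) - 1) / s n) \<longlonglongrightarrow> - (real DIM('a) / 2 * (1 + ln pi))"
    unfolding tendsto_at_iff_sequentially comp_def using s slim by (auto simp: less_le)
  have le: "(\<integral>u. (cmod (\<Psi> u))\<^sup>2 * (pert M (s n) (cmod (\<Psi> u)) / s n) \<partial>lebesgue) + (\<integral>u. (cmod (\<Phi> u))\<^sup>2 * (pert M (s n) (cmod (\<Phi> u)) / s n) \<partial>lebesgue)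
     \<le> (?k (s n) - 1) / s n" for n
  proof -
    have d: "(\<integral>u. (cmod (f u))\<^sup>2 * (pert M (s n) (cmod (f u)) / s n) \<partial>lebesgue) = (\<integral>u. (cmod (f u))\<^sup>2 * pert M (s n) (cmod (f u)) \<partial>lebesgue) / s n"
      for f :: "'a \<Rightarrow> complex" by (simp add: times_divide_eq_right)
    show ?thesis
      unfolding d add_divide_distrib [symmetric]
      using perturbation_inequality [OF ft n2 M s(1) s(2), of n] s(1) [of n] by (intro divide_right_mono) auto
  qed
  show ?thesis
    by (rule LIMSEQ_le [OF tendsto_add [OF lim [OF Pm(1) n2 fin(1)] lim [OF Pm(2) m2 fin(2)]] klim]) (use le in blast)
qed

text \<open>Each truncated integral is at least - \<open>shannon_pos\<close> / 2, so the bound on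
  the sum bounds each of them above. This makes both negative parts finite, after which M may tend
  to infinity.\<close>

theorem shannon_uncertainty:
  fixes \<Psi> :: "'a::euclidean_space \<Rightarrow> complex"
  assumes ft: "has_fourier_transform \<Psi> \<Phi>" and n2: "normp 2 \<Psi> = 1" and fin: "shannon_pos \<Psi> < \<infinity>" "shannon_pos \<Phi> < \<infinity>"
  shows "shannon_neg \<Psi> < \<infinity>" "shannon_neg \<Phi> < \<infinity>"
    "real DIM('a) * (1 + ln pi) \<le> (enn2real (shannon_pos \<Psi>) - enn2real (shannon_neg \<Psi>)) + (enn2real (shannon_pos \<Phi>) - enn2real (shannon_neg \<Phi>))"
proof -
  have m2: "normp 2 \<Phi> = 1" using has_fourier_transform_plancherel [OF ft] n2 by simp
  have Pm: "\<Psi> \<in> borel_measurable lebesgue" "\<Phi> \<in> borel_measurable lebesgue"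
    using has_fourier_transform_L2 [OF ft] by (auto simp: L2_functions_iff)
  have ge: "- (enn2real (shannon_pos f) / 2) \<le> (\<integral>u. trunc_log (real (Suc n)) f u \<partial>lebesgue)"
    if "f \<in> borel_measurable lebesgue" "normp 2 f = 1" "shannon_pos f < \<infinity>" for f :: "'a \<Rightarrow> complex" and n
  proof -
    have "0 \<le> (\<integral>u. max 0 (trunc_log (real (Suc n)) f u) \<partial>lebesgue)" by (intro integral_nonneg_AE) simp
    moreover have "1 \<le> real (Suc n)" by simp
    from trunc_log_lower_bound [OF that this]
    have "(\<integral>u. max 0 (trunc_log (real (Suc n)) f u) \<partial>lebesgue) - enn2real (shannon_pos f) / 2 = (\<integral>u. trunc_log (real (Suc n)) f u \<partial>lebesgue)" .
    ultimately show ?thesis by linarith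
  qed
  have sum: "(\<integral>u. trunc_log (real (Suc n)) \<Psi> u \<partial>lebesgue) + (\<integral>u. trunc_log (real (Suc n)) \<Phi> u \<partial>lebesgue) \<le> - (real DIM('a) / 2 * (1 + ln pi))" for n
    by (rule trunc_log_uncertainty [OF ft n2 fin]) simp
  show n1: "shannon_neg \<Psi> < \<infinity>"
    by (rule shannon_neg_finite [OF Pm(1) n2 fin(1), of "- (real DIM('a) / 2 * (1 + ln pi)) + enn2real (shannon_pos \<Phi>) / 2"])
       (use sum ge [OF Pm(2) m2 fin(2)] in \<open>smt (verit)\<close>)
  show n2': "shannon_neg \<Phi> < \<infinity>"
    by (rule shannon_neg_finite [OF Pm(2) m2 fin(2), of "- (real DIM('a) / 2 * (1 + ln pi)) + enn2real (shannon_pos \<Psi>) / 2"])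
       (use sum ge [OF Pm(1) n2 fin(1)] in \<open>smt (verit)\<close>)
  have "(enn2real (shannon_neg \<Psi>) - enn2real (shannon_pos \<Psi>)) / 2 + (enn2real (shannon_neg \<Phi>) - enn2real (shannon_pos \<Phi>)) / 2 \<le> - (real DIM('a) / 2 * (1 + ln pi))"
    by (rule LIMSEQ_le_const2 [OF tendsto_add [OF trunc_log_limit [OF Pm(1) n2 fin(1) n1] trunc_log_limit [OF Pm(2) m2 fin(2) n2']]])
       (use sum in blast)
  moreover have "c * (1 + l) \<le> (a - b) + (a' - b')" if "(b - a) / 2 + (b' - a') / 2 \<le> - (c / 2 * (1 + l))" for a b a' b' c l :: real
    using that by (simp add: field_simps)
  ultimately show "real DIM('a) * (1 + ln pi) \<le> (enn2real (shannon_pos \<Psi>) - enn2real (shannon_neg \<Psi>)) + (enn2real (shannon_pos \<Phi>) - enn2real (shannon_neg \<Phi>))"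
    by blast
qed

section \<open>The uncertainty relation\<close>

lemma conj_index_conj_index: "1 / 2 < a \<Longrightarrow> conj_index (conj_index a) = a"
proof -
  assume a: "1 / 2 < a"
  have "2 * (a / (2 * a - 1)) - 1 = 1 / (2 * a - 1)" using a by (simp add: field_simps)
  then show ?thesis using a by (simp add: conj_index_def)
qed

lemma conj_index_gt_half: "1 / 2 < a \<Longrightarrow> 1 / 2 < conj_index a"
  by (simp add: conj_index_def field_simps)

lemma conj_index_gt_1: "1 / 2 < a \<Longrightarrow> a < 1 \<Longrightarrow> 1 < conj_index a"
  by (simp add: conj_index_def field_simps)

lemma conj_index_lt_1: "1 < a \<Longrightarrow> conj_index a < 1"
  by (simp add: conj_index_def field_simps)

text \<open>Conjugation is an involution on indices above 1/2 and merely exchanges the two power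
  factors of the constant.\<close>

lemma B_single_conj_index:
  assumes "1 / 2 < a" "a \<noteq> 1"
  shows "B_single (conj_index a) = B_single a"
proof -
  have "conj_index a \<noteq> 1" using assms conj_index_gt_1 [of a] conj_index_lt_1 [of a] by (cases "a < 1") auto
  moreover have "conj_index a \<noteq> 1 / 2" using conj_index_gt_half [OF assms(1)] by simp
  ultimately show ?thesis
    using assms by (simp add: B_single_def conj_index_conj_index mult.assoc mult.commute)
qed

lemma renyi_power_reflect:
  fixes f :: "'a::euclidean_space \<Rightarrow> complex"
  assumes f [measurable]: "f \<in> borel_measurable lebesgue"
  shows "renyi_power l (\<lambda>x. f (- x)) = renyi_power l f"
    and "renyi_entropy_defined l (\<lambda>x. f (- x)) = renyi_entropy_defined l f"
proof -
  have "shannon_pos (\<lambda>x. f (- x)) = shannon_pos f" "shannon_neg (\<lambda>x. f (- x)) = shannon_neg f"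
    unfolding shannon_pos_def shannon_neg_def
    using nn_integral_lebesgue_reflect [of "\<lambda>x. ennreal (- ((cmod (f x))\<^sup>2 * ln ((cmod (f x))\<^sup>2)))"]
      nn_integral_lebesgue_reflect [of "\<lambda>x. ennreal ((cmod (f x))\<^sup>2 * ln ((cmod (f x))\<^sup>2))"] by auto
  note sh = this
  show "renyi_entropy_defined l (\<lambda>x. f (- x)) = renyi_entropy_defined l f"
    unfolding renyi_entropy_defined_def sh ..
  have "renyi_entropy l (\<lambda>x. f (- x)) = renyi_entropy l f"
  proof (cases "l = 1")
    case True
    then show ?thesis by (simp add: renyi_entropy_def sh)
  next
    case False
    then show ?thesis by (simp add: renyi_entropy_normp measurable_reflect normp_reflect)
  qed
  then show "renyi_power l (\<lambda>x. f (- x)) = renyi_power l f" by (simp add: renyi_power_def)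
qed

text \<open>Translates the constant of Hausdorff-Young into that of the entropy powers; the exponent
  on the left is the one with which the norm of the transform enters its entropy power.\<close>

lemma beckner_B_single:
  assumes a: "1 / 2 < a" "a < 1" and d: "0 < d"
  shows "beckner (2 * a) d powr (1 / (real d * (1 - conj_index a))) = B_single a"
proof -
  define g where "g = conj_index a"
  \<comment> \<open>The exponent that is left when d cancels. It equals - 1 / (2 (g - 1)), and e - 1
    / (2 (a - 1)) = 1 reduces the powers of pi to pi itself.\<close>
  define e where "e = (2 * a - 1) / (2 * (a - 1))"
  have g: "0 < g" "1 - g = (a - 1) / (2 * a - 1)" using a by (auto simp: g_def conj_index_def field_simps)
  have x: "2 * pi * (2 * a - 1) / (2 * a) = pi / g" using a by (simp add: g_def conj_index_def field_simps)
  have ex: "real d / 2 * (1 / (real d * (1 - g))) = e"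
    unfolding g(2) e_def using a d by (simp add: field_simps)
  have ew: "1 / (2 * a - 1) * e = 1 / (2 * (a - 1))" using a by (simp add: e_def)
  have e1: "- e = 1 / (2 * (g - 1))"
  proof -
    have "g - 1 = - ((a - 1) / (2 * a - 1))" using g(2) by simp
    moreover have "- (y / (2 * x)) = 1 / (2 * - (x / y))" for x y :: real
      by (cases "x = 0"; cases "y = 0") (auto simp: field_simps)
    ultimately show ?thesis unfolding e_def by (simp only:)
  qed
  have e2: "e - 1 / (2 * (a - 1)) = 1"
    unfolding e_def diff_divide_distrib [symmetric] using a by (simp add: right_diff_distrib)
  have "beckner (2 * a) d powr (1 / (real d * (1 - g))) = (pi / g * (a / pi) powr (1 / (2 * a - 1))) powr e"
    unfolding beckner_def x powr_powr ex by simp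
  also have "\<dots> = (pi / g) powr e * ((a / pi) powr (1 / (2 * a - 1))) powr e"
    using a g by (subst powr_mult) auto
  also have "((a / pi) powr (1 / (2 * a - 1))) powr e = (a / pi) powr (1 / (2 * (a - 1)))"
    unfolding powr_powr ew ..
  also have "(pi / g) powr e = pi powr e * g powr (- e)"
    using g by (simp add: powr_divide powr_minus_divide)
  also have "(a / pi) powr (1 / (2 * (a - 1))) = a powr (1 / (2 * (a - 1))) * pi powr (- (1 / (2 * (a - 1))))"
    using a by (simp add: powr_divide powr_minus_divide)
  also have "pi powr e * g powr (- e) * (a powr (1 / (2 * (a - 1))) * pi powr (- (1 / (2 * (a - 1))))) =
     (pi powr e * pi powr (- (1 / (2 * (a - 1))))) * a powr (1 / (2 * (a - 1))) * g powr (- e)"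
    by (simp only: mult_ac)
  also have "pi powr e * pi powr (- (1 / (2 * (a - 1)))) = pi powr (e - 1 / (2 * (a - 1)))"
    by (simp add: powr_add [symmetric])
  also have "\<dots> = pi" unfolding e2 by simp
  also have "pi * a powr (1 / (2 * (a - 1))) * g powr (- e) = B_single a"
    using a unfolding e1 by (simp add: B_single_def g_def)
  finally show ?thesis by (simp add: g_def)
qed

text \<open>The exponent 1 / (d (1 - g)) is negative because the partner g exceeds 1: it turns the
  upper bound for the norm of the transform into a lower bound for its entropy power. The first
  alternative is the case in which Hausdorff-Young is void.\<close>

lemma conjugate_pair_below_1:
  fixes \<Psi> :: "'a::euclidean_space \<Rightarrow> complex"
  assumes ft: "has_fourier_transform \<Psi> \<Phi>" and n2: "normp 2 \<Psi> = 1" and a: "1 / 2 < a" "a < 1"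
  shows "renyi_power a \<Psi> = \<infinity> \<or> ennreal (B_single a) \<le> renyi_power a \<Psi> * renyi_power (conj_index a) \<Phi>"
proof -
  have m2: "normp 2 \<Phi> = 1" using has_fourier_transform_plancherel [OF ft] n2 by simp
  have Pm: "\<Psi> \<in> borel_measurable lebesgue" "\<Phi> \<in> borel_measurable lebesgue"
    using has_fourier_transform_L2 [OF ft] by (auto simp: L2_functions_iff)
  let ?d = "real DIM('a)"
  define g where "g = conj_index a"
  have g: "1 < g" unfolding g_def by (rule conj_index_gt_1 [OF a])
  define w where "w = 1 / (2 * a - 1)"
  show ?thesis
    using normp_cases [OF Pm(1) n2, of "2 * a"]
  proof cases
    case 1
    then show ?thesis using renyi_power_infinite [OF Pm(1) a(2)] by simp
  next
    case A: (2 A)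
    define B where "B = beckner (2 * a) DIM('a)"
    have B: "0 < B" using a by (simp add: B_def beckner_def)
    have "2 * a / (2 * a - 1) = 2 * g" by (simp add: g_def conj_index_def)
    then have HY: "normp (2 * g) \<Phi> \<le> ennreal (B * A powr w)"
      using hausdorff_young [OF ft, of "2 * a" A] a A by (simp add: B_def w_def)
    obtain C where C: "0 < C" "normp (2 * g) \<Phi> = ennreal C"
      using normp_cases [OF Pm(2) m2, of "2 * g"] HY by (metis ennreal_neq_top infinity_ennreal_def neq_top_trans)
    have "C \<le> B * A powr w" using HY C B by (simp add: ennreal_le_iff)
    then have le: "(B * A powr w) powr (1 / (?d * (1 - g))) \<le> C powr (1 / (?d * (1 - g)))"
      using C g by (intro powr_mono2') (auto simp: divide_le_0_iff mult_le_0_iff)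
    \<comment> \<open>By conjugacy the total exponent of \<open>A\<close> vanishes, and only the
      constant survives.\<close>
    have "1 / (?d * (1 - a)) + w * (1 / (?d * (1 - g))) = 0"
    proof -
      have "1 - g = (a - 1) / (2 * a - 1)" using a by (simp add: g_def conj_index_def field_simps)
      moreover have "(1 / y) * (1 / (?d * (x / y))) = 1 / (?d * x)" if "y \<noteq> 0" for x y
        using that by (cases "x = 0") (auto simp: field_simps)
      moreover have "?d * (1 - a) = - (?d * (a - 1))" by (simp add: algebra_simps)
      ultimately show ?thesis using a by (simp add: w_def)
    qed
    then have "A powr (1 / (?d * (1 - a))) * (B * A powr w) powr (1 / (?d * (1 - g))) = B powr (1 / (?d * (1 - g)))"
      using A B by (simp add: powr_mult powr_powr mult.left_commute powr_add [symmetric])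
    also have "\<dots> = B_single a" unfolding B_def g_def by (rule beckner_B_single [OF a]) simp
    finally have "B_single a \<le> A powr (1 / (?d * (1 - a))) * C powr (1 / (?d * (1 - g)))"
      using mult_left_mono [OF le, of "A powr (1 / (?d * (1 - a)))"] by simp
    then have "ennreal (B_single a) \<le> renyi_power a \<Psi> * renyi_power g \<Phi>"
      using renyi_power_finite [OF Pm(1) _ A(2,1)] renyi_power_finite [OF Pm(2) _ C(2,1)] a g
      by (simp add: ennreal_mult [symmetric] ennreal_leI)
    then show ?thesis by (simp add: g_def)
  qed
qed

text \<open>Inversion reduces to \<open>conjugate_pair_below_1\<close>, applied to \<Phi> and the
  reflected \<Psi>: the partner of an index above 1 is below 1.\<close>

lemma conjugate_pair_above_1:
  fixes \<Psi> :: "'a::euclidean_space \<Rightarrow> complex"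
  assumes ft: "has_fourier_transform \<Psi> \<Phi>" and n2: "normp 2 \<Psi> = 1" and a: "1 < a"
  shows "renyi_power (conj_index a) \<Phi> = \<infinity> \<or> ennreal (B_single a) \<le> renyi_power a \<Psi> * renyi_power (conj_index a) \<Phi>"
proof -
  have m2: "normp 2 \<Phi> = 1" using has_fourier_transform_plancherel [OF ft] n2 by simp
  have Pm: "\<Psi> \<in> borel_measurable lebesgue"
    using has_fourier_transform_L2 [OF ft] by (auto simp: L2_functions_iff)
  have g: "1 / 2 < conj_index a" "conj_index a < 1"
    using a conj_index_gt_half [of a] conj_index_lt_1 [of a] by auto
  have a2: "1 / 2 < a" using a by simp
  show ?thesis
    using conjugate_pair_below_1 [OF has_fourier_transform_inversion [OF ft] m2 g] a
    by (simp add: conj_index_conj_index [OF a2] B_single_conj_index [OF a2] renyi_power_reflect [OF Pm] mult.commute)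
qed

lemma shannon_pair:
  fixes \<Psi> :: "'a::euclidean_space \<Rightarrow> complex"
  assumes ft: "has_fourier_transform \<Psi> \<Phi>" and n2: "normp 2 \<Psi> = 1"
    and def: "renyi_entropy_defined 1 \<Psi>" and fin: "shannon_pos \<Phi> < \<infinity>"
  shows "renyi_power 1 \<Psi> = \<infinity> \<or> ennreal (exp 1 * pi) \<le> renyi_power 1 \<Psi> * renyi_power 1 \<Phi>"
proof (cases "shannon_pos \<Psi> = \<infinity>")
  case True
  then have "shannon_neg \<Psi> < \<infinity>" using def by (simp add: renyi_entropy_defined_def less_top)
  then show ?thesis using renyi_power_1_infinite [OF True] by simp
next
  case False
  then have fin1: "shannon_pos \<Psi> < \<infinity>" by (simp add: less_top)
  note U = shannon_uncertainty [OF ft n2 fin1 fin]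
  define x y where "x = enn2real (shannon_pos \<Psi>) - enn2real (shannon_neg \<Psi>)" and "y = enn2real (shannon_pos \<Phi>) - enn2real (shannon_neg \<Phi>)"
  have "real DIM('a) * (1 + ln pi) \<le> x + y" using U(3) unfolding x_def y_def .
  then have "1 + ln pi \<le> (x + y) / real DIM('a)" by (simp add: pos_le_divide_eq mult.commute)
  then have "exp (1 + ln pi) \<le> exp (x / real DIM('a) + y / real DIM('a))" by (simp add: add_divide_distrib)
  then have "exp 1 * pi \<le> exp (x / real DIM('a)) * exp (y / real DIM('a))" by (simp add: exp_add)
  then have "ennreal (exp 1 * pi) \<le> ennreal (exp (x / real DIM('a))) * ennreal (exp (y / real DIM('a)))"
    by (subst ennreal_mult [symmetric]) (auto intro: ennreal_leI)
  then show ?thesis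
    using renyi_power_1_finite [OF fin1 U(1)] renyi_power_1_finite [OF fin U(2)] by (simp add: x_def y_def)
qed

text \<open>Comparison with the limiting index infinity: |f|^2 \<le> K^(2 - 2 b) |f|^(2 b) almost
  everywhere, and the left side has integral 1.\<close>

lemma renyi_power_sup_bound:
  fixes f :: "'a::euclidean_space \<Rightarrow> complex"
  assumes f [measurable]: "f \<in> borel_measurable lebesgue" and f2: "normp 2 f = 1" and K: "0 < K" "AE u in lebesgue. cmod (f u) \<le> K" and b: "b < 1"
  shows "ennreal (K powr (- (2 / real DIM('a)))) \<le> renyi_power b f"
  using normp_cases [OF f f2, of "2 * b"]
proof cases
  case 1
  then show ?thesis using renyi_power_infinite [OF f b] by simp
next
  case C: (2 C)
  have "normp 2 f \<le> (\<integral>\<^sup>+u. ennreal (K powr (2 - 2 * b)) * ennreal (cmod (f u) powr (2 * b)) \<partial>lebesgue)"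
    unfolding normp_def
  proof (rule nn_integral_mono_AE)
    show "AE u in lebesgue. ennreal (cmod (f u) powr 2) \<le> ennreal (K powr (2 - 2 * b)) * ennreal (cmod (f u) powr (2 * b))"
      using K(2)
    proof eventually_elim
      case (elim u)
      have "cmod (f u) powr 2 = cmod (f u) powr (2 - 2 * b) * cmod (f u) powr (2 * b)"
        by (simp add: powr_add [symmetric] del: powr_numeral)
      also have "\<dots> \<le> K powr (2 - 2 * b) * cmod (f u) powr (2 * b)"
        using b elim by (intro mult_right_mono powr_mono2) auto
      finally show ?case by (simp add: ennreal_mult [symmetric] ennreal_leI)
    qed
  qed
  also have "\<dots> = ennreal (K powr (2 - 2 * b)) * normp (2 * b) f"
    unfolding normp_def by (rule nn_integral_cmult) simp
  finally have "1 \<le> K powr (2 - 2 * b) * C"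
    unfolding f2 C(2) using C(1) by (simp add: ennreal_mult [symmetric])
  then have "1 powr (1 / (real DIM('a) * (1 - b))) \<le> (K powr (2 - 2 * b) * C) powr (1 / (real DIM('a) * (1 - b)))"
    using b by (intro powr_mono2) auto
  also have "\<dots> = K powr ((2 - 2 * b) * (1 / (real DIM('a) * (1 - b)))) * C powr (1 / (real DIM('a) * (1 - b)))"
    using C K by (simp add: powr_mult powr_powr)
  also have "(2 - 2 * b) * (1 / (real DIM('a) * (1 - b))) = 2 / real DIM('a)"
  proof -
    have "2 * z * (1 / (D * z)) = 2 / D" if "z \<noteq> 0" for z D :: real using that by simp
    from this [of "1 - b" "real DIM('a)"] show ?thesis using b by (simp add: right_diff_distrib)
  qed
  finally have "K powr (- (2 / real DIM('a))) \<le> C powr (1 / (real DIM('a) * (1 - b)))"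
    using K by (simp add: powr_minus_divide field_simps)
  then show ?thesis using renyi_power_finite [OF f _ C(2,1)] b by (simp add: ennreal_leI)
qed

text \<open>The index a is first raised to 1/2, where the entropy power is a power of the L^1 norm.
  This norm cancels against the bound for the supremum of the transform, and the factor (2 pi)^(-
  d/2) of the transform, raised to the power - 2/d, is the constant 2 pi.\<close>

lemma renyi_pair_half:
  fixes \<Psi> :: "'a::euclidean_space \<Rightarrow> complex"
  assumes ft: "has_fourier_transform \<Psi> \<Phi>" and n2: "normp 2 \<Psi> = 1" and ab: "a \<le> 1 / 2" "b < 1"
  shows "ennreal (2 * pi) \<le> renyi_power a \<Psi> * renyi_power b \<Phi>"
proof -
  have m2: "normp 2 \<Phi> = 1" using has_fourier_transform_plancherel [OF ft] n2 by simp
  have Pm: "\<Psi> \<in> borel_measurable lebesgue" "\<Phi> \<in> borel_measurable lebesgue"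
    using has_fourier_transform_L2 [OF ft] by (auto simp: L2_functions_iff)
  let ?d = "real DIM('a)"
  have le: "renyi_power (1 / 2) \<Psi> \<le> renyi_power a \<Psi>"
    by (rule renyi_power_antimono_below_1 [OF Pm(1) n2 ab(1)]) simp
  show ?thesis
    using normp_cases [OF Pm(1) n2, of 1]
  proof cases
    case 1
    then have "renyi_power (1 / 2) \<Psi> = \<infinity>" using renyi_power_infinite [OF Pm(1), of "1 / 2"] by simp
    then have "renyi_power a \<Psi> = \<infinity>" using le by (simp add: top_unique)
    then show ?thesis using renyi_power_pos [OF Pm(2) m2 ab(2)] by (simp add: ennreal_top_mult)
  next
    case A: (2 A)
    define K where "K = (2 * pi) powr (- ?d / 2) * A"
    have K: "0 < K" using A by (simp add: K_def)
    have "AE x in lebesgue. cmod (\<Phi> x) \<le> K"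
      unfolding K_def by (rule fourier_transform_sup_bound [OF ft]) (use A in auto)
    then have y: "ennreal (K powr (- (2 / ?d))) \<le> renyi_power b \<Phi>"
      by (rule renyi_power_sup_bound [OF Pm(2) m2 K _ ab(2)])
    have x: "ennreal (A powr (2 / ?d)) \<le> renyi_power a \<Psi>"
      using le renyi_power_finite [OF Pm(1), of "1 / 2" A] A by simp
    have "A powr (2 / ?d) * K powr (- (2 / ?d)) = 2 * pi"
    proof -
      define c where "c = 2 * pi"
      have "(c powr (- ?d / 2)) powr (- (2 / ?d)) = c" unfolding powr_powr by (simp add: c_def)
      then have "K powr (- (2 / ?d)) = c * A powr (- (2 / ?d))"
        unfolding K_def c_def [symmetric] using A by (subst powr_mult) (auto simp: c_def)
      then show ?thesis using A by (simp add: c_def powr_minus_divide)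
    qed
    then have "ennreal (2 * pi) = ennreal (A powr (2 / ?d)) * ennreal (K powr (- (2 / ?d)))"
      by (simp add: ennreal_mult [symmetric])
    also have "\<dots> \<le> renyi_power a \<Psi> * renyi_power b \<Phi>"
      by (intro mult_mono x y) auto
    finally show ?thesis .
  qed
qed

text \<open>The conjugate partner of \<open>a\<close> is lowered to \<open>b\<close>. For 1/2 < a <
  1 the partner lies above 1, hence above b \<le> a; for a > 1 it bounds \<open>b\<close> because
  (a, b) is outside \<open>D0_set\<close>; for a = 1 it is 1 itself.\<close>

lemma renyi_uncertainty_ordered:
  fixes \<Psi> :: "'a::euclidean_space \<Rightarrow> complex"
  assumes ft: "has_fourier_transform \<Psi> \<Phi>" and n2: "normp 2 \<Psi> = 1"
    and ab: "b \<le> a" "(a, b) \<notin> D0_set"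
    and def: "renyi_entropy_defined a \<Psi>" "renyi_entropy_defined b \<Phi>"
    and prod: "\<not> (renyi_power a \<Psi> = 0 \<and> renyi_power b \<Phi> = \<infinity>)" "\<not> (renyi_power a \<Psi> = \<infinity> \<and> renyi_power b \<Phi> = 0)"
  shows "ennreal (if a \<le> 1 / 2 then 2 * pi else B_single a) \<le> renyi_power a \<Psi> * renyi_power b \<Phi>"
proof -
  have m2: "normp 2 \<Phi> = 1" using has_fourier_transform_plancherel [OF ft] n2 by simp
  have Pm: "\<Psi> \<in> borel_measurable lebesgue" "\<Phi> \<in> borel_measurable lebesgue"
    using has_fourier_transform_L2 [OF ft] by (auto simp: L2_functions_iff)
  \<comment> \<open>With products of the form 0 times infinity excluded, an infinite factor makes
    the product infinite.\<close>
  have infl: "c \<le> renyi_power a \<Psi> * renyi_power b \<Phi>" if "renyi_power a \<Psi> = \<infinity>" for c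
    using that prod(2) by (simp add: ennreal_top_mult)
  have infr: "c \<le> renyi_power a \<Psi> * renyi_power b \<Phi>" if "renyi_power b \<Phi> = \<infinity>" for c
    using that prod(1) by (simp add: ennreal_mult_top)
  have mono: "c \<le> renyi_power a \<Psi> * renyi_power b \<Phi>"
    if "c \<le> renyi_power a \<Psi> * renyi_power g \<Phi>" "renyi_power g \<Phi> \<le> renyi_power b \<Phi>" for c g
    using that by (meson mult_left_mono order_trans zero_le)
  consider "a \<le> 1 / 2" | "1 / 2 < a" "a < 1" | "a = 1" | "1 < a" by linarith
  then show ?thesis
  proof cases
    case 1
    then show ?thesis using renyi_pair_half [OF ft n2, of a b] ab(1) by simp
  next
    case 2
    have "renyi_power (conj_index a) \<Phi> \<le> renyi_power b \<Phi>"
      by (rule renyi_power_antimono_across_1 [OF Pm(2) m2]) (use 2 ab conj_index_gt_1 [OF 2] in auto)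
    then show ?thesis
      using conjugate_pair_below_1 [OF ft n2 2] infl mono 2 by auto
  next
    case 3
    have B1: "(if a \<le> 1 / 2 then 2 * pi else B_single a) = exp 1 * pi" using 3 by (simp add: B_single_def)
    have shannon: "ennreal (exp 1 * pi) \<le> renyi_power a \<Psi> * renyi_power b \<Phi>"
      if "shannon_pos \<Phi> < \<infinity>" "renyi_power 1 \<Phi> \<le> renyi_power b \<Phi>"
      using shannon_pair [OF ft n2 _ that(1)] def(1) infl mono [OF _ that(2)] 3 by auto
    show ?thesis
      unfolding B1
    proof (cases "b = 1")
      case True
      show "ennreal (exp 1 * pi) \<le> renyi_power a \<Psi> * renyi_power b \<Phi>"
      proof (cases "shannon_pos \<Phi> = \<infinity>")
        case inf: True
        then have "shannon_neg \<Phi> < \<infinity>" using def(2) True by (simp add: renyi_entropy_defined_def less_top)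
        then show ?thesis using renyi_power_1_infinite [OF inf] True infr by simp
      next
        case False
        then show ?thesis using shannon True by (simp add: less_top)
      qed
    next
      case False
      then show "ennreal (exp 1 * pi) \<le> renyi_power a \<Psi> * renyi_power b \<Phi>"
        using renyi_power_antimono_at_1 [OF Pm(2) m2, of b] ab(1) 3 infr shannon by auto
    qed
  next
    case 4
    have le: "renyi_power (conj_index a) \<Phi> \<le> renyi_power b \<Phi>"
      by (rule renyi_power_antimono_below_1 [OF Pm(2) m2]) (use 4 ab conj_index_lt_1 [OF 4] in \<open>auto simp: D0_set_def\<close>)
    have "renyi_power b \<Phi> = \<infinity>" if "renyi_power (conj_index a) \<Phi> = \<infinity>"
      using le that by (simp add: top_unique)
    then show ?thesis
      using conjugate_pair_above_1 [OF ft n2 4] infr mono [OF _ le] 4 by auto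
  qed
qed

text \<open>For indices above 1/2 the condition reads a + b < 2 a b, and it forces the second index
  above 1/2 as well.\<close>

lemma D0_set_symmetric: "(a, b) \<in> D0_set \<Longrightarrow> (b, a) \<in> D0_set"
proof -
  assume D: "(a, b) \<in> D0_set"
  then have a: "1 / 2 < a" "a / (2 * a - 1) < b" by (auto simp: D0_set_def conj_index_def)
  have "1 / 2 < a / (2 * a - 1)" using a(1) by (simp add: field_simps)
  then have b: "1 / 2 < b" using a(2) by linarith
  have "a < b * (2 * a - 1)" using a by (simp add: pos_divide_less_eq)
  then have "b < a * (2 * b - 1)" by (simp add: algebra_simps)
  then show ?thesis using b by (simp add: D0_set_def conj_index_def pos_divide_less_eq)
qed

theorem mainTheorem1:
  fixes \<Psi> :: "real ^ 'n \<Rightarrow> complex" and \<alpha> \<beta> :: real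
  assumes "\<Psi> \<in> L2_functions"
    and "L2_normsq \<Psi> = 1"
    and "(\<alpha>, \<beta>) \<in> D_set"
    and "renyi_entropy_defined \<alpha> \<Psi>"
    and "renyi_entropy_defined \<beta> (fourier_transform \<Psi>)"
    and "\<not> (renyi_power \<alpha> \<Psi> = 0 \<and> renyi_power \<beta> (fourier_transform \<Psi>) = \<infinity>)"
    and "\<not> (renyi_power \<alpha> \<Psi> = \<infinity> \<and> renyi_power \<beta> (fourier_transform \<Psi>) = 0)"
  shows "renyi_power \<alpha> \<Psi> * renyi_power \<beta> (fourier_transform \<Psi>) \<ge> ennreal (B_bound \<alpha> \<beta>)"
proof -
  have ft: "has_fourier_transform \<Psi> (fourier_transform \<Psi>)"
    by (rule has_fourier_transform_fourier_transform [OF assms(1)])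
  have n2: "normp 2 \<Psi> = 1" using assms(2) by (simp add: L2_normsq_normp)
  have m2: "normp 2 (fourier_transform \<Psi>) = 1" using has_fourier_transform_plancherel [OF ft] n2 by simp
  have Pm: "\<Psi> \<in> borel_measurable lebesgue" using assms(1) by (simp add: L2_functions_iff)
  have D: "(\<alpha>, \<beta>) \<notin> D0_set" "0 \<le> \<alpha>" "0 \<le> \<beta>" using assms(3) by (auto simp: D_set_def)
  show ?thesis
  proof (cases "\<beta> \<le> \<alpha>")
    case True
    \<comment> \<open>For \<beta> \<le> \<alpha> membership in \<open>S_set\<close> means \<alpha> <
      1/2, and \<open>B_single\<close> has the value 2 pi at 1/2, so the boundary joins this
      case.\<close>
    have "B_bound \<alpha> \<beta> = (if \<alpha> \<le> 1 / 2 then 2 * pi else B_single \<alpha>)"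
      using True D by (auto simp: B_bound_def S_set_def B_single_def)
    then show ?thesis
      using renyi_uncertainty_ordered [OF ft n2 True D(1) assms(4-7)] by simp
  next
    case False
    have "B_bound \<alpha> \<beta> = (if \<beta> \<le> 1 / 2 then 2 * pi else B_single \<beta>)"
      using False D by (auto simp: B_bound_def S_set_def B_single_def)
    \<comment> \<open>The ordered case for the transform and the reflected \<Psi>, with the indices
      exchanged.\<close>
    moreover have "ennreal (if \<beta> \<le> 1 / 2 then 2 * pi else B_single \<beta>) \<le>
        renyi_power \<beta> (fourier_transform \<Psi>) * renyi_power \<alpha> (\<lambda>x. \<Psi> (- x))"
      using False D0_set_symmetric [of \<beta> \<alpha>] D(1) assms(4-7)
      by (intro renyi_uncertainty_ordered [OF has_fourier_transform_inversion [OF ft] m2])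
         (auto simp: renyi_power_reflect [OF Pm])
    ultimately show ?thesis by (simp add: renyi_power_reflect [OF Pm] mult.commute)
  qed
qed

end
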